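(* As formal power series in $q$, \[ \sum_{n=0}^\infty \Big(NT(1,5,5n+4)-NT(4,5,5n+4)+2M_{\omega}(2,5,5n+4)-2M_{\omega}(3,5,5n+4)\Big)q^n=-5\frac{(q^5;q^5)_\infty^4}{(q;q)_\infty}, \] and for all integers $n\geq 0$, \[ M_{\omega}(2,5,5n+4)-M_{\omega}(3,5,5n+4)=2NT(1,5,5n+4)-2NT(4,5,5n+4). \]
   Context: For a partition $\pi$ of a positive integer $n$ (written $\pi\vdash n$), let $\#(\pi)$ be the number of parts, $\lambda(\pi)$ the largest part, $\omega(\pi)$ the number of parts equal to $1$, and $\mu(\pi)$ the number of parts larger than $\omega(\pi)$. The rank is $\mathrm{rank}(\pi)=\lambda(\pi)-\#(\pi)$. The crank is $\mathrm{crank}(\pi)=\lambda(\pi)$ if $\omega(\pi)=0$ and $\mathrm{crank}(\pi)=\mu(\pi)-\omega(\pi)$ otherwise. For integers $m$, $j\ge1$, $n\ge0$: $NT(m,j,n)=\sum_{\pi\vdash n,\ \mathrm{rank}(\pi)\equiv m \ (\mathrm{mod}\ j)}\#(\pi)$ and $M_{\omega}(m,j,n)=\sum_{\pi\vdash n,\ \mathrm{crank}(\pi)\equiv m\ (\mathrm{mod}\ j)}\omega(\pi)$. Notation: $(a;q)_\infty=\prod_{k\ge0}(1-aq^k)$. *)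

theory Defs
  imports "HOL-Analysis.Analysis" "HOL-Computational_Algebra.Formal_Power_Series"
    "HOL-Library.Multiset" "HOL-Number_Theory.Cong"
begin

definition partitions :: "nat \<Rightarrow> nat multiset set" where
  "partitions n = {p. 0 \<notin># p \<and> \<Sum>\<^sub># p = n}"

lemma finite_partitions: "finite (partitions n)"
proof (rule finite_subset)
  show "partitions n \<subseteq> mset ` {xs. set xs \<subseteq> {0..n} \<and> length xs \<le> n}"
  proof
    fix p assume "p \<in> partitions n"
    then have p: "0 \<notin># p" "\<Sum>\<^sub># p = n" by (auto simp: partitions_def)
    obtain xs where xs: "p = mset xs" by (metis ex_mset)
    have "sum_list xs = n" "0 \<notin> set xs" using p by (auto simp: xs sum_mset_sum_list)
    moreover have "length xs \<le> sum_list xs" if "0 \<notin> set xs" for xs :: "nat list"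
      using that by (induction xs) auto
    moreover have "x \<le> sum_list xs" if "x \<in> set xs" for x
      using that by (auto intro: member_le_sum_list)
    ultimately show "p \<in> mset ` {xs. set xs \<subseteq> {0..n} \<and> length xs \<le> n}"
      unfolding xs by force
  qed
  show "finite (mset ` {xs. set xs \<subseteq> {0..n} \<and> length xs \<le> n})"
    by (intro finite_imageI finite_lists_length_le) auto
qed

(* The inserted 0 only matters for the empty partition of 0, whose largest part is taken to be 0. *)
definition largest_part :: "nat multiset \<Rightarrow> nat" where
  "largest_part p = Max (insert 0 (set_mset p))"

definition num_ones :: "nat multiset \<Rightarrow> nat" where
  "num_ones p = count p 1"

definition num_parts_gt_ones :: "nat multiset \<Rightarrow> nat" where
  "num_parts_gt_ones p = size {#k \<in># p. k > num_ones p#}"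

definition partition_rank :: "nat multiset \<Rightarrow> int" where
  "partition_rank p = int (largest_part p) - int (size p)"

definition partition_crank :: "nat multiset \<Rightarrow> int" where
  "partition_crank p =
     (if num_ones p = 0 then int (largest_part p)
      else int (num_parts_gt_ones p) - int (num_ones p))"

(* NT and M_omega are integer-valued so that their differences are not truncated. *)
definition NT :: "int \<Rightarrow> int \<Rightarrow> nat \<Rightarrow> int" where
  "NT m j n = (\<Sum>p | p \<in> partitions n \<and> [partition_rank p = m] (mod j). int (size p))"

definition M_omega :: "int \<Rightarrow> int \<Rightarrow> nat \<Rightarrow> int" where
  "M_omega m j n = (\<Sum>p | p \<in> partitions n \<and> [partition_crank p = m] (mod j). int (num_ones p))"

(* The infinite product is taken in the library's (X-adic) metric on formal power series. *)
definition qpoch_inf :: "'a::idom fps \<Rightarrow> 'a fps \<Rightarrow> 'a fps" where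
  "qpoch_inf a q = (\<Prod>k. 1 - a * q ^ k)"

(* Convergence, so that qpoch_inf is a genuine limit for the arguments of interest. *)
lemma qpoch_inf_has_prod:
  fixes a q :: "'a::idom fps"
  assumes "fps_nth a 0 = 0" "fps_nth q 0 = 0"
  shows "(\<lambda>k. 1 - a * q ^ k) has_prod qpoch_inf a q" "fps_nth (qpoch_inf a q) 0 = 1"
proof -
  define f where "f = (\<lambda>k. 1 - a * q ^ k)"
  define P where "P = Abs_fps (\<lambda>n. fps_nth (prod f {..n}) n)"
  have q: "q = fps_X * fps_shift 1 q"
    using assms(2) by (intro fps_ext) (auto simp: gr0_conv_Suc)
  have step: "fps_nth (A * f (Suc N)) n = fps_nth A n" if "n \<le> N" for A n N
  proof -
    have "A * f (Suc N) = A - fps_X ^ Suc N * (A * a * fps_shift 1 q ^ Suc N)"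
      unfolding f_def by (subst q, unfold power_mult_distrib) (simp add: algebra_simps)
    then show ?thesis
      using that by (simp del: power_Suc add: fps_X_power_mult_nth)
  qed
  have stable: "fps_nth (prod f {..N}) n = fps_nth P n" if "n \<le> N" for n N
    using that
  proof (induction N rule: dec_induct)
    case base
    show ?case by (simp add: P_def)
  next
    case (step N)
    then show ?case using \<open>\<And>A n N. n \<le> N \<Longrightarrow> fps_nth (A * f (Suc N)) n = fps_nth A n\<close>
      by simp
  qed
  have "(\<lambda>N. prod f {..N}) \<longlonglongrightarrow> P"
    using stable by (intro tendsto_fpsI) (auto intro: eventually_sequentiallyI)
  moreover have P0: "fps_nth P 0 = 1"
    using assms(1) by (simp add: P_def f_def)
  moreover from P0 have "P \<noteq> 0" by auto
  ultimately have "f has_prod P"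
    by (auto simp: has_prod_def raw_has_prod_def)
  moreover from this have "prodinf f = P" by (rule has_prod_unique[symmetric])
  ultimately show "(\<lambda>k. 1 - a * q ^ k) has_prod qpoch_inf a q" "fps_nth (qpoch_inf a q) 0 = 1"
    using P0 by (auto simp: qpoch_inf_def f_def)
qed

end

theory Submission
  imports Defs
begin

text \<open>
  Conjugation turns \<open>NT(1,5,n) - NT(4,5,n)\<close> into minus the sum of the ranks of the partitions of \<open>n\<close>
  whose rank is 1 modulo 5. By Dyson's adjoint its generating function is
  \<open>(1 + 5 w d/dw) V(w)\<close> at \<open>w = 1\<close>, where \<open>V(w)\<close> is a difference of two Appell sums divided by
  \<open>(q;q)\<close>. The partial fraction expansion of products of inverse theta functions (Atkin and
  Swinnerton-Dyer) dissects \<open>V(w)\<close> modulo 5 with theta quotients as coefficients. Differentiating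
  at \<open>w = 1\<close> leaves logarithmic derivatives of theta functions, which Weierstrass's three-term
  relation turns into products, and the norm of \<open>(q;q)\<close> under \<open>q \<mapsto> \<zeta>q\<close> (\<open>\<zeta>\<^sup>5 = 1\<close>) collapses the sum.

  For the crank, the \<open>q\<close>-binomial theorem gives
  \<open>K(z) = \<Sum>\<^sub>n q\<^sup>n \<Sum>\<^sub>\<pi> \<omega>(\<pi>) z\<^bsup>crank \<pi>\<^esup>\<close> in closed form, and \<open>K(z) - K(1/z)\<close> is a combination of \<open>1/\<theta>(z)\<close> and
  \<open>\<theta>'(z)/\<theta>(z)\<^sup>2\<close>. At a fifth root of unity \<open>1/\<theta>(z)\<close> is proportional to \<open>\<theta>(z\<^sup>2)\<close>, so splitting
  the theta series modulo 5 suffices. Both residue-4 parts are multiples of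
  \<open>(q\<^sup>2\<^sup>5;q\<^sup>2\<^sup>5)\<^sup>4/(q\<^sup>5;q\<^sup>5)\<close>, which gives the two identities at once.
\<close>

section \<open>Theta functions\<close>

text \<open>All analysis takes place at complex q with 0 < |q| < 1, because \<zeta> q is substituted
  for q, series are two-sided, and w is differentiated; at the end, power series agreeing on the
  disk have equal coefficients. The coefficients of a dissection depend on q^5 alone, so Y = q^5 and
  Q = q^25 are fixed and each dissection is asserted for all q with q^5 = Y at once; a root-of-unity
  filter isolates residue 4 and the other coefficients stay existential. The obstacle is w = 1: each
  Appell sum has a pole there, so the dissection is proved only near 1. In V(w) the offending term
  has numerator q^0 - 1 = 0, and a second description of V, pairing the terms N and -N, is regular
  at 1; through it the dissection yields value and derivative at 1. The operator 1 + 5 w d/dw comes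
  from summing m x^m over m = 1 and -m x^m over m = 4 modulo 5: this is x/(1 - w x^5) + x^4/(w -
  x^5) at w = 1 plus five times its w-derivative there.\<close>

definition qp :: "complex \<Rightarrow> complex \<Rightarrow> complex" where
  "qp a q = (\<Prod>k. 1 - a * q ^ k)"

lemma convergent_qp:
  fixes a q :: complex
  assumes "norm q < 1"
  shows "convergent_prod (\<lambda>k. 1 - a * q ^ k)"
proof -
  have "summable (\<lambda>k. norm (a * q ^ k))"
    using assms by (auto simp: norm_mult norm_power intro!: summable_mult summable_geometric)
  then have "summable (\<lambda>k. norm ((1 - a * q ^ k) - 1))"
    by simp
  then show ?thesis
    by (intro abs_convergent_prod_imp_convergent_prod summable_imp_abs_convergent_prod)
qed

lemma qp_tendsto:
  assumes "norm q < 1"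
  shows "(\<lambda>N. \<Prod>k<N. 1 - a * q ^ k) \<longlonglongrightarrow> qp a q"
proof (rule LIMSEQ_imp_Suc)
  show "(\<lambda>N. \<Prod>k<Suc N. 1 - a * q ^ k) \<longlonglongrightarrow> qp a q"
    using convergent_prod_LIMSEQ[OF convergent_qp[OF assms, of a]]
    by (simp only: qp_def lessThan_Suc_atMost)
qed

lemma qp_eq_0_iff:
  assumes "norm q < 1"
  shows "qp a q = 0 \<longleftrightarrow> (\<exists>k. a * q ^ k = 1)"
proof -
  have "(\<lambda>k. 1 - a * q ^ k) has_prod qp a q"
    using convergent_qp[OF assms] unfolding qp_def by auto
  then have "qp a q = 0 \<longleftrightarrow> (\<exists>k. 1 - a * q ^ k = 0)"
    by (subst has_prod_eq_0_iff) auto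
  moreover have "1 - x = 0 \<longleftrightarrow> x = 1" for x :: complex
    by auto
  ultimately show ?thesis by (simp only:)
qed

lemma qp_split_head:
  assumes "norm q < 1"
  shows "qp a q = (\<Prod>k<N. 1 - a * q ^ k) * qp (a * q ^ N) q"
proof (rule LIMSEQ_unique)
  show "(\<lambda>M. \<Prod>k<M+N. 1 - a * q ^ k) \<longlonglongrightarrow> qp a q"
    using qp_tendsto[OF assms] by (rule LIMSEQ_ignore_initial_segment)
  have "(\<Prod>k<M+N. 1 - a * q ^ k) = (\<Prod>k<N. 1 - a * q ^ k) * (\<Prod>k<M. 1 - (a * q ^ N) * q ^ k)" for M
    by (induction M) (auto simp: power_add algebra_simps)
  then show "(\<lambda>M. \<Prod>k<M+N. 1 - a * q ^ k) \<longlonglongrightarrow> (\<Prod>k<N. 1 - a * q ^ k) * qp (a * q ^ N) q"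
    using qp_tendsto[OF assms, of "a * q ^ N"] by (auto intro: tendsto_intros)
qed

lemma qp_rec:
  assumes "norm q < 1"
  shows "qp a q = (1 - a) * qp (a * q) q"
proof -
  have "qp a q = (\<Prod>k<1. 1 - a * q ^ k) * qp (a * q ^ 1) q"
    by (rule qp_split_head[OF assms])
  also have "(\<Prod>k<1. 1 - a * q ^ k) = 1 - a" by simp
  finally show ?thesis by (simp only: power_one_right)
qed

lemma qp_nonzero:
  assumes "norm q < 1" "norm a < 1"
  shows "qp a q \<noteq> 0"
proof
  assume "qp a q = 0"
  then obtain k where "a * q ^ k = 1"
    using assms by (auto simp: qp_eq_0_iff)
  then have "norm a * norm q ^ k = 1"
    by (metis norm_mult norm_one norm_power)
  moreover have "norm a * norm q ^ k \<le> norm a * 1"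
    using assms by (intro mult_left_mono power_le_one) auto
  ultimately show False using assms by simp
qed

text \<open>The exponents k are sorted by their residue modulo m; the finite products agree exactly
  when the full product is cut at a multiple of m, so its limit is taken along the multiples of
  m.\<close>

lemma qp_split_modulus:
  assumes "norm q < 1" "m > 0"
  shows "(\<Prod>j<m. qp (a * q ^ j) (q ^ m)) = qp a q"
proof (rule LIMSEQ_unique)
  have qm: "norm (q ^ m) < 1"
    using assms by (auto simp: norm_power power_less_one_iff)
  have "(\<Prod>j<m. \<Prod>k<N. 1 - a * q ^ j * (q ^ m) ^ k) = (\<Prod>k<N*m. 1 - a * q ^ k)" for N
  proof (induction N)
    case (Suc N)
    have "(\<Prod>k<Suc N*m. 1 - a * q ^ k) = (\<Prod>k<N*m+m. 1 - a * q ^ k)"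
      by (simp add: add.commute)
    also have "\<dots> = (\<Prod>k<N*m. 1 - a * q ^ k) * (\<Prod>j<m. 1 - a * q ^ (N * m + j))"
    proof -
      have "(\<Prod>k<L+n. f k) = (\<Prod>k<L. f k) * (\<Prod>j<n. f (L + j))" for L n and f :: "nat \<Rightarrow> complex"
        by (induction n) auto
      then show ?thesis .
    qed
    also have "(\<Prod>j<m. 1 - a * q ^ (N * m + j)) = (\<Prod>j<m. 1 - a * q ^ j * (q ^ m) ^ N)"
      by (simp add: power_add power_mult[symmetric] mult_ac)
    finally show ?case
      using Suc by (simp add: prod.distrib)
  qed simp
  moreover have "(\<lambda>N. \<Prod>j<m. \<Prod>k<N. 1 - a * q ^ j * (q ^ m) ^ k) \<longlonglongrightarrow> (\<Prod>j<m. qp (a * q ^ j) (q ^ m))"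
    by (intro tendsto_prod qp_tendsto qm)
  ultimately show "(\<lambda>N. \<Prod>k<N*m. 1 - a * q ^ k) \<longlonglongrightarrow> (\<Prod>j<m. qp (a * q ^ j) (q ^ m))"
    by simp
  have "filterlim (\<lambda>N. N * m) sequentially sequentially"
    using assms(2) by (intro filterlim_subseq) (auto simp: strict_mono_def)
  from filterlim_compose[OF qp_tendsto[OF assms(1), of a] this]
  show "(\<lambda>N. \<Prod>k<N*m. 1 - a * q ^ k) \<longlonglongrightarrow> qp a q" by simp
qed

text \<open>Bounds uniform in N supply the dominating terms when limits of finite products are
  exchanged with two-sided sums.\<close>

lemma qp_partial_inverse_bounded:
  fixes a q :: complex
  assumes "norm q < 1" "\<And>k. a * q ^ k \<noteq> 1"
  obtains C where "C > 0" "\<And>N. norm (inverse (\<Prod>k<N. 1 - a * q ^ k)) \<le> C"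
proof -
  have "qp a q \<noteq> 0"
    using assms by (auto simp: qp_eq_0_iff)
  then have "(\<lambda>N. inverse (\<Prod>k<N. 1 - a * q ^ k)) \<longlonglongrightarrow> inverse (qp a q)"
    by (intro tendsto_inverse qp_tendsto assms)
  then have "Bseq (\<lambda>N. inverse (\<Prod>k<N. 1 - a * q ^ k))"
    by (intro convergent_imp_Bseq convergentI)
  then show ?thesis
    using that by (auto simp: Bseq_def)
qed

lemma qp_partial_bounded:
  fixes a q :: complex
  assumes "norm q < 1"
  obtains C where "C > 0" "\<And>N. norm (\<Prod>k<N. 1 - a * q ^ k) \<le> C"
proof -
  have "Bseq (\<lambda>N. \<Prod>k<N. 1 - a * q ^ k)"
    by (intro convergent_imp_Bseq convergentI[OF qp_tendsto[OF assms]])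
  then show ?thesis
    using that by (auto simp: Bseq_def)
qed

section \<open>Euler's power series for (x;q) and its differentiability\<close>

fun qexp_coeff :: "complex \<Rightarrow> nat \<Rightarrow> complex" where
  "qexp_coeff q 0 = 1"
| "qexp_coeff q (Suc n) = - (q ^ n) / (1 - q ^ Suc n) * qexp_coeff q n"

lemma power_Suc_neq_1:
  fixes q :: complex
  assumes "norm q < 1"
  shows "q ^ Suc n \<noteq> 1"
proof
  assume "q ^ Suc n = 1"
  then have "norm q ^ Suc n = 1" by (metis norm_one norm_power)
  moreover have "norm q * norm q ^ n \<le> norm q * 1"
    using assms by (intro mult_left_mono power_le_one) auto
  ultimately show False using assms by simp
qed

lemma summable_of_ratio_tendsto:
  fixes c r :: "nat \<Rightarrow> 'a :: {real_normed_field, banach}"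
  assumes ratio: "\<And>n. c (Suc n) = r n * c n" and r: "r \<longlonglongrightarrow> l" and l: "norm l < 1"
  shows "summable c"
proof -
  obtain d where d: "norm l < d" "d < 1"
    using l dense by blast
  have "\<forall>\<^sub>F n in sequentially. norm (r n) < d"
    using tendsto_norm[OF r] d(1) order_tendstoD(2) by blast
  then obtain N where N: "\<And>n. n \<ge> N \<Longrightarrow> norm (r n) < d"
    by (auto simp: eventually_sequentially)
  show ?thesis
  proof (rule summable_ratio_test[of d N])
    fix n assume "N \<le> n"
    then show "norm (c (Suc n)) \<le> d * norm (c n)"
      unfolding ratio norm_mult using N[of n] by (intro mult_right_mono) auto
  qed (use d in auto)
qed

lemma summable_qexp:
  assumes "norm q < 1"
  shows "summable (\<lambda>n. qexp_coeff q n * x ^ n)"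
proof (rule summable_of_ratio_tendsto)
  have "(\<lambda>n. q ^ n) \<longlonglongrightarrow> 0"
    using assms by (rule LIMSEQ_power_zero)
  then show "(\<lambda>n. - (q ^ n) / (1 - q * q ^ n) * x) \<longlonglongrightarrow> - 0 / (1 - q * 0) * x"
    by (intro tendsto_mult tendsto_divide tendsto_minus tendsto_diff tendsto_const) auto
qed (use assms in auto)

text \<open>The coefficients are (-1)^n q^(n(n-1)/2) / ((1-q)...(1-q^n)). Their recursion amounts to
  g(x) = (1 - x) g(x q); iterating drives the argument to 0, where g is continuous with value
  1.\<close>

lemma suminf_qexp:
  assumes q: "norm q < 1"
  shows "(\<Sum>n. qexp_coeff q n * x ^ n) = qp x q"
proof -
  define g where "g = (\<lambda>x. \<Sum>n. qexp_coeff q n * x ^ n)"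
  note sm = summable_qexp[OF q]
  have fe: "g x = (1 - x) * g (x * q)" for x
  proof -
    have "g x - g (x * q) = (\<Sum>n. qexp_coeff q n * x ^ n - qexp_coeff q n * (x * q) ^ n)"
      unfolding g_def by (intro suminf_diff sm)
    also have "\<dots> = (\<Sum>n. qexp_coeff q (Suc n) * x ^ Suc n - qexp_coeff q (Suc n) * (x * q) ^ Suc n)"
      by (subst suminf_split_head) (auto intro!: summable_diff sm)
    also have "(\<lambda>n. qexp_coeff q (Suc n) * x ^ Suc n - qexp_coeff q (Suc n) * (x * q) ^ Suc n) =
               (\<lambda>n. (-x) * (qexp_coeff q n * (x * q) ^ n))"
    proof
      fix n
      have "qexp_coeff q (Suc n) * x ^ Suc n - qexp_coeff q (Suc n) * (x * q) ^ Suc n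
           = (qexp_coeff q (Suc n) * (1 - q ^ Suc n)) * x ^ Suc n"
        by (simp add: power_mult_distrib algebra_simps del: qexp_coeff.simps)
      also have "qexp_coeff q (Suc n) * (1 - q ^ Suc n) = - (q ^ n) * qexp_coeff q n"
        using power_Suc_neq_1[OF q, of n] by simp
      finally show "qexp_coeff q (Suc n) * x ^ Suc n - qexp_coeff q (Suc n) * (x * q) ^ Suc n =
               (-x) * (qexp_coeff q n * (x * q) ^ n)"
        by (simp add: power_mult_distrib)
    qed
    also have "suminf \<dots> = - x * g (x * q)"
      unfolding g_def by (intro suminf_mult sm)
    finally show ?thesis by (simp add: algebra_simps)
  qed
  have iter: "g x = (\<Prod>k<N. 1 - x * q ^ k) * g (x * q ^ N)" for N
  proof (induction N)
    case (Suc N)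
    have "x * q ^ N * q = x * q ^ Suc N" by (simp add: mult_ac)
    with Suc show ?case using fe[of "x * q ^ N"] by (simp add: mult_ac)
  qed simp
  have "isCont g 0"
    unfolding g_def using sm[of 1] by (intro isCont_powser[where K = 1]) auto
  moreover have "(\<lambda>N. x * q ^ N) \<longlonglongrightarrow> 0"
    using tendsto_mult[OF tendsto_const LIMSEQ_power_zero[OF q], of x] by simp
  ultimately have "(\<lambda>N. g (x * q ^ N)) \<longlonglongrightarrow> g 0"
    by (rule isCont_tendsto_compose)
  moreover have "g 0 = 1"
    by (simp add: g_def powser_zero)
  ultimately have "(\<lambda>N. (\<Prod>k<N. 1 - x * q ^ k) * g (x * q ^ N)) \<longlonglongrightarrow> qp x q * 1"
    by (intro tendsto_mult qp_tendsto q) simp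
  then have "(\<lambda>N. g x) \<longlonglongrightarrow> qp x q"
    using iter by simp
  then show ?thesis
    by (simp add: LIMSEQ_const_iff g_def)
qed

lemma qp_has_field_derivative:
  assumes "norm q < 1"
  shows "((\<lambda>x. qp x q) has_field_derivative deriv (\<lambda>x. qp x q) x) (at x)"
proof -
  have "((\<lambda>x. \<Sum>n. qexp_coeff q n * x ^ n) has_field_derivative
          (\<Sum>n. diffs (qexp_coeff q) n * x ^ n)) (at x)"
    by (rule termdiffs_strong_converges_everywhere) (rule summable_qexp[OF assms])
  then show ?thesis
    unfolding suminf_qexp[OF assms] using DERIV_imp_deriv by metis
qed

section \<open>The theta series and its functional equations\<close>

definition tri :: "int \<Rightarrow> int" where
  "tri n = n * (n - 1) div 2"

lemma two_tri: "2 * tri n = n * (n - 1)"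
  unfolding tri_def by (intro dvd_mult_div_cancel) (cases "even n"; simp)

lemma tri_0 [simp]: "tri 0 = 0" and tri_1 [simp]: "tri 1 = 0"
  by (simp_all add: tri_def)

lemma tri_add: "tri (m + n) = tri m + tri n + m * n"
  using two_tri[of "m + n"] two_tri[of m] two_tri[of n] by (simp add: algebra_simps)

lemma tri_minus: "tri (-n) = tri n + n"
  using two_tri[of "-n"] two_tri[of n] by (simp add: algebra_simps)

lemma tri_plus_1: "tri (n + 1) = tri n + n" and tri_minus_1: "tri (n - 1) = tri n - n + 1"
  using two_tri[of "n+1"] two_tri[of "n-1"] two_tri[of n] by (simp_all add: algebra_simps)

text \<open>Dominated convergence over the integers: enumerating them by \<open>int_decode\<close>
  reduces it to Tannery's theorem for ordinary series, which is legitimate by absolute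
  convergence.\<close>

lemma infsum_int_tannery:
  fixes f :: "nat \<Rightarrow> int \<Rightarrow> complex"
  assumes lim: "\<And>n. (\<lambda>N. f N n) \<longlonglongrightarrow> g n"
    and bound: "\<And>N n. norm (f N n) \<le> M n" and M: "M summable_on UNIV"
  shows "(\<lambda>N. infsum (f N) UNIV) \<longlonglongrightarrow> infsum g UNIV"
proof -
  have bij: "bij_betw int_decode UNIV UNIV"
    by (rule bij_int_decode)
  have M': "summable (\<lambda>k. M (int_decode k))"
    using M summable_on_reindex_bij_betw[OF bij, of M] summable_on_imp_summable by blast
  have eq: "infsum h UNIV = (\<Sum>k. h (int_decode k))"
    if h: "\<And>n. norm (h n) \<le> M n" for h :: "int \<Rightarrow> complex"
  proof -
    have "(\<lambda>n. norm (h n)) summable_on UNIV"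
      using M h by (rule Infinite_Sum.abs_summable_on_comparison_test')
    then have "h summable_on UNIV"
      by (rule abs_summable_summable)
    then have "((\<lambda>k. h (int_decode k)) has_sum infsum h UNIV) UNIV"
      using has_sum_reindex_bij_betw[OF bij, of h] by simp
    then show ?thesis
      using has_sum_imp_sums sums_unique by blast
  qed
  have gM: "norm (g n) \<le> M n" for n
    by (rule tendsto_upperbound[OF tendsto_norm[OF lim]]) (auto simp: bound)
  have "(\<lambda>N. \<Sum>k. f N (int_decode k)) \<longlonglongrightarrow> (\<Sum>k. g (int_decode k))"
    using tannerys_theorem[of "\<lambda>k N. f N (int_decode k)" "\<lambda>k. g (int_decode k)" sequentially
        "\<lambda>k. M (int_decode k)"] lim bound M' by (auto simp: eventually_prod_sequentially)
  then show ?thesis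
    using eq[OF bound] eq[OF gM] by simp
qed

lemma summable_on_int_iff:
  fixes f :: "int \<Rightarrow> real"
  assumes "summable (\<lambda>n. f (int n))" "summable (\<lambda>n. f (- int n))" "\<And>n. f n \<ge> 0"
  shows "f summable_on UNIV"
proof -
  have "(\<lambda>n. f (int n)) summable_on UNIV"
    using assms by (intro summable_nonneg_imp_summable_on) auto
  also have "?this \<longleftrightarrow> f summable_on {0..}"
    by (rule summable_on_reindex_bij_witness[of _ nat int]) auto
  finally have 1: "f summable_on {0..}" .
  have "(\<lambda>n. f (- int n)) summable_on UNIV"
    using assms by (intro summable_nonneg_imp_summable_on) auto
  also have "?this \<longleftrightarrow> f summable_on {..0}"
    by (rule summable_on_reindex_bij_witness[of _ "\<lambda>n. nat (-n)" "\<lambda>n. - int n"]) auto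
  finally have 2: "f summable_on {..0}" .
  have "f summable_on ({0..} \<union> {..0})"
    using 1 2 by (rule summable_on_union)
  also have "{0..} \<union> {..0} = (UNIV :: int set)" by auto
  finally show ?thesis .
qed

text \<open>The ratio of consecutive terms is a constant times r^n and tends to 0. The negative half
  is a series of the same kind with r/x in place of x, since tri(-n) = tri(n) + n.\<close>

lemma summable_on_tri_real:
  fixes r x :: real
  assumes "0 < r" "r < 1" "x > 0"
  shows "(\<lambda>n. r powi tri n * x powi n) summable_on UNIV"
proof -
  have base: "summable (\<lambda>n::nat. r powi tri (int n) * y ^ n)" for y
  proof (rule summable_of_ratio_tendsto)
    show "r powi tri (int (Suc n)) * y ^ Suc n = (r ^ n * y) * (r powi tri (int n) * y ^ n)" for n
    proof -
      have "r powi tri (int (Suc n)) = r powi tri (int n) * r ^ n"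
        using tri_plus_1[of "int n"] assms by (simp add: add.commute power_int_add)
      then show ?thesis by simp
    qed
    show "(\<lambda>n. r ^ n * y) \<longlonglongrightarrow> 0 * y"
      using assms by (intro tendsto_intros LIMSEQ_power_zero) auto
  qed auto
  show ?thesis
  proof (rule summable_on_int_iff)
    show "summable (\<lambda>n. r powi tri (int n) * x powi int n)"
      using base[of x] by simp
    have "r powi tri (- int n) * x powi - int n = r powi tri (int n) * (r / x) ^ n" for n
      using assms by (simp add: tri_minus power_int_add power_int_minus power_divide field_simps)
    then show "summable (\<lambda>n. r powi tri (- int n) * x powi - int n)"
      using base[of "r / x"] by simp
  qed (use assms in auto)
qed

lemma summable_on_tri:
  assumes "0 < norm q" "norm q < 1" "x \<noteq> (0::complex)"
  shows "(\<lambda>n. norm (x powi n * q powi tri n)) summable_on UNIV"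
    and "(\<lambda>n. x powi n * q powi tri n) summable_on UNIV"
proof -
  show "(\<lambda>n. norm (x powi n * q powi tri n)) summable_on UNIV"
    using summable_on_tri_real[of "norm q" "norm x"] assms
    by (simp add: norm_mult norm_power_int mult.commute)
  then show "(\<lambda>n. x powi n * q powi tri n) summable_on UNIV"
    by (rule abs_summable_summable)
qed

text \<open>Normalised so that the product form is (q;q)(x;q)(q/x;q), with zeros exactly at the
  integral powers of q.\<close>

definition theta :: "complex \<Rightarrow> complex \<Rightarrow> complex" where
  "theta x q = (\<Sum>\<^sub>\<infinity>n. (-x) powi n * q powi tri n)"

lemma has_sum_theta:
  assumes "0 < norm q" "norm q < 1" "x \<noteq> 0"
  shows "((\<lambda>n. (-x) powi n * q powi tri n) has_sum theta x q) UNIV"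
  unfolding theta_def using summable_on_tri(2)[of q "-x"] assms by auto

lemma theta_mult_q:
  assumes "0 < norm q" "norm q < 1" "x \<noteq> 0"
  shows "theta (x * q) q = - theta x q / x"
proof -
  have "((\<lambda>n. (-x) powi n * q powi tri n * (-1 / x)) has_sum theta x q * (- 1 / x)) UNIV"
    by (intro has_sum_cmult_left has_sum_theta assms)
  also have "?this \<longleftrightarrow> ((\<lambda>n. (-(x * q)) powi n * q powi tri n) has_sum theta x q * (- 1 / x)) UNIV"
  proof (rule has_sum_reindex_bij_witness[of _ "\<lambda>n. n + 1" "\<lambda>n. n - 1"])
    fix n :: int
    have "(-(x * q)) powi (n - 1) * q powi tri (n - 1)
          = (-x) powi (n - 1) * (q powi (n - 1) * q powi tri (n - 1))"
      by (simp add: power_int_mult_distrib[symmetric])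
    also have "q powi (n - 1) * q powi tri (n - 1) = q powi tri n"
      using assms tri_minus_1[of n] by (subst power_int_add[symmetric]) auto
    also have "(-x) powi (n - 1) = (-x) powi n * (-1 / x)"
      using assms by (simp add: power_int_diff)
    finally show "(-(x * q)) powi (n - 1) * q powi tri (n - 1) = (-x) powi n * q powi tri n * (-1 / x)"
      by simp
  qed auto
  finally have "((\<lambda>n. (-(x * q)) powi n * q powi tri n) has_sum theta x q * (- 1 / x)) UNIV" .
  moreover have "((\<lambda>n. (-(x * q)) powi n * q powi tri n) has_sum theta (x * q) q) UNIV"
    using assms by (intro has_sum_theta) auto
  ultimately show ?thesis
    using has_sum_unique by fastforce
qed

text \<open>Reversing the summation index turns the series at 1/x into the one at x q, because
  tri(-n) = tri(n) + n.\<close>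

lemma theta_inverse:
  assumes "0 < norm q" "norm q < 1" "x \<noteq> 0"
  shows "theta (1 / x) q = - theta x q / x"
proof -
  have "((\<lambda>n. (-(x * q)) powi n * q powi tri n) has_sum theta (x * q) q) UNIV"
    using assms by (intro has_sum_theta) auto
  also have "?this \<longleftrightarrow> ((\<lambda>n. (-(1 / x)) powi n * q powi tri n) has_sum theta (x * q) q) UNIV"
  proof (rule has_sum_reindex_bij_witness[of _ uminus uminus])
    fix n :: int
    have "(-(1 / x)) powi (-n) = (-x) powi n"
      using assms by (simp add: power_int_minus power_int_divide_distrib flip: minus_divide_right)
        (metis divide_minus_right inverse_eq_divide inverse_inverse_eq power_int_inverse)
    moreover have "q powi tri (-n) = q powi n * q powi tri n"
      using assms by (simp add: tri_minus power_int_add)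
    moreover have "(-(x * q)) powi n = (-x) powi n * q powi n"
      by (simp flip: power_int_mult_distrib)
    ultimately show "(-(1 / x)) powi (-n) * q powi tri (-n) = (-(x * q)) powi n * q powi tri n"
      by simp
  qed auto
  finally have "((\<lambda>n. (-(1 / x)) powi n * q powi tri n) has_sum theta (x * q) q) UNIV" .
  moreover have "((\<lambda>n. (-(1 / x)) powi n * q powi tri n) has_sum theta (1 / x) q) UNIV"
    using assms by (intro has_sum_theta) auto
  ultimately have "theta (1 / x) q = theta (x * q) q"
    using has_sum_unique by blast
  then show ?thesis
    using theta_mult_q[OF assms] by simp
qed

lemma theta_q_div:
  assumes "0 < norm q" "norm q < 1" "x \<noteq> 0"
  shows "theta (q / x) q = theta x q"
  using theta_mult_q[of q "1 / x"] theta_inverse[OF assms] assms by (simp add: mult.commute)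

section \<open>Jacobi's triple product as a limit of a finite identity\<close>

definition inv_qfact :: "complex \<Rightarrow> int \<Rightarrow> complex" where
  "inv_qfact q m = (if m < 0 then 0 else inverse (\<Prod>k<nat m. 1 - q * q ^ k))"

text \<open>With 1/(q;q)_m read as 0 for negative m, the recursion holds at every integer: at m = 0
  the factor 1 - q^0 supplies the zero.\<close>

lemma inv_qfact_rec:
  assumes "norm q < 1" "q \<noteq> 0"
  shows "inv_qfact q (m - 1) = (1 - q powi m) * inv_qfact q m"
proof (cases "m \<le> 0")
  case True
  then show ?thesis by (cases "m = 0") (auto simp: inv_qfact_def)
next
  case False
  define k where "k = nat (m - 1)"
  have m: "m = int (Suc k)" using False by (simp add: k_def)
  have "1 - q * q ^ k \<noteq> 0"
    using power_Suc_neq_1[OF assms(1), of k] by simp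
  moreover have "q powi m = q * q ^ k"
    unfolding m by (simp only: power_int_of_nat power_Suc)
  moreover have "nat m = Suc k" using m by simp
  ultimately show ?thesis
    using False by (simp add: inv_qfact_def k_def[symmetric])
qed

lemma inv_qfact_tendsto:
  assumes "norm q < 1"
  shows "(\<lambda>N. inv_qfact q (int N + n)) \<longlonglongrightarrow> inverse (qp q q)"
proof -
  have "(\<lambda>N. inverse (\<Prod>k<N. 1 - q * q ^ k)) \<longlonglongrightarrow> inverse (qp q q)"
    using assms by (intro tendsto_inverse qp_tendsto qp_nonzero)
  moreover have "filterlim (\<lambda>N. nat (int N + n)) sequentially sequentially"
    unfolding filterlim_at_top
  proof
    fix Z :: nat
    show "\<forall>\<^sub>F N in sequentially. Z \<le> nat (int N + n)"
      by (rule eventually_sequentiallyI[of "Z + nat (-n)"]) linarith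
  qed
  ultimately have "(\<lambda>N. inverse (\<Prod>k<nat (int N + n). 1 - q * q ^ k)) \<longlonglongrightarrow> inverse (qp q q)"
    by (rule filterlim_compose)
  then show ?thesis
  proof (rule Lim_transform_eventually)
    show "\<forall>\<^sub>F N in sequentially. inverse (\<Prod>k<nat (int N + n). 1 - q * q ^ k) = inv_qfact q (int N + n)"
      by (rule eventually_sequentiallyI[of "nat (-n)"]) (auto simp: inv_qfact_def)
  qed
qed

lemma inv_qfact_bounded:
  assumes "norm q < 1"
  obtains C where "C > 0" "\<And>n. norm (inv_qfact q n) \<le> C"
proof -
  have "q * q ^ k \<noteq> 1" for k
    using power_Suc_neq_1[OF assms, of k] by simp
  then obtain C where "C > 0" "\<And>N. norm (inverse (\<Prod>k<N. 1 - q * q ^ k)) \<le> C"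
    using qp_partial_inverse_bounded[OF assms, of q] by metis
  then show ?thesis
    by (intro that[of C]) (auto simp: inv_qfact_def)
qed

text \<open>\<^const>\<open>inv_qfact\<close> vanishes at negative arguments, so the sum is finite.\<close>
lemma has_sum_finite_jtp:
  assumes q: "norm q < 1" "q \<noteq> 0" and x: "x \<noteq> 0"
  shows "((\<lambda>n. (\<Prod>k<2*N. 1 - q * q ^ k) * inv_qfact q (int N - n) * inv_qfact q (int N + n)
            * ((-x) powi n * q powi tri n)) has_sum
          (\<Prod>k<N. 1 - x * q ^ k) * (\<Prod>k<N. 1 - q / x * q ^ k)) UNIV"
proof (induction N)
  case 0
  have "((\<lambda>n. if n = 0 then 1 else 0) has_sum (1 :: complex)) (UNIV :: int set)"
    by (rule has_sum_finite_neutralI[of "{0}"]) auto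
  also have "?this \<longleftrightarrow> ((\<lambda>n. (\<Prod>k<2*0. 1 - q * q ^ k) * inv_qfact q (int 0 - n) * inv_qfact q (int 0 + n)
            * ((-x) powi n * q powi tri n)) has_sum 1) UNIV"
    by (intro has_sum_cong) (auto simp: inv_qfact_def)
  finally show ?case by simp
next
  case (Suc N)
  define p where "p = (\<Prod>k<2*N. 1 - q * q ^ k)"
  define f where "f = (\<lambda>n. p * inv_qfact q (int N - n) * inv_qfact q (int N + n))"
  define h where "h = (\<lambda>n. f n * ((-x) powi n * q powi tri n))"
  define S where "S = (\<Prod>k<N. 1 - x * q ^ k) * (\<Prod>k<N. 1 - q / x * q ^ k)"
  have h: "(h has_sum S) UNIV"
    using Suc.IH by (simp add: h_def f_def p_def S_def)
  have h1: "((\<lambda>n. h (n - 1)) has_sum S) UNIV"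
    using h by (subst has_sum_reindex_bij_witness[of _ "\<lambda>n. n + 1" "\<lambda>n. n - 1" UNIV h]) auto
  have h2: "((\<lambda>n. h (n + 1)) has_sum S) UNIV"
    using h by (subst has_sum_reindex_bij_witness[of _ "\<lambda>n. n - 1" "\<lambda>n. n + 1" UNIV h]) auto
  \<comment> \<open>Passing from N to N + 1 multiplies the product by (1 - x q^N)(1 - q^(N+1)/x) = 1
    + q^(2N+1) - x q^N - q^(N+1)/x; multiplication by x or 1/x is a shift of the summation
    index.\<close>
  have "((\<lambda>n. (1 + q ^ (2 * N + 1)) * h n + (- (x * q ^ N)) * h (n - 1) + (- (q ^ (N + 1) / x)) * h (n + 1))
      has_sum ((1 + q ^ (2 * N + 1)) * S + (- (x * q ^ N)) * S + (- (q ^ (N + 1) / x)) * S)) UNIV"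
    by (intro has_sum_add has_sum_cmult_right h h1 h2)
  also have "(1 + q ^ (2 * N + 1)) * S + (- (x * q ^ N)) * S + (- (q ^ (N + 1) / x)) * S
      = (\<Prod>k<Suc N. 1 - x * q ^ k) * (\<Prod>k<Suc N. 1 - q / x * q ^ k)"
    using x unfolding S_def by (simp add: field_simps power_add power_mult power2_eq_square)
  also have "(\<lambda>n. (1 + q ^ (2 * N + 1)) * h n + (- (x * q ^ N)) * h (n - 1) + (- (q ^ (N + 1) / x)) * h (n + 1))
     = (\<lambda>n. (\<Prod>k<2*Suc N. 1 - q * q ^ k) * inv_qfact q (int (Suc N) - n) * inv_qfact q (int (Suc N) + n)
            * ((-x) powi n * q powi tri n))"
  proof
    fix n :: int
    \<comment> \<open>All six inverse factorials are expressed through u and v, the values needed at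
      N + 1, with factors that are polynomials in A and B. The induction step becomes a polynomial
      identity together with A B = q^(2N+2).\<close>
    define A B where "A = q powi (int N + 1 - n)" and "B = q powi (int N + 1 + n)"
    define u v where "u = inv_qfact q (int N + 1 - n)" and "v = inv_qfact q (int N + 1 + n)"
    define w where "w = (-x) powi n * q powi tri n"
    have AB: "A * B = q * q * q ^ (2 * N)"
    proof -
      have "A * B = q powi (int (2 * N + 2))"
        unfolding A_def B_def using q
        by (subst power_int_add[symmetric]) (auto simp: algebra_simps)
      also have "\<dots> = q ^ (2 * N + 2)" by (simp only: power_int_of_nat)
      finally show ?thesis by (simp add: power2_eq_square)
    qed
    have u0: "inv_qfact q (int N - n) = (1 - A) * u"
      using inv_qfact_rec[OF q, of "int N + 1 - n"] by (simp add: u_def A_def algebra_simps)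
    have v0: "inv_qfact q (int N + n) = (1 - B) * v"
      using inv_qfact_rec[OF q, of "int N + 1 + n"] by (simp add: v_def B_def algebra_simps)
    have Aq: "q powi (int N - n) = A / q" "q powi (int N + n) = B / q"
      using q by (simp_all add: A_def B_def power_int_add power_int_diff)
    have u1: "inv_qfact q (int N - (n + 1)) = (1 - A / q) * ((1 - A) * u)"
      using inv_qfact_rec[OF q, of "int N - n"] unfolding u0 Aq by (simp only: diff_diff_eq)
    have v1: "inv_qfact q (int N + (n - 1)) = (1 - B / q) * ((1 - B) * v)"
      using inv_qfact_rec[OF q, of "int N + n"] unfolding v0 Aq by (simp only: add_diff_eq)
    have u2: "inv_qfact q (int N - (n - 1)) = u" and v2: "inv_qfact q (int N + (n + 1)) = v"
      by (simp_all add: u_def v_def algebra_simps)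
    have s1: "(- (x * q ^ N)) * ((-x) powi (n - 1) * q powi tri (n - 1)) = A * w"
    proof -
      have "q ^ N * q powi tri (n - 1) = A * q powi tri n"
        unfolding A_def tri_minus_1 using q by (simp add: power_int_add power_int_diff field_simps)
      moreover have "(- x) * (-x) powi (n - 1) = (-x) powi n"
        using x by (simp add: power_int_diff)
      ultimately show ?thesis unfolding w_def
        by (smt (verit) mult.assoc mult.commute mult_minus_left)
    qed
    have s2: "(- (q ^ (N + 1) / x)) * ((-x) powi (n + 1) * q powi tri (n + 1)) = B * w"
    proof -
      have "q ^ (N + 1) * q powi tri (n + 1) = B * q powi tri n"
        unfolding B_def tri_plus_1 using q by (simp add: power_int_add field_simps)
      moreover have "(- 1 / x) * (-x) powi (n + 1) = (-x) powi n"
        using x by (simp add: power_int_add)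
      moreover have "- (q ^ (N + 1) / x) = q ^ (N + 1) * (- 1 / x)" by simp
      ultimately show ?thesis unfolding w_def
        by (smt (verit) mult.assoc mult.commute)
    qed
    have "(1 + q ^ (2 * N + 1)) * h n + (- (x * q ^ N)) * h (n - 1) + (- (q ^ (N + 1) / x)) * h (n + 1)
       = (1 + q ^ (2 * N + 1)) * (f n * w) + f (n - 1) * ((- (x * q ^ N)) * ((-x) powi (n - 1) * q powi tri (n - 1)))
          + f (n + 1) * ((- (q ^ (N + 1) / x)) * ((-x) powi (n + 1) * q powi tri (n + 1)))"
      unfolding h_def w_def by (simp only: mult_ac)
    also have "\<dots> = ((1 + q ^ (2 * N + 1)) * f n + A * f (n - 1) + B * f (n + 1)) * w"
      unfolding s1 s2 by (simp add: algebra_simps)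
    also have "(1 + q ^ (2 * N + 1)) * f n + A * f (n - 1) + B * f (n + 1) =
        p * u * v * ((1 + A * B / q) * (1 - A) * (1 - B) + A * (1 - B / q) * (1 - B) + B * (1 - A / q) * (1 - A))"
    proof -
      have "q ^ (2 * N + 1) = A * B / q"
        using AB q by simp
      then show ?thesis
        unfolding f_def u0 v0 u1 v1 u2 v2 by (simp only:) (simp add: algebra_simps add_divide_distrib diff_divide_distrib)
    qed
    also have "(1 + A * B / q) * (1 - A) * (1 - B) + A * (1 - B / q) * (1 - B) + B * (1 - A / q) * (1 - A)
        = (1 - A * B / q) * (1 - A * B)"
      using q(2) by (simp add: field_simps)
    \<comment> \<open>These are the two new factors in the passage from (q;q)_(2N) to
      (q;q)_(2N+2).\<close>
    also have "(1 - A * B / q) * (1 - A * B) = (1 - q * q ^ (2 * N)) * (1 - q * q ^ (2 * N + 1))"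
      using AB q by (simp add: mult_ac)
    finally show "(1 + q ^ (2 * N + 1)) * h n + (- (x * q ^ N)) * h (n - 1) + (- (q ^ (N + 1) / x)) * h (n + 1)
       = (\<Prod>k<2*Suc N. 1 - q * q ^ k) * inv_qfact q (int (Suc N) - n) * inv_qfact q (int (Suc N) + n)
            * ((-x) powi n * q powi tri n)"
      by (simp add: p_def u_def v_def w_def mult_ac add_ac)
  qed
  finally show ?case .
qed

text \<open>In \<open>has_sum_finite_jtp\<close> the coefficient of the n-th theta term tends to
  (q;q)/(q;q)^2 and is bounded uniformly in N and n, so the limit may be taken termwise.\<close>

theorem jacobi_triple_product:
  assumes q: "0 < norm q" "norm q < 1" and x: "x \<noteq> 0"
  shows "theta x q = qp q q * qp x q * qp (q / x) q"
proof -
  have q': "q \<noteq> 0" using q by auto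
  define P where "P = qp q q"
  have P: "P \<noteq> 0"
    unfolding P_def using q by (intro qp_nonzero)
  obtain C where C: "C > 0" "\<And>n. norm (inv_qfact q n) \<le> C"
    using inv_qfact_bounded[OF q(2)] by metis
  obtain D where D: "D > 0" "\<And>N. norm (\<Prod>k<N. 1 - q * q ^ k) \<le> D"
    using qp_partial_bounded[OF q(2), of q] by metis
  define f where "f = (\<lambda>N n. (\<Prod>k<2*N. 1 - q * q ^ k) * inv_qfact q (int N - n) * inv_qfact q (int N + n)
            * ((-x) powi n * q powi tri n))"
  have "(\<lambda>N. infsum (f N) UNIV) \<longlonglongrightarrow> (\<Sum>\<^sub>\<infinity>n. P * inverse P * inverse P * ((-x) powi n * q powi tri n))"
  proof (rule infsum_int_tannery)
    fix n
    have "filterlim (\<lambda>N::nat. 2 * N) sequentially sequentially"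
      by (intro filterlim_subseq) (auto simp: strict_mono_def)
    then have 1: "(\<lambda>N. \<Prod>k<2*N. 1 - q * q ^ k) \<longlonglongrightarrow> P"
      unfolding P_def by (rule filterlim_compose[OF qp_tendsto[OF q(2)]])
    have 2: "(\<lambda>N. inv_qfact q (int N - n)) \<longlonglongrightarrow> inverse P"
      using inv_qfact_tendsto[OF q(2), of "-n"] by (simp add: P_def)
    have 3: "(\<lambda>N. inv_qfact q (int N + n)) \<longlonglongrightarrow> inverse P"
      using inv_qfact_tendsto[OF q(2), of "n"] by (simp add: P_def)
    show "(\<lambda>N. f N n) \<longlonglongrightarrow> P * inverse P * inverse P * ((-x) powi n * q powi tri n)"
      unfolding f_def by (intro tendsto_mult 1 2 3 tendsto_const)
  next
    fix N n
    show "norm (f N n) \<le> D * C * C * norm ((-x) powi n * q powi tri n)"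
      unfolding f_def norm_mult
      using C D by (intro mult_mono mult_nonneg_nonneg) (auto simp: less_imp_le)
  next
    show "(\<lambda>n. D * C * C * norm ((-x) powi n * q powi tri n)) summable_on UNIV"
      using summable_on_tri(1)[OF q, of "-x"] x by (intro summable_on_cmult_right) auto
  qed
  also have "(\<Sum>\<^sub>\<infinity>n. P * inverse P * inverse P * ((-x) powi n * q powi tri n)) = inverse P * theta x q"
    using P by (simp add: theta_def infsum_cmult_right')
  also have "(\<lambda>N. infsum (f N) UNIV) = (\<lambda>N. (\<Prod>k<N. 1 - x * q ^ k) * (\<Prod>k<N. 1 - q / x * q ^ k))"
    unfolding f_def by (intro ext infsumI has_sum_finite_jtp[OF q(2) q' x])
  finally have "(\<lambda>N. (\<Prod>k<N. 1 - x * q ^ k) * (\<Prod>k<N. 1 - q / x * q ^ k)) \<longlonglongrightarrow> inverse P * theta x q" .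
  moreover have "(\<lambda>N. (\<Prod>k<N. 1 - x * q ^ k) * (\<Prod>k<N. 1 - q / x * q ^ k)) \<longlonglongrightarrow> qp x q * qp (q / x) q"
    by (intro tendsto_mult qp_tendsto q)
  ultimately have "inverse P * theta x q = qp x q * qp (q / x) q"
    by (rule LIMSEQ_unique)
  then show ?thesis
    using P by (simp add: P_def field_simps)
qed

lemma theta_eq_0_iff:
  assumes q: "0 < norm q" "norm q < 1" and x: "x \<noteq> 0"
  shows "theta x q = 0 \<longleftrightarrow> (\<exists>n. x = q powi n)"
proof -
  have q': "q \<noteq> 0" using q by auto
  have "theta x q = 0 \<longleftrightarrow> (\<exists>k. x * q ^ k = 1) \<or> (\<exists>k. q / x * q ^ k = 1)"
    using qp_nonzero[OF q(2) q(2)] by (simp add: jacobi_triple_product[OF q x] qp_eq_0_iff[OF q(2)])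
  also have "(\<exists>k. x * q ^ k = 1) \<longleftrightarrow> (\<exists>k. x = q powi (- int k))"
    using q' by (simp add: power_int_minus field_simps)
  also have "(\<exists>k. q / x * q ^ k = 1) \<longleftrightarrow> (\<exists>k. x = q powi (int (Suc k)))"
    unfolding power_int_of_nat using q' x by (auto simp: field_simps)
  also have "(\<exists>k. x = q powi (- int k)) \<or> (\<exists>k. x = q powi (int (Suc k))) \<longleftrightarrow> (\<exists>n. x = q powi n)"
  proof
    assume "\<exists>n. x = q powi n"
    then obtain n where n: "x = q powi n" ..
    show "(\<exists>k. x = q powi (- int k)) \<or> (\<exists>k. x = q powi (int (Suc k)))"
    proof (cases "n \<le> 0")
      case True
      then have "x = q powi (- int (nat (-n)))" using n by simp
      then show ?thesis by (rule exI[THEN disjI1])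
    next
      case False
      then have "int (Suc (nat (n - 1))) = n" by simp
      then have "x = q powi (int (Suc (nat (n - 1))))" using n by simp
      then show ?thesis by (rule exI[THEN disjI2])
    qed
  qed (elim disjE exE; rule exI; assumption)
  finally show ?thesis .
qed

lemma theta_1 [simp]:
  assumes "0 < norm q" "norm q < 1"
  shows "theta 1 q = 0"
proof -
  have "(1 :: complex) = q powi 0" by simp
  then show ?thesis
    using theta_eq_0_iff[OF assms, of 1] by (metis one_neq_zero)
qed

section \<open>Derivatives of theta functions and the pentagonal number theorem\<close>

lemma qp_DERIV_chain:
  assumes "norm q < 1" "(g has_field_derivative g') (at x)" "deriv (\<lambda>x. qp x q) (g x) * g' = D"
  shows "((\<lambda>x. qp (g x) q) has_field_derivative D) (at x)"
  using DERIV_chain2[OF qp_has_field_derivative[OF assms(1)] assms(2)] assms(3) by simp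

lemma theta_has_field_derivative:
  assumes "0 < norm q" "norm q < 1" "x \<noteq> 0"
  shows "((\<lambda>x. theta x q) has_field_derivative deriv (\<lambda>x. theta x q) x) (at x)"
proof -
  have "\<exists>D. ((\<lambda>x. qp q q * qp x q * qp (q / x) q) has_field_derivative D) (at x)"
    by (rule exI, (rule qp_DERIV_chain[OF assms(2)] derivative_eq_intros assms refl)+)
  then obtain D where "((\<lambda>x. qp q q * qp x q * qp (q / x) q) has_field_derivative D) (at x)" ..
  then have "((\<lambda>x. theta x q) has_field_derivative D) (at x)"
  proof (rule has_field_derivative_transform_within_open)
    show "open (- {0 :: complex})" "x \<in> - {0}" using assms by auto
  qed (use assms in \<open>auto simp: jacobi_triple_product\<close>)
  then show ?thesis
    using DERIV_imp_deriv by metis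
qed

text \<open>The simple zero at 1 is the factor 1 - x of (x;q); with it removed, the product at x = 1
  is the cube of (q;q).\<close>

lemma deriv_theta_1:
  assumes "0 < norm q" "norm q < 1"
  shows "deriv (\<lambda>x. theta x q) 1 = - (qp q q ^ 3)"
proof -
  define g where "g = (\<lambda>x. qp q q * qp (x * q) q * qp (q / x) q)"
  have "\<exists>D. (g has_field_derivative D) (at 1)"
    unfolding g_def
    by (rule exI, (rule qp_DERIV_chain[OF assms(2)] derivative_eq_intros refl one_neq_zero)+)
  then obtain D where "(g has_field_derivative D) (at 1)" ..
  then have "((\<lambda>x. (1 - x) * g x) has_field_derivative (1 - 1) * D + (- 1) * g 1) (at 1)"
    by (auto intro!: derivative_eq_intros)
  then have "((\<lambda>x. theta x q) has_field_derivative (1 - 1) * D + (- 1) * g 1) (at 1)"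
  proof (rule has_field_derivative_transform_within_open)
    show "open (- {0 :: complex})" "1 \<in> - {0 :: complex}" by auto
    show "(1 - x) * g x = theta x q" if "x \<in> - {0}" for x
      using that assms qp_rec[OF assms(2), of x] by (simp add: g_def jacobi_triple_product)
  qed
  then show ?thesis
    by (simp add: DERIV_imp_deriv g_def power3_eq_cube)
qed

text \<open>The left side is the sum of (-1)^n q^(n(3n-1)/2). Its three product factors run through
  the exponents congruent to 0, 1 and 2 modulo 3.\<close>

lemma euler_pentagonal:
  assumes "0 < norm q" "norm q < 1"
  shows "theta q (q ^ 3) = qp q q"
proof -
  have q3: "0 < norm (q ^ 3)" "norm (q ^ 3) < 1"
    using assms by (auto simp: norm_power power_less_one_iff)
  have "theta q (q ^ 3) = qp (q ^ 3) (q ^ 3) * qp q (q ^ 3) * qp (q ^ 3 / q) (q ^ 3)"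
    using assms by (intro jacobi_triple_product q3) auto
  also have "q ^ 3 / q = q * q"
    by (simp add: power3_eq_cube)
  also have "qp (q ^ 3) (q ^ 3) * qp q (q ^ 3) * qp (q * q) (q ^ 3) = (\<Prod>j<3. qp (q * q ^ j) (q ^ 3))"
    by (simp add: eval_nat_numeral mult_ac)
  also have "\<dots> = qp q q"
    by (rule qp_split_modulus[OF assms(2)]) auto
  finally show ?thesis .
qed

section \<open>Partial fractions and Appell sums\<close>

text \<open>Lagrange interpolation of the monomial z^m at the nodes 1/a_i, divided by the product of
  all the factors; m < card I makes the interpolation exact.\<close>

lemma lagrange_partial_fraction:
  fixes a :: "'i \<Rightarrow> complex"
  assumes I: "finite I" "inj_on a I" "\<And>i. i \<in> I \<Longrightarrow> a i \<noteq> 0" and m: "m < card I"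
    and z: "\<And>i. i \<in> I \<Longrightarrow> a i * z \<noteq> 1"
  shows "z ^ m / (\<Prod>i\<in>I. 1 - a i * z)
       = (\<Sum>i\<in>I. (1 / a i) ^ m / (\<Prod>j\<in>I-{i}. 1 - a j / a i) / (1 - a i * z))"
proof -
  define c where "c = (\<lambda>i. (1 / a i) ^ m / (\<Prod>j\<in>I-{i}. 1 - a j / a i))"
  define r where "r = (\<Sum>i\<in>I. smult (c i) (\<Prod>j\<in>I-{i}. [:1, - a j:]))"
  have nz: "(\<Prod>j\<in>I-{i}. 1 - a j / a i) \<noteq> 0" if "i \<in> I" for i
    using I that by (auto simp: prod_zero_iff inj_on_def)
  have "degree (smult (c i) (\<Prod>j\<in>I-{i}. [:1, - a j:])) < card I" if "i \<in> I" for i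
  proof -
    have "degree (smult (c i) (\<Prod>j\<in>I-{i}. [:1, - a j:])) \<le> degree (\<Prod>j\<in>I-{i}. [:1, - a j:])"
      by (rule degree_smult_le)
    also have "\<dots> \<le> (\<Sum>j\<in>I-{i}. degree [:1, - a j:])"
      using degree_prod_sum_le[of "I - {i}" "\<lambda>j. [:1, - a j:]"] I(1) by (simp add: o_def)
    also have "\<dots> \<le> (\<Sum>j\<in>I-{i}. 1)"
      by (intro sum_mono) auto
    also have "\<dots> < card I"
      using that I(1) m by (simp add: card_Diff_singleton)
    finally show ?thesis .
  qed
  then have deg_r: "degree r < card I"
    unfolding r_def using m by (intro degree_sum_less) auto
  have "monom 1 m = r"
  proof (rule poly_eqI_degree)
    fix x assume "x \<in> (\<lambda>i. 1 / a i) ` I"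
    then obtain k where k: "k \<in> I" "x = 1 / a k" by auto
    have "poly r x = (\<Sum>i\<in>I. c i * (\<Prod>j\<in>I-{i}. 1 - a j / a k))"
      by (simp add: r_def poly_sum poly_prod k)
    also have "\<dots> = (\<Sum>i\<in>I. if i = k then x ^ m else 0)"
    proof (intro sum.cong refl)
      fix i assume i: "i \<in> I"
      show "c i * (\<Prod>j\<in>I-{i}. 1 - a j / a k) = (if i = k then x ^ m else 0)"
      proof (cases "i = k")
        case True
        then show ?thesis using nz[OF i] by (simp add: c_def k)
      next
        case False
        then have "(\<Prod>j\<in>I-{i}. 1 - a j / a k) = 0"
          using I k by (intro prod_zero) (auto intro!: bexI[of _ k])
        then show ?thesis using False by simp
      qed
    qed
    also have "\<dots> = x ^ m"
      using k I by simp
    finally show "poly (monom 1 m) x = poly r x"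
      by (simp add: poly_monom)
  next
    have "inj_on (\<lambda>i. 1 / a i) I"
      using I by (auto simp: inj_on_def field_simps)
    then have card: "card ((\<lambda>i. 1 / a i) ` I) = card I"
      by (rule card_image)
    show "degree (monom (1::complex) m) < card ((\<lambda>i. 1 / a i) ` I)"
      using m unfolding card by (simp add: degree_monom_eq)
    show "degree r < card ((\<lambda>i. 1 / a i) ` I)"
      unfolding card by (rule deg_r)
  qed
  then have "z ^ m = poly r z"
    by (metis mult_1 poly_monom)
  also have "\<dots> = (\<Sum>i\<in>I. c i * (\<Prod>j\<in>I-{i}. 1 - a j * z))"
    by (simp add: r_def poly_sum poly_prod mult.commute)
  finally have "z ^ m / (\<Prod>i\<in>I. 1 - a i * z) = (\<Sum>i\<in>I. c i * (\<Prod>j\<in>I-{i}. 1 - a j * z) / (\<Prod>i\<in>I. 1 - a i * z))"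
    by (simp add: sum_divide_distrib)
  also have "\<dots> = (\<Sum>i\<in>I. c i / (1 - a i * z))"
  proof (intro sum.cong refl)
    fix i assume i: "i \<in> I"
    have "(\<Prod>i\<in>I. 1 - a i * z) = (1 - a i * z) * (\<Prod>j\<in>I-{i}. 1 - a j * z)"
      using i I(1) by (simp add: prod.remove)
    moreover have "(\<Prod>j\<in>I-{i}. 1 - a j * z) \<noteq> 0"
      using z I(1) by (auto simp: prod_zero_iff)
    ultimately show "c i * (\<Prod>j\<in>I-{i}. 1 - a j * z) / (\<Prod>i\<in>I. 1 - a i * z) = c i / (1 - a i * z)"
      by simp
  qed
  finally show ?thesis by (simp add: c_def)
qed

lemma power_int_eq_1_D:
  fixes q :: complex
  assumes "norm q < 1" "q powi n = 1"
  shows "n = 0"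
proof (rule ccontr)
  assume "n \<noteq> 0"
  then have n: "int (Suc (nat \<bar>n\<bar> - 1)) = \<bar>n\<bar>" by auto
  have "q powi \<bar>n\<bar> = 1"
    using assms(2) by (cases "n \<ge> 0") (auto simp: power_int_minus)
  then have "q ^ Suc (nat \<bar>n\<bar> - 1) = 1"
    by (metis n power_int_of_nat)
  then show False
    using power_Suc_neq_1[OF assms(1)] by blast
qed

section \<open>Finite forms of inverse theta products and their partial fractions\<close>

lemma prod_power_int:
  "(\<Prod>x\<in>A. f x powi n) = (\<Prod>x\<in>A. f x) powi n" for f :: "'a \<Rightarrow> 'b :: field"
  by (induction A rule: infinite_finite_induct) (simp_all add: power_int_mult_distrib)

text \<open>Collects the factors -x/q^(k+1) that are split off from 1 - x/q^(k+1) when negative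
  powers of q are turned into positive ones.\<close>

lemma prod_neg_powers:
  assumes "x \<noteq> 0" "q \<noteq> (0 :: complex)"
  shows "(\<Prod>k<M. - x / q ^ Suc k) = (-x) ^ M * q powi (- tri (int M + 1))"
proof (induction M)
  case (Suc M)
  have "q powi (- tri (int (Suc M) + 1)) = q powi (- tri (int M + 1)) * q powi (- int (Suc M))"
    using tri_plus_1[of "int (Suc M)"] assms by (simp flip: power_int_add add: algebra_simps)
  also have "q powi (- int (Suc M)) = 1 / q ^ Suc M"
    by (simp only: power_int_minus power_int_of_nat inverse_eq_divide)
  finally have "q powi (- tri (int (Suc M) + 1)) = q powi (- tri (int M + 1)) * (1 / q ^ Suc M)" .
  then show ?case
    using Suc by (simp only: prod.lessThan_Suc power_Suc) (simp add: mult_ac)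
qed simp

lemma prod_int_interval_split:
  "(\<Prod>j\<in>{- int M..<int L}. f j) = (\<Prod>k<M. f (- int (Suc k))) * (\<Prod>k<L. f (int k))"
  for f :: "int \<Rightarrow> complex"
proof -
  have "{- int M..<int L} = (\<lambda>k. - int (Suc k)) ` {..<M} \<union> int ` {..<L}" (is "?A = ?B \<union> ?C")
  proof (intro equalityI subsetI)
    fix j assume j: "j \<in> ?A"
    show "j \<in> ?B \<union> ?C"
    proof (cases "j < 0")
      case True
      then have "j = - int (Suc (nat (- j - 1)))" "nat (-j - 1) < M" using j by auto
      then show ?thesis by blast
    next
      case False
      then have "j = int (nat j)" "nat j < L" using j by auto
      then show ?thesis by blast
    qed
  qed auto
  then have "(\<Prod>j\<in>?A. f j) = (\<Prod>j\<in>?B. f j) * (\<Prod>j\<in>?C. f j)"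
    by (simp only:) (rule prod.union_disjoint; auto)
  then show ?thesis
    by (simp add: prod.reindex inj_on_def)
qed

text \<open>A finite approximation of (q;q)/theta(x). The offset n is there because the other poles,
  seen from the pole of index n, fill the window -N <= k < N shifted by n.\<close>

definition itheta :: "complex \<Rightarrow> nat \<Rightarrow> int \<Rightarrow> complex \<Rightarrow> complex" where
  "itheta q N n x = inverse (\<Prod>k<nat (int N + n). 1 - q / x * q ^ k) * inverse (\<Prod>k<nat (int N - n). 1 - x * q ^ k)"

lemma itheta_nonzero:
  assumes "q \<noteq> 0" "x \<noteq> 0" "\<And>n::int. x * q powi n \<noteq> 1"
  shows "q / x * q ^ k \<noteq> 1" "x * q ^ k \<noteq> 1" "itheta q N n x \<noteq> 0"
proof -
  show 1: "q / x * q ^ k \<noteq> 1" for k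
  proof
    assume "q / x * q ^ k = 1"
    then have "x * q powi (- int (Suc k)) = 1"
      using assms(1,2) unfolding power_int_minus power_int_of_nat by (simp add: field_simps)
    then show False using assms(3) by blast
  qed
  show 2: "x * q ^ k \<noteq> 1" for k
    using assms(3)[of "int k"] by simp
  show "itheta q N n x \<noteq> 0"
    unfolding itheta_def using 1 2 by (auto simp: prod_zero_iff)
qed

text \<open>A factor with a negative exponent is rewritten as 1 - x/q^(k+1) = (-x/q^(k+1)) (1 -
  q^(k+1)/x); the shifted window has N + n such factors and N - n others.\<close>

lemma prod_shifted_eq_itheta:
  assumes q: "q \<noteq> 0" and x: "x \<noteq> 0" "\<And>n::int. x * q powi n \<noteq> 1" and n: "n \<in> {- int N..<int N}"
  shows "(\<Prod>k\<in>{- int N..<int N}. 1 - x * q powi (k - n))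
    = (-x) powi (int N + n) * q powi (- tri (int N + n + 1)) / itheta q N n x"
proof -
  define M L where "M = nat (int N + n)" and "L = nat (int N - n)"
  have dims: "int M = int N + n" "int L = int N - n" using n by (auto simp: M_def L_def)
  have "(\<Prod>k\<in>{- int N..<int N}. 1 - x * q powi (k - n)) = (\<Prod>j\<in>{- int M..<int L}. 1 - x * q powi j)"
    by (rule prod.reindex_bij_witness[of _ "\<lambda>j. j + n" "\<lambda>k. k - n"]) (auto simp: dims)
  also have "\<dots> = (\<Prod>k<M. 1 - x * q powi (- int (Suc k))) * (\<Prod>k<L. 1 - x * q powi (int k))"
    by (rule prod_int_interval_split)
  also have "(\<Prod>k<M. 1 - x * q powi (- int (Suc k))) = (\<Prod>k<M. (- x / q ^ Suc k) * (1 - q / x * q ^ k))"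
    using q x by (intro prod.cong refl) (simp only: power_int_minus power_int_of_nat, simp add: field_simps)
  also have "\<dots> = (-x) ^ M * q powi (- tri (int M + 1)) * (\<Prod>k<M. 1 - q / x * q ^ k)"
    by (simp only: prod.distrib prod_neg_powers[OF x(1) q])
  also have "(-x) ^ M = (-x) powi (int N + n)"
    unfolding dims(1)[symmetric] power_int_of_nat ..
  finally show ?thesis
    unfolding itheta_def M_def[symmetric] L_def[symmetric] dims(1)[symmetric] power_int_of_nat
    by (simp add: field_simps)
qed

text \<open>The analogue of \<open>prod_shifted_eq_itheta\<close> at x = 1 with the vanishing factor
  k = n left out. That factor is missing on the side of nonnegative exponents, whence N - n -
  1.\<close>

lemma prod_shifted_eq_inv_qfact:
  assumes q: "q \<noteq> 0" "norm q < 1" and n: "n \<in> {- int N..<int N}"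
  shows "(\<Prod>k\<in>{- int N..<int N}-{n}. 1 - q powi (k - n))
    = (-1) powi (int N + n) * q powi (- tri (int N + n + 1)) / (inv_qfact q (int N + n) * inv_qfact q (int N - n - 1))"
proof -
  define M L where "M = nat (int N + n)" and "L = nat (int N - n - 1)"
  have dims: "int M = int N + n" "int L = int N - n - 1" using n by (auto simp: M_def L_def)
  have "(\<Prod>k\<in>{- int N..<int N}-{n}. 1 - q powi (k - n)) = (\<Prod>j\<in>{- int M..<int (Suc L)}-{0}. 1 - q powi j)"
    by (rule prod.reindex_bij_witness[of _ "\<lambda>j. j + n" "\<lambda>k. k - n"]) (use dims in auto)
  also have "\<dots> = (\<Prod>j\<in>{- int M..<int (Suc L)}. if j = 0 then 1 else 1 - q powi j)"
    by (rule prod.mono_neutral_cong_left) auto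
  also have "\<dots> = (\<Prod>k<M. if - int (Suc k) = 0 then 1 else 1 - q powi (- int (Suc k))) *
       (\<Prod>k<Suc L. if int k = 0 then 1 else 1 - q powi (int k))"
    by (rule prod_int_interval_split)
  also have "(\<Prod>k<Suc L. if int k = 0 then 1 else 1 - q powi (int k)) = (\<Prod>k<L. 1 - q * q ^ k)"
    by (subst prod.lessThan_Suc_shift) (simp add: power_int_add add.commute[of 1] mult.commute flip: power_int_of_nat)
  also have "(\<Prod>k<M. if - int (Suc k) = 0 then 1 else 1 - q powi (- int (Suc k))) = (\<Prod>k<M. (- 1 / q ^ Suc k) * (1 - q * q ^ k))"
    using q by (intro prod.cong refl) (simp only: power_int_minus power_int_of_nat, simp add: field_simps)
  also have "\<dots> = (-1) ^ M * q powi (- tri (int M + 1)) * (\<Prod>k<M. 1 - q * q ^ k)"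
    using prod_neg_powers[OF one_neq_zero q(1), of M] by (simp only: prod.distrib)
  also have "(-1) ^ M = (-1::complex) powi (int N + n)"
    unfolding dims(1)[symmetric] power_int_of_nat ..
  also have "(\<Prod>k<M. 1 - q * q ^ k) = 1 / inv_qfact q (int N + n)"
    using n by (simp add: inv_qfact_def M_def field_simps)
  also have "(\<Prod>k<L. 1 - q * q ^ k) = 1 / inv_qfact q (int N - n - 1)"
    using n by (simp add: inv_qfact_def L_def field_simps)
  finally show ?thesis
    unfolding dims(1)[symmetric] by simp
qed

text \<open>Lagrange's formula for the 2 N r factors 1 - \<alpha> q^k z, with r = card S and -N <= k
  < N. The numerator z^(N r) is chosen to cancel the powers of z that come from the N negative
  exponents in each of the r products.\<close>

lemma finite_theta_partial_fraction:
  assumes q: "q \<noteq> 0" "norm q < 1" and N: "N > 0"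
    and S: "finite S" "S \<noteq> {}" "0 \<notin> S"
    and gen: "\<And>\<alpha> \<beta> n. \<alpha> \<in> S \<Longrightarrow> \<beta> \<in> S \<Longrightarrow> \<alpha> \<noteq> \<beta> \<Longrightarrow> \<beta> / \<alpha> * q powi n \<noteq> 1"
    and z: "z \<noteq> 0" "\<And>\<alpha> n. \<alpha> \<in> S \<Longrightarrow> \<alpha> * z * q powi n \<noteq> 1"
  defines "c \<equiv> (\<lambda>\<alpha>. (-1) ^ card S * (\<Prod>\<beta>\<in>S-{\<alpha>}. \<alpha> / \<beta>))"
  shows "(\<Prod>\<alpha>\<in>S. itheta q N 0 (\<alpha> * z)) =
    (\<Sum>\<alpha>\<in>S. \<Sum>n\<in>{- int N..<int N}. c \<alpha> powi n * q powi (int (card S) * tri (n + 1))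
        * (\<Prod>\<beta>\<in>S-{\<alpha>}. itheta q N n (\<beta> / \<alpha>)) * inv_qfact q (int N + n) * inv_qfact q (int N - n - 1)
        / (1 - \<alpha> * z * q powi n))"
proof -
  define r where "r = card S"
  define K where "K = {- int N..<int N}"
  define a where "a = (\<lambda>(\<alpha>, k). \<alpha> * q powi k)"
  \<comment> \<open>The constant that remains when the r products are normalised to
    \<open>itheta\<close>; its dependence on N has to cancel against the residues.\<close>
  define G where "G = (-1) ^ (N * r) * (\<Prod>\<alpha>\<in>S. \<alpha>) ^ N * q powi (- int r * tri (int N + 1))"
  have r: "r > 0" using S by (auto simp: r_def card_gt_0_iff)
  have Pnz: "(\<Prod>\<alpha>\<in>S. \<alpha>) \<noteq> 0" using S by (auto simp: prod_zero_iff)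
  have Gnz: "G \<noteq> 0" using Pnz q by (auto simp: G_def)
  have "inj_on a (S \<times> K)"
  proof (rule inj_onI, clarsimp simp: a_def)
    fix \<alpha> \<beta> k l assume as: "\<alpha> \<in> S" "\<beta> \<in> S" "\<alpha> * q powi k = \<beta> * q powi l"
    then have eq: "\<beta> / \<alpha> * q powi (l - k) = 1"
      using q S by (auto simp: power_int_diff field_simps)
    then have "\<alpha> = \<beta>" using gen[OF as(1,2)] by blast
    moreover have "\<alpha> \<noteq> 0" using as S by auto
    ultimately have "q powi (l - k) = 1" using eq by simp
    then have "l = k" using power_int_eq_1_D[OF q(2)] by fastforce
    then show "\<alpha> = \<beta> \<and> k = l" using \<open>\<alpha> = \<beta>\<close> by simp
  qed
  moreover have "card (S \<times> K) = 2 * N * r"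
    by (simp add: K_def r_def card_cartesian_product nat_mult_distrib)
  ultimately have "z ^ (N * r) / (\<Prod>i\<in>S \<times> K. 1 - a i * z)
       = (\<Sum>i\<in>S \<times> K. (1 / a i) ^ (N * r) / (\<Prod>j\<in>S \<times> K-{i}. 1 - a j / a i) / (1 - a i * z))"
    using S q z N r by (intro lagrange_partial_fraction) (auto simp: a_def K_def mult_ac)
  also have "(\<Prod>i\<in>S \<times> K. 1 - a i * z) = (\<Prod>\<alpha>\<in>S. \<Prod>k\<in>K. 1 - (\<alpha> * z) * q powi (k - 0))"
    by (simp add: prod.cartesian_product a_def mult_ac split_def)
  also have "\<dots> = (\<Prod>\<alpha>\<in>S. (-(\<alpha> * z)) powi (int N + 0) * q powi (- tri (int N + 0 + 1)) / itheta q N 0 (\<alpha> * z))"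
    unfolding K_def using S z N by (intro prod.cong refl prod_shifted_eq_itheta[OF q(1)]) auto
  also have "\<dots> = G * z ^ (N * r) / (\<Prod>\<alpha>\<in>S. itheta q N 0 (\<alpha> * z))"
  proof -
    have "(\<Prod>\<alpha>\<in>S. (-(\<alpha> * z)) powi (int N + 0)) = (-1) ^ (N * r) * (\<Prod>\<alpha>\<in>S. \<alpha>) ^ N * z ^ (N * r)"
    proof -
      have "(\<Prod>\<alpha>\<in>S. (-(\<alpha> * z)) powi (int N + 0)) = (\<Prod>\<alpha>\<in>S. (-1) ^ N * \<alpha> ^ N * z ^ N)"
        by (intro prod.cong refl) (simp flip: power_mult_distrib)
      then show ?thesis
        by (simp add: prod.distrib r_def power_mult prod_power_distrib)
    qed
    moreover have "(\<Prod>\<alpha>\<in>S. q powi (- tri (int N + 0 + 1))) = q powi (- int r * tri (int N + 1))"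
      by (simp add: r_def power_int_mult[symmetric] flip: power_int_of_nat) (simp add: mult.commute)
    ultimately show ?thesis
      by (simp only: prod_dividef prod.distrib G_def) (simp add: mult_ac)
  qed
  also have "z ^ (N * r) / (G * z ^ (N * r) / (\<Prod>\<alpha>\<in>S. itheta q N 0 (\<alpha> * z))) = (\<Prod>\<alpha>\<in>S. itheta q N 0 (\<alpha> * z)) / G"
    using z(1) by simp
  finally have "(\<Prod>\<alpha>\<in>S. itheta q N 0 (\<alpha> * z)) =
      G * (\<Sum>i\<in>S \<times> K. (1 / a i) ^ (N * r) / (\<Prod>j\<in>S \<times> K-{i}. 1 - a j / a i) / (1 - a i * z))"
    using Gnz by (simp add: field_simps)
  also have "\<dots> = (\<Sum>\<alpha>\<in>S. \<Sum>n\<in>K. G * ((1 / a (\<alpha>, n)) ^ (N * r) / (\<Prod>j\<in>S \<times> K-{(\<alpha>, n)}. 1 - a j / a (\<alpha>, n)) / (1 - a (\<alpha>, n) * z)))"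
    by (simp add: sum_distrib_left sum.cartesian_product split_def)
  also have "\<dots> = (\<Sum>\<alpha>\<in>S. \<Sum>n\<in>K. c \<alpha> powi n * q powi (int (card S) * tri (n + 1))
        * (\<Prod>\<beta>\<in>S-{\<alpha>}. itheta q N n (\<beta> / \<alpha>)) * inv_qfact q (int N + n) * inv_qfact q (int N - n - 1)
        / (1 - \<alpha> * z * q powi n))"
  proof (intro sum.cong refl)
    fix \<alpha> n assume \<alpha>: "\<alpha> \<in> S" and n: "n \<in> K"
    have \<alpha>0: "\<alpha> \<noteq> 0" using \<alpha> S by auto
    define m where "m = int N + n"
    define W where "W = q powi (- tri (m + 1))"
    define X where "X = (\<Prod>\<beta>\<in>S-{\<alpha>}. itheta q N n (\<beta> / \<alpha>))"
    define Y where "Y = inv_qfact q (int N + n) * inv_qfact q (int N - n - 1)"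
    have "S \<times> K - {(\<alpha>, n)} = (S - {\<alpha>}) \<times> K \<union> {\<alpha>} \<times> (K - {n})"
      using \<alpha> n by auto
    then have "(\<Prod>j\<in>S \<times> K-{(\<alpha>, n)}. 1 - a j / a (\<alpha>, n)) =
        (\<Prod>j\<in>(S - {\<alpha>}) \<times> K. 1 - a j / a (\<alpha>, n)) * (\<Prod>j\<in>{\<alpha>} \<times> (K - {n}). 1 - a j / a (\<alpha>, n))"
      using S by (simp only:) (rule prod.union_disjoint; auto simp: K_def)
    also have "(\<Prod>j\<in>(S - {\<alpha>}) \<times> K. 1 - a j / a (\<alpha>, n)) = (\<Prod>\<beta>\<in>S-{\<alpha>}. \<Prod>k\<in>K. 1 - \<beta> / \<alpha> * q powi (k - n))"
      using q by (simp add: prod.cartesian_product a_def split_def power_int_diff)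
    also have "\<dots> = (\<Prod>\<beta>\<in>S-{\<alpha>}. (-(\<beta> / \<alpha>)) powi (int N + n) * q powi (- tri (int N + n + 1)) / itheta q N n (\<beta> / \<alpha>))"
    proof (intro prod.cong refl)
      fix \<beta> assume \<beta>: "\<beta> \<in> S - {\<alpha>}"
      show "(\<Prod>k\<in>K. 1 - \<beta> / \<alpha> * q powi (k - n)) = (-(\<beta> / \<alpha>)) powi (int N + n) * q powi (- tri (int N + n + 1)) / itheta q N n (\<beta> / \<alpha>)"
        unfolding K_def
      proof (rule prod_shifted_eq_itheta[OF q(1)])
        show "\<beta> / \<alpha> \<noteq> 0" using \<beta> \<alpha>0 S by auto
        show "\<beta> / \<alpha> * q powi l \<noteq> 1" for l using gen[of \<alpha> \<beta> l] \<alpha> \<beta> by auto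
        show "n \<in> {- int N..<int N}" using n by (simp add: K_def)
      qed
    qed
    also have "\<dots> = (\<Prod>\<beta>\<in>S-{\<alpha>}. - (\<beta> / \<alpha>)) powi m * W ^ (r - 1) / X"
      using \<alpha> S by (simp add: prod_dividef prod.distrib X_def W_def m_def r_def prod_power_int card_Diff_singleton)
    also have "(\<Prod>j\<in>{\<alpha>} \<times> (K - {n}). 1 - a j / a (\<alpha>, n)) = (\<Prod>k\<in>K - {n}. 1 - q powi (k - n))"
      by (rule prod.reindex_bij_witness[of _ "\<lambda>k. (\<alpha>, k)" snd])
        (use q \<alpha>0 in \<open>auto simp: a_def power_int_diff\<close>)
    also have "\<dots> = (-1) powi m * W / Y"
      using n unfolding K_def W_def Y_def m_def by (intro prod_shifted_eq_inv_qfact q)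
    also have "(\<Prod>\<beta>\<in>S-{\<alpha>}. - (\<beta> / \<alpha>)) powi m * W ^ (r - 1) / X * ((-1) powi m * W / Y)
       = (-1 * (\<Prod>\<beta>\<in>S-{\<alpha>}. - (\<beta> / \<alpha>))) powi m * W ^ r / (X * Y)"
    proof -
      have "W ^ r = W ^ (r - 1) * W" using r by (metis One_nat_def Suc_pred power_Suc2)
      then show ?thesis by (simp only: power_int_mult_distrib) simp
    qed
    also have "-1 * (\<Prod>\<beta>\<in>S-{\<alpha>}. - (\<beta> / \<alpha>)) = 1 / c \<alpha>"
    proof -
      have "(-1 :: complex) ^ r = - ((-1) ^ (r - 1))"
        using r by (metis One_nat_def Suc_pred mult_minus1 power_Suc)
      moreover have "(\<Prod>\<beta>\<in>S-{\<alpha>}. - (\<beta> / \<alpha>)) = (-1) ^ (r - 1) * (\<Prod>\<beta>\<in>S-{\<alpha>}. \<beta> / \<alpha>)"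
      proof -
        have "(\<Prod>\<beta>\<in>S-{\<alpha>}. - (\<beta> / \<alpha>)) = (\<Prod>\<beta>\<in>S-{\<alpha>}. (-1) * (\<beta> / \<alpha>))" by simp
        then show ?thesis using \<alpha> S by (simp only: prod.distrib) (simp add: r_def card_Diff_singleton)
      qed
      moreover have "(\<Prod>\<beta>\<in>S-{\<alpha>}. \<beta> / \<alpha>) = 1 / (\<Prod>\<beta>\<in>S-{\<alpha>}. \<alpha> / \<beta>)"
        by (simp add: prod_dividef)
      ultimately show ?thesis
        unfolding c_def r_def[symmetric] by (cases "even (r - 1)") simp_all
    qed
    finally have den: "(\<Prod>j\<in>S \<times> K-{(\<alpha>, n)}. 1 - a j / a (\<alpha>, n)) = (1 / c \<alpha>) powi m * W ^ r / (X * Y)" .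
    have c0: "c \<alpha> \<noteq> 0"
      using \<alpha>0 S by (auto simp: c_def prod_zero_iff)
    \<comment> \<open>All powers that involve N cancel: up to sign, the product of the elements of S
      times c(\<alpha>) is \<alpha>^r, and the exponents of q combine by the addition formula for
      \<open>tri\<close>.\<close>
    have main: "G * (1 / a (\<alpha>, n)) ^ (N * r) * c \<alpha> powi m / W ^ r = c \<alpha> powi n * q powi (int r * tri (n + 1))"
    proof -
      have "(\<Prod>\<alpha>\<in>S. \<alpha>) * (\<Prod>\<beta>\<in>S-{\<alpha>}. \<alpha> / \<beta>) = \<alpha> ^ r"
      proof -
        have "(\<Prod>\<alpha>\<in>S. \<alpha>) = \<alpha> * (\<Prod>\<beta>\<in>S-{\<alpha>}. \<beta>)" using \<alpha> S(1) by (simp add: prod.remove)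
        then have "(\<Prod>\<alpha>\<in>S. \<alpha>) * (\<Prod>\<beta>\<in>S-{\<alpha>}. \<alpha> / \<beta>) = \<alpha> * (\<Prod>\<beta>\<in>S-{\<alpha>}. \<beta> * (\<alpha> / \<beta>))"
          by (simp only: prod.distrib mult.assoc)
        also have "(\<Prod>\<beta>\<in>S-{\<alpha>}. \<beta> * (\<alpha> / \<beta>)) = (\<Prod>\<beta>\<in>S-{\<alpha>}. \<alpha>)"
          using S by (intro prod.cong refl) auto
        also have "\<dots> = \<alpha> ^ (r - 1)" using \<alpha> S(1) by (simp add: r_def card_Diff_singleton)
        finally show ?thesis using r by (simp add: power_eq_if)
      qed
      then have "(-1) ^ r * (\<Prod>\<alpha>\<in>S. \<alpha>) * c \<alpha> = \<alpha> ^ r"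
        unfolding c_def r_def[symmetric] by (simp add: mult_ac flip: power_add mult_2)
      then have "((-1) ^ r * (\<Prod>\<alpha>\<in>S. \<alpha>) * c \<alpha>) ^ N = \<alpha> ^ (N * r)"
        by (simp add: power_mult[symmetric] mult.commute)
      then have 1: "(-1) ^ (N * r) * (\<Prod>\<alpha>\<in>S. \<alpha>) ^ N * c \<alpha> ^ N = \<alpha> ^ (N * r)"
        by (simp add: power_mult_distrib power_mult[symmetric] mult.commute)
      have 2: "q powi (- int r * tri (int N + 1)) * (1 / q powi n) ^ (N * r) / W ^ r = q powi (int r * tri (n + 1))"
      proof -
        have "(1 / q powi n) ^ (N * r) = q powi (- (n * int N * int r))"
          using q by (simp add: power_int_minus power_int_mult field_simps power_mult flip: power_int_of_nat)
        moreover have "1 / W ^ r = q powi (int r * tri (m + 1))"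
        proof -
          have "W ^ r = q powi (- tri (m + 1) * int r)"
            unfolding W_def power_int_mult power_int_of_nat ..
          also have "- tri (m + 1) * int r = - (int r * tri (m + 1))" by simp
          finally show ?thesis
            by (simp only: power_int_minus inverse_eq_divide) simp
        qed
        moreover have "x * y / w = x * y * (1 / w)" for x y w :: complex by simp
        ultimately have "q powi (- int r * tri (int N + 1)) * (1 / q powi n) ^ (N * r) / W ^ r
          = q powi (- int r * tri (int N + 1)) * q powi (- (n * int N * int r)) * q powi (int r * tri (m + 1))"
          by (simp only:)
        also have "\<dots> = q powi (- int r * tri (int N + 1) + - (n * int N * int r) + int r * tri (m + 1))"
          by (subst power_int_add, simp add: q)+ (rule refl)
        also have "tri (m + 1) = tri (int N + 1) + tri n + (int N + 1) * n"
          unfolding m_def by (subst tri_add[symmetric]) (simp add: algebra_simps)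
        also have "- int r * tri (int N + 1) + - (n * int N * int r) + int r * (tri (int N + 1) + tri n + (int N + 1) * n)
             = int r * tri (n + 1)"
          unfolding tri_plus_1[of n] by (simp add: algebra_simps)
        finally show ?thesis .
      qed
      have "G * (1 / a (\<alpha>, n)) ^ (N * r) * c \<alpha> powi m / W ^ r =
         ((-1) ^ (N * r) * (\<Prod>\<alpha>\<in>S. \<alpha>) ^ N * c \<alpha> ^ N) / \<alpha> ^ (N * r) * c \<alpha> powi n *
         (q powi (- int r * tri (int N + 1)) * (1 / q powi n) ^ (N * r) / W ^ r)"
        unfolding G_def m_def a_def using c0 by (simp add: power_int_add power_mult_distrib power_divide mult_ac)
      also have "\<dots> = c \<alpha> powi n * q powi (int r * tri (n + 1))"
        unfolding 1 2 using \<alpha>0 by simp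
      finally show ?thesis .
    qed
    have "G * ((1 / a (\<alpha>, n)) ^ (N * r) / (\<Prod>j\<in>S \<times> K-{(\<alpha>, n)}. 1 - a j / a (\<alpha>, n)) / (1 - a (\<alpha>, n) * z))
       = (G * (1 / a (\<alpha>, n)) ^ (N * r) * c \<alpha> powi m / W ^ r) * (X * Y) / (1 - a (\<alpha>, n) * z)"
      unfolding den using c0 by (simp add: power_int_divide_distrib divide_simps)
    then show "G * ((1 / a (\<alpha>, n)) ^ (N * r) / (\<Prod>j\<in>S \<times> K-{(\<alpha>, n)}. 1 - a j / a (\<alpha>, n)) / (1 - a (\<alpha>, n) * z))
       = c \<alpha> powi n * q powi (int (card S) * tri (n + 1))
        * (\<Prod>\<beta>\<in>S-{\<alpha>}. itheta q N n (\<beta> / \<alpha>)) * inv_qfact q (int N + n) * inv_qfact q (int N - n - 1)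
        / (1 - \<alpha> * z * q powi n)"
      unfolding main by (simp add: X_def Y_def r_def a_def mult_ac)
  qed
  finally show ?thesis unfolding K_def .
qed

lemma itheta_tendsto:
  assumes "norm q < 1" "q \<noteq> 0" "x \<noteq> 0" "\<And>n::int. x * q powi n \<noteq> 1"
  shows "(\<lambda>N. itheta q N n x) \<longlonglongrightarrow> qp q q / theta x q"
proof -
  note nz = itheta_nonzero[OF assms(2-4)]
  have lim: "filterlim (\<lambda>N. nat (int N + l)) sequentially sequentially" for l
    unfolding filterlim_at_top
  proof
    fix Z :: nat
    show "\<forall>\<^sub>F N in sequentially. Z \<le> nat (int N + l)"
      by (rule eventually_sequentiallyI[of "Z + nat (-l)"]) linarith
  qed
  have "(\<lambda>N. inverse (\<Prod>k<nat (int N + n). 1 - q / x * q ^ k)) \<longlonglongrightarrow> inverse (qp (q / x) q)"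
    using nz(1) by (intro tendsto_inverse filterlim_compose[OF qp_tendsto[OF assms(1)] lim])
      (auto simp: qp_eq_0_iff[OF assms(1)])
  moreover have "(\<lambda>N. inverse (\<Prod>k<nat (int N - n). 1 - x * q ^ k)) \<longlonglongrightarrow> inverse (qp x q)"
    using nz(2) lim[of "-n"] by (intro tendsto_inverse filterlim_compose[OF qp_tendsto[OF assms(1)]])
      (auto simp: qp_eq_0_iff[OF assms(1)])
  ultimately have "(\<lambda>N. itheta q N n x) \<longlonglongrightarrow> inverse (qp (q / x) q) * inverse (qp x q)"
    unfolding itheta_def by (rule tendsto_mult)
  also have "inverse (qp (q / x) q) * inverse (qp x q) = qp q q / theta x q"
    using assms qp_nonzero[OF assms(1,1)] by (simp add: jacobi_triple_product field_simps)
  finally show ?thesis .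
qed

lemma itheta_bounded:
  assumes "norm q < 1" "q \<noteq> 0" "x \<noteq> 0" "\<And>n::int. x * q powi n \<noteq> 1"
  obtains C where "C > 0" "\<And>N n. norm (itheta q N n x) \<le> C"
proof -
  note nz = itheta_nonzero[OF assms(2-4)]
  obtain C where C: "C > 0" "\<And>N. norm (inverse (\<Prod>k<N. 1 - q / x * q ^ k)) \<le> C"
    using qp_partial_inverse_bounded[OF assms(1) nz(1)] by metis
  obtain D where D: "D > 0" "\<And>N. norm (inverse (\<Prod>k<N. 1 - x * q ^ k)) \<le> D"
    using qp_partial_inverse_bounded[OF assms(1) nz(2)] by metis
  show ?thesis
  proof (rule that[of "C * D"])
    show "norm (itheta q N n x) \<le> C * D" for N n
      unfolding itheta_def norm_mult using C D by (intro mult_mono) (auto simp: less_imp_le)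
  qed (use C D in auto)
qed

text \<open>As n tends to infinity the quotient tends to 1. For n = -k it equals q^k/(q^k - y),
  which tends to 0, so both halves are bounded.\<close>

lemma bounded_inverse_one_minus_power_int:
  assumes "norm q < 1" "q \<noteq> (0::complex)" "y \<noteq> 0" "\<And>n. y * q powi n \<noteq> 1"
  obtains C where "C > 0" "\<And>n. norm (1 / (1 - y * q powi n)) \<le> C"
proof -
  have q0: "(\<lambda>k. q ^ k) \<longlonglongrightarrow> 0" using assms(1) by (rule LIMSEQ_power_zero)
  have "(\<lambda>k. 1 / (1 - y * q ^ k)) \<longlonglongrightarrow> 1 / (1 - y * 0)"
    by (intro tendsto_divide tendsto_diff tendsto_mult tendsto_const q0) auto
  then have "Bseq (\<lambda>k. 1 / (1 - y * q ^ k))"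
    by (intro convergent_imp_Bseq convergentI)
  then obtain C where C: "C > 0" "\<And>k. norm (1 / (1 - y * q ^ k)) \<le> C"
    by (auto simp: Bseq_def)
  have "(\<lambda>k. q ^ k / (q ^ k - y)) \<longlonglongrightarrow> 0 / (0 - y)"
    using assms(3) by (intro tendsto_divide tendsto_diff tendsto_const q0) auto
  then have "Bseq (\<lambda>k. q ^ k / (q ^ k - y))"
    by (intro convergent_imp_Bseq convergentI)
  then obtain D where D: "D > 0" "\<And>k. norm (q ^ k / (q ^ k - y)) \<le> D"
    by (auto simp: Bseq_def)
  show ?thesis
  proof (rule that[of "C + D"])
    fix n :: int
    show "norm (1 / (1 - y * q powi n)) \<le> C + D"
    proof (cases "n \<ge> 0")
      case True
      then have "norm (1 / (1 - y * q powi n)) \<le> C"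
        using C(2)[of "nat n"] by (simp add: power_int_def)
      then show ?thesis using D(1) by simp
    next
      case False
      define k where "k = nat (-n)"
      have "q powi n = inverse (q ^ k)"
        using False by (simp add: k_def power_int_def power_inverse)
      then have "1 - y * q powi n = (q ^ k - y) / q ^ k"
        using assms(2) by (simp add: divide_inverse algebra_simps)
      then have "1 / (1 - y * q powi n) = q ^ k / (q ^ k - y)"
        by simp
      then show ?thesis using D(2)[of k] C(1) by simp
    qed
  qed (use C D in auto)
qed

text \<open>Partial fractions of a product of inverse theta functions, as the limit of the partial
  fraction expansion of the finite products.\<close>
theorem theta_partial_fraction:
  assumes q: "0 < norm q" "norm q < 1"
    and S: "finite S" "S \<noteq> {}" "0 \<notin> S"
    and gen: "\<And>\<alpha> \<beta> n. \<alpha> \<in> S \<Longrightarrow> \<beta> \<in> S \<Longrightarrow> \<alpha> \<noteq> \<beta> \<Longrightarrow> \<beta> / \<alpha> * q powi n \<noteq> 1"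
    and z: "z \<noteq> 0" "\<And>\<alpha> n. \<alpha> \<in> S \<Longrightarrow> \<alpha> * z * q powi n \<noteq> 1"
  defines "c \<equiv> (\<lambda>\<alpha>. (-1) ^ card S * (\<Prod>\<beta>\<in>S-{\<alpha>}. \<alpha> / \<beta>))"
  shows "qp q q ^ 3 / (\<Prod>\<alpha>\<in>S. theta (\<alpha> * z) q) =
    (\<Sum>\<alpha>\<in>S. (\<Sum>\<^sub>\<infinity>n. c \<alpha> powi n * q powi (int (card S) * tri (n + 1)) / (1 - \<alpha> * z * q powi n))
        / (\<Prod>\<beta>\<in>S-{\<alpha>}. theta (\<beta> / \<alpha>) q))"
proof -
  have q': "q \<noteq> 0" using q by auto
  define P where "P = qp q q"
  have P: "P \<noteq> 0" unfolding P_def using q by (intro qp_nonzero)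
  define r where "r = card S"
  have r: "r > 0" using S by (auto simp: r_def card_gt_0_iff)
  define t where "t = (\<lambda>\<alpha> n. c \<alpha> powi n * q powi (int r * tri (n + 1)))"
  have lhs: "(\<lambda>N. \<Prod>\<alpha>\<in>S. itheta q N 0 (\<alpha> * z)) \<longlonglongrightarrow> (\<Prod>\<alpha>\<in>S. P / theta (\<alpha> * z) q)"
    unfolding P_def using q' q S z by (intro tendsto_prod itheta_tendsto) auto
  define f where "f = (\<lambda>\<alpha> N n. if n \<in> {- int N..<int N} then t \<alpha> n
        * (\<Prod>\<beta>\<in>S-{\<alpha>}. itheta q N n (\<beta> / \<alpha>)) * inv_qfact q (int N + n) * inv_qfact q (int N - n - 1)
        / (1 - \<alpha> * z * q powi n) else 0)"
  have rhs: "(\<lambda>N. infsum (f \<alpha> N) UNIV) \<longlonglongrightarrow>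
      (\<Sum>\<^sub>\<infinity>n. t \<alpha> n * (\<Prod>\<beta>\<in>S-{\<alpha>}. P / theta (\<beta> / \<alpha>) q) * inverse P * inverse P / (1 - \<alpha> * z * q powi n))"
    if \<alpha>: "\<alpha> \<in> S" for \<alpha>
  proof -
    have \<alpha>0: "\<alpha> \<noteq> 0" using \<alpha> S by auto
    have c0: "c \<alpha> \<noteq> 0" using \<alpha>0 S by (auto simp: c_def prod_zero_iff)
    obtain C1 where C1: "C1 > 0" "\<And>n. norm (1 / (1 - \<alpha> * z * q powi n)) \<le> C1"
      using bounded_inverse_one_minus_power_int[OF q(2) q', of "\<alpha> * z"] \<alpha> \<alpha>0 z by auto
    have gen1: "\<beta> / \<alpha> * q powi n \<noteq> 1" if "\<beta> \<in> S - {\<alpha>}" for \<beta> n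
      using that \<alpha> gen[of \<alpha> \<beta> n] by blast
    have gen2: "\<beta> / \<alpha> \<noteq> 0" if "\<beta> \<in> S - {\<alpha>}" for \<beta>
      using that \<alpha>0 S by auto
    have "\<exists>C>0. \<forall>N n. norm (itheta q N n (\<beta> / \<alpha>)) \<le> C" if "\<beta> \<in> S - {\<alpha>}" for \<beta>
      using itheta_bounded[OF q(2) q' gen2[OF that] gen1[OF that]] by metis
    then obtain C2 where C2: "\<And>\<beta>. \<beta> \<in> S - {\<alpha>} \<Longrightarrow> C2 \<beta> > 0"
        "\<And>\<beta> N n. \<beta> \<in> S - {\<alpha>} \<Longrightarrow> norm (itheta q N n (\<beta> / \<alpha>)) \<le> C2 \<beta>"
      by metis
    obtain C3 where C3: "C3 > 0" "\<And>n. norm (inv_qfact q n) \<le> C3"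
      using inv_qfact_bounded[OF q(2)] by metis
    show ?thesis
    proof (rule infsum_int_tannery)
      fix n :: int
      have 1: "(\<lambda>N. \<Prod>\<beta>\<in>S-{\<alpha>}. itheta q N n (\<beta> / \<alpha>)) \<longlonglongrightarrow> (\<Prod>\<beta>\<in>S-{\<alpha>}. P / theta (\<beta> / \<alpha>) q)"
        unfolding P_def by (intro tendsto_prod itheta_tendsto q q' gen1 gen2)
      have 2: "(\<lambda>N. inv_qfact q (int N + n)) \<longlonglongrightarrow> inverse P"
          "(\<lambda>N. inv_qfact q (int N - n - 1)) \<longlonglongrightarrow> inverse P"
        unfolding P_def using inv_qfact_tendsto[OF q(2), of n] inv_qfact_tendsto[OF q(2), of "- n - 1"]
        by (simp_all add: algebra_simps)
      have "(\<lambda>N. t \<alpha> n * (\<Prod>\<beta>\<in>S-{\<alpha>}. itheta q N n (\<beta> / \<alpha>)) * inv_qfact q (int N + n) * inv_qfact q (int N - n - 1)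
        / (1 - \<alpha> * z * q powi n)) \<longlonglongrightarrow>
         t \<alpha> n * (\<Prod>\<beta>\<in>S-{\<alpha>}. P / theta (\<beta> / \<alpha>) q) * inverse P * inverse P / (1 - \<alpha> * z * q powi n)"
        using z(2)[OF \<alpha>, of n] by (intro tendsto_divide tendsto_mult tendsto_const 1 2) auto
      then show "(\<lambda>N. f \<alpha> N n) \<longlonglongrightarrow>
         t \<alpha> n * (\<Prod>\<beta>\<in>S-{\<alpha>}. P / theta (\<beta> / \<alpha>) q) * inverse P * inverse P / (1 - \<alpha> * z * q powi n)"
      proof (rule Lim_transform_eventually)
        show "\<forall>\<^sub>F N in sequentially. t \<alpha> n * (\<Prod>\<beta>\<in>S-{\<alpha>}. itheta q N n (\<beta> / \<alpha>)) * inv_qfact q (int N + n)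
           * inv_qfact q (int N - n - 1) / (1 - \<alpha> * z * q powi n) = f \<alpha> N n"
          by (rule eventually_sequentiallyI[of "nat \<bar>n\<bar> + 1"]) (auto simp: f_def)
      qed
    next
      fix N n
      have "norm (f \<alpha> N n) \<le> norm (t \<alpha> n * (\<Prod>\<beta>\<in>S-{\<alpha>}. itheta q N n (\<beta> / \<alpha>)) * inv_qfact q (int N + n) * inv_qfact q (int N - n - 1)
        * (1 / (1 - \<alpha> * z * q powi n)))"
        by (simp add: f_def)
      also have "\<dots> \<le> norm (t \<alpha> n) * (\<Prod>\<beta>\<in>S-{\<alpha>}. C2 \<beta>) * C3 * C3 * C1"
        unfolding norm_mult prod_norm[symmetric] using C1 C2 C3
        by (intro mult_mono mult_nonneg_nonneg prod_mono prod_nonneg) (auto simp: less_imp_le)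
      finally show "norm (f \<alpha> N n) \<le> norm (t \<alpha> n) * (\<Prod>\<beta>\<in>S-{\<alpha>}. C2 \<beta>) * C3 * C3 * C1" .
    next
      have qr: "0 < norm (q ^ r)" "norm (q ^ r) < 1"
        using q r by (auto simp: norm_power power_less_one_iff)
      have "t \<alpha> n = (c \<alpha> * q ^ r) powi n * (q ^ r) powi tri n" for n
      proof -
        have "(q ^ r) powi n * (q ^ r) powi tri n = (q ^ r) powi tri (n + 1)"
          using q' by (simp add: tri_plus_1 power_int_add)
        also have "\<dots> = q powi (int r * tri (n + 1))"
          unfolding power_int_mult power_int_of_nat ..
        finally show ?thesis by (simp add: t_def power_int_mult_distrib mult.assoc)
      qed
      then have "(\<lambda>n. norm (t \<alpha> n)) summable_on UNIV"
        using summable_on_tri(1)[OF qr, of "c \<alpha> * q ^ r"] c0 q' by simp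
      then show "(\<lambda>n. norm (t \<alpha> n) * (\<Prod>\<beta>\<in>S-{\<alpha>}. C2 \<beta>) * C3 * C3 * C1) summable_on UNIV"
        by (intro summable_on_cmult_left)
    qed
  qed
  have "(\<lambda>N. \<Sum>\<alpha>\<in>S. infsum (f \<alpha> N) UNIV) \<longlonglongrightarrow> (\<Sum>\<alpha>\<in>S. \<Sum>\<^sub>\<infinity>n. t \<alpha> n * (\<Prod>\<beta>\<in>S-{\<alpha>}. P / theta (\<beta> / \<alpha>) q)
        * inverse P * inverse P / (1 - \<alpha> * z * q powi n))"
    by (intro tendsto_sum rhs)
  moreover have "\<forall>\<^sub>F N in sequentially. (\<Sum>\<alpha>\<in>S. infsum (f \<alpha> N) UNIV) = (\<Prod>\<alpha>\<in>S. itheta q N 0 (\<alpha> * z))"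
  proof (rule eventually_sequentiallyI[of 1])
    fix N :: nat assume "1 \<le> N"
    then have N: "N > 0" by simp
    have "infsum (f \<alpha> N) UNIV = (\<Sum>n\<in>{- int N..<int N}. t \<alpha> n
        * (\<Prod>\<beta>\<in>S-{\<alpha>}. itheta q N n (\<beta> / \<alpha>)) * inv_qfact q (int N + n) * inv_qfact q (int N - n - 1)
        / (1 - \<alpha> * z * q powi n))" for \<alpha>
      by (rule infsumI, rule has_sum_finite_neutralI[of "{- int N..<int N}"]) (auto simp: f_def)
    then show "(\<Sum>\<alpha>\<in>S. infsum (f \<alpha> N) UNIV) = (\<Prod>\<alpha>\<in>S. itheta q N 0 (\<alpha> * z))"
      using finite_theta_partial_fraction[OF q' q(2) N S gen z] by (simp add: t_def c_def r_def)
  qed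
  ultimately have "(\<lambda>N. \<Prod>\<alpha>\<in>S. itheta q N 0 (\<alpha> * z)) \<longlonglongrightarrow> (\<Sum>\<alpha>\<in>S. \<Sum>\<^sub>\<infinity>n. t \<alpha> n * (\<Prod>\<beta>\<in>S-{\<alpha>}. P / theta (\<beta> / \<alpha>) q)
        * inverse P * inverse P / (1 - \<alpha> * z * q powi n))"
    by (rule Lim_transform_eventually)
  with lhs have "(\<Prod>\<alpha>\<in>S. P / theta (\<alpha> * z) q) = (\<Sum>\<alpha>\<in>S. \<Sum>\<^sub>\<infinity>n. t \<alpha> n * (\<Prod>\<beta>\<in>S-{\<alpha>}. P / theta (\<beta> / \<alpha>) q)
        * inverse P * inverse P / (1 - \<alpha> * z * q powi n))"
    by (rule LIMSEQ_unique)
  \<comment> \<open>In every term r - 1 theta quotients contribute P^(r-1) and the two inverse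
    factorials P^(-2). The left side carries P^r, so exactly the cube of (q;q) survives.\<close>
  also have "\<dots> = (\<Sum>\<alpha>\<in>S. P ^ r / P ^ 3 * ((\<Sum>\<^sub>\<infinity>n. t \<alpha> n / (1 - \<alpha> * z * q powi n)) / (\<Prod>\<beta>\<in>S-{\<alpha>}. theta (\<beta> / \<alpha>) q)))"
  proof (intro sum.cong refl)
    fix \<alpha> assume \<alpha>: "\<alpha> \<in> S"
    define X where "X = (\<Prod>\<beta>\<in>S-{\<alpha>}. theta (\<beta> / \<alpha>) q)"
    have "(\<Prod>\<beta>\<in>S-{\<alpha>}. P / theta (\<beta> / \<alpha>) q) = P ^ (r - 1) / X"
      using \<alpha> S by (simp add: prod_dividef r_def card_Diff_singleton X_def)
    also have "P ^ (r - 1) = P ^ r / P" using r P by (simp add: power_eq_if)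
    finally have 1: "(\<Prod>\<beta>\<in>S-{\<alpha>}. P / theta (\<beta> / \<alpha>) q) = P ^ r / P / X" .
    have "t \<alpha> n * (\<Prod>\<beta>\<in>S-{\<alpha>}. P / theta (\<beta> / \<alpha>) q) * inverse P * inverse P / (1 - \<alpha> * z * q powi n)
       = P ^ r / P ^ 3 / X * (t \<alpha> n / (1 - \<alpha> * z * q powi n))" for n
      unfolding 1 by (simp add: power3_eq_cube field_simps)
    then show "(\<Sum>\<^sub>\<infinity>n. t \<alpha> n * (\<Prod>\<beta>\<in>S-{\<alpha>}. P / theta (\<beta> / \<alpha>) q) * inverse P * inverse P / (1 - \<alpha> * z * q powi n))
        = P ^ r / P ^ 3 * ((\<Sum>\<^sub>\<infinity>n. t \<alpha> n / (1 - \<alpha> * z * q powi n)) / X)"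
      by (simp only: infsum_cmult_right') simp
  qed
  also have "(\<Prod>\<alpha>\<in>S. P / theta (\<alpha> * z) q) = P ^ r / (\<Prod>\<alpha>\<in>S. theta (\<alpha> * z) q)"
    by (simp add: prod_dividef r_def)
  finally have "P ^ r / (\<Prod>\<alpha>\<in>S. theta (\<alpha> * z) q) = P ^ r / P ^ 3 *
      (\<Sum>\<alpha>\<in>S. (\<Sum>\<^sub>\<infinity>n. t \<alpha> n / (1 - \<alpha> * z * q powi n)) / (\<Prod>\<beta>\<in>S-{\<alpha>}. theta (\<beta> / \<alpha>) q))"
    by (simp only: sum_distrib_left)
  moreover have "P ^ 3 / T = U" if "P ^ r / T = P ^ r / P ^ 3 * U" for T U
  proof -
    have "P ^ 3 / T = P ^ 3 / P ^ r * (P ^ r / T)" using P by simp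
    also have "\<dots> = U" unfolding that using P by simp
    finally show ?thesis .
  qed
  ultimately have "P ^ 3 / (\<Prod>\<alpha>\<in>S. theta (\<alpha> * z) q) =
      (\<Sum>\<alpha>\<in>S. (\<Sum>\<^sub>\<infinity>n. t \<alpha> n / (1 - \<alpha> * z * q powi n)) / (\<Prod>\<beta>\<in>S-{\<alpha>}. theta (\<beta> / \<alpha>) q))"
    by blast
  then show ?thesis unfolding t_def r_def P_def .
qed

text \<open>An Appell-Lerch sum with separate nomes: p governs the theta numerators and r the
  denominators. The rank leads to p = q^3 with r = q^5, the partial fraction expansion to p = Q^3
  with r = Q.\<close>

definition appell :: "complex \<Rightarrow> complex \<Rightarrow> complex \<Rightarrow> complex \<Rightarrow> complex" where
  "appell x p v r = (\<Sum>\<^sub>\<infinity>n. (-x) powi n * p powi tri n / (1 - v * r powi n))"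

text \<open>The inverse denominators are bounded uniformly in n, so convergence is that of the theta
  series in the numerators.\<close>

lemma has_sum_appell:
  assumes p: "0 < norm p" "norm p < 1" and r: "r \<noteq> 0" "norm r < 1"
    and x: "x \<noteq> 0" and v: "v \<noteq> 0" "\<And>n. v * r powi n \<noteq> 1"
  shows "((\<lambda>n. (-x) powi n * p powi tri n / (1 - v * r powi n)) has_sum appell x p v r) UNIV"
proof -
  obtain C where C: "C > 0" "\<And>n. norm (1 / (1 - v * r powi n)) \<le> C"
    using bounded_inverse_one_minus_power_int[OF r(2,1) v] by metis
  have "(\<lambda>n. norm ((-x) powi n * p powi tri n) * C) summable_on UNIV"
    using summable_on_tri(1)[OF p, of "-x"] x by (intro summable_on_cmult_left) auto
  then have "(\<lambda>n. norm ((-x) powi n * p powi tri n / (1 - v * r powi n))) summable_on UNIV"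
  proof (rule Infinite_Sum.abs_summable_on_comparison_test')
    fix n
    have "norm ((-x) powi n * p powi tri n / (1 - v * r powi n))
        = norm ((-x) powi n * p powi tri n) * norm (1 / (1 - v * r powi n))"
      by (simp add: norm_divide norm_mult)
    also have "\<dots> \<le> norm ((-x) powi n * p powi tri n) * C"
      by (intro mult_left_mono C) auto
    finally show "norm ((-x) powi n * p powi tri n / (1 - v * r powi n)) \<le> norm ((-x) powi n * p powi tri n) * C" .
  qed
  then have "(\<lambda>n. (-x) powi n * p powi tri n / (1 - v * r powi n)) summable_on UNIV"
    by (rule abs_summable_summable)
  then show ?thesis
    unfolding appell_def by (rule has_sum_infsum)
qed

lemma appell_shift:
  assumes "p \<noteq> 0" "r \<noteq> 0" "x \<noteq> 0"
  shows "appell x p v r = (-x) powi k * p powi tri k * appell (x * p powi k) p (v * r powi k) r"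
proof -
  have "appell x p v r = (\<Sum>\<^sub>\<infinity>n. (-x) powi (n + k) * p powi tri (n + k) / (1 - v * r powi (n + k)))"
    unfolding appell_def by (rule infsum_reindex_bij_witness[of _ "\<lambda>n. n + k" "\<lambda>n. n - k"]) auto
  also have "\<dots> = (\<Sum>\<^sub>\<infinity>n. (-x) powi k * p powi tri k *
      ((-(x * p powi k)) powi n * p powi tri n / (1 - v * r powi k * r powi n)))"
  proof (intro infsum_cong)
    fix n
    have "(-(x * p powi k)) powi n = (-x) powi n * p powi (n * k)"
      by (simp add: power_int_mult mult.commute[of n] flip: power_int_mult_distrib)
    moreover have "p powi tri (n + k) = p powi tri n * p powi tri k * p powi (n * k)"
      using assms by (simp add: tri_add power_int_add)
    ultimately show "(-x) powi (n + k) * p powi tri (n + k) / (1 - v * r powi (n + k)) =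
      (-x) powi k * p powi tri k * ((-(x * p powi k)) powi n * p powi tri n / (1 - v * r powi k * r powi n))"
      using assms by (simp add: power_int_add mult_ac)
  qed
  also have "\<dots> = (-x) powi k * p powi tri k * appell (x * p powi k) p (v * r powi k) r"
    unfolding appell_def by (rule infsum_cmult_right')
  finally show ?thesis .
qed

text \<open>Termwise this is v r^n / (1 - v r^n) = 1/(1 - v r^n) - 1; the subtracted ones form a
  theta series.\<close>

lemma appell_step:
  assumes "0 < norm p" "norm p < 1" and r: "r \<noteq> 0" "norm r < 1"
    and x: "x \<noteq> 0" and v: "v \<noteq> 0" "\<And>n. v * r powi n \<noteq> 1"
  shows "v * appell (x * r) p v r = appell x p v r - theta x p"
proof -
  have "((\<lambda>n. (-x) powi n * p powi tri n / (1 - v * r powi n) + - ((-x) powi n * p powi tri n))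
      has_sum (appell x p v r + - theta x p)) UNIV"
    using assms by (intro has_sum_add has_sum_uminusI has_sum_appell has_sum_theta) auto
  also have "(\<lambda>n. (-x) powi n * p powi tri n / (1 - v * r powi n) + - ((-x) powi n * p powi tri n)) =
     (\<lambda>n. v * ((-(x * r)) powi n * p powi tri n / (1 - v * r powi n)))"
  proof
    fix n
    have "1 - v * r powi n \<noteq> 0" using v(2)[of n] by auto
    moreover have "(-(x * r)) powi n = (-x) powi n * r powi n"
      by (simp flip: power_int_mult_distrib)
    ultimately show "(-x) powi n * p powi tri n / (1 - v * r powi n) + - ((-x) powi n * p powi tri n) =
       v * ((-(x * r)) powi n * p powi tri n / (1 - v * r powi n))"
      by (simp add: field_simps)
  qed
  finally have "((\<lambda>n. v * ((-(x * r)) powi n * p powi tri n / (1 - v * r powi n))) has_sum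
      (appell x p v r - theta x p)) UNIV" by simp
  moreover have "((\<lambda>n. v * ((-(x * r)) powi n * p powi tri n / (1 - v * r powi n))) has_sum
      (v * appell (x * r) p v r)) UNIV"
    using assms by (intro has_sum_cmult_right has_sum_appell) auto
  ultimately show ?thesis using has_sum_unique by blast
qed

text \<open>The residues are represented by -2, ..., 2 so that the pieces of an Appell sum for b and
  -b form the pairs that occur in the Atkin-Swinnerton-Dyer identity.\<close>

lemma has_sum_split_mod5:
  fixes f :: "int \<Rightarrow> complex"
  assumes f: "(f has_sum s) UNIV" and g: "\<And>b. b \<in> {-2..2} \<Longrightarrow> ((\<lambda>m. f (5 * m + b)) has_sum g b) UNIV"
  shows "s = (\<Sum>b\<in>{-2..2}. g b)"
proof -
  have "((\<lambda>(b, m). f (5 * m + b)) has_sum s) ({-2..2} \<times> UNIV)"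
    using f by (subst has_sum_reindex_bij_witness[of _ "\<lambda>n. ((n + 2) mod 5 - 2, (n + 2) div 5)" "\<lambda>(b, m). 5 * m + b" UNIV f])
      (auto simp: algebra_simps; presburger)+
  then have "(g has_sum s) {-2..2}"
    by (rule has_sum_Sigma') (use g in auto)
  then show ?thesis
    using has_sum_unique has_sum_finite by blast
qed

lemma tri_5_mult_add: "tri (5 * m + b) = 25 * tri m + (10 + 5 * b) * m + tri b"
  using two_tri[of "5 * m + b"] two_tri[of m] two_tri[of b] by (simp add: algebra_simps)

lemma mod5_term:
  fixes x p :: complex
  assumes "x \<noteq> 0" "p \<noteq> 0"
  shows "(-x) powi (5 * m + b) * p powi tri (5 * m + b) =
    (-x) powi b * p powi tri b * ((-(x ^ 5 * p powi (10 + 5 * b))) powi m * (p ^ 25) powi tri m)"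
proof -
  have "(-x) powi (5 * m) = (- (x ^ 5)) powi m"
    by (simp add: power_int_mult)
  moreover have "p powi (25 * tri m) = (p ^ 25) powi tri m"
    by (simp add: power_int_mult)
  moreover have "(-(x ^ 5 * p powi (10 + 5 * b))) powi m = (- (x ^ 5)) powi m * p powi ((10 + 5 * b) * m)"
    by (simp add: power_int_mult flip: power_int_mult_distrib)
  ultimately show ?thesis
    unfolding tri_5_mult_add using assms by (simp add: power_int_add mult_ac)
qed

lemma theta_split_mod5:
  assumes p: "0 < norm p" "norm p < 1" and x: "x \<noteq> 0"
  shows "theta x p = (\<Sum>b\<in>{-2..2}. (-x) powi b * p powi tri b * theta (x ^ 5 * p powi (10 + 5 * b)) (p ^ 25))"
proof (rule has_sum_split_mod5)
  show "((\<lambda>n. (-x) powi n * p powi tri n) has_sum theta x p) UNIV"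
    by (rule has_sum_theta[OF p x])
  have p25: "0 < norm (p ^ 25)" "norm (p ^ 25) < 1"
    using p by (auto simp: norm_power power_less_one_iff)
  show "((\<lambda>m. (-x) powi (5 * m + b) * p powi tri (5 * m + b)) has_sum
      (-x) powi b * p powi tri b * theta (x ^ 5 * p powi (10 + 5 * b)) (p ^ 25)) UNIV" for b
  proof -
    have p0: "p \<noteq> 0" using p by auto
    show ?thesis
      unfolding mod5_term[OF x p0] using p x by (intro has_sum_cmult_right has_sum_theta p25) auto
  qed
qed

lemma appell_split_mod5:
  assumes p: "0 < norm p" "norm p < 1" and r: "r \<noteq> 0" "norm r < 1"
    and x: "x \<noteq> 0" and v: "v \<noteq> 0" "\<And>n. v * r powi n \<noteq> 1"
  shows "appell x p v r = (\<Sum>b\<in>{-2..2}. (-x) powi b * p powi tri b *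
      appell (x ^ 5 * p powi (10 + 5 * b)) (p ^ 25) (v * r powi b) (r ^ 5))"
proof (rule has_sum_split_mod5)
  show "((\<lambda>n. (-x) powi n * p powi tri n / (1 - v * r powi n)) has_sum appell x p v r) UNIV"
    by (rule has_sum_appell[OF p r x v])
  have p25: "0 < norm (p ^ 25)" "norm (p ^ 25) < 1"
    using p by (auto simp: norm_power power_less_one_iff)
  have p0: "p \<noteq> 0" using p by auto
  show "((\<lambda>m. (-x) powi (5 * m + b) * p powi tri (5 * m + b) / (1 - v * r powi (5 * m + b))) has_sum
      (-x) powi b * p powi tri b * appell (x ^ 5 * p powi (10 + 5 * b)) (p ^ 25) (v * r powi b) (r ^ 5)) UNIV" for b
  proof -
    have "r powi (5 * m) = (r ^ 5) powi m" for m
      by (simp add: power_int_mult)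
    then have r5: "v * r powi (5 * m + b) = v * r powi b * (r ^ 5) powi m" for m
      using r by (simp add: power_int_add)
    have "((\<lambda>m. (-x) powi b * p powi tri b * ((-(x ^ 5 * p powi (10 + 5 * b))) powi m * (p ^ 25) powi tri m
         / (1 - v * r powi b * (r ^ 5) powi m))) has_sum
      (-x) powi b * p powi tri b * appell (x ^ 5 * p powi (10 + 5 * b)) (p ^ 25) (v * r powi b) (r ^ 5)) UNIV"
    proof (intro has_sum_cmult_right has_sum_appell p25)
      show "norm (r ^ 5) < 1" using r by (simp add: norm_power power_less_one_iff)
      show "v * r powi b * (r ^ 5) powi m \<noteq> 1" for m
        unfolding r5[symmetric] by (rule v)
    qed (use r v x p0 in auto)
    then show ?thesis
      unfolding mod5_term[OF x p0] r5 by (simp add: mult.assoc)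
  qed
qed

text \<open>Atkin and Swinnerton-Dyer's identity is the partial fraction expansion of
  \<open>1 / (\<theta>(z/\<zeta>) \<theta>(z) \<theta>(z\<zeta>))\<close>.\<close>
lemma atkin_swinnerton_dyer:
  assumes Q: "0 < norm Q" "norm Q < 1" and \<zeta>: "\<zeta> \<noteq> 0" "\<And>n. \<zeta> * Q powi n \<noteq> 1" "\<And>n. \<zeta>\<^sup>2 * Q powi n \<noteq> 1"
    and z: "z \<noteq> 0" "\<And>n. z * Q powi n \<noteq> 1" "\<And>n. z * \<zeta> * Q powi n \<noteq> 1" "\<And>n. z / \<zeta> * Q powi n \<noteq> 1"
  shows "\<zeta> ^ 3 * appell (\<zeta> ^ 3 * Q ^ 3) (Q ^ 3) (z * \<zeta>) Q + appell (Q ^ 3 / \<zeta> ^ 3) (Q ^ 3) (z / \<zeta>) Q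
    = qp Q Q ^ 3 * theta \<zeta> Q * theta (\<zeta>\<^sup>2) Q / (theta (z / \<zeta>) Q * theta z Q * theta (z * \<zeta>) Q)
      + \<zeta> * theta (\<zeta>\<^sup>2) Q / theta \<zeta> Q * appell (Q ^ 3) (Q ^ 3) z Q"
proof -
  have Q0: "Q \<noteq> 0" using Q by auto
  have \<zeta>1: "\<zeta> \<noteq> 1" "\<zeta>\<^sup>2 \<noteq> 1" using \<zeta>(2)[of 0] \<zeta>(3)[of 0] by auto
  have inv: "1 / y * Q powi n \<noteq> 1" if "y \<noteq> 0" "\<And>n. y * Q powi n \<noteq> 1" for y n
    using that(1) that(2)[of "-n"] Q0 by (auto simp: power_int_minus field_simps)
  define S where "S = {1 / \<zeta>, 1, \<zeta>}"
  have dist: "1 / \<zeta> \<noteq> 1" "1 / \<zeta> \<noteq> \<zeta>" "1 \<noteq> \<zeta>"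
    using \<zeta>1 \<zeta>(1) by (auto simp: field_simps power2_eq_square)
  have card: "card S = 3" unfolding S_def using dist by simp
  have a: "(\<Sum>\<^sub>\<infinity>n. ((-1) ^ 3 * y) powi n * Q powi (int 3 * tri (n + 1)) / (1 - v * Q powi n)) = appell (y * Q ^ 3) (Q ^ 3) v Q" for y v
    unfolding appell_def
  proof (intro infsum_cong)
    fix n
    have "Q powi (int 3 * tri (n + 1)) = (Q ^ 3) powi n * (Q ^ 3) powi tri n"
      unfolding power_int_mult power_int_of_nat using Q0 by (simp add: tri_plus_1 power_int_add)
    moreover have "(- (y * Q ^ 3)) powi n = (-y) powi n * (Q ^ 3) powi n"
      by (simp flip: power_int_mult_distrib)
    ultimately show "((-1) ^ 3 * y) powi n * Q powi (int 3 * tri (n + 1)) / (1 - v * Q powi n) =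
        (- (y * Q ^ 3)) powi n * (Q ^ 3) powi tri n / (1 - v * Q powi n)"
      by (simp add: mult.assoc)
  qed
  have "qp Q Q ^ 3 / (\<Prod>\<alpha>\<in>S. theta (\<alpha> * z) Q) =
    (\<Sum>\<alpha>\<in>S. (\<Sum>\<^sub>\<infinity>n. ((-1) ^ card S * (\<Prod>\<beta>\<in>S-{\<alpha>}. \<alpha> / \<beta>)) powi n * Q powi (int (card S) * tri (n + 1))
       / (1 - \<alpha> * z * Q powi n)) / (\<Prod>\<beta>\<in>S-{\<alpha>}. theta (\<beta> / \<alpha>) Q))"
  proof (rule theta_partial_fraction[OF Q _ _ _ _ z(1)])
    show "finite S" "S \<noteq> {}" "0 \<notin> S" using \<zeta> by (auto simp: S_def)
    show "\<alpha> * z * Q powi n \<noteq> 1" if "\<alpha> \<in> S" for \<alpha> n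
      using that z(2-4)[of n] by (auto simp: S_def mult_ac)
    show "\<beta> / \<alpha> * Q powi n \<noteq> 1" if "\<alpha> \<in> S" "\<beta> \<in> S" "\<alpha> \<noteq> \<beta>" for \<alpha> \<beta> n
    proof -
      have 1: "\<zeta> * Q powi n \<noteq> 1" "\<zeta>\<^sup>2 * Q powi n \<noteq> 1" "1 / \<zeta> * Q powi n \<noteq> 1" "1 / \<zeta>\<^sup>2 * Q powi n \<noteq> 1"
        using \<zeta>(1) by (rule \<zeta> | intro inv \<zeta>; simp)+
      have "\<beta> / \<alpha> \<in> {\<zeta>, \<zeta>\<^sup>2, 1 / \<zeta>, 1 / \<zeta>\<^sup>2}"
        using that \<zeta>(1) by (auto simp: S_def power2_eq_square)
      then consider "\<beta> / \<alpha> = \<zeta>" | "\<beta> / \<alpha> = \<zeta>\<^sup>2" | "\<beta> / \<alpha> = 1 / \<zeta>" | "\<beta> / \<alpha> = 1 / \<zeta>\<^sup>2"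
        by blast
      then show ?thesis by cases (simp_all only: 1 not_False_eq_True)
    qed
  qed
  \<comment> \<open>For the poles belonging to 1/\<zeta>, 1 and \<zeta> the constants (-1)^3 times
    the product of \<alpha>/\<beta> are -\<zeta>^(-3), -1 and -\<zeta>^3, which gives the arguments
    of the three Appell sums.\<close>
  also have "\<dots> = appell (Q ^ 3 / \<zeta> ^ 3) (Q ^ 3) (z / \<zeta>) Q / (theta \<zeta> Q * theta (\<zeta>\<^sup>2) Q)
     + (appell (Q ^ 3) (Q ^ 3) z Q / (theta (1 / \<zeta>) Q * theta \<zeta> Q)
     + appell (\<zeta> ^ 3 * Q ^ 3) (Q ^ 3) (z * \<zeta>) Q / (theta (1 / \<zeta>\<^sup>2) Q * theta (1 / \<zeta>) Q))"
  proof -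
    have D: "S - {1 / \<zeta>} = {1, \<zeta>}" "S - {1} = {1 / \<zeta>, \<zeta>}" "S - {\<zeta>} = {1 / \<zeta>, 1}"
      using dist unfolding S_def by auto
    have sumS: "(\<Sum>\<alpha>\<in>S. h \<alpha>) = h (1 / \<zeta>) + (h 1 + h \<zeta>)" for h :: "complex \<Rightarrow> complex"
      unfolding S_def using dist by simp
    have p: "(\<Prod>\<beta>\<in>{1, \<zeta>}. h \<beta>) = h 1 * h \<zeta>" "(\<Prod>\<beta>\<in>{1 / \<zeta>, \<zeta>}. h \<beta>) = h (1 / \<zeta>) * h \<zeta>"
       "(\<Prod>\<beta>\<in>{1 / \<zeta>, 1}. h \<beta>) = h (1 / \<zeta>) * h 1" for h :: "complex \<Rightarrow> complex"
      using dist by simp_all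
    have s: "1 / \<zeta> * (1 / \<zeta>\<^sup>2) * Q ^ 3 = Q ^ 3 / \<zeta> ^ 3" "\<zeta> * (1 / \<zeta>) * Q ^ 3 = Q ^ 3"
      "\<zeta>\<^sup>2 * \<zeta> * Q ^ 3 = \<zeta> ^ 3 * Q ^ 3" "1 / \<zeta> * z = z / \<zeta>" "1 * z = z" "\<zeta> * z = z * \<zeta>"
      "1 / (1 / \<zeta>) = \<zeta>" "\<zeta> / (1 / \<zeta>) = \<zeta>\<^sup>2" "1 / \<zeta> / 1 = 1 / \<zeta>" "\<zeta> / 1 = \<zeta>" "1 / \<zeta> / \<zeta> = 1 / \<zeta>\<^sup>2"
      using \<zeta>(1) by (simp_all add: power2_eq_square power3_eq_cube)
    show ?thesis
      unfolding card a sumS D p s ..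
  qed
  also have "(\<Prod>\<alpha>\<in>S. theta (\<alpha> * z) Q) = theta (z / \<zeta>) Q * theta z Q * theta (z * \<zeta>) Q"
    unfolding S_def using dist by (simp add: mult_ac)
  also have "theta (1 / \<zeta>) Q = - theta \<zeta> Q / \<zeta>"
    by (rule theta_inverse[OF Q \<zeta>(1)])
  also have "theta (1 / \<zeta>\<^sup>2) Q = - theta (\<zeta>\<^sup>2) Q / \<zeta>\<^sup>2"
    using \<zeta>(1) by (intro theta_inverse[OF Q]) auto
  finally have *: "qp Q Q ^ 3 / (theta (z / \<zeta>) Q * theta z Q * theta (z * \<zeta>) Q) =
      appell (Q ^ 3 / \<zeta> ^ 3) (Q ^ 3) (z / \<zeta>) Q / (theta \<zeta> Q * theta (\<zeta>\<^sup>2) Q)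
     + (appell (Q ^ 3) (Q ^ 3) z Q / (- theta \<zeta> Q / \<zeta> * theta \<zeta> Q)
     + appell (\<zeta> ^ 3 * Q ^ 3) (Q ^ 3) (z * \<zeta>) Q / (- theta (\<zeta>\<^sup>2) Q / \<zeta>\<^sup>2 * (- theta \<zeta> Q / \<zeta>)))" .
  have nz: "theta \<zeta> Q \<noteq> 0" "theta (\<zeta>\<^sup>2) Q \<noteq> 0"
  proof -
    have "y \<noteq> Q powi n" if "\<And>n. y * Q powi n \<noteq> 1" for y n
      using that[of "-n"] Q0 by (auto simp: power_int_minus)
    then show "theta \<zeta> Q \<noteq> 0" "theta (\<zeta>\<^sup>2) Q \<noteq> 0"
      using \<zeta> by (auto simp: theta_eq_0_iff[OF Q])
  qed
  define A B C D t1 t2 where "A = appell (Q ^ 3 / \<zeta> ^ 3) (Q ^ 3) (z / \<zeta>) Q"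
    and "B = appell (Q ^ 3) (Q ^ 3) z Q" and "C = appell (\<zeta> ^ 3 * Q ^ 3) (Q ^ 3) (z * \<zeta>) Q"
    and "D = theta (z / \<zeta>) Q * theta z Q * theta (z * \<zeta>) Q" and "t1 = theta \<zeta> Q" and "t2 = theta (\<zeta>\<^sup>2) Q"
  have "qp Q Q ^ 3 * t1 * t2 / D = (qp Q Q ^ 3 / D) * (t1 * t2)"
    by simp
  also have "\<dots> = (A / (t1 * t2) + (B / (- t1 / \<zeta> * t1) + C / (- t2 / \<zeta>\<^sup>2 * (- t1 / \<zeta>)))) * (t1 * t2)"
    using * unfolding A_def B_def C_def D_def t1_def t2_def by simp
  also have "\<dots> = A - \<zeta> * t2 / t1 * B + \<zeta> ^ 3 * C"
    using nz \<zeta>(1) unfolding t1_def[symmetric] t2_def[symmetric]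
    by (simp add: field_simps power2_eq_square power3_eq_cube)
  finally show ?thesis
    unfolding A_def B_def C_def D_def t1_def t2_def by simp
qed

lemma sum_int_m2_2: "(\<Sum>b\<in>{-2..2::int}. g b) = g (-2) + g (-1) + g 0 + g 1 + g 2"
  for g :: "int \<Rightarrow> complex"
proof -
  have "{-2..2::int} = {-2, -1, 0, 1, 2}" by auto
  then show ?thesis by simp
qed

section \<open>Dissection modulo 5\<close>

lemma ex_fifth_root_of_unity: "\<exists>\<omega>::complex. \<omega> ^ 5 = 1 \<and> \<omega> \<noteq> 1"
proof (intro exI conjI)
  have "cis (2 * pi / 5) ^ 5 = cis (real 5 * (2 * pi / 5))"
    by (rule Complex.DeMoivre)
  also have "real 5 * (2 * pi / 5) = 2 * pi" by simp
  finally show "cis (2 * pi / 5) ^ 5 = 1" by simp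
  have "sin (2 * pi / 5) > 0" by (intro sin_gt_zero) auto
  then show "cis (2 * pi / 5) \<noteq> 1" by (auto simp: complex_eq_iff)
qed

lemma norm_fifth_root_of_unity: "norm \<omega> = 1" if "\<omega> ^ 5 = 1" for \<omega> :: complex
  using that by (metis norm_ge_zero norm_one norm_power power_eq_1_iff zero_neq_numeral)

lemma fifth_root_power_neq_1:
  fixes \<omega> :: complex
  assumes "\<omega> ^ 5 = 1" "\<omega> \<noteq> 1"
  shows "\<omega>\<^sup>2 \<noteq> 1" "\<omega> ^ 3 \<noteq> 1" "\<omega> ^ 4 \<noteq> 1"
proof -
  have e: "\<omega> ^ 5 = \<omega>\<^sup>2 * \<omega>\<^sup>2 * \<omega>" "\<omega> * \<omega> ^ 5 = \<omega> ^ 3 * \<omega> ^ 3" "\<omega> ^ 5 = \<omega> ^ 4 * \<omega>"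
    by (simp_all add: eval_nat_numeral)
  show "\<omega>\<^sup>2 \<noteq> 1" "\<omega> ^ 3 \<noteq> 1" "\<omega> ^ 4 \<noteq> 1"
    using e assms by (metis mult_1 mult_1_right)+
qed

lemma sum_fifth_root:
  fixes \<omega> :: complex
  assumes "\<omega> ^ 5 = 1" "\<omega> \<noteq> 1"
  shows "1 + \<omega> + \<omega>\<^sup>2 + \<omega> ^ 3 + \<omega> ^ 4 = 0"
proof -
  have "(1 - \<omega>) * (1 + \<omega> + \<omega>\<^sup>2 + \<omega> ^ 3 + \<omega> ^ 4) = 1 - \<omega> ^ 5"
    by (simp add: eval_nat_numeral algebra_simps)
  then show ?thesis using assms by simp
qed

lemma prod_fifth_roots:
  fixes \<omega> s :: complex
  assumes "\<omega> ^ 5 = 1" "\<omega> \<noteq> 1"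
  shows "(\<Prod>k<5. 1 - \<omega> ^ k * s) = 1 - s ^ 5"
proof -
  have "(1 - s) * (1 - \<omega> * s) * (1 - \<omega>\<^sup>2 * s) * (1 - \<omega> ^ 3 * s) * (1 - \<omega> ^ 4 * s) = 1 - s ^ 5"
    using sum_fifth_root[OF assms] assms(1) by algebra
  moreover have "{..<5::nat} = {0, 1, 2, 3, 4}" by auto
  ultimately show ?thesis by (simp add: mult_ac)
qed

text \<open>With the golden ratio and its conjugate, 1 - v - v^2 = (1 - \<phi> v)(1 - \<psi> v), and
  \<open>prod_fifth_roots\<close> applies to each factor. The 11 is the Lucas number \<phi>^5 +
  \<psi>^5, and \<phi> \<psi> = -1.\<close>

lemma prod_quadratic_fifth_roots:
  fixes \<omega> u :: complex
  assumes "\<omega> ^ 5 = 1" "\<omega> \<noteq> 1"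
  shows "(\<Prod>k<5. 1 - \<omega> ^ k * u - (\<omega> ^ k * u)\<^sup>2) = 1 - 11 * u ^ 5 - u ^ 10"
proof -
  define \<phi> \<psi> :: complex where "\<phi> = (1 + csqrt 5) / 2" and "\<psi> = (1 - csqrt 5) / 2"
  have s5: "csqrt 5 * csqrt 5 = 5"
    by (metis power2_csqrt power2_eq_square)
  have \<phi>\<psi>: "\<phi> + \<psi> = 1" "\<phi> * \<psi> = -1"
    using s5 by (simp_all add: \<phi>_def \<psi>_def field_simps)
  have fact: "1 - v - v\<^sup>2 = (1 - \<phi> * v) * (1 - \<psi> * v)" for v
    using \<phi>\<psi> by algebra
  have "(\<Prod>k<5. 1 - \<omega> ^ k * u - (\<omega> ^ k * u)\<^sup>2) = (\<Prod>k<5. (1 - \<omega> ^ k * (\<phi> * u)) * (1 - \<omega> ^ k * (\<psi> * u)))"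
    unfolding fact by (simp add: mult_ac)
  also have "\<dots> = (1 - (\<phi> * u) ^ 5) * (1 - (\<psi> * u) ^ 5)"
    by (simp only: prod.distrib prod_fifth_roots[OF assms])
  also have "\<dots> = 1 - 11 * u ^ 5 - u ^ 10"
    using \<phi>\<psi> by algebra
  finally show ?thesis .
qed

text \<open>The long factor is the product of the four other conjugates x - \<omega>^k q -
  (\<omega>^k q)^2/x, sorted by powers of q modulo 5. It rationalises the denominator when (q;q) is
  inverted.\<close>

lemma quintic_factorization:
  fixes x q :: complex
  assumes "x \<noteq> 0"
  shows "(x - q - q\<^sup>2 / x) * ((x ^ 4 - 3 * q ^ 5 / x) + q * (x ^ 3 + 2 * q ^ 5 / x\<^sup>2)
      + q\<^sup>2 * (2 * x\<^sup>2 - q ^ 5 / x ^ 3) + q ^ 3 * (3 * x + q ^ 5 / x ^ 4) + 5 * q ^ 4)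
    = x ^ 5 - 11 * q ^ 5 - (q ^ 5)\<^sup>2 / x ^ 5"
  using assms by (simp add: field_simps eval_nat_numeral)

lemma prod_lessThan_add:
  "(\<Prod>k<m+n. f k) = (\<Prod>k<m. f k) * (\<Prod>k<n. f (m + k))" for f :: "nat \<Rightarrow> complex"
  by (induction n) auto

text \<open>Over the five conjugates, the factors 1 - q^m multiply to 1 - Y^m with Y = q^5 if 5 does
  not divide m, and to (1 - q^m)^5 otherwise. The multiples of 5 give (Y;Y)^5, the rest
  (Y;Y)/(Y^5;Y^5).\<close>

lemma qp_norm_fifth_roots:
  fixes \<omega> q :: complex
  assumes \<omega>: "\<omega> ^ 5 = 1" "\<omega> \<noteq> 1" and q: "norm q < 1"
  shows "(\<Prod>k<5. qp (\<omega> ^ k * q) (\<omega> ^ k * q)) * qp (q ^ 25) (q ^ 25) = qp (q ^ 5) (q ^ 5) ^ 6"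
proof -
  define Y where "Y = q ^ 5"
  have norm_\<omega>: "norm \<omega> = 1"
    using \<omega>(1) by (rule norm_fifth_root_of_unity)
  have qk: "norm (\<omega> ^ k * q) < 1" for k
    using q norm_\<omega> by (simp add: norm_mult norm_power)
  have Y: "norm Y < 1" "norm (Y ^ 5) < 1"
    using q by (simp_all add: Y_def norm_power power_less_one_iff)
  have inner: "(\<Prod>k<5. 1 - \<omega> ^ k * q * (\<omega> ^ k * q) ^ n) = (\<Prod>k<5. 1 - (\<omega> ^ Suc n) ^ k * q ^ Suc n)" for n
  proof (intro prod.cong refl)
    fix k
    have "\<omega> ^ k * q * (\<omega> ^ k * q) ^ n = (\<omega> ^ k) ^ Suc n * q ^ Suc n"
      by (metis power_Suc power_mult_distrib)
    also have "(\<omega> ^ k) ^ Suc n = (\<omega> ^ Suc n) ^ k"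
      by (metis mult.commute power_mult)
    finally show "1 - \<omega> ^ k * q * (\<omega> ^ k * q) ^ n = 1 - (\<omega> ^ Suc n) ^ k * q ^ Suc n"
      by (simp only:)
  qed
  have inner1: "(\<Prod>k<5. 1 - \<omega> ^ k * q * (\<omega> ^ k * q) ^ n) = 1 - Y ^ Suc n" if "\<omega> ^ Suc n \<noteq> 1" for n
  proof -
    have "(\<omega> ^ Suc n) ^ 5 = 1"
      using \<omega>(1) by (metis mult.commute power_mult power_one)
    from prod_fifth_roots[OF this that, of "q ^ Suc n"]
    have "(\<Prod>k<5. 1 - \<omega> ^ k * q * (\<omega> ^ k * q) ^ n) = 1 - (q ^ Suc n) ^ 5"
      unfolding inner .
    also have "(q ^ Suc n) ^ 5 = Y ^ Suc n"
      by (metis Y_def mult.commute power_mult)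
    finally show ?thesis .
  qed
  have inner2: "(\<Prod>k<5. 1 - \<omega> ^ k * q * (\<omega> ^ k * q) ^ n) = (1 - q ^ Suc n) ^ 5" if "\<omega> ^ Suc n = 1" for n
    unfolding inner that by simp
  \<comment> \<open>The induction adds a block of five consecutive exponents, of which the first
    four are prime to 5 and the last is a multiple of 5.\<close>
  have "(\<Prod>k<5. \<Prod>n<5*N. 1 - \<omega> ^ k * q * (\<omega> ^ k * q) ^ n) * (\<Prod>m<N. 1 - Y ^ 5 * (Y ^ 5) ^ m)
       = (\<Prod>n<5*N. 1 - Y * Y ^ n) * (\<Prod>m<N. 1 - Y * Y ^ m) ^ 5" for N
  proof (induction N)
    case (Suc N)
    have \<omega>p: "\<omega> ^ (5 * N + j) = \<omega> ^ j" for j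
      using \<omega>(1) by (simp add: power_add power_mult)
    have "(\<Prod>n<5. \<Prod>k<5. 1 - \<omega> ^ k * q * (\<omega> ^ k * q) ^ (5 * N + n))
        = (1 - Y ^ (5 * N + 1)) * (1 - Y ^ (5 * N + 2)) * (1 - Y ^ (5 * N + 3)) * (1 - Y ^ (5 * N + 4)) * (1 - q ^ (5 * N + 5)) ^ 5"
    proof -
      have gen: "(\<Prod>k<5. 1 - \<omega> ^ k * q * (\<omega> ^ k * q) ^ (5 * N + j)) = 1 - Y ^ (5 * N + Suc j)"
        if "\<omega> ^ Suc j \<noteq> 1" for j
      proof -
        have "\<omega> ^ Suc (5 * N + j) \<noteq> 1"
          using \<omega>p[of "Suc j"] that by (simp only: add_Suc_right) simp
        from inner1[OF this] show ?thesis by (simp only: add_Suc_right)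
      qed
      note root = \<omega>(2) fifth_root_power_neq_1[OF \<omega>]
      have "(\<Prod>k<5. 1 - \<omega> ^ k * q * (\<omega> ^ k * q) ^ (5 * N + 0)) = 1 - Y ^ (5 * N + 1)"
           "(\<Prod>k<5. 1 - \<omega> ^ k * q * (\<omega> ^ k * q) ^ (5 * N + 1)) = 1 - Y ^ (5 * N + 2)"
           "(\<Prod>k<5. 1 - \<omega> ^ k * q * (\<omega> ^ k * q) ^ (5 * N + 2)) = 1 - Y ^ (5 * N + 3)"
           "(\<Prod>k<5. 1 - \<omega> ^ k * q * (\<omega> ^ k * q) ^ (5 * N + 3)) = 1 - Y ^ (5 * N + 4)"
        using gen[of 0] gen[of 1] gen[of 2] gen[of 3] root
        by (simp_all only: Suc_eq_plus1 add_0 power_one_right one_add_one numeral_plus_one add_num_simps)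
          simp_all
      moreover have "(\<Prod>k<5. 1 - \<omega> ^ k * q * (\<omega> ^ k * q) ^ (5 * N + 4)) = (1 - q ^ (5 * N + 5)) ^ 5"
        using inner2[of "5 * N + 4"] \<omega>p[of 5] \<omega>(1) by (simp only: add_Suc_right[symmetric]) (simp add: eval_nat_numeral)
      moreover have "(\<Prod>n<5. h n) = h 0 * h 1 * h 2 * h 3 * h 4" for h :: "nat \<Rightarrow> complex"
        by (simp add: eval_nat_numeral)
      ultimately show ?thesis by (simp only:)
    qed
    moreover have "(\<Prod>n<5. 1 - Y * Y ^ (5 * N + n))
        = (1 - Y ^ (5 * N + 1)) * (1 - Y ^ (5 * N + 2)) * (1 - Y ^ (5 * N + 3)) * (1 - Y ^ (5 * N + 4)) * (1 - Y ^ 5 * (Y ^ 5) ^ N)"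
    proof -
      have "(\<Prod>n<5. 1 - Y * Y ^ (M + n))
        = (1 - Y ^ (M + 1)) * (1 - Y ^ (M + 2)) * (1 - Y ^ (M + 3)) * (1 - Y ^ (M + 4)) * (1 - Y ^ (M + 5))" for M
        by (simp add: eval_nat_numeral)
      moreover have "Y ^ 5 * (Y ^ 5) ^ N = Y ^ (5 * N + 5)"
        by (simp add: power_add power_mult)
      ultimately show ?thesis by (simp only:)
    qed
    moreover have "q ^ (5 * N + 5) = Y * Y ^ N"
      by (simp add: Y_def power_add power_mult)
    moreover have "(\<Prod>k<5. \<Prod>n<5*Suc N. 1 - \<omega> ^ k * q * (\<omega> ^ k * q) ^ n) =
        (\<Prod>k<5. \<Prod>n<5*N. 1 - \<omega> ^ k * q * (\<omega> ^ k * q) ^ n) * (\<Prod>n<5. \<Prod>k<5. 1 - \<omega> ^ k * q * (\<omega> ^ k * q) ^ (5 * N + n))"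
    proof -
      have "5 * Suc N = 5 * N + 5" by simp
      then show ?thesis
        by (simp only: prod_lessThan_add prod.distrib) (subst (2) prod.swap, rule refl)
    qed
    moreover have "(\<Prod>n<5*Suc N. 1 - Y * Y ^ n) = (\<Prod>n<5*N. 1 - Y * Y ^ n) * (\<Prod>n<5. 1 - Y * Y ^ (5 * N + n))"
    proof -
      have "5 * Suc N = 5 * N + 5" by simp
      then show ?thesis by (simp only: prod_lessThan_add)
    qed
    ultimately show ?case
      using Suc.IH by (simp only: prod.lessThan_Suc power_mult_distrib) (simp only: mult_ac)
  qed simp
  moreover have sub: "filterlim (\<lambda>N::nat. 5 * N) sequentially sequentially"
    by (intro filterlim_subseq) (auto simp: strict_mono_def)
  have "(\<lambda>N. (\<Prod>k<5. \<Prod>n<5*N. 1 - \<omega> ^ k * q * (\<omega> ^ k * q) ^ n) * (\<Prod>m<N. 1 - Y ^ 5 * (Y ^ 5) ^ m))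
     \<longlonglongrightarrow> (\<Prod>k<5. qp (\<omega> ^ k * q) (\<omega> ^ k * q)) * qp (Y ^ 5) (Y ^ 5)"
    by (intro tendsto_mult tendsto_prod filterlim_compose[OF qp_tendsto sub] qp_tendsto qk Y)
  moreover have "(\<lambda>N. (\<Prod>n<5*N. 1 - Y * Y ^ n) * (\<Prod>m<N. 1 - Y * Y ^ m) ^ 5) \<longlonglongrightarrow> qp Y Y * qp Y Y ^ 5"
    by (intro tendsto_mult tendsto_power filterlim_compose[OF qp_tendsto sub] qp_tendsto Y)
  ultimately have "(\<Prod>k<5. qp (\<omega> ^ k * q) (\<omega> ^ k * q)) * qp (Y ^ 5) (Y ^ 5) = qp Y Y * qp Y Y ^ 5"
    using LIMSEQ_unique by simp
  moreover have "q ^ 25 = Y ^ 5" by (simp add: Y_def flip: power_mult)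
  moreover have "qp Y Y ^ 6 = qp Y Y * qp Y Y ^ 5" by (simp flip: power_Suc)
  ultimately show ?thesis
    by (simp only: Y_def[symmetric])
qed

section \<open>Dissections valid for every q with q^5 = Y\<close>

locale quintic_nome =
  fixes Y :: complex
  assumes Y_pos: "0 < norm Y" and Y_less_1: "norm Y < 1"
begin

definition "Q = Y ^ 5"
definition "PQ = qp Q Q"
definition "PY = qp Y Y"
definition "a = theta Y Q"
definition "b = theta (Y\<^sup>2) Q"
text \<open>Up to the factor Y^(1/5), the reciprocal of the Rogers-Ramanujan continued fraction at
  Y.\<close>

definition "x = b / a"

lemma Q: "0 < norm Q" "norm Q < 1"
  using Y_pos Y_less_1 by (auto simp: Q_def norm_power power_less_one_iff)

lemma nonzero [simp]: "Y \<noteq> 0" "Q \<noteq> 0"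
  using Y_pos by (auto simp: Q_def)

lemma PQ_nonzero [simp]: "PQ \<noteq> 0" and PY_nonzero [simp]: "PY \<noteq> 0"
  unfolding PQ_def PY_def using qp_nonzero[OF Q(2) Q(2)] qp_nonzero[OF Y_less_1 Y_less_1] by simp_all

lemma Q_powi: "Q powi n = Y powi (5 * n)"
  by (simp add: Q_def power_int_mult)

lemma theta_nonzero:
  assumes "z \<noteq> 0" "\<And>n. z * Y powi n \<noteq> 1"
  shows "theta z Q \<noteq> 0"
proof
  assume "theta z Q = 0"
  then obtain n where "z = Q powi n"
    using assms theta_eq_0_iff[OF Q] by blast
  then have "z * Y powi (- (5 * n)) = 1"
    by (simp add: Q_powi power_int_minus)
  with assms show False by blast
qed

lemma Y_powi_mult_Q_powi: "Y powi m * Q powi n \<noteq> 1" if "\<not> 5 dvd m"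
proof
  assume "Y powi m * Q powi n = 1"
  then have "Y powi (m + 5 * n) = 1"
    by (simp add: Q_powi power_int_add)
  then have "m + 5 * n = 0"
    by (rule power_int_eq_1_D[OF Y_less_1])
  then show False using that by presburger
qed

lemma theta_Y_powi_nonzero: "theta (Y powi m) Q \<noteq> 0" if "\<not> 5 dvd m"
proof
  assume "theta (Y powi m) Q = 0"
  then obtain n where "Y powi m = Q powi n"
    using theta_eq_0_iff[OF Q] by auto
  then have "Y powi m * Q powi (-n) = 1"
    by (simp add: power_int_minus)
  then show False using Y_powi_mult_Q_powi[OF that] by blast
qed

lemma a_nonzero [simp]: "a \<noteq> 0" and b_nonzero [simp]: "b \<noteq> 0" and x_nonzero [simp]: "x \<noteq> 0"
proof -
  show "a \<noteq> 0" using theta_Y_powi_nonzero[of 1] by (simp add: a_def)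
  moreover show "b \<noteq> 0" using theta_Y_powi_nonzero[of 2] by (simp add: b_def)
  ultimately show "x \<noteq> 0" by (simp add: x_def)
qed

text \<open>Of the five residue classes of exponents in (Y;Y), the classes 1 and 4 belong to a, 2
  and 3 to b, and the multiples of 5 form (Q;Q); in addition a and b each contain one factor
  (Q;Q).\<close>

lemma ab: "a * b = PQ * PY"
proof -
  have "a = PQ * qp Y Q * qp (Q / Y) Q" "b = PQ * qp (Y\<^sup>2) Q * qp (Q / Y\<^sup>2) Q"
    unfolding a_def b_def PQ_def by (simp_all add: jacobi_triple_product[OF Q])
  moreover have "Q / Y = Y ^ 4" "Q / Y\<^sup>2 = Y ^ 3"
    by (simp_all add: Q_def eval_nat_numeral)
  moreover have "PY = (\<Prod>j<5. qp (Y * Y ^ j) (Y ^ 5))"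
    unfolding PY_def by (rule qp_split_modulus[OF Y_less_1, symmetric]) auto
  moreover have "(\<Prod>j<5. qp (Y * Y ^ j) (Y ^ 5)) = qp Y Q * qp (Y\<^sup>2) Q * qp (Y ^ 3) Q * qp (Y ^ 4) Q * PQ"
    by (simp add: eval_nat_numeral Q_def PQ_def)
  ultimately show ?thesis by (simp add: mult_ac)
qed

lemma theta_Y4: "theta (Y ^ 4) Q = a" and theta_Y3: "theta (Y ^ 3) Q = b"
proof -
  have "Y ^ 4 = Q / Y" "Y ^ 3 = Q / Y\<^sup>2" by (simp_all add: Q_def eval_nat_numeral)
  then show "theta (Y ^ 4) Q = a" "theta (Y ^ 3) Q = b"
    by (simp_all add: a_def b_def theta_q_div[OF Q])
qed

text \<open>Splitting modulo 5 gives pieces S(m) for m = -2, ..., 2. Atkin and Swinnerton-Dyer's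
  identity at \<zeta> = Y and \<zeta> = Y^2 eliminates S(1), S(-1) and S(2), S(-2), so only S(0) and
  theta quotients remain. The argument q^9 is the one for which S(0) has argument Q^3, as that
  identity requires.\<close>

lemma appell_decomposition:
  assumes q: "q ^ 5 = Y" and w: "w \<noteq> 0" "\<And>n. w * Y powi n \<noteq> 1"
  shows "appell (q ^ 9) (q ^ 3) w Y = (1 - x / q + q / x) * appell (Q ^ 3) (Q ^ 3) w Q
    + PQ ^ 4 * PY * (1 / (q ^ 9 * (theta (w / Y\<^sup>2) Q * theta w Q * theta (w * Y\<^sup>2) Q))
                      - 1 / (q ^ 6 * (theta (w / Y) Q * theta w Q * theta (w * Y) Q)))"
proof -
  have q0: "q \<noteq> 0" using q nonzero(1) by auto
  have qn: "norm q < 1"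
  proof -
    have "norm q ^ 5 < 1" using q Y_less_1 by (metis norm_power)
    then show ?thesis by (metis linorder_not_less norm_ge_zero one_le_power)
  qed
  have q3: "0 < norm (q ^ 3)" "norm (q ^ 3) < 1"
    using q0 qn by (auto simp: norm_power power_less_one_iff)
  have "Q = (q ^ 5) ^ 5" by (simp only: Q_def q)
  then have Qq: "Q = q ^ 25" by (simp flip: power_mult)
  have wQ: "w * Q powi n \<noteq> 1" "w * Y powi m * Q powi n \<noteq> 1" for n m
    using w(2)[of "5 * n"] w(2)[of "m + 5 * n"] by (simp_all add: Q_powi power_int_add mult.assoc)
  define S where "S = (\<lambda>m. appell (Q ^ 3 * Y powi (3 * m)) (Q ^ 3) (w * Y powi m) Q)"
  have tri: "tri (-2) = 3" "tri (-1) = 1" "tri 2 = 1" by (simp_all add: tri_def)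
  have arg: "(q ^ 9) ^ 5 * (q ^ 3) powi (10 + 5 * m) = Q ^ 3 * Y powi (3 * m)" for m
  proof -
    have "(q ^ 3) powi (10 + 5 * m) = (q ^ 3) ^ 10 * (q ^ 15) powi m"
    proof -
      have "(q ^ 3) powi (5 * m) = (q ^ 15) powi m"
        unfolding power_int_mult by (simp flip: power_mult)
      then show ?thesis using q0 by (simp add: power_int_add)
    qed
    moreover have "Y powi (3 * m) = (q ^ 15) powi m"
      unfolding power_int_mult by (simp add: q[symmetric] flip: power_mult)
    ultimately show ?thesis by (simp add: Qq flip: power_mult power_add)
  qed
  have Q3: "(q ^ 3) ^ 25 = Q ^ 3" by (simp add: Qq flip: power_mult)
  have "appell (q ^ 9) (q ^ 3) w Y = (\<Sum>m\<in>{-2..2}. (- (q ^ 9)) powi m * (q ^ 3) powi tri m *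
      appell ((q ^ 9) ^ 5 * (q ^ 3) powi (10 + 5 * m)) ((q ^ 3) ^ 25) (w * Y powi m) (Y ^ 5))"
    by (rule appell_split_mod5[OF q3 _ Y_less_1 _ w]) (use q0 in auto)
  also have "\<dots> = (\<Sum>m\<in>{-2..2}. (- (q ^ 9)) powi m * (q ^ 3) powi tri m * S m)"
    unfolding arg Q3 S_def Q_def[symmetric] ..
  also have "\<dots> = S 0 - (q ^ 9 * S 1 + S (-1) / q ^ 6) + (q ^ 21 * S 2 + S (-2) / q ^ 9)"
  proof -
    have "(- (q ^ 9)) powi -2 * (q ^ 3) powi 3 = 1 / q ^ 9" "(- (q ^ 9)) powi -1 * (q ^ 3) powi 1 = - (1 / q ^ 6)"
        "(- (q ^ 9)) powi 0 * (q ^ 3) powi 0 = 1" "(- (q ^ 9)) powi 1 * (q ^ 3) powi 0 = - (q ^ 9)"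
        "(- (q ^ 9)) powi 2 * (q ^ 3) powi 1 = q ^ 21"
      using q0 by (simp_all add: power_int_minus field_simps flip: power_mult power_add)
    then show ?thesis
      unfolding sum_int_m2_2 tri tri_0 tri_1 by (simp only:) simp
  qed
  also have "q ^ 9 * S 1 + S (-1) / q ^ 6 = (Y ^ 3 * S 1 + S (-1)) / q ^ 6"
    using q0 by (simp add: q[symmetric] field_simps flip: power_mult power_add)
  also have "Y ^ 3 * S 1 + S (-1) = PQ ^ 3 * a * b / (theta (w / Y) Q * theta w Q * theta (w * Y) Q) + Y * b / a * S 0"
  proof -
    have "Y ^ 3 * appell (Y ^ 3 * Q ^ 3) (Q ^ 3) (w * Y) Q + appell (Q ^ 3 / Y ^ 3) (Q ^ 3) (w / Y) Q
    = qp Q Q ^ 3 * theta Y Q * theta (Y\<^sup>2) Q / (theta (w / Y) Q * theta w Q * theta (w * Y) Q)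
      + Y * theta (Y\<^sup>2) Q / theta Y Q * appell (Q ^ 3) (Q ^ 3) w Q"
      using Y_powi_mult_Q_powi[of 1] Y_powi_mult_Q_powi[of 2] wQ(1) wQ(2)[of 1] wQ(2)[of "-1"] w(1)
      by (intro atkin_swinnerton_dyer[OF Q]) (simp_all add: power_int_minus field_simps)
    then show ?thesis
      by (simp add: S_def power_int_minus field_simps a_def b_def PQ_def)
  qed
  also have "q ^ 21 * S 2 + S (-2) / q ^ 9 = ((Y\<^sup>2) ^ 3 * S 2 + S (-2)) / q ^ 9"
    using q0 by (simp add: q[symmetric] field_simps flip: power_mult power_add)
  also have "(Y\<^sup>2) ^ 3 * S 2 + S (-2) = PQ ^ 3 * b * a / (theta (w / Y\<^sup>2) Q * theta w Q * theta (w * Y\<^sup>2) Q) + Y\<^sup>2 * a / b * S 0"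
  proof -
    have Y4: "(Y\<^sup>2)\<^sup>2 = Y ^ 4" by (simp flip: power_mult)
    have "(Y\<^sup>2) ^ 3 * appell ((Y\<^sup>2) ^ 3 * Q ^ 3) (Q ^ 3) (w * Y\<^sup>2) Q + appell (Q ^ 3 / (Y\<^sup>2) ^ 3) (Q ^ 3) (w / Y\<^sup>2) Q
    = qp Q Q ^ 3 * theta (Y\<^sup>2) Q * theta ((Y\<^sup>2)\<^sup>2) Q / (theta (w / Y\<^sup>2) Q * theta w Q * theta (w * Y\<^sup>2) Q)
      + Y\<^sup>2 * theta ((Y\<^sup>2)\<^sup>2) Q / theta (Y\<^sup>2) Q * appell (Q ^ 3) (Q ^ 3) w Q"
      using Y_powi_mult_Q_powi[of 2] Y_powi_mult_Q_powi[of 4] wQ(1) wQ(2)[of 2] wQ(2)[of "-2"] w(1)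
      by (intro atkin_swinnerton_dyer[OF Q]) (simp_all add: Y4 power_int_minus field_simps)
    then show ?thesis
      by (simp add: S_def Y4 theta_Y4 power_int_minus field_simps b_def PQ_def flip: power_mult)
  qed
  also have "S 0 = appell (Q ^ 3) (Q ^ 3) w Q" by (simp add: S_def)
  finally have main: "appell (q ^ 9) (q ^ 3) w Y = appell (Q ^ 3) (Q ^ 3) w Q -
      (PQ ^ 3 * a * b / (theta (w / Y) Q * theta w Q * theta (w * Y) Q) + Y * b / a * appell (Q ^ 3) (Q ^ 3) w Q) / q ^ 6 +
      (PQ ^ 3 * b * a / (theta (w / Y\<^sup>2) Q * theta w Q * theta (w * Y\<^sup>2) Q) + Y\<^sup>2 * a / b * appell (Q ^ 3) (Q ^ 3) w Q) / q ^ 9" .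
  define D1 D2 A where "D1 = theta (w / Y) Q * theta w Q * theta (w * Y) Q"
    and "D2 = theta (w / Y\<^sup>2) Q * theta w Q * theta (w * Y\<^sup>2) Q" and "A = appell (Q ^ 3) (Q ^ 3) w Q"
  have P4: "PQ ^ 4 * PY = PQ ^ 3 * a * b"
    using ab by (simp add: eval_nat_numeral mult_ac)
  have "Y / q ^ 6 = 1 / q" "Y\<^sup>2 / q ^ 9 = q"
    using q0 by (simp_all add: q[symmetric] field_simps flip: power_mult power_add power_Suc)
  moreover have "Y * b / a / q ^ 6 = (Y / q ^ 6) * (b / a)" "Y\<^sup>2 * a / b / q ^ 9 = (Y\<^sup>2 / q ^ 9) * (a / b)"
    by simp_all
  ultimately have Yq: "Y * b / a / q ^ 6 = x / q" "Y\<^sup>2 * a / b / q ^ 9 = q / x"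
    by (simp_all add: x_def)
  have "A - (PQ ^ 3 * a * b / D1 + Y * b / a * A) / q ^ 6 + (PQ ^ 3 * b * a / D2 + Y\<^sup>2 * a / b * A) / q ^ 9
     = (1 - Y * b / a / q ^ 6 + Y\<^sup>2 * a / b / q ^ 9) * A + PQ ^ 3 * a * b * (1 / (q ^ 9 * D2) - 1 / (q ^ 6 * D1))"
    by (simp add: add_divide_distrib algebra_simps)
  then show ?thesis
    unfolding main P4 D1_def[symmetric] D2_def[symmetric] A_def[symmetric] Yq by simp
qed

lemma nome_power_less_1:
  assumes "q ^ 5 = Y"
  shows "q \<noteq> 0" "norm q < 1" "0 < norm (q ^ 3)" "norm (q ^ 3) < 1"
proof -
  show q0: "q \<noteq> 0" using assms nonzero(1) by auto
  have "norm q ^ 5 < 1" using assms Y_less_1 by (metis norm_power)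
  then show qn: "norm q < 1" by (metis linorder_not_less norm_ge_zero one_le_power)
  show "0 < norm (q ^ 3)" "norm (q ^ 3) < 1"
    using q0 qn by (auto simp: norm_power power_less_one_iff)
qed

text \<open>Both Appell sums in \<open>appell_decomposition\<close> change by theta values under \<open>w \<mapsto> w Q\<close>;
  comparing them identifies the coefficient.\<close>
lemma qp_dissection:
  assumes q: "q ^ 5 = Y"
  shows "qp q q = PQ * (x - q - q\<^sup>2 / x)"
proof -
  note q0 = nome_power_less_1(1)[OF q] and qn = nome_power_less_1(2)[OF q] and q3 = nome_power_less_1(3,4)[OF q]
  define P where "P = qp q q"
  have "Q = (q ^ 5) ^ 5" by (simp only: Q_def q)
  then have Qq: "Q = q ^ 25" by (simp flip: power_mult)
  \<comment> \<open>A comparison point off the poles is wanted. Any point of modulus one other than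
    1 avoids them, since |Y| < 1; \<i> is a concrete choice.\<close>
  have gen: "\<i> * Y powi n \<noteq> 1" for n
  proof
    assume *: "\<i> * Y powi n = 1"
    then have "norm \<i> * norm Y powi n = 1"
      by (metis norm_mult norm_one norm_power_int)
    then have "norm (complex_of_real (norm Y)) < 1" "complex_of_real (norm Y) powi n = 1"
      using Y_less_1 by (simp_all flip: of_real_power_int)
    then have "n = 0" by (rule power_int_eq_1_D)
    with * show False by simp
  qed
  define v where "v = \<i> * Q"
  have v0: "v \<noteq> 0" by (simp add: v_def)
  have genv: "v * Y powi n \<noteq> 1" for n
    using gen[of "5 + n"] by (simp add: v_def Q_def power_int_add mult_ac)
  have genQ: "\<i> * Q powi n \<noteq> 1" "v * Q powi n \<noteq> 1" for n
    using gen[of "5 * n"] genv[of "5 * n"] by (simp_all add: Q_powi)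
  define F where "F = (\<lambda>w. appell (q ^ 9) (q ^ 3) w Y)"
  define G where "G = (\<lambda>w. appell (Q ^ 3) (Q ^ 3) w Q)"
  define R where "R = (\<lambda>w. PQ ^ 4 * PY * (1 / (q ^ 9 * (theta (w / Y\<^sup>2) Q * theta w Q * theta (w * Y\<^sup>2) Q))
                      - 1 / (q ^ 6 * (theta (w / Y) Q * theta w Q * theta (w * Y) Q))))"
  define \<kappa> where "\<kappa> = 1 - x / q + q / x"
  have dec: "F \<i> = \<kappa> * G \<i> + R \<i>" "F v = \<kappa> * G v + R v"
    unfolding F_def G_def R_def \<kappa>_def using gen genv v0 by (auto intro!: appell_decomposition[OF q])
  define e where "e = (\<lambda>n. theta (q ^ n) (q ^ 3))"
  \<comment> \<open>A shift of the index by 5 moves w to w Y^5 = w Q and the argument q^9 to q^24;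
    three steps by Y = q^5 connect q^9 with q^24, each at the cost of one theta value.\<close>
  have F: "F \<i> * v ^ 3 = - (Q ^ 3) * (F v - (e 9 + v * e 14 + v\<^sup>2 * e 19))"
  proof -
    have t5: "tri 5 = 10" by (simp add: tri_def)
    have "F \<i> = (- (q ^ 9)) powi 5 * (q ^ 3) powi tri 5 * appell (q ^ 9 * (q ^ 3) powi 5) (q ^ 3) (\<i> * Y powi 5) Y"
      unfolding F_def using q0 by (intro appell_shift) auto
    also have "(- (q ^ 9)) powi 5 * (q ^ 3) powi tri 5 = - (Q ^ 3)"
      unfolding t5 Qq by (simp flip: power_mult power_add)
    also have "q ^ 9 * (q ^ 3) powi 5 = q ^ 24" by (simp flip: power_mult power_add)
    also have "\<i> * Y powi 5 = v" by (simp add: v_def Q_def)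
    finally have 1: "F \<i> = - (Q ^ 3) * appell (q ^ 24) (q ^ 3) v Y" .
    have step: "v * appell (q ^ n * Y) (q ^ 3) v Y = appell (q ^ n) (q ^ 3) v Y - e n" for n
      unfolding e_def using q0 v0 genv Y_less_1 by (intro appell_step q3) auto
    have "v * appell (q ^ (n + 5)) (q ^ 3) v Y = appell (q ^ n) (q ^ 3) v Y - e n" for n
      using step[of n] by (simp add: power_add q)
    from this[of 9] this[of 14] this[of 19]
    have "v * appell (q ^ 14) (q ^ 3) v Y = F v - e 9" "v * appell (q ^ 19) (q ^ 3) v Y = appell (q ^ 14) (q ^ 3) v Y - e 14"
      "v * appell (q ^ 24) (q ^ 3) v Y = appell (q ^ 19) (q ^ 3) v Y - e 19"
      by (simp_all add: F_def)
    then have "v ^ 3 * appell (q ^ 24) (q ^ 3) v Y = F v - (e 9 + v * e 14 + v\<^sup>2 * e 19)"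
      by algebra
    then show ?thesis unfolding 1 by (simp add: mult_ac)
  qed
  define d where "d = (\<lambda>n. theta (Q ^ n) (Q ^ 3))"
  have Q3: "0 < norm (Q ^ 3)" "norm (Q ^ 3) < 1"
    using Q by (auto simp: norm_power power_less_one_iff)
  \<comment> \<open>Here one shift of the index moves w to w Q and the argument to Q^6, and three
    steps by Q connect Q^3 with Q^6. The factor -Q^3/v^3 is the same as for F.\<close>
  have G: "G \<i> * v ^ 3 = - (Q ^ 3) * (G v - (d 3 + v * d 4 + v\<^sup>2 * d 5))"
  proof -
    have "G \<i> = (- (Q ^ 3)) powi 1 * (Q ^ 3) powi tri 1 * appell (Q ^ 3 * (Q ^ 3) powi 1) (Q ^ 3) (\<i> * Q powi 1) Q"
      unfolding G_def by (intro appell_shift) auto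
    also have "\<dots> = - (Q ^ 3) * appell (Q ^ 6) (Q ^ 3) v Q"
      by (simp add: v_def flip: power_add)
    finally have 1: "G \<i> = - (Q ^ 3) * appell (Q ^ 6) (Q ^ 3) v Q" .
    have step: "v * appell (Q ^ n * Q) (Q ^ 3) v Q = appell (Q ^ n) (Q ^ 3) v Q - d n" for n
      unfolding d_def using v0 genQ Q by (intro appell_step Q3) auto
    have "v * appell (Q ^ (n + 1)) (Q ^ 3) v Q = appell (Q ^ n) (Q ^ 3) v Q - d n" for n
      using step[of n] by (simp add: mult.commute)
    from this[of 3] this[of 4] this[of 5]
    have "v * appell (Q ^ 4) (Q ^ 3) v Q = G v - d 3" "v * appell (Q ^ 5) (Q ^ 3) v Q = appell (Q ^ 4) (Q ^ 3) v Q - d 4"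
      "v * appell (Q ^ 6) (Q ^ 3) v Q = appell (Q ^ 5) (Q ^ 3) v Q - d 5"
      by (simp_all add: G_def)
    then have "v ^ 3 * appell (Q ^ 6) (Q ^ 3) v Q = G v - (d 3 + v * d 4 + v\<^sup>2 * d 5)"
      by algebra
    then show ?thesis unfolding 1 by (simp add: mult_ac)
  qed
  \<comment> \<open>The theta quotients transform by this very factor without a remainder, so they
    drop out of the comparison and leave a relation among theta values alone.\<close>
  have R: "R \<i> * v ^ 3 = - (Q ^ 3) * R v"
  proof -
    have th: "theta (v * y) Q = - theta (\<i> * y) Q / (\<i> * y)" if "y \<noteq> 0" for y
      using theta_mult_q[OF Q, of "\<i> * y"] that by (simp add: v_def mult_ac)
    have three: "theta (v / y) Q * theta v Q * theta (v * y) Q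
        = - (theta (\<i> / y) Q * theta \<i> Q * theta (\<i> * y) Q) / \<i> ^ 3" if "y \<noteq> 0" for y
      using th[of "1 / y"] th[of 1] th[of y] that by (simp add: power3_eq_cube)
    have "R v = - (R \<i> * \<i> ^ 3)"
      unfolding R_def three[OF nonzero(1)] three[OF power_not_zero[OF nonzero(1), of 2]]
      by (simp add: field_simps)
    moreover have "v ^ 3 = \<i> ^ 3 * Q ^ 3"
      by (simp add: v_def power_mult_distrib)
    ultimately show ?thesis by simp
  qed
  have "- (Q ^ 3) * (F v - (e 9 + v * e 14 + v\<^sup>2 * e 19)) = \<kappa> * (G \<i> * v ^ 3) + R \<i> * v ^ 3"
    unfolding F[symmetric] dec(1) by (simp add: algebra_simps)
  also have "\<dots> = - (Q ^ 3) * (\<kappa> * (G v - (d 3 + v * d 4 + v\<^sup>2 * d 5)) + R v)"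
    unfolding G R by (simp add: algebra_simps)
  finally have "F v - (e 9 + v * e 14 + v\<^sup>2 * e 19) = \<kappa> * (G v - (d 3 + v * d 4 + v\<^sup>2 * d 5)) + R v"
    by (simp only: mult_cancel_left) simp
  then have ed: "e 9 + v * e 14 + v\<^sup>2 * e 19 = \<kappa> * (d 3 + v * d 4 + v\<^sup>2 * d 5)"
    unfolding dec(2) by (simp add: algebra_simps)
  \<comment> \<open>Quasi-periodicity reduces every remaining theta value to theta(1) = 0 or to the
    pentagonal series: (q;q) in base q^3 and likewise (Q;Q) in base Q^3.\<close>
  have estep: "e (n + 3) = - e n / q ^ n" for n
    unfolding e_def using theta_mult_q[OF q3, of "q ^ n"] q0 by (simp add: power_add)
  have e1: "e 1 = P" and e2: "e 2 = P"
  proof -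
    show "e 1 = P" using euler_pentagonal[of q] q0 qn by (simp add: e_def P_def)
    moreover have "e 2 = e 1"
      using theta_q_div[OF q3, of q] q0 by (simp add: e_def power3_eq_cube power2_eq_square)
    ultimately show "e 2 = P" by simp
  qed
  have e9: "e 9 = 0"
    using estep[of 6] estep[of 3] estep[of 0] theta_1[OF q3] by (simp add: e_def)
  have e14: "e 14 = P / q ^ 26"
    using estep[of 11] estep[of 8] estep[of 5] estep[of 2] e2 by (simp flip: power_add)
  have e19: "e 19 = P / q ^ 51"
  proof -
    have "q * q ^ 4 * q ^ 7 * q ^ 10 * q ^ 13 * q ^ 16 = q ^ (1 + 4 + 7 + 10 + 13 + 16)"
      by (simp only: power_add power_one_right)
    then show ?thesis
      using estep[of 16] estep[of 13] estep[of 10] estep[of 7] estep[of 4] estep[of 1] e1 by simp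
  qed
  have dstep: "d (n + 3) = - d n / Q ^ n" for n
    unfolding d_def using theta_mult_q[OF Q3, of "Q ^ n"] by (simp add: power_add)
  have d1: "d 1 = PQ" and d2: "d 2 = PQ"
  proof -
    show "d 1 = PQ" using euler_pentagonal[OF Q] by (simp add: d_def PQ_def)
    moreover have "d 2 = d 1"
      using theta_q_div[OF Q3, of Q] by (simp add: d_def power3_eq_cube power2_eq_square)
    ultimately show "d 2 = PQ" by simp
  qed
  have d3: "d 3 = 0" using dstep[of 0] theta_1[OF Q3] by (simp add: d_def)
  have d4: "d 4 = - PQ / Q" using dstep[of 1] d1 by simp
  have d5: "d 5 = - PQ / Q\<^sup>2" using dstep[of 2] d2 by simp
  have vq: "v = \<i> * q ^ 25" "v\<^sup>2 = - (q ^ 50)"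
    by (simp_all add: v_def Qq power_mult_distrib flip: power_mult)
  have l: "v * (P / q ^ 26) = \<i> * (P / q)" "v\<^sup>2 * (P / q ^ 51) = - (P / q)"
    using q0 unfolding vq by (simp_all add: divide_simps flip: power_add power_Suc power_Suc2)
  have r: "v * (- PQ / Q) = - (\<i> * PQ)" "v\<^sup>2 * (- PQ / Q\<^sup>2) = PQ"
    unfolding v_def by (simp_all add: power_mult_distrib)
  define y where "y = P / q"
  have eq: "(\<i> - 1) * y = \<kappa> * ((1 - \<i>) * PQ)"
    using ed unfolding e9 e14 e19 d3 d4 d5 l r y_def[symmetric] by (simp add: algebra_simps)
  have "(\<i> - 1) * (y + \<kappa> * PQ) = (\<i> - 1) * y - \<kappa> * ((1 - \<i>) * PQ)"
    by (simp add: algebra_simps)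
  then have "(\<i> - 1) * (P / q + \<kappa> * PQ) = 0"
    unfolding y_def[symmetric] by (simp only: diff_self eq)
  moreover have "\<i> - 1 \<noteq> 0"
    by (simp add: complex_eq_iff)
  ultimately have "P / q + \<kappa> * PQ = 0" by simp
  then have "P = - q * \<kappa> * PQ"
    using q0 by (simp add: field_simps add_eq_0_iff)
  also have "\<dots> = PQ * (x - q - q\<^sup>2 / x)"
    using q0 by (simp add: \<kappa>_def field_simps power2_eq_square)
  finally show ?thesis by (simp add: P_def)
qed

text \<open>The product of \<open>qp_dissection\<close> over the five q with q^5 = Y: the left sides
  multiply by \<open>qp_norm_fifth_roots\<close>, the right sides by
  \<open>prod_quadratic_fifth_roots\<close> at u = q/x.\<close>

lemma norm_x: "x ^ 5 - 11 * Y - Y\<^sup>2 / x ^ 5 = PY ^ 6 / PQ ^ 6"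
proof -
  obtain \<omega> :: complex where \<omega>: "\<omega> ^ 5 = 1" "\<omega> \<noteq> 1"
    using ex_fifth_root_of_unity by blast
  define q where "q = exp (Ln Y / 5)"
  have q: "q ^ 5 = Y"
    by (simp add: q_def flip: exp_of_nat_mult)
  have q\<omega>: "(\<omega> ^ k * q) ^ 5 = Y" for k
    using \<omega>(1) q by (simp add: power_mult_distrib flip: power_mult) (simp add: mult.commute[of k] power_mult)
  define u where "u = q / x"
  have "(\<Prod>k<5. qp (\<omega> ^ k * q) (\<omega> ^ k * q)) = (\<Prod>k<5. PQ * x * (1 - \<omega> ^ k * u - (\<omega> ^ k * u)\<^sup>2))"
    unfolding qp_dissection[OF q\<omega>] by (intro prod.cong refl) (simp add: u_def field_simps power2_eq_square)
  also have "\<dots> = (PQ * x) ^ 5 * (1 - 11 * u ^ 5 - u ^ 10)"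
    by (simp only: prod.distrib prod_quadratic_fifth_roots[OF \<omega>]) (simp add: power_mult_distrib)
  also have "\<dots> = PQ ^ 5 * (x ^ 5 - 11 * Y - Y\<^sup>2 / x ^ 5)"
  proof -
    have "u ^ 5 = Y / x ^ 5" by (simp add: u_def power_divide q)
    moreover have "u ^ 10 = (u ^ 5)\<^sup>2" by (simp flip: power_mult)
    moreover have "(PQ * x) ^ 5 = PQ ^ 5 * x ^ 5" by (rule power_mult_distrib)
    ultimately show ?thesis
      by (simp only:) (simp add: field_simps power2_eq_square)
  qed
  finally have prod: "(\<Prod>k<5. qp (\<omega> ^ k * q) (\<omega> ^ k * q)) = PQ ^ 5 * (x ^ 5 - 11 * Y - Y\<^sup>2 / x ^ 5)" .
  have "Q = (q ^ 5) ^ 5" by (simp only: Q_def q)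
  then have "q ^ 25 = Q" by (simp flip: power_mult)
  then have "PQ ^ 5 * (x ^ 5 - 11 * Y - Y\<^sup>2 / x ^ 5) * PQ = PY ^ 6"
    using qp_norm_fifth_roots[OF \<omega> nome_power_less_1(2)[OF q]] unfolding prod
    by (simp only: q PQ_def PY_def)
  moreover have "z = PQ ^ 5 * z * PQ / PQ ^ 6" for z
    by (simp add: eval_nat_numeral)
  ultimately show ?thesis by metis
qed

text \<open>The denominator x - q - q^2/x is rationalised by its four conjugates with
  \<open>quintic_factorization\<close>; the resulting norm is evaluated by
  \<open>norm_x\<close>.\<close>

lemma inverse_qp_dissection:
  assumes q: "q ^ 5 = Y"
  shows "1 / qp q q = PQ ^ 5 / PY ^ 6 * ((x ^ 4 - 3 * Y / x) + q * (x ^ 3 + 2 * Y / x\<^sup>2)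
      + q\<^sup>2 * (2 * x\<^sup>2 - Y / x ^ 3) + q ^ 3 * (3 * x + Y / x ^ 4) + 5 * q ^ 4)"
proof -
  define f where "f = x - q - q\<^sup>2 / x"
  define g where "g = (x ^ 4 - 3 * Y / x) + q * (x ^ 3 + 2 * Y / x\<^sup>2)
      + q\<^sup>2 * (2 * x\<^sup>2 - Y / x ^ 3) + q ^ 3 * (3 * x + Y / x ^ 4) + 5 * q ^ 4"
  have "f * g = x ^ 5 - 11 * Y - Y\<^sup>2 / x ^ 5"
    using quintic_factorization[OF x_nonzero, of q] unfolding f_def g_def q .
  then have fg: "f * g = PY ^ 6 / PQ ^ 6" by (simp add: norm_x)
  then have "f \<noteq> 0" by auto
  have "1 / qp q q = 1 / (PQ * f)"
    using qp_dissection[OF q] by (simp add: f_def)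
  also have "\<dots> = (f * g) / (PQ * f * (f * g))"
    using fg by simp
  also have "\<dots> = g / (PQ * (PY ^ 6 / PQ ^ 6))"
    using \<open>f \<noteq> 0\<close> unfolding fg[symmetric] by simp
  also have "\<dots> = PQ ^ 5 / PY ^ 6 * g"
    by (simp add: eval_nat_numeral)
  finally show ?thesis by (simp add: g_def)
qed

end

section \<open>Weierstrass's three-term relation and logarithmic derivatives\<close>

lemma has_sum_product:
  fixes f :: "'a \<Rightarrow> complex" and g :: "'b \<Rightarrow> complex"
  assumes f: "(\<lambda>x. norm (f x)) summable_on A" "(f has_sum s) A"
    and g: "(\<lambda>x. norm (g x)) summable_on B" "(g has_sum t) B"
  shows "((\<lambda>(x, y). f x * g y) has_sum (s * t)) (A \<times> B)"
proof -
  have "(\<lambda>(x, y). norm (f x) * norm (g y)) summable_on A \<times> B"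
  proof (rule summable_on_SigmaI)
    show "((\<lambda>y. case (x, y) of (x, y) \<Rightarrow> norm (f x) * norm (g y)) has_sum
        (norm (f x) * (\<Sum>\<^sub>\<infinity>y\<in>B. norm (g y)))) B" for x
      using has_sum_infsum[OF g(1)] by (auto intro: has_sum_cmult_right)
    show "(\<lambda>x. norm (f x) * (\<Sum>\<^sub>\<infinity>y\<in>B. norm (g y))) summable_on A"
      by (intro summable_on_cmult_left f)
  qed auto
  then have "(\<lambda>z. norm (case z of (x, y) \<Rightarrow> f x * g y)) summable_on A \<times> B"
    by (simp add: split_def norm_mult)
  then have "(\<lambda>(x, y). f x * g y) summable_on A \<times> B"
    by (rule abs_summable_summable)
  then obtain r where r: "((\<lambda>(x, y). f x * g y) has_sum r) (A \<times> B)"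
    by (auto simp: summable_on_def)
  have "((\<lambda>x. f x * t) has_sum r) A"
    by (rule has_sum_Sigma'[OF r]) (use g(2) in \<open>auto intro!: has_sum_cmult_right\<close>)
  moreover have "((\<lambda>x. f x * t) has_sum (s * t)) A"
    by (intro has_sum_cmult_left f)
  ultimately show ?thesis using r has_sum_unique by blast
qed

text \<open>In the double series over (m, n) the substitution i = (m + n)/2, j = (m - n)/2, shifted
  by one half if m + n is odd, separates x from y. The two parities of m + n give the two products
  in a 2 by 2 determinant of theta functions of base q^2.\<close>

lemma theta_addition:
  assumes q: "0 < norm q" "norm q < 1" and xy: "x \<noteq> 0" "y \<noteq> 0"
  defines "d0 \<equiv> (\<lambda>z. theta (-(z\<^sup>2 * q)) (q\<^sup>2))" and "d1 \<equiv> (\<lambda>z. z * theta (-(z\<^sup>2 * q\<^sup>2)) (q\<^sup>2))"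
  shows "theta (x * y) q * theta (x / y) q = x * (d1 x * d0 y - d0 x * d1 y)"
proof -
  have q0: "q \<noteq> 0" using q by auto
  have q2: "0 < norm (q\<^sup>2)" "norm (q\<^sup>2) < 1"
    using q by (auto simp: norm_power power_less_one_iff)
  define f where "f = (\<lambda>z n. (-z) powi n * q powi tri n)"
  have f: "(\<lambda>n. norm (f z n)) summable_on UNIV" "(f z has_sum theta z q) UNIV" if "z \<noteq> 0" for z
    unfolding f_def using summable_on_tri(1)[OF q, of "-z"] has_sum_theta[OF q that] that by auto
  define g where "g = (\<lambda>z n. z powi n * (q\<^sup>2) powi tri n)"
  have g: "(\<lambda>n. norm (g z n)) summable_on UNIV" "(g z has_sum theta (-z) (q\<^sup>2)) UNIV" if "z \<noteq> 0" for z
    unfolding g_def using summable_on_tri(1)[OF q2, of z] has_sum_theta[OF q2, of "-z"] that by auto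
  define h where "h = (\<lambda>(m, n). f (x * y) m * f (x / y) n)"
  have h: "(h has_sum (theta (x * y) q * theta (x / y) q)) (UNIV \<times> UNIV)"
    unfolding h_def using xy by (intro has_sum_product f) auto
  have h_eq: "h (m, n) = (-1) powi (m + n) * x powi (m + n) * y powi (m - n) * q powi (tri m + tri n)" for m n
  proof -
    have "(-(x * y)) powi m = (-1) powi m * x powi m * y powi m"
      by (simp flip: power_int_mult_distrib)
    moreover have "(-(x / y)) powi n = (-1) powi n * x powi n * y powi (- n)"
      by (simp add: power_int_minus power_int_divide_distrib field_simps flip: power_int_mult_distrib)
        (metis divide_minus_left power_int_divide_distrib)
    ultimately show ?thesis
      using xy q0 by (simp add: h_def f_def power_int_add power_int_diff power_int_minus field_simps)
  qed
  have sq: "(z\<^sup>2) powi n = z powi (2 * n)" for z :: complex and n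
    by (simp add: power_int_mult)
  have E: "(h has_sum (theta (-(x\<^sup>2)) (q\<^sup>2) * d0 y)) {(m, n). even (m + n)}"
  proof -
    have "((\<lambda>(i, j). g (x\<^sup>2) i * g (y\<^sup>2 * q) j) has_sum (theta (-(x\<^sup>2)) (q\<^sup>2) * d0 y)) (UNIV \<times> UNIV)"
      unfolding d0_def using xy q0 by (intro has_sum_product g) auto
    also have "?this \<longleftrightarrow> ?thesis"
    proof (rule has_sum_reindex_bij_witness[of _ "\<lambda>(m, n). ((m + n) div 2, (m - n) div 2)" "\<lambda>(i, j). (i + j, i - j)"])
      fix ij :: "int \<times> int"
      obtain i j where ij: "ij = (i, j)" by (cases ij)
      have "tri (i + j) + tri (i - j) = 2 * tri i + 2 * tri j + j"
        using tri_add[of i j] tri_add[of i "-j"] tri_minus[of j] by simp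
      moreover have "(-1::complex) powi (2 * i) = 1" by (simp add: power_int_mult)
      ultimately show "h (case ij of (i, j) \<Rightarrow> (i + j, i - j)) = (case ij of (i, j) \<Rightarrow> g (x\<^sup>2) i * g (y\<^sup>2 * q) j)"
        using xy q0 unfolding ij by (simp add: h_eq g_def sq power_int_mult_distrib power_int_add)
    qed (auto simp: split_def; presburger)+
    finally show ?thesis .
  qed
  have O: "(h has_sum (- x * (d0 x * d1 y))) {(m, n). odd (m + n)}"
  proof -
    have "((\<lambda>(i, j). - (x * y) * (g (x\<^sup>2 * q) i * g (y\<^sup>2 * q\<^sup>2) j)) has_sum
        (- (x * y) * (theta (-(x\<^sup>2 * q)) (q\<^sup>2) * theta (-(y\<^sup>2 * q\<^sup>2)) (q\<^sup>2)))) (UNIV \<times> UNIV)"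
      using has_sum_cmult_right[OF has_sum_product[OF g g, of "x\<^sup>2 * q" "y\<^sup>2 * q\<^sup>2"], of "- (x * y)"] xy q0
      by (simp add: split_def)
    also have "- (x * y) * (theta (-(x\<^sup>2 * q)) (q\<^sup>2) * theta (-(y\<^sup>2 * q\<^sup>2)) (q\<^sup>2)) = - x * (d0 x * d1 y)"
      by (simp add: d0_def d1_def)
    also have "((\<lambda>(i, j). - (x * y) * (g (x\<^sup>2 * q) i * g (y\<^sup>2 * q\<^sup>2) j)) has_sum (- x * (d0 x * d1 y))) (UNIV \<times> UNIV) \<longleftrightarrow> ?thesis"
    proof (rule has_sum_reindex_bij_witness[of _ "\<lambda>(m, n). ((m + n - 1) div 2, (m - n - 1) div 2)" "\<lambda>(i, j). (i + j + 1, i - j)"])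
      fix ij :: "int \<times> int"
      obtain i j where ij: "ij = (i, j)" by (cases ij)
      have "tri (i + j + 1) + tri (i - j) = 2 * tri i + i + (2 * tri j + 2 * j)"
        using tri_add[of i j] tri_add[of i "-j"] tri_minus[of j] tri_plus_1[of "i + j"] by simp
      moreover have "(-1::complex) powi (2 * i) = 1" by (simp add: power_int_mult)
      ultimately show "h (case ij of (i, j) \<Rightarrow> (i + j + 1, i - j)) = (case ij of (i, j) \<Rightarrow> - (x * y) * (g (x\<^sup>2 * q) i * g (y\<^sup>2 * q\<^sup>2) j))"
        using xy q0 unfolding ij by (simp add: h_eq g_def sq power_int_mult_distrib power_int_add)
    qed (auto simp: split_def; presburger)+
    finally show ?thesis .
  qed
  have "(h has_sum (theta (-(x\<^sup>2)) (q\<^sup>2) * d0 y + - x * (d0 x * d1 y))) ({(m, n). even (m + n)} \<union> {(m, n). odd (m + n)})"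
    by (rule has_sum_Un_disjoint[OF E O]) auto
  also have "{(m, n). even (m + n)} \<union> {(m, n). odd (m + n)} = (UNIV :: (int \<times> int) set)" by auto
  finally have "theta (x * y) q * theta (x / y) q = theta (-(x\<^sup>2)) (q\<^sup>2) * d0 y + - x * (d0 x * d1 y)"
    using h has_sum_unique by fastforce
  also have "theta (-(x\<^sup>2)) (q\<^sup>2) = x * d1 x"
    using theta_mult_q[OF q2, of "-(x\<^sup>2)"] xy by (simp add: d1_def power2_eq_square)
  finally show ?thesis by (simp add: algebra_simps)
qed

text \<open>By \<open>theta_addition\<close>, theta(x y) theta(x/y) is x times a 2 by 2 determinant
  H(x, y), and theta(z)^2 is -z H(1, z). The claim is the Pluecker relation between the determinants
  of the four columns belonging to 1, u, v and y.\<close>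

lemma theta_three_term:
  assumes q: "0 < norm q" "norm q < 1" and uvy: "u \<noteq> 0" "v \<noteq> 0" "y \<noteq> 0"
  shows "(theta u q)\<^sup>2 * theta (y * v) q * theta (y / v) q - (theta y q)\<^sup>2 * theta (u * v) q * theta (u / v) q
     = u / v * (theta v q)\<^sup>2 * theta (y * u) q * theta (y / u) q"
proof -
  define d0 where "d0 = (\<lambda>z. theta (-(z\<^sup>2 * q)) (q\<^sup>2))"
  define d1 where "d1 = (\<lambda>z. z * theta (-(z\<^sup>2 * q\<^sup>2)) (q\<^sup>2))"
  define H where "H = (\<lambda>x y. d1 x * d0 y - d0 x * d1 y)"
  have H: "theta (x * y) q * theta (x / y) q = x * H x y" if "x \<noteq> 0" "y \<noteq> 0" for x y
    unfolding H_def d0_def d1_def by (rule theta_addition[OF q that])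
  have sq: "(theta z q)\<^sup>2 = - z * H 1 z" if "z \<noteq> 0" for z
  proof -
    have "theta z q * (- theta z q / z) = H 1 z"
      using H[of 1 z] theta_inverse[OF q that] that by simp
    then have "- z * H 1 z = - z * (theta z q * (- theta z q / z))" by simp
    then show ?thesis using that by (simp add: power2_eq_square)
  qed
  have "(theta u q)\<^sup>2 * (theta (y * v) q * theta (y / v) q) - (theta y q)\<^sup>2 * (theta (u * v) q * theta (u / v) q)
     = u / v * (theta v q)\<^sup>2 * (theta (y * u) q * theta (y / u) q)"
    unfolding sq[OF uvy(1)] sq[OF uvy(2)] sq[OF uvy(3)] H[OF uvy(3,2)] H[OF uvy(1,2)] H[OF uvy(3,1)]
    using uvy by (simp add: H_def algebra_simps)
  then show ?thesis by (simp add: mult.assoc)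
qed

definition theta_log_deriv :: "complex \<Rightarrow> complex \<Rightarrow> complex" where
  "theta_log_deriv q z = z * deriv (\<lambda>x. theta x q) z / theta z q"

text \<open>The value of the derivative is left as a separate equation, so that it can be brought
  into the desired form after the rule is applied.\<close>

lemma theta_DERIV_chain:
  assumes q: "0 < norm q" "norm q < 1" and g: "(g has_field_derivative g') (at x)" "g x \<noteq> 0"
    and D: "deriv (\<lambda>x. theta x q) (g x) * g' = D"
  shows "((\<lambda>x. theta (g x) q) has_field_derivative D) (at x)"
  using DERIV_chain2[OF theta_has_field_derivative[OF q g(2)] g(1)] D by simp

lemma has_field_derivative_cong_open:
  assumes "(f has_field_derivative D) (at x)" "(g has_field_derivative E) (at x)"
    "open S" "x \<in> S" "\<And>y. y \<in> S \<Longrightarrow> f y = g y"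
  shows "D = E"
  using has_field_derivative_transform_within_open[OF assms(1,3,4,5)] assms(2) DERIV_unique by blast

text \<open>Differentiate the three-term relation in \<open>v\<close> at \<open>v = u\<close>.\<close>
lemma theta_log_deriv_addition:
  assumes q: "0 < norm q" "norm q < 1" and uy: "u \<noteq> 0" "y \<noteq> 0"
    and nz: "theta u q \<noteq> 0" "theta (y * u) q \<noteq> 0" "theta (y / u) q \<noteq> 0"
  shows "1 + theta_log_deriv q (y * u) - theta_log_deriv q (y / u) - 2 * theta_log_deriv q u
    = qp q q ^ 3 * (theta y q)\<^sup>2 * theta (u\<^sup>2) q / ((theta u q)\<^sup>2 * theta (y * u) q * theta (y / u) q)"
proof -
  define t where "t = (\<lambda>z. theta z q)"
  define d where "d = deriv t"
  have d1: "d 1 = - (qp q q ^ 3)" unfolding d_def t_def by (rule deriv_theta_1[OF q])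
  have t1: "t 1 = 0" by (simp add: t_def theta_1[OF q])
  have chain: "((\<lambda>v. t (g v)) has_field_derivative (d (g v) * g')) (at v)"
    if "(g has_field_derivative g') (at v)" "g v \<noteq> 0" for g g' v
    unfolding t_def d_def by (rule theta_DERIV_chain[OF q that]) (simp add: t_def)
  have 1: "((\<lambda>v. t (z * v)) has_field_derivative (d (z * u) * z)) (at u)" if "z \<noteq> 0" for z
    using that uy by (intro chain) (auto intro!: derivative_eq_intros)
  have 2: "((\<lambda>v. t (z / v)) has_field_derivative (d (z / u) * (- z / u\<^sup>2))) (at u)" if "z \<noteq> 0" for z
    using that uy by (intro chain) (auto intro!: derivative_eq_intros simp: power2_eq_square)
  have 3: "(t has_field_derivative d u) (at u)"
    using chain[of "\<lambda>v. v" 1 u] uy by simp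
  have L: "((\<lambda>v. (t u)\<^sup>2 * t (y * v) * t (y / v) - (t y)\<^sup>2 * t (u * v) * t (u / v)) has_field_derivative
      ((t u)\<^sup>2 * (d (y * u) * y * t (y / u) + t (y * u) * (d (y / u) * (- y / u\<^sup>2)))
        - (t y)\<^sup>2 * (d (u * u) * u * t (u / u) + t (u * u) * (d (u / u) * (- u / u\<^sup>2))))) (at u)"
    by (rule derivative_eq_intros 1 2 uy refl)+ (simp add: algebra_simps)
  have R: "((\<lambda>v. u / v * (t v)\<^sup>2 * t (y * u) * t (y / u)) has_field_derivative
      ((- u / u\<^sup>2 * (t u)\<^sup>2 + u / u * (2 * t u * d u)) * t (y * u) * t (y / u))) (at u)"
    by (rule derivative_eq_intros 3 uy refl)+ (use uy in \<open>simp add: algebra_simps power2_eq_square\<close>)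
  have eq: "(t u)\<^sup>2 * (d (y * u) * y * t (y / u) + t (y * u) * (d (y / u) * (- y / u\<^sup>2)))
        - (t y)\<^sup>2 * (d (u * u) * u * t (u / u) + t (u * u) * (d (u / u) * (- u / u\<^sup>2)))
      = (- u / u\<^sup>2 * (t u)\<^sup>2 + u / u * (2 * t u * d u)) * t (y * u) * t (y / u)"
    by (rule has_field_derivative_cong_open[OF L R, of "- {0}"])
      (use uy theta_three_term[OF q uy(1) _ uy(2)] in \<open>auto simp: t_def\<close>)
  define T1 T2 E1 E2 where "T1 = t (y * u)" and "T2 = t (y / u)" and "E1 = d (y * u)" and "E2 = d (y / u)"
  \<comment> \<open>theta(u/v) vanishes at v = u, so of the second product only the derivative of
    that factor survives; it involves theta'(1) = -(q;q)^3, the source of the cube.\<close>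
  have eq': "(t u)\<^sup>2 * (E1 * y * T2 + T1 * (E2 * (- y / u\<^sup>2))) - (t y)\<^sup>2 * (t (u\<^sup>2) * (qp q q ^ 3 / u))
      = (- 1 / u * (t u)\<^sup>2 + 2 * t u * d u) * T1 * T2"
    using eq uy unfolding T1_def T2_def E1_def E2_def by (simp add: t1 d1 power2_eq_square)
  have "1 + (y * u) * E1 / T1 - (y / u) * E2 / T2 - 2 * (u * d u / t u)
    = u * ((t u)\<^sup>2 * (E1 * y * T2 + T1 * (E2 * (- y / u\<^sup>2))) - (- 1 / u * (t u)\<^sup>2 + 2 * t u * d u) * T1 * T2) / ((t u)\<^sup>2 * T1 * T2)"
    using nz uy unfolding T1_def[symmetric] T2_def[symmetric] t_def[symmetric]
    by (simp add: divide_simps) (simp add: algebra_simps power2_eq_square T1_def T2_def t_def)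
  also have "(t u)\<^sup>2 * (E1 * y * T2 + T1 * (E2 * (- y / u\<^sup>2))) - (- 1 / u * (t u)\<^sup>2 + 2 * t u * d u) * T1 * T2
     = (t y)\<^sup>2 * (t (u\<^sup>2) * (qp q q ^ 3 / u))"
    using eq' by (simp add: algebra_simps)
  finally show ?thesis
    using uy unfolding theta_log_deriv_def T1_def T2_def E1_def E2_def t_def d_def
    by (simp add: mult_ac)
qed

lemma theta_log_deriv_q_div:
  assumes q: "0 < norm q" "norm q < 1" and z: "z \<noteq> 0"
  shows "theta_log_deriv q (q / z) = - theta_log_deriv q z"
proof -
  have "((\<lambda>z. theta (q / z) q) has_field_derivative (deriv (\<lambda>x. theta x q) (q / z) * (- q / z\<^sup>2))) (at z)"
    using q z by (intro theta_DERIV_chain[OF q]) (auto intro!: derivative_eq_intros simp: power2_eq_square)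
  then have "deriv (\<lambda>x. theta x q) (q / z) * (- q / z\<^sup>2) = deriv (\<lambda>x. theta x q) z"
    using theta_has_field_derivative[OF q z] by (rule has_field_derivative_cong_open[of _ _ _ _ _ "- {0}"])
      (use z in \<open>auto simp: theta_q_div[OF q]\<close>)
  then have "z * deriv (\<lambda>x. theta x q) z = z * (deriv (\<lambda>x. theta x q) (q / z) * (- q / z\<^sup>2))"
    by simp
  also have "\<dots> = - (q / z * deriv (\<lambda>x. theta x q) (q / z))"
    using z by (simp add: power2_eq_square)
  finally have "z * deriv (\<lambda>x. theta x q) z = - (q / z * deriv (\<lambda>x. theta x q) (q / z))" .
  then show ?thesis
    unfolding theta_log_deriv_def theta_q_div[OF q z] by simp
qed

lemma theta_log_deriv_mult_q:
  assumes q: "0 < norm q" "norm q < 1" and z: "z \<noteq> 0" "theta z q \<noteq> 0"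
  shows "theta_log_deriv q (z * q) = theta_log_deriv q z - 1"
proof -
  define d where "d = deriv (\<lambda>x. theta x q)"
  have "((\<lambda>z. theta (z * q) q) has_field_derivative (d (z * q) * q)) (at z)"
    unfolding d_def using q z by (intro theta_DERIV_chain[OF q]) (auto intro!: derivative_eq_intros)
  moreover have "((\<lambda>z. - theta z q / z) has_field_derivative (- ((d z * z - theta z q) / z\<^sup>2))) (at z)"
    unfolding d_def
    by (rule derivative_eq_intros theta_has_field_derivative[OF q z(1)] z refl)+
      (use z in \<open>simp add: power2_eq_square diff_divide_distrib\<close>)
  ultimately have "d (z * q) * q = - ((d z * z - theta z q) / z\<^sup>2)"
    by (rule has_field_derivative_cong_open[of _ _ _ _ _ "- {0}"]) (use z in \<open>auto simp: theta_mult_q[OF q]\<close>)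
  then have "z * q * d (z * q) = - ((d z * z - theta z q) / z)"
    using z by (simp add: power2_eq_square field_simps)
  then show ?thesis
    using z unfolding theta_log_deriv_def d_def[symmetric] theta_mult_q[OF q z(1)] by (simp add: field_simps)
qed

section \<open>The residue 4 coefficient of V(w) and its derivative at w = 1\<close>

context quintic_nome
begin

definition "l1 = theta_log_deriv Q Y"
definition "l2 = theta_log_deriv Q (Y\<^sup>2)"
text \<open>A and B are theta quotients that turn out to be linear in the logarithmic derivatives l1
  and l2, so suitable quadratic expressions in l1 and l2 become products of theta functions.\<close>

definition "A = Y * PQ ^ 3 * a\<^sup>2 / b ^ 3"
definition "B = PQ ^ 3 * b\<^sup>2 / a ^ 3"

text \<open>\<open>theta_log_deriv_addition\<close> at u = Y, y = Y^2: y u = Y^3 is the reflection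
  of Y^2 and y/u is Y itself, so only l1 and l2 occur.\<close>

lemma B_eq: "B = 1 - 3 * l1 - l2"
proof -
  have e: "Y\<^sup>2 * Y = Y ^ 3" "Y\<^sup>2 / Y = Y" "Q / Y\<^sup>2 = Y ^ 3"
    by (simp_all add: Q_def eval_nat_numeral)
  have "theta_log_deriv Q (Y ^ 3) = - l2"
    using theta_log_deriv_q_div[OF Q, of "Y\<^sup>2"] by (simp add: e l2_def)
  moreover have "1 + theta_log_deriv Q (Y ^ 3) - theta_log_deriv Q Y - 2 * theta_log_deriv Q Y
    = qp Q Q ^ 3 * (theta (Y\<^sup>2) Q)\<^sup>2 * theta (Y\<^sup>2) Q / ((theta Y Q)\<^sup>2 * theta (Y ^ 3) Q * theta Y Q)"
    using theta_log_deriv_addition[OF Q, of Y "Y\<^sup>2", unfolded e] by (simp add: theta_Y3 flip: a_def)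
  ultimately have "1 - l2 - l1 - 2 * l1 = PQ ^ 3 * b\<^sup>2 * b / (a\<^sup>2 * b * a)"
    unfolding theta_Y3 a_def[symmetric] b_def[symmetric] PQ_def[symmetric] l1_def[symmetric] by simp
  also have "\<dots> = B"
    by (simp add: B_def power2_eq_square power3_eq_cube mult_ac)
  finally have "1 - l2 - l1 - 2 * l1 = B" .
  moreover have "1 - l2 - l1 - 2 * l1 = 1 - 3 * l1 - l2" by simp
  ultimately show ?thesis by metis
qed

text \<open>\<open>theta_log_deriv_addition\<close> at u = Y^2, y = Y^4: y u = Y^6 = Y Q reduces to
  Y by quasi-periodicity, whose extra -1 cancels the constant term.\<close>

lemma A_eq: "A = 3 * l2 - l1"
proof -
  have e: "Y ^ 4 * Y\<^sup>2 = Y * Q" "Y ^ 4 / Y\<^sup>2 = Y\<^sup>2" "(Y\<^sup>2)\<^sup>2 = Y ^ 4"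
    by (simp_all add: Q_def eval_nat_numeral)
  have YQ: "theta (Y * Q) Q = - a / Y"
    using theta_mult_q[OF Q, of Y] by (simp add: a_def)
  have "theta_log_deriv Q (Y * Q) = l1 - 1"
    using theta_log_deriv_mult_q[OF Q, of Y] by (simp add: l1_def flip: a_def)
  moreover have "1 + theta_log_deriv Q (Y * Q) - theta_log_deriv Q (Y\<^sup>2) - 2 * theta_log_deriv Q (Y\<^sup>2)
    = qp Q Q ^ 3 * (theta (Y ^ 4) Q)\<^sup>2 * theta (Y ^ 4) Q / ((theta (Y\<^sup>2) Q)\<^sup>2 * theta (Y * Q) Q * theta (Y\<^sup>2) Q)"
    using theta_log_deriv_addition[OF Q, of "Y\<^sup>2" "Y ^ 4", unfolded e] by (simp add: YQ flip: b_def)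
  ultimately have "l1 - 3 * l2 = PQ ^ 3 * a\<^sup>2 * a / (b\<^sup>2 * (- a / Y) * b)"
    unfolding theta_Y4 YQ a_def[symmetric] b_def[symmetric] PQ_def[symmetric] l2_def[symmetric] by simp
  also have "\<dots> = - A"
    by (simp add: A_def power2_eq_square power3_eq_cube mult_ac)
  finally show ?thesis by (simp add: algebra_simps)
qed

text \<open>\<open>norm_x\<close> multiplied by PQ^6/(a b), which turns x^5, Y and Y^2/x^5 into B^2,
  A B and A^2.\<close>

lemma AB_norm: "B\<^sup>2 - 11 * A * B - A\<^sup>2 = PY ^ 5 / PQ"
proof -
  define C where "C = PQ ^ 6 / (a * b)"
  have 1: "B\<^sup>2 = C * x ^ 5" "A * B = C * Y" "A\<^sup>2 = C * (Y\<^sup>2 / x ^ 5)"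
    by (simp_all add: A_def B_def C_def x_def field_simps eval_nat_numeral)
  have "B\<^sup>2 - 11 * A * B - A\<^sup>2 = C * (x ^ 5 - 11 * Y - Y\<^sup>2 / x ^ 5)"
    using 1 by (simp add: algebra_simps)
  also have "\<dots> = PY ^ 5 / PQ"
    unfolding norm_x C_def ab by (simp add: eval_nat_numeral)
  finally show ?thesis .
qed

text \<open>The coefficients of the dissection divided by a or b are linear in A and B. Expressing A
  and B through l1 and l2 shows the left side to be the quadratic form B^2 - 11 A B - A^2 over PQ^3
  a b, and \<open>AB_norm\<close> evaluates it.\<close>

lemma rank_derivative_value:
  "(2 * x\<^sup>2 - Y / x ^ 3) * (1 - 5 * l2) / (a\<^sup>2 * b) - (x ^ 3 + 2 * Y / x\<^sup>2) * (1 - 5 * l1) / (a * b\<^sup>2)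
     + 10 * l2 * (5 * l1 - 3 / 2) / (a * b * PQ ^ 3) = PY ^ 4 / PQ ^ 5"
proof -
  have c: "(2 * x\<^sup>2 - Y / x ^ 3) / a = (2 * B - A) / PQ ^ 3" "(x ^ 3 + 2 * Y / x\<^sup>2) / b = (B + 2 * A) / PQ ^ 3"
    by (simp_all add: A_def B_def x_def field_simps eval_nat_numeral)
  have "C2 * (1 - 5 * l2) / (a\<^sup>2 * b) - C1 * (1 - 5 * l1) / (a * b\<^sup>2) + 10 * l2 * (5 * l1 - 3 / 2) / (a * b * PQ ^ 3)
    = (C2 / a * (1 - 5 * l2) - C1 / b * (1 - 5 * l1) + 10 * l2 * (5 * l1 - 3 / 2) / PQ ^ 3) / (a * b)" for C1 C2
    by (simp add: power2_eq_square add_divide_distrib diff_divide_distrib mult_ac)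
  then have "(2 * x\<^sup>2 - Y / x ^ 3) * (1 - 5 * l2) / (a\<^sup>2 * b) - (x ^ 3 + 2 * Y / x\<^sup>2) * (1 - 5 * l1) / (a * b\<^sup>2)
     + 10 * l2 * (5 * l1 - 3 / 2) / (a * b * PQ ^ 3)
    = ((2 * x\<^sup>2 - Y / x ^ 3) / a * (1 - 5 * l2) - (x ^ 3 + 2 * Y / x\<^sup>2) / b * (1 - 5 * l1)
      + 10 * l2 * (5 * l1 - 3 / 2) / PQ ^ 3) / (a * b)" .
  also have "\<dots> = ((2 * B - A) * (1 - 5 * l2) - (B + 2 * A) * (1 - 5 * l1) + 10 * l2 * (5 * l1 - 3 / 2)) / (PQ ^ 3 * (a * b))"
  proof -
    have "(U / P * p - V / P * r + W / P) / R = (U * p - V * r + W) / (P * R)" for U V W P R p r :: complex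
      by (simp add: add_divide_distrib diff_divide_distrib)
    then show ?thesis unfolding c .
  qed
  also have "(2 * B - A) * (1 - 5 * l2) - (B + 2 * A) * (1 - 5 * l1) + 10 * l2 * (5 * l1 - 3 / 2)
     = B\<^sup>2 - 11 * A * B - A\<^sup>2"
    unfolding A_eq B_eq by (simp add: field_simps power2_eq_square)
  also have "\<dots> / (PQ ^ 3 * (a * b)) = PY ^ 4 / PQ ^ 5"
    unfolding AB_norm ab by (simp add: eval_nat_numeral)
  finally show ?thesis .
qed

text \<open>The coefficient of q^4 in the dissection of V(w), without the factor PQ^9/PY^5. The
  first two numerators and the 5 are coefficients in \<open>inverse_qp_dissection\<close>; the
  difference in the last term tends to 0 at w = 1, where theta(w) vanishes.\<close>

definition "rank_theta w = (2 * x\<^sup>2 - Y / x ^ 3) / (theta (w * Y) Q * theta (Y / w) Q * theta (w * Y\<^sup>2) Q)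
   - (x ^ 3 + 2 * Y / x\<^sup>2) / (theta (w * Y) Q * theta (w * Y\<^sup>2) Q * theta (Y\<^sup>2 / w) Q)
   - 5 * (1 / theta (Y\<^sup>2 / w) Q - 1 / theta (w * Y\<^sup>2) Q) / (theta (Y / w) Q * theta w Q)"

text \<open>With \<open>V(w) = (appell (q\<^sup>3) - appell (q\<^sup>2)) / (q;q)\<close>, both Appell sums are shifts of
  \<open>appell (q\<^sup>9)\<close>, whose part that is not a theta quotient contributes only to residues 0 and 3.\<close>
lemma rank_dissection:
  assumes w: "w \<noteq> 0" "\<And>n. w * Y powi n \<noteq> 1"
  shows "\<exists>e0 e1 e2 e3. \<forall>q. q ^ 5 = Y \<longrightarrow>
    (appell (q ^ 3) (q ^ 3) w Y - appell (q\<^sup>2) (q ^ 3) w Y) / qp q q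
      = e0 + e1 * q + e2 * q\<^sup>2 + e3 * q ^ 3 + PQ ^ 9 / PY ^ 5 * rank_theta w * q ^ 4"
proof -
  have genw: "w * Y powi m \<noteq> 0" "w * Y powi m * Y powi n \<noteq> 1" for m n
    using w(1) w(2)[of "m + n"] by (simp_all add: power_int_add mult.assoc)
  define t where "t = (\<lambda>z. theta z Q)"
  define p0 p1 p2 p3 where "p0 = x ^ 4 - 3 * Y / x" and "p1 = x ^ 3 + 2 * Y / x\<^sup>2"
    and "p2 = 2 * x\<^sup>2 - Y / x ^ 3" and "p3 = 3 * x + Y / x ^ 4"
  define t1 where "t1 = 1 / (t (w * Y) * t (Y / w) * t (w * Y\<^sup>2))"
  define t2 where "t2 = 1 / (t (w * Y) * t (w * Y\<^sup>2) * t (Y\<^sup>2 / w))"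
  define t3 where "t3 = (1 / t (Y\<^sup>2 / w) - 1 / t (w * Y\<^sup>2)) / (t (Y / w) * t w)"
  define G where "G = (\<lambda>w. appell (Q ^ 3) (Q ^ 3) w Q)"
  define K where "K = PQ ^ 9 / PY ^ 5"
  have tw: "t w \<noteq> 0" "t (w * Y) \<noteq> 0" "t (w * Y\<^sup>2) \<noteq> 0" "t (Y / w) \<noteq> 0" "t (Y\<^sup>2 / w) \<noteq> 0"
  proof -
    show "t w \<noteq> 0" "t (w * Y) \<noteq> 0" "t (w * Y\<^sup>2) \<noteq> 0"
      unfolding t_def using theta_nonzero[OF w] theta_nonzero[OF genw, of 1] theta_nonzero[OF genw, of 2] by simp_all
    have "t (w / Y) \<noteq> 0" "t (w / Y\<^sup>2) \<noteq> 0"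
      unfolding t_def using theta_nonzero[OF genw, of "-1"] theta_nonzero[OF genw, of "-2"] by (simp_all add: power_int_minus divide_inverse)
    then show "t (Y / w) \<noteq> 0" "t (Y\<^sup>2 / w) \<noteq> 0"
      unfolding t_def using theta_inverse[OF Q, of "w / Y"] theta_inverse[OF Q, of "w / Y\<^sup>2"] w(1) by auto
  qed
  have inv1: "t (w / Y) = - w / Y * t (Y / w)" and inv2: "t (w / Y\<^sup>2) = - w / Y\<^sup>2 * t (Y\<^sup>2 / w)"
    unfolding t_def using theta_inverse[OF Q, of "Y / w"] theta_inverse[OF Q, of "Y\<^sup>2 / w"] w(1) by simp_all
  have inv3: "t (w / Y ^ 3) = - w / Y ^ 3 * t (w * Y\<^sup>2)"
  proof -
    have "t (w / Y ^ 3) = - w / Y ^ 3 * t (Y ^ 3 / w)"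
      unfolding t_def using theta_inverse[OF Q, of "Y ^ 3 / w"] w(1) by simp
    also have "Y ^ 3 / w = Q / (w * Y\<^sup>2)"
      using w(1) by (simp add: Q_def field_simps eval_nat_numeral)
    also have "t \<dots> = t (w * Y\<^sup>2)"
      unfolding t_def using w(1) by (intro theta_q_div[OF Q]) auto
    finally show ?thesis .
  qed
  have inv4: "t (w * Y ^ 3) = t (Y\<^sup>2 / w)" "t (w * Y ^ 4) = t (Y / w)"
  proof -
    have "w * Y ^ 3 = Q / (Y\<^sup>2 / w)" "w * Y ^ 4 = Q / (Y / w)"
      using w(1) by (simp_all add: Q_def field_simps eval_nat_numeral)
    then show "t (w * Y ^ 3) = t (Y\<^sup>2 / w)" "t (w * Y ^ 4) = t (Y / w)"
      unfolding t_def using theta_q_div[OF Q, of "Y\<^sup>2 / w"] theta_q_div[OF Q, of "Y / w"] w(1) by simp_all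
  qed
  have main: "(appell (q ^ 3) (q ^ 3) w Y - appell (q\<^sup>2) (q ^ 3) w Y) / qp q q =
     (- 1 - w / Y - w\<^sup>2 / Y\<^sup>2 * G (w / Y) / PQ + 5 * K * Y * (q * t1 - q\<^sup>2 * t2))
     + K * (q\<^sup>2 * t1 * (p0 + q * p1) + Y * t1 * p3 - q ^ 3 * t2 * p0 - Y * t2 * (p2 + q * p3)
           - t3 * (p0 + q * p1 + q\<^sup>2 * p2 + q ^ 3 * p3))
     - q ^ 3 * (Y / PQ * G (w * Y\<^sup>2)) + K * (p2 * t1 - p1 * t2 - 5 * t3) * q ^ 4"
    if q: "q ^ 5 = Y" for q
  proof -
    note q0 = nome_power_less_1(1)[OF q] and q3 = nome_power_less_1(3,4)[OF q]
    define P where "P = qp q q"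
    have P0: "P \<noteq> 0" unfolding P_def using nome_power_less_1(2)[OF q] by (intro qp_nonzero) auto
    define F where "F = (\<lambda>w. appell (q ^ 9) (q ^ 3) w Y)"
    have tri: "tri (-2) = 3" by (simp add: tri_def)
    have Yq: "Y ^ n = q ^ (5 * n)" for n by (simp add: q[symmetric] power_mult)
    have th2: "theta (q\<^sup>2) (q ^ 3) = P"
    proof -
      have "q\<^sup>2 = q ^ 3 / q" by (simp add: power3_eq_cube power2_eq_square)
      then show ?thesis
        using theta_q_div[OF q3 q0] euler_pentagonal[of q] q0 nome_power_less_1(2)[OF q] by (simp add: P_def)
    qed
    have th7: "theta (q ^ 7) (q ^ 3) = P / Y"
    proof -
      have "theta (q ^ 4) (q ^ 3) = - theta q (q ^ 3) / q"
        using theta_mult_q[OF q3 q0] by (simp add: power_numeral_reduce mult_ac)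
      moreover have "theta (q ^ 7) (q ^ 3) = - theta (q ^ 4) (q ^ 3) / q ^ 4"
        using theta_mult_q[OF q3, of "q ^ 4"] q0 by (simp flip: power_add)
      ultimately show ?thesis
        using euler_pentagonal[of q] q0 nome_power_less_1(2)[OF q]
        by (simp add: P_def q[symmetric] flip: power_Suc)
    qed
    \<comment> \<open>Two steps lead from q^2 over q^7 to q^12, which is q^9 after an index shift by
      1; q^3 is q^9 after a shift by -2. The theta values on the way are multiples of (q;q) and
      contribute only to residue 0 after the division.\<close>
    have step: "w * appell (q ^ n * Y) (q ^ 3) w Y = appell (q ^ n) (q ^ 3) w Y - theta (q ^ n) (q ^ 3)" for n
      using w q0 Y_less_1 by (intro appell_step q3) auto
    have "q\<^sup>2 * Y = q ^ 7" "q ^ 7 * Y = q ^ 12" by (simp_all add: q[symmetric] flip: power_add)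
    then have S2: "appell (q\<^sup>2) (q ^ 3) w Y = P + w * appell (q ^ 7) (q ^ 3) w Y"
      and S7: "appell (q ^ 7) (q ^ 3) w Y = P / Y + w * appell (q ^ 12) (q ^ 3) w Y"
      using step[of 2] step[of 7] unfolding th2 th7 by simp_all
    have T2: "appell (q\<^sup>2) (q ^ 3) w Y = P + w * (P / Y) + w\<^sup>2 * appell (q ^ 12) (q ^ 3) w Y"
      unfolding S2 S7 by (simp add: power2_eq_square algebra_simps)
    have F1: "F (w / Y) = - (q ^ 9) * appell (q ^ 12) (q ^ 3) w Y"
    proof -
      have "F (w / Y) = (- (q ^ 9)) powi 1 * (q ^ 3) powi tri 1 * appell (q ^ 9 * (q ^ 3) powi 1) (q ^ 3) (w / Y * Y powi 1) Y"
        unfolding F_def using q0 by (intro appell_shift) auto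
      then show ?thesis by (simp flip: power_add)
    qed
    have F2: "F (w * Y\<^sup>2) = appell (q ^ 3) (q ^ 3) w Y / q ^ 9"
    proof -
      have "F (w * Y\<^sup>2) = (- (q ^ 9)) powi -2 * (q ^ 3) powi tri (-2) * appell (q ^ 9 * (q ^ 3) powi -2) (q ^ 3) (w * Y\<^sup>2 * Y powi -2) Y"
        unfolding F_def using q0 by (intro appell_shift) auto
      also have "(- (q ^ 9)) powi -2 * (q ^ 3) powi tri (-2) = 1 / q ^ 9"
        unfolding tri using q0 by (simp add: power_int_minus field_simps flip: power_mult power_add)
      also have "q ^ 9 * (q ^ 3) powi -2 = q ^ 3"
        using q0 by (simp add: power_int_minus field_simps flip: power_mult power_add)
      also have "w * Y\<^sup>2 * Y powi -2 = w" by (simp add: power_int_minus)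
      finally show ?thesis by simp
    qed
    \<comment> \<open>By \<open>qp_dissection\<close> the coefficient of the remaining Appell sum is
      a multiple of (q;q). After division by (q;q) the dependence on q is a pure power: q^(-10) =
      Y^(-2) in residue 0 and q^8 = Y q^3 in residue 3.\<close>
    have \<kappa>: "1 - x / q + q / x = - P / (q * PQ)"
      unfolding P_def qp_dissection[OF q] using q0 by (simp add: field_simps power2_eq_square)
    have D: "F v = - P / (q * PQ) * G v + PQ ^ 4 * PY * (1 / (q ^ 9 * (t (v / Y\<^sup>2) * t v * t (v * Y\<^sup>2)))
                      - 1 / (q ^ 6 * (t (v / Y) * t v * t (v * Y))))"
      if "v \<noteq> 0" "\<And>n. v * Y powi n \<noteq> 1" for v
      unfolding F_def G_def t_def \<kappa>[symmetric] by (rule appell_decomposition[OF q that])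
    have A1: "appell (q ^ 12) (q ^ 3) w Y = P / (q ^ 10 * PQ) * G (w / Y)
        - PQ ^ 4 * PY / w\<^sup>2 * (q\<^sup>2 * t1 - 1 / (t (Y\<^sup>2 / w) * t (Y / w) * t w))"
    proof -
      have e: "w / Y / Y\<^sup>2 = w / Y ^ 3" "w / Y * Y\<^sup>2 = w * Y" "w / Y / Y = w / Y\<^sup>2" "w / Y * Y = w"
        by (simp_all add: power2_eq_square power3_eq_cube)
      have gen: "w / Y \<noteq> 0" "\<And>n. w / Y * Y powi n \<noteq> 1"
        using genw[of "-1"] by (simp_all add: power_int_minus divide_inverse)
      define u1 u2 where "u1 = t (w / Y ^ 3) * t (w / Y) * t (w * Y)" and "u2 = t (w / Y\<^sup>2) * t (w / Y) * t w"
      have "1 / (q ^ 9 * u1) = q ^ 11 / w\<^sup>2 * t1"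
      proof -
        have "u1 = w\<^sup>2 / Y ^ 4 * (1 / t1)"
          unfolding u1_def t1_def inv3 inv1 by (simp add: power2_eq_square eval_nat_numeral mult_ac)
        then have "u1 = w\<^sup>2 / q ^ 20 * (1 / t1)"
          unfolding Yq by simp
        then show ?thesis using q0 w(1) by (simp add: field_simps flip: power_add)
      qed
      moreover have "1 / (q ^ 6 * u2) = q ^ 9 / w\<^sup>2 * (1 / (t (Y\<^sup>2 / w) * t (Y / w) * t w))"
      proof -
        have "u2 = w\<^sup>2 / Y ^ 3 * (t (Y\<^sup>2 / w) * t (Y / w) * t w)"
          unfolding u2_def inv2 inv1 by (simp add: power2_eq_square eval_nat_numeral mult_ac)
        then have "u2 = w\<^sup>2 / q ^ 15 * (t (Y\<^sup>2 / w) * t (Y / w) * t w)"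
          unfolding Yq by simp
        moreover have "1 / (c * (W / (c * d) * h)) = d / W * (1 / h)" if "c \<noteq> 0" for c d W h :: complex
          using that by simp
        moreover have "q ^ 6 * q ^ 9 = q ^ 15" by (simp flip: power_add)
        ultimately show ?thesis using q0 by (metis power_not_zero)
      qed
      moreover have "F (w / Y) = - P / (q * PQ) * G (w / Y) + PQ ^ 4 * PY * (1 / (q ^ 9 * u1) - 1 / (q ^ 6 * u2))"
        using D[OF gen] unfolding e u1_def u2_def .
      ultimately have "- (q ^ 9) * appell (q ^ 12) (q ^ 3) w Y = - P / (q * PQ) * G (w / Y) + PQ ^ 4 * PY *
         (q ^ 11 / w\<^sup>2 * t1 - q ^ 9 / w\<^sup>2 * (1 / (t (Y\<^sup>2 / w) * t (Y / w) * t w)))"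
        unfolding F1 by simp
      then have "appell (q ^ 12) (q ^ 3) w Y = - (- P / (q * PQ) * G (w / Y) + PQ ^ 4 * PY *
         (q ^ 11 / w\<^sup>2 * t1 - q ^ 9 / w\<^sup>2 * (1 / (t (Y\<^sup>2 / w) * t (Y / w) * t w)))) / q ^ 9"
        using q0 by (simp add: field_simps)
      also have "\<dots> = P / (q ^ 10 * PQ) * G (w / Y) - PQ ^ 4 * PY / w\<^sup>2 *
         (q ^ 11 / q ^ 9 * t1 - 1 / (t (Y\<^sup>2 / w) * t (Y / w) * t w))"
      proof -
        have expand: "- (- P / (q * PQ) * g + R * (c / W * h - d / W * k)) / d = P / (d * q * PQ) * g - R / W * (c / d * h - k)"
          if "d \<noteq> 0" for g R c W h d k :: complex
          using that by (simp add: add_divide_distrib diff_divide_distrib right_diff_distrib)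
        have "q ^ 10 = q ^ 9 * q" by (simp flip: power_Suc2)
        show ?thesis unfolding \<open>q ^ 10 = q ^ 9 * q\<close> by (rule expand) (simp add: q0)
      qed
      also have "q ^ 11 / q ^ 9 = q\<^sup>2" using q0 by (simp add: field_simps flip: power_add)
      finally show ?thesis .
    qed
    have A2: "appell (q ^ 3) (q ^ 3) w Y = - P * q ^ 8 / PQ * G (w * Y\<^sup>2)
        + PQ ^ 4 * PY * (1 / (t w * t (w * Y\<^sup>2) * t (Y / w)) - q ^ 3 * t2)"
    proof -
      have e: "w * Y\<^sup>2 / Y\<^sup>2 = w" "w * Y\<^sup>2 * Y\<^sup>2 = w * Y ^ 4" "w * Y\<^sup>2 / Y = w * Y" "w * Y\<^sup>2 * Y = w * Y ^ 3"
        by (simp_all add: eval_nat_numeral)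
      have gen: "w * Y\<^sup>2 \<noteq> 0" "\<And>n. w * Y\<^sup>2 * Y powi n \<noteq> 1"
        using genw[of 2] by simp_all
      have "F (w * Y\<^sup>2) = - P / (q * PQ) * G (w * Y\<^sup>2) + PQ ^ 4 * PY * (1 / (q ^ 9 * (t w * t (w * Y\<^sup>2) * t (Y / w)))
          - 1 / (q ^ 6 * (t (w * Y) * t (w * Y\<^sup>2) * t (Y\<^sup>2 / w))))"
        using D[OF gen] unfolding e inv4 .
      note Fv = this
      have "appell (q ^ 3) (q ^ 3) w Y = q ^ 9 * F (w * Y\<^sup>2)"
        unfolding F2 using q0 by simp
      also have "\<dots> = q ^ 9 * (- P / (q * PQ) * G (w * Y\<^sup>2) + PQ ^ 4 * PY *
          (1 / (q ^ 9 * (t w * t (w * Y\<^sup>2) * t (Y / w))) - 1 / (q ^ 6 * (t (w * Y) * t (w * Y\<^sup>2) * t (Y\<^sup>2 / w)))))"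
        by (simp only: Fv)
      also have "\<dots> = - P * (q ^ 9 / q) / PQ * G (w * Y\<^sup>2) + PQ ^ 4 * PY *
          (1 / (t w * t (w * Y\<^sup>2) * t (Y / w)) - q ^ 9 / q ^ 6 * t2)"
      proof -
        have expand: "d * (- P / (q * PQ) * g + R * (1 / (d * h) - 1 / (c * k))) = - P * (d / q) / PQ * g + R * (1 / h - d / c * (1 / k))"
          if "d \<noteq> 0" for g R c h d k :: complex
          using that by (simp add: distrib_left right_diff_distrib mult_ac)
        show ?thesis unfolding t2_def by (rule expand) (simp add: q0)
      qed
      also have "q ^ 9 / q = q ^ 8"
        using q0 by (simp add: field_simps flip: power_Suc)
      also have "q ^ 9 / q ^ 6 = q ^ 3"
        using q0 by (simp add: field_simps flip: power_add)
      finally show ?thesis by simp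
    qed
    have t3': "1 / (t w * t (w * Y\<^sup>2) * t (Y / w)) - 1 / (t (Y\<^sup>2 / w) * t (Y / w) * t w) = - t3"
      unfolding t3_def using tw by (simp add: field_simps)
    define X where "X = PQ ^ 4 * PY * (q\<^sup>2 * t1 - q ^ 3 * t2 - t3)"
    have num: "appell (q ^ 3) (q ^ 3) w Y - appell (q\<^sup>2) (q ^ 3) w Y
      = P * (- 1 - w / Y - w\<^sup>2 / q ^ 10 * G (w / Y) / PQ - q ^ 8 / PQ * G (w * Y\<^sup>2)) + X"
    proof -
      have "X = PQ ^ 4 * PY * (q\<^sup>2 * t1 - q ^ 3 * t2 + (1 / (t w * t (w * Y\<^sup>2) * t (Y / w)) - 1 / (t (Y\<^sup>2 / w) * t (Y / w) * t w)))"
        unfolding t3' X_def by simp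
      moreover have "w\<^sup>2 * (P / (q ^ 10 * PQ) * g - R / w\<^sup>2 * h) = P * (w\<^sup>2 / q ^ 10 * g / PQ) - R * h" for g R h
        using w(1) by (simp add: right_diff_distrib mult_ac)
      moreover have "- P * q ^ 8 / PQ * g2 + R * (k - q ^ 3 * t2) - (P + w * (P / Y) + (P * (w\<^sup>2 / q ^ 10 * g1 / PQ) - R * (q\<^sup>2 * t1 - l)))
          = P * (- 1 - w / Y - w\<^sup>2 / q ^ 10 * g1 / PQ - q ^ 8 / PQ * g2) + R * (q\<^sup>2 * t1 - q ^ 3 * t2 + (k - l))" for g1 g2 R k l
        by (simp add: algebra_simps)
      ultimately show ?thesis
        unfolding T2 A1 A2 by (simp only:)
    qed
    have Pinv: "X / P = K * ((q\<^sup>2 * t1 - q ^ 3 * t2 - t3) * (p0 + q * p1 + q\<^sup>2 * p2 + q ^ 3 * p3 + 5 * q ^ 4))"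
    proof -
      have "X / P = X * (1 / P)" by simp
      also have "1 / P = PQ ^ 5 / PY ^ 6 * (p0 + q * p1 + q\<^sup>2 * p2 + q ^ 3 * p3 + 5 * q ^ 4)"
        unfolding P_def inverse_qp_dissection[OF q] p0_def p1_def p2_def p3_def ..
      finally show ?thesis
        unfolding X_def K_def by (simp add: eval_nat_numeral mult_ac)
    qed
    have "(appell (q ^ 3) (q ^ 3) w Y - appell (q\<^sup>2) (q ^ 3) w Y) / P
      = - 1 - w / Y - w\<^sup>2 / q ^ 10 * G (w / Y) / PQ - q ^ 8 / PQ * G (w * Y\<^sup>2) + X / P"
      unfolding num using P0 by (simp add: add_divide_distrib)
    also have "q ^ 10 = Y\<^sup>2"
      by (simp add: q[symmetric] flip: power_mult)
    also have "q ^ 8 = q ^ 3 * Y"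
      by (simp add: q[symmetric] flip: power_add)
    finally have "(appell (q ^ 3) (q ^ 3) w Y - appell (q\<^sup>2) (q ^ 3) w Y) / P
      = - 1 - w / Y - w\<^sup>2 / Y\<^sup>2 * G (w / Y) / PQ - q ^ 3 * (Y / PQ * G (w * Y\<^sup>2)) + X / P"
      by simp
    \<comment> \<open>The residue 4 terms are q^2 t1 times q^2 p2, -q^3 t2 times q p1, and -t3 times
      5 q^4; in products reaching q^5 that power is replaced by Y.\<close>
    moreover have "(q\<^sup>2 * u1 - q ^ 3 * u2 - u3) * (r0 + q * r1 + q\<^sup>2 * r2 + q ^ 3 * r3 + 5 * q ^ 4)
      = 5 * q ^ 5 * (q * u1 - q\<^sup>2 * u2) + (q\<^sup>2 * u1 * (r0 + q * r1) + q ^ 5 * u1 * r3 - q ^ 3 * u2 * r0 - q ^ 5 * u2 * (r2 + q * r3)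
           - u3 * (r0 + q * r1 + q\<^sup>2 * r2 + q ^ 3 * r3)) + (r2 * u1 - r1 * u2 - 5 * u3) * q ^ 4" for u1 u2 u3 r0 r1 r2 r3
      by algebra
    ultimately show ?thesis
      unfolding Pinv P_def[symmetric] q by (simp only:) (simp only: distrib_left diff_conv_add_uminus add_ac mult_ac)
  qed
  show ?thesis
  proof (intro exI allI impI)
    fix q assume q: "q ^ 5 = Y"
    have W: "rank_theta w = p2 * t1 - p1 * t2 - 5 * t3"
      by (simp add: rank_theta_def p2_def p1_def t1_def t2_def t3_def t_def)
    show "(appell (q ^ 3) (q ^ 3) w Y - appell (q\<^sup>2) (q ^ 3) w Y) / qp q q
      = (- 1 - w / Y - w\<^sup>2 / Y\<^sup>2 * G (w / Y) / PQ + K * (Y * t1 * p3 - Y * t2 * p2 - t3 * p0))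
       + (K * (5 * Y * t1 - Y * t2 * p3 - t3 * p1)) * q
       + (K * (t1 * p0 - 5 * Y * t2 - t3 * p2)) * q\<^sup>2
       + (K * (t1 * p1 - t2 * p0 - t3 * p3) - Y / PQ * G (w * Y\<^sup>2)) * q ^ 3
       + PQ ^ 9 / PY ^ 5 * rank_theta w * q ^ 4"
      unfolding main[OF q] W K_def[symmetric] by (simp add: algebra_simps power2_eq_square power3_eq_cube)
  qed
qed

text \<open>The first two terms of \<^const>\<open>rank_theta\<close> are differentiated logarithmically. The third is
  \<open>s(w) / \<theta>(Y/w)\<close> with \<open>s(1/w) = w s(w)\<close>, whence \<open>s'(1) = - s(1) / 2\<close>.\<close>
lemma rank_theta_derivative:
  assumes f: "(f has_field_derivative f') (at 1)" and \<delta>: "\<delta> > 0"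
    and gen: "\<And>w n. w \<in> ball 1 \<delta> - {1} \<Longrightarrow> w \<noteq> 0 \<and> w * Y powi n \<noteq> 1"
    and fW: "\<And>w. w \<in> ball 1 \<delta> - {1} \<Longrightarrow> f w = rank_theta w"
  shows "f 1 + 5 * f' = PY ^ 4 / PQ ^ 5"
proof -
  define t where "t = (\<lambda>z. theta z Q)"
  define d where "d = deriv t"
  define p1 p2 where "p1 = x ^ 3 + 2 * Y / x\<^sup>2" and "p2 = 2 * x\<^sup>2 - Y / x ^ 3"
  have t1: "t 1 = 0" by (simp add: t_def theta_1[OF Q])
  have d1: "d 1 = - (PQ ^ 3)" unfolding d_def t_def PQ_def by (rule deriv_theta_1[OF Q])
  have tY: "t Y = a" "t (Y\<^sup>2) = b" by (simp_all add: t_def a_def b_def)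
  have dY: "d Y = l1 * a / Y" "d (Y\<^sup>2) = l2 * b / Y\<^sup>2"
    by (simp_all add: l1_def l2_def theta_log_deriv_def d_def t_def flip: a_def b_def)
  have chain: "((\<lambda>v. t (g v)) has_field_derivative (d (g v) * g')) (at v)"
    if "(g has_field_derivative g') (at v)" "g v \<noteq> 0" for g g' v
    unfolding t_def d_def by (rule theta_DERIV_chain[OF Q that]) (simp add: t_def)
  have D1: "((\<lambda>w. t (w * Y)) has_field_derivative l1 * a) (at 1)"
  proof -
    have "((\<lambda>w. w * Y) has_field_derivative Y) (at 1)"
      by (auto intro!: derivative_eq_intros)
    from chain[OF this] show ?thesis by (simp add: dY)
  qed
  have D2: "((\<lambda>w. t (Y / w)) has_field_derivative - (l1 * a)) (at 1)"
  proof -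
    have "((\<lambda>w. Y / w) has_field_derivative - Y) (at 1)"
      by (auto intro!: derivative_eq_intros)
    from chain[OF this] show ?thesis by (simp add: dY)
  qed
  have D3: "((\<lambda>w. t (w * Y\<^sup>2)) has_field_derivative l2 * b) (at 1)"
  proof -
    have "((\<lambda>w. w * Y\<^sup>2) has_field_derivative Y\<^sup>2) (at 1)"
      by (auto intro!: derivative_eq_intros)
    from chain[OF this] show ?thesis by (simp add: dY)
  qed
  have D4: "((\<lambda>w. t (Y\<^sup>2 / w)) has_field_derivative - (l2 * b)) (at 1)"
  proof -
    have "((\<lambda>w. Y\<^sup>2 / w) has_field_derivative - Y\<^sup>2) (at 1)"
      by (auto intro!: derivative_eq_intros)
    from chain[OF this] show ?thesis by (simp add: dY)
  qed
  have Dt: "(t has_field_derivative - (PQ ^ 3)) (at 1)"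
    using chain[of "\<lambda>w. w" 1 1] by (simp add: d1)
  define h1 where "h1 = (\<lambda>w. 1 / (t (w * Y) * t (Y / w) * t (w * Y\<^sup>2)))"
  define h2 where "h2 = (\<lambda>w. 1 / (t (w * Y) * t (w * Y\<^sup>2) * t (Y\<^sup>2 / w)))"
  have H1: "(h1 has_field_derivative - l2 / (a\<^sup>2 * b)) (at 1)"
    unfolding h1_def by (rule derivative_eq_intros D1 D2 D3 refl)+
      (simp_all add: tY, simp_all add: field_simps power2_eq_square)
  have H2: "(h2 has_field_derivative - l1 / (a * b\<^sup>2)) (at 1)"
    unfolding h2_def by (rule derivative_eq_intros D1 D3 D4 refl)+
      (simp_all add: tY, simp_all add: field_simps power2_eq_square)
  \<comment> \<open>Away from w = 1 this is (1/theta(Y^2/w) - 1/theta(w Y^2)) / theta(w). Solving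
    the definition of \<open>rank_theta\<close> for it, with f in place of
    \<open>rank_theta\<close>, gives a function that is differentiable at 1.\<close>
  define s where "s = (\<lambda>w. (p2 * h1 w - p1 * h2 w - f w) * t (Y / w) * (1 / 5))"
  define s' where "s' = ((p2 * (- l2 / (a\<^sup>2 * b)) - p1 * (- l1 / (a * b\<^sup>2)) - f') * a + (p2 * h1 1 - p1 * h2 1 - f 1) * - (l1 * a)) * (1 / 5)"
  have Ds: "(s has_field_derivative s') (at 1)"
    unfolding s_def s'_def by (rule derivative_eq_intros D2 H1 H2 f refl)+ (simp_all add: tY algebra_simps)
  \<comment> \<open>A neighbourhood of 1 on which both w and 1/w lie in the ball, as the reflection
    w -> 1/w is to be differentiated.\<close>
  define S where "S = ball (1 :: complex) \<delta> \<inter> (- {0} \<inter> (\<lambda>w. 1 / w) -` ball 1 \<delta>)"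
  have "open (- {0 :: complex} \<inter> (\<lambda>w. 1 / w) -` ball 1 \<delta>)"
    by (rule continuous_open_preimage) (auto intro!: continuous_intros)
  then have openS: "open S"
    unfolding S_def by (rule open_Int[OF open_ball])
  have S1: "1 \<in> S" using \<delta> by (simp add: S_def)
  have st: "s w * t w = 1 / t (Y\<^sup>2 / w) - 1 / t (w * Y\<^sup>2)" if "w \<in> ball 1 \<delta>" for w
  proof (cases "w = 1")
    case False
    then have w: "w \<in> ball 1 \<delta> - {1}" using that by simp
    have gen1: "w * Y powi m \<noteq> 0" "w * Y powi m * Y powi n \<noteq> 1" for m n
      using gen[OF w, of "m + n"] by (simp_all add: power_int_add mult.assoc)
    have "t w \<noteq> 0" "t (w / Y) \<noteq> 0"
      unfolding t_def using theta_nonzero[OF gen1, of 0] theta_nonzero[OF gen1, of "-1"] by (simp_all add: power_int_minus divide_inverse)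
    moreover from this have "t (Y / w) \<noteq> 0"
      using theta_inverse[OF Q, of "w / Y"] gen[OF w] unfolding t_def by auto
    moreover have "rank_theta w = p2 * h1 w - p1 * h2 w
        - 5 * (1 / t (Y\<^sup>2 / w) - 1 / t (w * Y\<^sup>2)) / (t (Y / w) * t w)"
      by (simp add: rank_theta_def t_def h1_def h2_def p1_def p2_def)
    ultimately show ?thesis
      unfolding s_def fW[OF w] by simp
  qed (simp add: t1)
  have nz: "t w \<noteq> 0" if "w \<in> S" "w \<noteq> 1" for w
    unfolding t_def using gen[of w] that by (intro theta_nonzero) (auto simp: S_def)
  have s_reflect: "s (1 / w) = w * s w" if w: "w \<in> S" for w
  proof (cases "w = 1")
    case False
    have w0: "w \<noteq> 0" "1 / w \<in> ball 1 \<delta>" "w \<in> ball 1 \<delta>" using w by (auto simp: S_def)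
    have "s (1 / w) * t (1 / w) = - (s w * t w)"
      unfolding st[OF w0(2)] st[OF w0(3)] by (simp add: mult.commute)
    moreover have "t (1 / w) = - t w / w"
      unfolding t_def by (rule theta_inverse[OF Q w0(1)])
    ultimately have "s (1 / w) * t w = w * s w * t w"
      using w0(1) by (simp add: field_simps)
    then show ?thesis using nz[OF w False] by simp
  qed simp
  have "((\<lambda>w. s (1 / w)) has_field_derivative s' * (- 1)) (at 1)"
    using Ds by (intro DERIV_chain2[where f = s]) (auto intro!: derivative_eq_intros)
  moreover have "((\<lambda>w. w * s w) has_field_derivative s 1 + s') (at 1)"
    by (rule derivative_eq_intros Ds refl)+ simp
  ultimately have "s' * (- 1) = s 1 + s'"
    using openS S1 by (rule has_field_derivative_cong_open) (rule s_reflect)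
  then have "s 1 + 2 * s' = 0" by algebra
  moreover have "s' = (s 1 + 2 * s') / 2 - s 1 / 2" by (simp add: add_divide_distrib)
  ultimately have s': "s' = - s 1 / 2" by simp
  \<comment> \<open>Since theta vanishes at 1 with derivative -(Q;Q)^3, the derivative of the
    product at 1 determines s(1).\<close>
  have "((\<lambda>w. s w * t w) has_field_derivative s 1 * - (PQ ^ 3)) (at 1)"
    by (rule derivative_eq_intros Ds Dt refl)+ (simp add: t1)
  moreover have "((\<lambda>w. 1 / t (Y\<^sup>2 / w) - 1 / t (w * Y\<^sup>2)) has_field_derivative 2 * l2 / b) (at 1)"
  proof -
    have "((\<lambda>w. 1 / t (Y\<^sup>2 / w)) has_field_derivative l2 / b) (at 1)"
      by (rule derivative_eq_intros D4 refl)+ (simp_all add: tY)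
    moreover have "((\<lambda>w. 1 / t (w * Y\<^sup>2)) has_field_derivative - (l2 / b)) (at 1)"
      by (rule derivative_eq_intros D3 refl)+ (simp_all add: tY)
    ultimately have "((\<lambda>w. 1 / t (Y\<^sup>2 / w) - 1 / t (w * Y\<^sup>2)) has_field_derivative l2 / b - - (l2 / b)) (at 1)"
      by (rule DERIV_diff)
    then show ?thesis by simp
  qed
  ultimately have "s 1 * - (PQ ^ 3) = 2 * l2 / b"
    using openS S1 by (rule has_field_derivative_cong_open) (simp add: st S_def)
  then have "- (s 1 * - (PQ ^ 3)) / PQ ^ 3 = - (2 * l2 / b) / PQ ^ 3"
    by simp
  then have s1: "s 1 = - 2 * l2 / (b * PQ ^ 3)"
    by simp
  have h: "h1 1 = 1 / (a\<^sup>2 * b)" "h2 1 = 1 / (a * b\<^sup>2)"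
    unfolding h1_def h2_def by (simp_all add: tY) (simp_all add: power2_eq_square mult_ac)
  have f1: "f 1 = p2 * h1 1 - p1 * h2 1 - 5 * s 1 / a"
    by (simp add: s_def tY)
  have "p2 * h1 1 - p1 * h2 1 - f 1 = 5 * s 1 / a" using f1 by simp
  then have s'_eq: "s' = ((p2 * (- l2 / (a\<^sup>2 * b)) - p1 * (- l1 / (a * b\<^sup>2)) - f') * a + (5 * s 1 / a) * - (l1 * a)) / 5"
    unfolding s'_def by (simp only:) simp
  then have f': "f' = p2 * (- l2 / (a\<^sup>2 * b)) - p1 * (- l1 / (a * b\<^sup>2)) - 5 * s' / a - 5 * l1 * s 1 / a"
  proof -
    have "f' = R - 5 * s' / a - 5 * l1 * s 1 / a"
      if "s' = ((R - f') * a + (5 * s 1 / a) * - (l1 * a)) / 5" for R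
    proof -
      have "5 * s' = (R - f') * a - 5 * s 1 * l1" unfolding that by simp
      then have "5 * s' / a = R - f' - 5 * s 1 * l1 / a" by (simp add: diff_divide_distrib)
      then show ?thesis by (simp add: mult_ac)
    qed
    then show ?thesis using s'_eq by blast
  qed
  \<comment> \<open>The factor -5 (5 l1 - 3/2) of s(1)/a is -5 + 25/2 - 25 l1: the -5 stems from
    f(1), the 25/2 from s' = -s(1)/2, and the rest from the derivative of theta(Y/w).\<close>
  have "f 1 + 5 * f' = p2 * (1 - 5 * l2) / (a\<^sup>2 * b) - p1 * (1 - 5 * l1) / (a * b\<^sup>2) - 5 * s 1 / a * (5 * l1 - 3 / 2)"
    unfolding f1 f' h s' by (simp add: algebra_simps add_divide_distrib diff_divide_distrib)
  also have "5 * s 1 / a * (5 * l1 - 3 / 2) = - (10 * l2 * (5 * l1 - 3 / 2) / (a * b * PQ ^ 3))"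
    unfolding s1 by simp
  also have "p2 * (1 - 5 * l2) / (a\<^sup>2 * b) - p1 * (1 - 5 * l1) / (a * b\<^sup>2) - - (10 * l2 * (5 * l1 - 3 / 2) / (a * b * PQ ^ 3)) =
     p2 * (1 - 5 * l2) / (a\<^sup>2 * b) - p1 * (1 - 5 * l1) / (a * b\<^sup>2) + 10 * l2 * (5 * l1 - 3 / 2) / (a * b * PQ ^ 3)"
    by (rule diff_minus_eq_add)
  also have "\<dots> = PY ^ 4 / PQ ^ 5"
    unfolding p1_def p2_def by (rule rank_derivative_value)
  finally show ?thesis .
qed

end

section \<open>The rank series\<close>

text \<open>With N = n + 1 the exponent is the pentagonal number N(3N-1)/2.\<close>

definition rank_coeff :: "complex \<Rightarrow> nat \<Rightarrow> complex" where
  "rank_coeff q n = (-1) ^ n * q powi (3 * tri (int (Suc n)) + int (Suc n)) * (1 - q ^ Suc n)"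

text \<open>The terms N = n + 1 and -N of the difference of the two Appell sums, combined into an
  expression that is regular at w = 1.\<close>

definition rank_term :: "complex \<Rightarrow> nat \<Rightarrow> complex \<Rightarrow> complex" where
  "rank_term q n w = rank_coeff q n * (q ^ Suc n / (1 - w * q ^ (5 * Suc n)) + q ^ (4 * Suc n) / (w - q ^ (5 * Suc n)))"

lemma sums_int_pairs:
  fixes f :: "int \<Rightarrow> complex"
  assumes f: "(f has_sum s) UNIV" and f0: "f 0 = 0"
  shows "(\<lambda>n. f (int (Suc n)) + f (- int (Suc n))) sums s"
proof -
  have sm: "f summable_on UNIV" using f by (auto simp: summable_on_def)
  obtain s1 where s1: "(f has_sum s1) {1..}"
    using summable_on_subset_banach[OF sm, of "{1..}"] by (auto simp: summable_on_def)
  obtain s2 where s2: "(f has_sum s2) {..-1}"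
    using summable_on_subset_banach[OF sm, of "{..-1}"] by (auto simp: summable_on_def)
  have "(f has_sum (s1 + s2)) ({1..} \<union> {..-1})"
    using s1 s2 by (rule has_sum_Un_disjoint) auto
  moreover have "(f has_sum (s1 + s2)) UNIV \<longleftrightarrow> (f has_sum (s1 + s2)) ({1..} \<union> {..-1})"
  proof (rule has_sum_cong_neutral)
    fix n assume "n \<in> UNIV - ({1..} \<union> {..-1::int})"
    then have "n = 0" by auto
    then show "f n = 0" by (simp add: f0)
  qed auto
  ultimately have s: "s = s1 + s2" using f has_sum_unique by blast
  have "((\<lambda>n. f (int (Suc n))) has_sum s1) UNIV"
    using s1 by (subst has_sum_reindex_bij_witness[of _ "\<lambda>k. nat (k - 1)" "\<lambda>n. int (Suc n)" "{1..}" f]) auto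
  moreover have "((\<lambda>n. f (- int (Suc n))) has_sum s2) UNIV"
    using s2 by (subst has_sum_reindex_bij_witness[of _ "\<lambda>k. nat (- k - 1)" "\<lambda>n. - int (Suc n)" "{..-1}" f]) auto
  ultimately show ?thesis
    unfolding s by (intro sums_add has_sum_imp_sums)
qed

text \<open>The numerators of the two sums differ by the factor q^n, so their difference contains
  q^n - 1 and the term n = 0, which carries 1/(1 - w), vanishes. The remaining terms are paired as n
  and -n.\<close>

lemma appell_diff_sums:
  assumes q: "0 < norm q" "norm q < 1" and w: "w \<noteq> 0" "\<And>n. w * (q ^ 5) powi n \<noteq> 1"
  shows "(\<lambda>n. rank_term q n w) sums (appell (q ^ 3) (q ^ 3) w (q ^ 5) - appell (q\<^sup>2) (q ^ 3) w (q ^ 5))"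
proof -
  have q0: "q \<noteq> 0" using q by auto
  have q3: "0 < norm (q ^ 3)" "norm (q ^ 3) < 1" "norm (q ^ 5) < 1"
    using q by (auto simp: norm_power power_less_one_iff)
  define f where "f = (\<lambda>n. (-1) powi n * q powi (3 * tri n + 2 * n) * (q powi n - 1) / (1 - w * q powi (5 * n)))"
  have "((\<lambda>n. (- (q ^ 3)) powi n * (q ^ 3) powi tri n / (1 - w * (q ^ 5) powi n)
        + - ((- (q\<^sup>2)) powi n * (q ^ 3) powi tri n / (1 - w * (q ^ 5) powi n))) has_sum
      (appell (q ^ 3) (q ^ 3) w (q ^ 5) + - appell (q\<^sup>2) (q ^ 3) w (q ^ 5))) UNIV"
    using q0 q3 w by (intro has_sum_add has_sum_uminusI has_sum_appell) auto
  also have "(\<lambda>n. (- (q ^ 3)) powi n * (q ^ 3) powi tri n / (1 - w * (q ^ 5) powi n)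
        + - ((- (q\<^sup>2)) powi n * (q ^ 3) powi tri n / (1 - w * (q ^ 5) powi n))) = f"
  proof
    fix n
    have neg: "(- (q ^ j)) powi n = (-1) powi n * q powi (int j * n)" for j
      by (simp add: power_int_mult flip: power_int_mult_distrib)
    have e3: "(- (q ^ 3)) powi n = (-1) powi n * (q powi (2 * n) * q powi n)"
      using neg[of 3] q0 by (simp flip: power_int_add)
    have e2: "(- (q\<^sup>2)) powi n = (-1) powi n * q powi (2 * n)"
      using neg[of 2] by simp
    have e1: "(q ^ 3) powi tri n = q powi (3 * tri n)" "(q ^ 5) powi n = q powi (5 * n)"
      by (simp_all add: power_int_mult)
    show "(- (q ^ 3)) powi n * (q ^ 3) powi tri n / (1 - w * (q ^ 5) powi n)
        + - ((- (q\<^sup>2)) powi n * (q ^ 3) powi tri n / (1 - w * (q ^ 5) powi n)) = f n"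
      unfolding e1 e2 e3 f_def using q0 by (simp add: power_int_add algebra_simps diff_divide_distrib)
  qed
  finally have f: "(f has_sum (appell (q ^ 3) (q ^ 3) w (q ^ 5) - appell (q\<^sup>2) (q ^ 3) w (q ^ 5))) UNIV"
    by simp
  have "(\<lambda>n. f (int (Suc n)) + f (- int (Suc n))) = (\<lambda>n. rank_term q n w)"
  proof
    fix n
    define N where "N = Suc n"
    define c where "c = (-1) ^ n * q powi (3 * tri (int N) + int N)"
    have s: "(-1) powi int N = - ((-1) ^ n :: complex)" "(-1) powi (- int N) = - ((-1) ^ n :: complex)"
    proof -
      show "(-1) powi int N = - ((-1) ^ n :: complex)"
        unfolding power_int_of_nat N_def by simp
      then show "(-1) powi (- int N) = - ((-1) ^ n :: complex)"
        unfolding power_int_minus by (cases "even n") simp_all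
    qed
    have p: "q powi int N = q ^ N" "q powi (5 * int N) = q ^ (5 * N)" "q powi (- int N) = 1 / q ^ N"
       "q powi (5 * (- int N)) = 1 / q ^ (5 * N)"
    proof -
      show "q powi int N = q ^ N" by (rule power_int_of_nat)
      show "q powi (- int N) = 1 / q ^ N" by (simp only: power_int_minus power_int_of_nat inverse_eq_divide)
      have "q powi (int (5 * N)) = q ^ (5 * N)" by (rule power_int_of_nat)
      then show "q powi (5 * int N) = q ^ (5 * N)" by simp
      then show "q powi (5 * (- int N)) = 1 / q ^ (5 * N)"
        by (simp add: power_int_minus inverse_eq_divide)
    qed
    have f1: "f (int N) = c * (1 - q ^ N) * (q ^ N / (1 - w * q ^ (5 * N)))"
    proof -
      have "q powi (3 * tri (int N) + 2 * int N) = q powi (3 * tri (int N) + int N) * q ^ N"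
      proof -
        have "3 * tri (int N) + 2 * int N = (3 * tri (int N) + int N) + int N" by simp
        then show ?thesis
          unfolding p(1)[symmetric] using q0 by (metis power_int_add)
      qed
      moreover have "- e * (Z * y) * (y - 1) / D = e * Z * (1 - y) * (y / D)" for e Z y D :: complex
        by (simp add: algebra_simps diff_divide_distrib)
      ultimately show ?thesis
        unfolding f_def s p c_def by (simp only:)
    qed
    have f2: "f (- int N) = c * (1 - q ^ N) * (q ^ (4 * N) / (w - q ^ (5 * N)))"
    proof -
      have "3 * tri (- int N) + 2 * (- int N) = 3 * tri (int N) + int N"
        using tri_minus[of "int N"] by simp
      then have "f (- int N) = - c * (1 / q ^ N - 1) / (1 - w * (1 / q ^ (5 * N)))"
        unfolding f_def s p c_def by (simp only:) simp
      also have "1 / q ^ N - 1 = (1 - q ^ N) / q ^ N"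
        using q0 by (simp add: field_simps)
      also have "1 - w * (1 / q ^ (5 * N)) = - (w - q ^ (5 * N)) / q ^ (5 * N)"
        using q0 by (simp add: field_simps)
      also have "q ^ (5 * N) = q ^ (4 * N) * q ^ N"
        by (simp flip: power_add)
      also have "- c * ((1 - q ^ N) / q ^ N) / (- (w - q ^ (4 * N) * q ^ N) / (q ^ (4 * N) * q ^ N))
          = c * (1 - q ^ N) * (q ^ (4 * N) / (w - q ^ (4 * N) * q ^ N))"
      proof -
        have cancel: "- c * (u / d) / (- v / (e * d)) = c * u * (e / v)" if "d \<noteq> 0" for c u v e d :: complex
          using that by simp
        show ?thesis by (rule cancel) (simp add: q0)
      qed
      finally show ?thesis by (simp flip: power_add)
    qed
    show "f (int (Suc n)) + f (- int (Suc n)) = rank_term q n w"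
      using f1 f2 unfolding N_def[symmetric] rank_term_def rank_coeff_def c_def by (simp only: distrib_left)
  qed
  with sums_int_pairs[OF f] show ?thesis by (simp add: f_def)
qed

lemma norm_rank_coeff_le:
  assumes q: "0 < norm q" "norm q < 1"
  shows "norm (rank_coeff q n) \<le> 2 * norm q ^ n"
proof -
  have "tri (int (Suc n)) \<ge> 0"
  proof -
    have "int (Suc n) * (int (Suc n) - 1) \<ge> 0"
      by (intro mult_nonneg_nonneg) auto
    then show ?thesis using two_tri[of "int (Suc n)"] by linarith
  qed
  then obtain k where k: "tri (int (Suc n)) = int k" using nonneg_int_cases by blast
  have "q powi (3 * tri (int (Suc n)) + int (Suc n)) = q ^ (3 * k + Suc n)"
  proof -
    have e: "3 * int k + int (Suc n) = int (3 * k + Suc n)" by simp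
    show ?thesis unfolding k e power_int_of_nat ..
  qed
  moreover have "norm q ^ (3 * k + Suc n) \<le> norm q ^ n"
    using q by (intro power_decreasing) auto
  moreover have "norm (1 - q ^ Suc n) \<le> 2"
  proof -
    have "norm (1 - q ^ Suc n) \<le> norm (1::complex) + norm (q ^ Suc n)"
      by (rule norm_triangle_ineq4)
    also have "norm (q ^ Suc n) \<le> 1"
      unfolding norm_power using q by (intro power_le_one) auto
    finally show ?thesis by simp
  qed
  ultimately have "norm q ^ (3 * k + Suc n) * norm (1 - q ^ Suc n) \<le> norm q ^ n * 2"
    by (intro mult_mono) auto
  moreover have "norm (rank_coeff q n) = norm q ^ (3 * k + Suc n) * norm (1 - q ^ Suc n)"
    unfolding rank_coeff_def \<open>q powi _ = _\<close> by (simp add: norm_mult norm_power)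
  ultimately show ?thesis by simp
qed

definition rank_term' :: "complex \<Rightarrow> nat \<Rightarrow> complex \<Rightarrow> complex" where
  "rank_term' q n w = rank_coeff q n * (q ^ (6 * Suc n) / (1 - w * q ^ (5 * Suc n))\<^sup>2 - q ^ (4 * Suc n) / (w - q ^ (5 * Suc n))\<^sup>2)"

text \<open>Termwise differentiation, with the Weierstrass M-test for the differentiated series on a
  ball around 1.\<close>

lemma rank_term_series_derivative:
  assumes q: "0 < norm q" "norm q < 1"
  shows "summable (\<lambda>n. rank_term q n 1)" "summable (\<lambda>n. rank_term' q n 1)"
    "((\<lambda>w. \<Sum>n. rank_term q n w) has_field_derivative (\<Sum>n. rank_term' q n 1)) (at 1)"
proof -
  define \<rho> where "\<rho> = norm q ^ 5"
  \<comment> \<open>For |w - 1| < \<eta> both |1 - w q^(5N)| and |w - q^(5N)| are at least \<eta>,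
    because |q^(5N)| <= \<rho>; the same number serves as radius and as lower bound.\<close>
  define \<eta> where "\<eta> = (1 - \<rho>) / 2"
  have \<rho>: "0 < \<rho>" "\<rho> < 1" using q by (auto simp: \<rho>_def power_less_one_iff)
  have \<eta>: "\<eta> > 0" using \<rho> by (simp add: \<eta>_def)
  define S where "S = ball (1::complex) \<eta>"
  have qn: "norm (q ^ (k * Suc n)) \<le> 1" for k n
    unfolding norm_power using q by (intro power_le_one) auto
  have q5: "norm (q ^ (5 * Suc n)) \<le> \<rho>" for n
  proof -
    have "norm (q ^ (5 * Suc n)) = \<rho> * \<rho> ^ n" by (simp add: \<rho>_def norm_mult norm_power power_add flip: power_mult)
    also have "\<dots> \<le> \<rho> * 1" using \<rho> by (intro mult_left_mono power_le_one) auto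
    finally show ?thesis by simp
  qed
  have den: "norm (1 - w * q ^ (5 * Suc n)) \<ge> \<eta>" "norm (w - q ^ (5 * Suc n)) \<ge> \<eta>" if w: "w \<in> S" for w n
  proof -
    have w1: "norm (w - 1) < \<eta>" using w by (simp add: S_def dist_norm norm_minus_commute)
    have nw: "norm w \<le> 1 + \<eta>" "norm w \<ge> 1 - \<eta>"
      using w1 norm_triangle_ineq2[of w 1] norm_triangle_ineq3[of w 1] norm_triangle_ineq2[of 1 w] norm_minus_commute[of w 1] by auto
    have "norm (w * q ^ (5 * Suc n)) \<le> (1 + \<eta>) * \<rho>"
      unfolding norm_mult using nw q5 \<eta> by (intro mult_mono) auto
    moreover have "norm (1 - w * q ^ (5 * Suc n)) \<ge> norm (1::complex) - norm (w * q ^ (5 * Suc n))"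
      by (rule norm_triangle_ineq2)
    moreover have "1 - (1 + \<eta>) * \<rho> = \<eta> + (1 - \<rho>) * (1 - \<rho>) / 2"
      by (simp add: \<eta>_def field_simps)
    ultimately show "norm (1 - w * q ^ (5 * Suc n)) \<ge> \<eta>"
      using zero_le_square[of "1 - \<rho>"] unfolding norm_one by linarith
    have "norm (w - q ^ (5 * Suc n)) \<ge> norm w - norm (q ^ (5 * Suc n))"
      by (rule norm_triangle_ineq2)
    then have "norm (w - q ^ (5 * Suc n)) \<ge> 1 - \<eta> - \<rho>"
      using nw(2) q5[of n] by linarith
    also have "1 - \<eta> - \<rho> = \<eta>" by (simp add: \<eta>_def field_simps)
    finally show "norm (w - q ^ (5 * Suc n)) \<ge> \<eta>" .
  qed
  have one_in: "1 \<in> S" using \<eta> by (simp add: S_def)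
  have D: "(rank_term q n has_field_derivative rank_term' q n w) (at w within S)" if w: "w \<in> S" for n w
  proof -
    have nz: "1 - w * q ^ (5 * Suc n) \<noteq> 0" "w - q ^ (5 * Suc n) \<noteq> 0"
      using den[OF w, of n] \<eta> by auto
    have "q ^ (6 * Suc n) = q ^ Suc n * q ^ (5 * Suc n)"
      by (simp only: flip: power_add) simp
    then show ?thesis
      unfolding rank_term_def[abs_def] rank_term'_def using nz
      by (auto intro!: derivative_eq_intros simp: power2_eq_square field_simps)
  qed
  define M where "M = (\<lambda>n. 2 * norm q ^ n * (1 / \<eta>\<^sup>2 + 1 / \<eta>\<^sup>2))"
  have M: "summable M" unfolding M_def using q by (intro summable_mult2 summable_mult summable_geometric) auto
  have bound': "norm (rank_term' q n w) \<le> M n" if w: "w \<in> S" for n w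
  proof -
    have 1: "norm (q ^ (k * Suc n) / u\<^sup>2) \<le> 1 / \<eta>\<^sup>2" if "norm u \<ge> \<eta>" for k u
      unfolding norm_divide using qn[of k n] that \<eta> by (intro frac_le) (auto simp: norm_power intro!: power_mono)
    have "norm (rank_term' q n w) \<le> norm (rank_coeff q n) * (norm (q ^ (6 * Suc n) / (1 - w * q ^ (5 * Suc n))\<^sup>2) + norm (q ^ (4 * Suc n) / (w - q ^ (5 * Suc n))\<^sup>2))"
      unfolding rank_term'_def norm_mult by (intro mult_left_mono norm_triangle_ineq4) auto
    also have "\<dots> \<le> 2 * norm q ^ n * (1 / \<eta>\<^sup>2 + 1 / \<eta>\<^sup>2)"
      by (intro mult_mono add_mono norm_rank_coeff_le q 1 den w) auto
    finally show ?thesis by (simp add: M_def)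
  qed
  show "summable (\<lambda>n. rank_term' q n 1)"
    using bound'[OF one_in] by (intro summable_comparison_test'[OF M, of 0]) auto
  have b1: "norm (rank_term q n 1) \<le> 2 * norm q ^ n * (1 / \<eta> + 1 / \<eta>)" for n
  proof -
    have 1: "norm (q ^ (k * Suc n) / u) \<le> 1 / \<eta>" if "norm u \<ge> \<eta>" for k u
      unfolding norm_divide using qn[of k n] that \<eta> by (intro frac_le) auto
    have "norm (rank_term q n 1) \<le> norm (rank_coeff q n) * (norm (q ^ (1 * Suc n) / (1 - 1 * q ^ (5 * Suc n))) + norm (q ^ (4 * Suc n) / (1 - q ^ (5 * Suc n))))"
      unfolding rank_term_def norm_mult mult_1 by (intro mult_left_mono norm_triangle_ineq) auto
    also have "\<dots> \<le> 2 * norm q ^ n * (1 / \<eta> + 1 / \<eta>)"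
      by (intro mult_mono add_mono norm_rank_coeff_le q 1 den one_in) auto
    finally show ?thesis .
  qed
  have "summable (\<lambda>n. 2 * norm q ^ n * (1 / \<eta> + 1 / \<eta>))"
    using q by (intro summable_mult2 summable_mult summable_geometric) auto
  then show sm: "summable (\<lambda>n. rank_term q n 1)"
    by (rule summable_comparison_test'[where N = 0]) (rule b1)
  have uc: "uniformly_convergent_on S (\<lambda>n w. \<Sum>i<n. rank_term' q i w)"
    by (rule Weierstrass_m_test'[OF bound' M])
  show "((\<lambda>w. \<Sum>n. rank_term q n w) has_field_derivative (\<Sum>n. rank_term' q n 1)) (at 1)"
  proof (rule has_field_derivative_series'(2)[where f = "rank_term q" and f' = "rank_term' q" and S = S, OF _ D uc one_in sm])
    show "convex S" "1 \<in> interior S"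
      using \<eta> by (simp_all add: S_def)
  qed
qed

text \<open>The weight \<omega>^k gives the power q^j the factor \<omega>^(k(j+1)), whose sum over k
  vanishes unless 5 divides j + 1.\<close>

lemma fifth_root_filter:
  fixes \<omega> q :: complex
  assumes "\<omega> ^ 5 = 1" "\<omega> \<noteq> 1"
    and F: "\<And>k. F k = e0 + e1 * (\<omega> ^ k * q) + e2 * (\<omega> ^ k * q)\<^sup>2 + e3 * (\<omega> ^ k * q) ^ 3 + e4 * (\<omega> ^ k * q) ^ 4"
  shows "(\<Sum>k<5. \<omega> ^ k * F k) / 5 = e4 * q ^ 4"
proof -
  have "{..<5::nat} = {0, 1, 2, 3, 4}" by auto
  then have "(\<Sum>k<5. \<omega> ^ k * F k) = F 0 + (\<omega> * F 1 + (\<omega>\<^sup>2 * F 2 + (\<omega> ^ 3 * F 3 + \<omega> ^ 4 * F 4)))"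
    by simp
  also have "\<dots> = 5 * (e4 * q ^ 4)"
    unfolding F power_0 power_one_right mult_1
    using sum_fifth_root[OF assms(1,2)] assms(1) by algebra
  finally show ?thesis by simp
qed

text \<open>The value of (1 + 5 w d/dw) V(w) at w = 1, through the paired series instead of the
  Appell sums, which have poles there.\<close>

definition rank_series :: "complex \<Rightarrow> complex" where
  "rank_series q = ((\<Sum>n. rank_term q n 1) + 5 * (\<Sum>n. rank_term' q n 1)) / qp q q"

text \<open>The filter is applied to V(w) for w near 1 but different from 1, where the dissection
  holds and gives a multiple of \<open>rank_theta\<close>. The filtered series is differentiable at
  1, so \<open>rank_theta_derivative\<close> yields its value plus five times its
  derivative.\<close>

lemma rank_series_residue_4:
  assumes \<omega>: "\<omega> ^ 5 = 1" "\<omega> \<noteq> 1" and q: "0 < norm q" "norm q < 1"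
  shows "(\<Sum>k<5. \<omega> ^ k * rank_series (\<omega> ^ k * q)) / 5
    = q ^ 4 * qp (q ^ 25) (q ^ 25) ^ 4 / qp (q ^ 5) (q ^ 5)"
proof -
  define Y where "Y = q ^ 5"
  have Y: "0 < norm Y" "norm Y < 1"
    using q by (auto simp: Y_def norm_power power_less_one_iff)
  interpret quintic_nome Y by unfold_locales (fact Y)+
  have norm_\<omega>: "norm \<omega> = 1"
    using \<omega>(1) by (rule norm_fifth_root_of_unity)
  define z where "z = (\<lambda>k. \<omega> ^ k * q)"
  have z: "0 < norm (z k)" "norm (z k) < 1" for k
    using q norm_\<omega> by (simp_all add: z_def norm_mult norm_power)
  have z5: "z k ^ 5 = Y" for k
  proof -
    have "(\<omega> ^ k) ^ 5 = 1" using \<omega>(1) by (metis mult.commute power_mult power_one)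
    then show ?thesis by (simp add: z_def Y_def power_mult_distrib)
  qed
  \<comment> \<open>Small enough that |w - 1| < \<delta> implies |Y| < |w| < 1/|Y|; then w Y^n = 1
    forces n = 0 and w = 1.\<close>
  define \<delta> where "\<delta> = (1 - norm Y) / 2"
  have \<delta>: "\<delta> > 0" using Y by (simp add: \<delta>_def)
  have gen: "w \<noteq> 0 \<and> w * Y powi n \<noteq> 1" if w: "w \<in> ball 1 \<delta> - {1}" for w n
  proof -
    have w1: "norm (w - 1) < \<delta>" using w by (simp add: dist_norm norm_minus_commute)
    have nw: "norm w < 1 + \<delta>" "norm w > 1 - \<delta>"
      using w1 norm_triangle_ineq2[of w 1] norm_triangle_ineq2[of 1 w] norm_minus_commute[of w 1] by auto
    have b: "norm Y < norm w" "norm w * norm Y < 1"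
    proof -
      have "1 + norm Y < 2 * norm w" using nw(2) by (simp add: \<delta>_def field_simps)
      then show "norm Y < norm w" using Y by linarith
      have "norm w * norm Y < (1 + \<delta>) * norm Y" using nw Y by (intro mult_strict_right_mono) auto
      also have "\<dots> = 1 - (1 - norm Y) * (2 - norm Y) / 2" by (simp add: \<delta>_def field_simps)
      also have "\<dots> < 1" using Y by simp
      finally show "norm w * norm Y < 1" .
    qed
    have w0: "w \<noteq> 0" using b(1) Y by auto
    have "w * Y powi n \<noteq> 1"
    proof
      assume *: "w * Y powi n = 1"
      then have n: "norm w * norm Y powi n = 1" by (metis norm_mult norm_one norm_power_int)
      consider "n = 0" | "n \<ge> 1" | "n \<le> -1" by linarith
      then show False
      proof cases
        case 1
        with * w show False by simp
      next
        case 2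
        then have "norm Y powi n \<le> norm Y powi 1"
          using Y by (intro power_int_decreasing) auto
        then have "norm w * norm Y powi n \<le> norm w * norm Y"
          by (intro mult_left_mono) auto
        then show False using n b(2) by simp
      next
        case 3
        then have "norm Y powi (-1) \<le> norm Y powi n"
          using Y by (intro power_int_decreasing) auto
        then have "norm w * norm Y powi (-1) \<le> norm w * norm Y powi n"
          by (intro mult_left_mono) auto
        then have "norm w / norm Y \<le> 1"
          using n by (simp add: power_int_minus divide_inverse)
        then show False using b(1) Y by (simp add: field_simps)
      qed
    qed
    with w0 show ?thesis by simp
  qed
  define K where "K = PQ ^ 9 / PY ^ 5"
  have K: "K \<noteq> 0" by (simp add: K_def)
  have q0: "q \<noteq> 0" using q by auto
  define V where "V = (\<lambda>w. (\<Sum>k<5. \<omega> ^ k * ((\<Sum>n. rank_term (z k) n w) / qp (z k) (z k))) / 5)"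
  define f where "f = (\<lambda>w. V w / (K * q ^ 4))"
  define V' where "V' = (\<Sum>k<5. \<omega> ^ k * ((\<Sum>n. rank_term' (z k) n 1) / qp (z k) (z k))) / 5"
  have "(V has_field_derivative V') (at 1)"
    unfolding V_def V'_def
    by (intro DERIV_cdivide DERIV_sum DERIV_cmult rank_term_series_derivative z)
  then have Df: "(f has_field_derivative V' / (K * q ^ 4)) (at 1)"
    unfolding f_def by (rule DERIV_cdivide)
  have fW: "f w = rank_theta w" if w: "w \<in> ball 1 \<delta> - {1}" for w
  proof -
    have gw: "w \<noteq> 0" "\<And>n. w * Y powi n \<noteq> 1" using gen[OF w] by auto
    obtain e0 e1 e2 e3 where e: "\<And>q. q ^ 5 = Y \<Longrightarrow> (appell (q ^ 3) (q ^ 3) w Y - appell (q\<^sup>2) (q ^ 3) w Y) / qp q q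
      = e0 + e1 * q + e2 * q\<^sup>2 + e3 * q ^ 3 + K * rank_theta w * q ^ 4"
      using rank_dissection[OF gw] unfolding K_def by metis
    have "(\<Sum>n. rank_term (z k) n w) = appell (z k ^ 3) (z k ^ 3) w Y - appell ((z k)\<^sup>2) (z k ^ 3) w Y" for k
      using appell_diff_sums[OF z gw(1), of k] gw(2) sums_unique unfolding z5 by metis
    then have "(\<Sum>n. rank_term (z k) n w) / qp (z k) (z k)
       = e0 + e1 * (\<omega> ^ k * q) + e2 * (\<omega> ^ k * q)\<^sup>2 + e3 * (\<omega> ^ k * q) ^ 3 + K * rank_theta w * (\<omega> ^ k * q) ^ 4" for k
      using e[OF z5] unfolding z_def by simp
    then have "V w = K * rank_theta w * q ^ 4"
      unfolding V_def by (rule fifth_root_filter[OF \<omega>])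
    then show ?thesis using K q0 by (simp add: f_def)
  qed
  have "f 1 + 5 * (V' / (K * q ^ 4)) = PY ^ 4 / PQ ^ 5"
    by (rule rank_theta_derivative[OF Df \<delta> gen fW])
  then have "V 1 + 5 * V' = K * q ^ 4 * (PY ^ 4 / PQ ^ 5)"
    unfolding f_def using K q0 by (simp add: field_simps)
  also have "\<dots> = q ^ 4 * PQ ^ 4 / PY"
    by (simp add: K_def eval_nat_numeral)
  finally have "V 1 + 5 * V' = q ^ 4 * PQ ^ 4 / PY" .
  moreover have "V 1 + 5 * V' = (\<Sum>k<5. \<omega> ^ k * rank_series (z k)) / 5"
    unfolding V_def V'_def rank_series_def
    by (simp add: sum_distrib_left sum.distrib[symmetric] add_divide_distrib[symmetric] distrib_left mult_ac flip: sum_divide_distrib)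
  moreover have "Y ^ 5 = q ^ 25" by (simp add: Y_def flip: power_mult)
  then have "Q = q ^ 25" by (simp only: Q_def)
  ultimately show ?thesis
    by (simp only: z_def PQ_def PY_def) (simp only: Y_def)
qed

section \<open>Generating functions in the unit disk\<close>

lemma fps_conv_radius_unit_disk:
  fixes F :: "complex fps"
  assumes "\<And>r. 0 < r \<Longrightarrow> r < 1 \<Longrightarrow> \<exists>C. \<forall>n. norm (fps_nth F n) * r ^ n \<le> C"
  shows "fps_conv_radius F \<ge> 1"
  unfolding fps_conv_radius_def
proof (rule conv_radius_geI_ex)
  fix r :: real assume r: "0 < r" "ereal r < 1"
  define s where "s = (r + 1) / 2"
  have s: "0 < s" "s < 1" "r < s" using r by (auto simp: s_def)
  obtain C where C: "\<And>n. norm (fps_nth F n) * s ^ n \<le> C"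
    using assms[OF s(1,2)] by blast
  have "summable (\<lambda>n. fps_nth F n * of_real r ^ n)"
  proof (rule summable_comparison_test')
    show "summable (\<lambda>n. C * (r / s) ^ n)"
      using r s by (intro summable_mult summable_geometric) simp
    fix n
    have "norm (fps_nth F n * of_real r ^ n) = norm (fps_nth F n) * s ^ n * (r / s) ^ n"
      using r s by (simp add: norm_mult norm_power power_divide)
    also have "\<dots> \<le> C * (r / s) ^ n"
      using r s by (intro mult_right_mono C) auto
    finally show "norm (fps_nth F n * of_real r ^ n) \<le> C * (r / s) ^ n" .
  qed
  then show "\<exists>z. norm z = r \<and> summable (\<lambda>n. fps_nth F n * z ^ n)"
    using r by (intro exI[of _ "of_real r"]) auto
qed

text \<open>Coefficientwise stabilisation together with a bound uniform in N for every radius below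
  1 permits Tannery's theorem. In this way X-adic limits are evaluated as limits of numbers.\<close>

lemma eval_fps_limit:
  fixes F :: "nat \<Rightarrow> complex fps" and G :: "complex fps"
  assumes bound: "\<And>r. 0 < r \<Longrightarrow> r < 1 \<Longrightarrow> \<exists>C. \<forall>N n. norm (fps_nth (F N) n) * r ^ n \<le> C"
    and stable: "\<And>N n. n \<le> N \<Longrightarrow> fps_nth (F N) n = fps_nth G n"
  shows "fps_conv_radius (F N) \<ge> 1" "fps_conv_radius G \<ge> 1"
    "norm q < 1 \<Longrightarrow> (\<lambda>N. eval_fps (F N) q) \<longlonglongrightarrow> eval_fps G q"
proof -
  show "fps_conv_radius (F N) \<ge> 1"
    using bound by (intro fps_conv_radius_unit_disk) blast
  show "fps_conv_radius G \<ge> 1"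
    using bound stable by (intro fps_conv_radius_unit_disk) (metis order_refl)
  assume q: "norm q < 1"
  define s where "s = (norm q + 1) / 2"
  have s: "0 < s" "s < 1" "norm q < s" using q by (auto simp: s_def intro: add_nonneg_pos)
  obtain C where C: "\<And>N n. norm (fps_nth (F N) n) * s ^ n \<le> C"
    using bound[OF s(1,2)] by blast
  have le: "norm (fps_nth (F N) n * q ^ n) \<le> C * (norm q / s) ^ n" for N n
  proof -
    have "norm (fps_nth (F N) n * q ^ n) = norm (fps_nth (F N) n) * s ^ n * (norm q / s) ^ n"
      using s by (simp add: norm_mult norm_power power_divide)
    also have "\<dots> \<le> C * (norm q / s) ^ n"
      using s by (intro mult_right_mono C) auto
    finally show ?thesis .
  qed
  have "(\<lambda>N. \<Sum>n. fps_nth (F N) n * q ^ n) \<longlonglongrightarrow> (\<Sum>n. fps_nth G n * q ^ n)"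
  proof (rule tannerys_theorem[THEN conjunct2, THEN conjunct2])
    show "\<forall>\<^sub>F (k, n) in at_top \<times>\<^sub>F sequentially. norm (fps_nth (F n) k * q ^ k) \<le> C * (norm q / s) ^ k"
      using le by (intro always_eventually) auto
    show "summable (\<lambda>n. C * (norm q / s) ^ n)"
      using s by (intro summable_mult summable_geometric) simp
    show "(\<lambda>N. fps_nth (F N) n * q ^ n) \<longlonglongrightarrow> fps_nth G n * q ^ n" for n
      using stable[of n] by (intro tendsto_eventually) (auto intro!: eventually_sequentiallyI[of n])
  qed auto
  then show "(\<lambda>N. eval_fps (F N) q) \<longlonglongrightarrow> eval_fps G q"
    by (simp add: eval_fps_def)
qed

lemma prod_one_plus_power_le:
  fixes r :: real
  assumes "0 < r" "r < 1"
  shows "(\<Prod>k<N. 1 + r ^ Suc k) \<le> exp (1 / (1 - r))"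
proof -
  have "(\<Prod>k<N. 1 + r ^ Suc k) \<le> (\<Prod>k<N. exp (r ^ Suc k))"
    using assms by (intro prod_mono conjI exp_ge_add_one_self) (auto intro: add_nonneg_nonneg simp del: power_Suc)
  also have "\<dots> = exp (\<Sum>k<N. r ^ Suc k)"
    by (simp add: exp_sum)
  also have "(\<Sum>k<N. r ^ Suc k) \<le> (\<Sum>k<Suc N. r ^ k)"
    using sum.lessThan_Suc_shift[of "\<lambda>k. r ^ k" N] by simp
  also have "\<dots> \<le> (\<Sum>k. r ^ k)"
    using assms by (intro sum_le_suminf summable_geometric) auto
  also have "\<dots> = 1 / (1 - r)"
    using assms by (intro suminf_geometric) simp
  finally show ?thesis by simp
qed

text \<open>A factor \<open>1 - a X\<^sup>k\<close> multiplies the weighted coefficient sum by at most \<open>1 + r\<^sup>k\<close>.\<close>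
lemma prod_coeff_bound:
  fixes c :: "nat \<Rightarrow> complex"
  assumes c: "\<And>k. norm (c k) \<le> 1" and s: "\<And>k. s k \<ge> Suc k" and r: "0 < r" "r < 1"
  shows "norm (fps_nth (\<Prod>k<N. 1 - fps_const (c k) * fps_X ^ s k) n) * r ^ n \<le> exp (1 / (1 - r))"
proof -
  define F where "F = (\<lambda>N. \<Prod>k<N. 1 - fps_const (c k) * fps_X ^ s k)"
  have S: "(\<Sum>n\<le>M. norm (fps_nth (F N) n) * r ^ n) \<le> (\<Prod>k<N. 1 + r ^ Suc k)" for M
  proof (induction N arbitrary: M)
    case 0
    have "(\<Sum>n\<le>M. norm (fps_nth (1 :: complex fps) n) * r ^ n) = (\<Sum>n\<in>{0::nat}. 1)"
      by (rule sum.mono_neutral_cong_right) auto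
    then show ?case by (simp add: F_def)
  next
    case (Suc N)
    let ?a = "\<lambda>n. norm (fps_nth (F N) n) * r ^ n"
    have pos: "?a n \<ge> 0" for n using r by simp
    have F: "F (Suc N) = F N - fps_X ^ s N * (fps_const (c N) * F N)"
      by (simp add: F_def algebra_simps)
    have step: "norm (fps_nth (F (Suc N)) n) * r ^ n \<le> ?a n + (if n < s N then 0 else r ^ s N * ?a (n - s N))" for n
    proof (cases "n < s N")
      case False
      then have e: "r ^ n = r ^ s N * r ^ (n - s N)" by (simp flip: power_add)
      have "norm (fps_nth (F (Suc N)) n) \<le> norm (fps_nth (F N) n) + norm (c N) * norm (fps_nth (F N) (n - s N))"
        using norm_triangle_ineq4[of "fps_nth (F N) n" "c N * fps_nth (F N) (n - s N)"] False
        by (simp add: F fps_X_power_mult_nth norm_mult)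
      also have "\<dots> \<le> norm (fps_nth (F N) n) + 1 * norm (fps_nth (F N) (n - s N))"
        by (intro add_left_mono mult_right_mono c) auto
      finally have "norm (fps_nth (F (Suc N)) n) * r ^ n \<le>
          (norm (fps_nth (F N) n) + 1 * norm (fps_nth (F N) (n - s N))) * r ^ n"
        using r by (intro mult_right_mono) auto
      then show ?thesis using False by (simp add: algebra_simps) (simp add: e)
    qed (simp add: F fps_X_power_mult_nth)
    have "(\<Sum>n\<le>M. norm (fps_nth (F (Suc N)) n) * r ^ n) \<le>
        (\<Sum>n\<le>M. ?a n) + (\<Sum>n\<le>M. if n < s N then 0 else r ^ s N * ?a (n - s N))"
      unfolding sum.distrib[symmetric] by (intro sum_mono step)
    also have "(\<Sum>n\<le>M. if n < s N then 0 else r ^ s N * ?a (n - s N)) = (\<Sum>n | n \<le> M \<and> \<not> n < s N. r ^ s N * ?a (n - s N))"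
      by (rule sum.mono_neutral_cong_right) auto
    also have "\<dots> = (\<Sum>n\<in>(\<lambda>n. n - s N) ` {n. n \<le> M \<and> \<not> n < s N}. r ^ s N * ?a n)"
      by (subst sum.reindex) (auto simp: inj_on_def)
    also have "\<dots> \<le> (\<Sum>n\<le>M. r ^ s N * ?a n)"
      using r by (intro sum_mono2) auto
    also have "\<dots> \<le> (\<Sum>n\<le>M. r ^ Suc N * ?a n)"
      using r s by (intro sum_mono mult_right_mono power_decreasing) auto
    also have "(\<Sum>n\<le>M. ?a n) + \<dots> = (1 + r ^ Suc N) * (\<Sum>n\<le>M. ?a n)"
      by (simp only: sum_distrib_left[symmetric] distrib_right mult_1)
    also have "\<dots> \<le> (1 + r ^ Suc N) * (\<Prod>k<N. 1 + r ^ Suc k)"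
      using r by (intro mult_left_mono Suc.IH) (auto intro: add_nonneg_nonneg)
    finally show ?case by (simp add: mult_ac)
  qed
  have "norm (fps_nth (F N) n) * r ^ n \<le> (\<Sum>n\<le>n. norm (fps_nth (F N) n) * r ^ n)"
    using r by (intro member_le_sum) auto
  also have "\<dots> \<le> (\<Prod>k<N. 1 + r ^ Suc k)" by (rule S)
  also have "\<dots> \<le> exp (1 / (1 - r))" by (rule prod_one_plus_power_le[OF r])
  finally show ?thesis by (simp add: F_def)
qed

text \<open>The factor of index k changes only coefficients from d (k + 1) > k upwards, so the
  coefficient of X^n is final after n factors; it is compared with the X-adic limit at a
  sufficiently late index.\<close>

lemma fps_nth_qpoch_inf:
  assumes "d \<ge> 1" "n \<le> N"
  shows "fps_nth (\<Prod>k<N. 1 - fps_X ^ d * (fps_X ^ d) ^ k) n = fps_nth (qpoch_inf (fps_X ^ d) (fps_X ^ d) :: complex fps) n"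
proof -
  define f where "f = (\<lambda>k. 1 - (fps_X ^ d :: complex fps) * (fps_X ^ d) ^ k)"
  have "f has_prod qpoch_inf (fps_X ^ d) (fps_X ^ d)"
    unfolding f_def using assms by (intro qpoch_inf_has_prod(1)) auto
  then have "(\<lambda>N. prod f {..<Suc N}) \<longlonglongrightarrow> qpoch_inf (fps_X ^ d) (fps_X ^ d)"
    using has_prod_imp_tendsto by (simp add: lessThan_Suc_atMost)
  then have "(\<lambda>N. prod f {..<N}) \<longlonglongrightarrow> qpoch_inf (fps_X ^ d) (fps_X ^ d)"
    by (rule LIMSEQ_imp_Suc)
  then have "\<forall>\<^sub>F N in sequentially. fps_nth (prod f {..<N}) n = fps_nth (qpoch_inf (fps_X ^ d) (fps_X ^ d)) n"
    unfolding tendsto_fps_iff by blast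
  then obtain M where M: "\<And>N. N \<ge> M \<Longrightarrow> fps_nth (prod f {..<N}) n = fps_nth (qpoch_inf (fps_X ^ d) (fps_X ^ d)) n"
    by (auto simp: eventually_sequentially)
  have step: "fps_nth (prod f {..<N}) n = fps_nth (prod f {..<n}) n" if "n \<le> N" for N
    using that
  proof (induction N rule: dec_induct)
    case (step N)
    have "N < d * Suc N" using assms(1) by (cases d) auto
    moreover have "prod f {..<Suc N} = prod f {..<N} - fps_X ^ (d * Suc N) * prod f {..<N}"
      by (simp add: f_def algebra_simps flip: power_mult power_add)
    ultimately show ?case using step by (simp add: fps_X_power_mult_nth del: mult_Suc_right)
  qed simp
  show ?thesis
    using step[OF assms(2)] step[of "max n M"] M[of "max n M"] by (simp add: f_def)
qed

text \<open>Connects the X-adic product with the numerical product \<open>qp\<close>: the values of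
  the finite products converge to both.\<close>

lemma eval_qpoch_inf:
  assumes "d \<ge> 1"
  shows "fps_conv_radius (qpoch_inf (fps_X ^ d) (fps_X ^ d) :: complex fps) \<ge> 1"
    and "norm q < 1 \<Longrightarrow> eval_fps (qpoch_inf (fps_X ^ d) (fps_X ^ d)) q = qp (q ^ d) (q ^ d)"
proof -
  define F :: "nat \<Rightarrow> complex fps" where "F = (\<lambda>N. \<Prod>k<N. 1 - fps_X ^ d * (fps_X ^ d) ^ k)"
  have F: "F N = (\<Prod>k<N. 1 - fps_const 1 * fps_X ^ (d * Suc k))" for N
    by (simp add: F_def power_mult power_add)
  have s: "Suc k \<le> d * Suc k" for k
    using assms by (cases d) auto
  have b: "norm (fps_nth (F N) n) * r ^ n \<le> exp (1 / (1 - r))" if "0 < r" "r < 1" for r N n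
    unfolding F using that s by (intro prod_coeff_bound) auto
  have stable: "fps_nth (F N) n = fps_nth (qpoch_inf (fps_X ^ d) (fps_X ^ d)) n" if "n \<le> N" for N n
    unfolding F_def using assms that by (rule fps_nth_qpoch_inf)
  note lim = eval_fps_limit[of F "qpoch_inf (fps_X ^ d) (fps_X ^ d)", OF _ stable]
  show "fps_conv_radius (qpoch_inf (fps_X ^ d) (fps_X ^ d) :: complex fps) \<ge> 1"
    using b by (intro lim(2)) blast+
  assume q: "norm q < 1"
  have "eval_fps (F N) q = (\<Prod>k<N. 1 - q ^ d * (q ^ d) ^ k)" for N
  proof (induction N)
    case (Suc N)
    have R: "fps_conv_radius (F N) \<ge> 1" using b by (intro lim(1)) blast+
    have e: "F (Suc N) = F N * (1 - fps_X ^ (d * Suc N))"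
      by (simp add: F)
    have R': "fps_conv_radius (1 - fps_X ^ (d * Suc N) :: complex fps) = \<infinity>"
      using fps_conv_radius_diff[of "1 :: complex fps" "fps_X ^ (d * Suc N)"] by (simp del: mult_Suc_right)
    have "ereal (norm q) < fps_conv_radius (F N)"
      using q R less_le_trans[of "ereal (norm q)" 1] by simp
    then have "eval_fps (F (Suc N)) q = eval_fps (F N) q * (1 - q ^ (d * Suc N))"
      unfolding e by (simp add: eval_fps_mult R' eval_fps_diff del: mult_Suc_right)
    then show ?case using Suc by (simp add: power_mult power_add)
  qed (simp add: F)
  moreover have "norm (q ^ d) < 1"
    using q assms by (simp add: norm_power power_less_one_iff)
  ultimately have "(\<lambda>N. eval_fps (F N) q) \<longlonglongrightarrow> qp (q ^ d) (q ^ d)"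
    using qp_tendsto by simp
  moreover have "(\<lambda>N. eval_fps (F N) q) \<longlonglongrightarrow> eval_fps (qpoch_inf (fps_X ^ d) (fps_X ^ d)) q"
    using b q by (intro lim(3)) blast+
  ultimately show "eval_fps (qpoch_inf (fps_X ^ d) (fps_X ^ d)) q = qp (q ^ d) (q ^ d)"
    using LIMSEQ_unique by blast
qed

section \<open>Weighted generating functions of partitions\<close>

definition part_weight :: "(nat \<Rightarrow> complex) \<Rightarrow> nat multiset \<Rightarrow> complex" where
  "part_weight c p = prod_mset (image_mset c p)"

definition bounded_partitions :: "nat \<Rightarrow> nat \<Rightarrow> nat multiset set" where
  "bounded_partitions N n = {p \<in> partitions n. \<forall>k\<in>#p. k \<le> N}"

lemma member_le_Sum_mset: "k \<in># p \<Longrightarrow> k \<le> \<Sum>\<^sub># (p :: nat multiset)"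
  by (induction p) auto

lemma partition_part_le: "p \<in> partitions n \<Longrightarrow> k \<in># p \<Longrightarrow> k \<le> n"
  unfolding partitions_def using member_le_Sum_mset by auto

lemma finite_bounded_partitions: "finite (bounded_partitions N n)"
  using finite_partitions by (rule finite_subset[rotated]) (auto simp: bounded_partitions_def)

lemma bounded_partitions_0: "bounded_partitions 0 n = (if n = 0 then {{#}} else {})"
proof -
  have "p = {#}" if "0 \<notin># p" "\<forall>k\<in>#p. k = 0" for p :: "nat multiset"
    using that by (cases p) auto
  then have "bounded_partitions 0 n \<subseteq> {{#}}"
    by (auto simp: bounded_partitions_def partitions_def)
  moreover have "{#} \<in> bounded_partitions 0 n \<longleftrightarrow> n = 0"
    by (auto simp: bounded_partitions_def partitions_def)
  ultimately show ?thesis by auto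
qed

text \<open>Either N + 1 is not a part, or one copy of it can be removed.\<close>

lemma bounded_partitions_Suc:
  "bounded_partitions (Suc N) n = bounded_partitions N n \<union>
     (if Suc N \<le> n then add_mset (Suc N) ` bounded_partitions (Suc N) (n - Suc N) else {})"
proof (intro equalityI subsetI)
  fix p assume p: "p \<in> bounded_partitions (Suc N) n"
  show "p \<in> bounded_partitions N n \<union> (if Suc N \<le> n then add_mset (Suc N) ` bounded_partitions (Suc N) (n - Suc N) else {})"
  proof (cases "Suc N \<in># p")
    case True
    then obtain r where r: "p = add_mset (Suc N) r" by (metis multi_member_split)
    with p show ?thesis by (auto simp: bounded_partitions_def partitions_def)
  next
    case False
    with p show ?thesis by (auto simp: bounded_partitions_def le_Suc_eq)
  qed
qed (auto simp: bounded_partitions_def partitions_def split: if_splits)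

lemma bounded_partitions_eq: "n \<le> N \<Longrightarrow> bounded_partitions N n = partitions n"
  using partition_part_le by (fastforce simp: bounded_partitions_def)

definition bounded_partition_fps :: "(nat \<Rightarrow> complex) \<Rightarrow> nat \<Rightarrow> complex fps" where
  "bounded_partition_fps c N = Abs_fps (\<lambda>n. \<Sum>p\<in>bounded_partitions N n. part_weight c p)"

definition partition_fps :: "(nat \<Rightarrow> complex) \<Rightarrow> complex fps" where
  "partition_fps c = Abs_fps (\<lambda>n. \<Sum>p\<in>partitions n. part_weight c p)"

lemma bounded_partition_fps_nth_Suc:
  "fps_nth (bounded_partition_fps c (Suc N)) n = fps_nth (bounded_partition_fps c N) n +
     (if Suc N \<le> n then c (Suc N) * fps_nth (bounded_partition_fps c (Suc N)) (n - Suc N) else 0)"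
proof -
  have "Suc N \<notin># p" if "p \<in> bounded_partitions N n" for p
    using that by (auto simp: bounded_partitions_def)
  then have "bounded_partitions N n \<inter> add_mset (Suc N) ` X = {}" for X
    by (metis (no_types, lifting) disjoint_iff imageE union_single_eq_member)
  moreover have "inj_on (add_mset (Suc N)) X" for X by (auto simp: inj_on_def)
  ultimately show ?thesis
    unfolding bounded_partition_fps_def
    by (simp add: bounded_partitions_Suc[of N n] sum.union_disjoint sum.reindex finite_bounded_partitions
        sum_distrib_left part_weight_def)
qed

lemma bounded_partition_fps_Suc:
  "bounded_partition_fps c (Suc N) * (1 - fps_const (c (Suc N)) * fps_X ^ Suc N) = bounded_partition_fps c N"
proof (rule fps_ext)
  fix n
  have "bounded_partition_fps c (Suc N) * (1 - fps_const (c (Suc N)) * fps_X ^ Suc N)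
    = bounded_partition_fps c (Suc N) - fps_X ^ Suc N * (fps_const (c (Suc N)) * bounded_partition_fps c (Suc N))"
    by (simp add: algebra_simps)
  then show "fps_nth (bounded_partition_fps c (Suc N) * (1 - fps_const (c (Suc N)) * fps_X ^ Suc N)) n
      = fps_nth (bounded_partition_fps c N) n"
    using bounded_partition_fps_nth_Suc[of c N n]
    by (simp add: fps_X_power_mult_nth not_less del: power_Suc)
qed

lemma bounded_partition_fps_0: "bounded_partition_fps c 0 = 1"
  by (rule fps_ext) (simp add: bounded_partition_fps_def bounded_partitions_0 part_weight_def)

text \<open>The partial products decrease to a convergent infinite product with nonzero factors, so
  their limit is a positive lower bound.\<close>

lemma prod_one_minus_power_ge:
  fixes r :: real
  assumes "0 < r" "r < 1"
  shows "\<exists>C>0. \<forall>N. (\<Prod>k<N. 1 - r ^ Suc k) \<ge> C"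
proof -
  define f where "f = (\<lambda>k. 1 - r ^ Suc k)"
  have "summable (\<lambda>k. norm (f k - 1))"
    unfolding f_def using assms summable_mult[OF summable_geometric[of r], of r] by simp
  then have "convergent_prod f"
    by (intro abs_convergent_prod_imp_convergent_prod summable_imp_abs_convergent_prod)
  then have hp: "f has_prod prodinf f" by (rule convergent_prod_has_prod)
  have f: "0 < f k" "f k \<le> 1" for k
    using assms power_less_one_iff[of r "Suc k"] by (auto simp: f_def simp del: power_Suc)
  have nz: "prodinf f \<noteq> 0"
    using has_prod_eq_0_iff[OF hp] f(1) by (metis less_irrefl imageE)
  have lim: "(\<lambda>N. \<Prod>k\<le>N. f k) \<longlonglongrightarrow> prodinf f"
    by (rule has_prod_imp_tendsto[OF hp])
  have dec: "decseq (\<lambda>N. \<Prod>k\<le>N. f k)"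
    using f by (intro decseq_SucI) (simp add: mult_right_le_one_le prod_nonneg less_imp_le)
  have ge: "prodinf f \<le> (\<Prod>k\<le>N. f k)" for N
    by (rule decseq_ge[OF dec lim])
  have "prodinf f \<ge> 0"
    by (rule LIMSEQ_le_const[OF lim]) (simp add: prod_nonneg less_imp_le[OF f(1)])
  then have "prodinf f > 0" using nz by simp
  moreover have "prodinf f \<le> (\<Prod>k<N. f k)" for N
  proof -
    have "prodinf f \<le> (\<Prod>k<N. f k) * f N" using ge[of N] by (simp flip: lessThan_Suc_atMost)
    also have "\<dots> \<le> (\<Prod>k<N. f k)" using f by (intro mult_right_le_one_le prod_nonneg) (auto intro: less_imp_le)
    finally show ?thesis .
  qed
  ultimately show ?thesis unfolding f_def by blast
qed

text \<open>Allowing the part N + 1 gives a(N+1) <= a(N) + r^(N+1) a(N+1) for the weighted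
  coefficient sums. Multiplying by 1 - r^(N+1) instead of dividing keeps the induction free of
  inverses.\<close>

lemma bounded_partition_fps_sum_le:
  assumes c: "\<And>k. norm (c k) \<le> 1" and r: "0 < r" "r < 1"
  shows "(\<Sum>n\<le>M. norm (fps_nth (bounded_partition_fps c N) n) * r ^ n) * (\<Prod>k<N. 1 - r ^ Suc k) \<le> 1"
proof (induction N)
  case 0
  have "(\<Sum>n\<le>M. norm (fps_nth (1 :: complex fps) n) * r ^ n) = (\<Sum>n\<in>{0::nat}. 1)"
    by (rule sum.mono_neutral_cong_right) auto
  then show ?case by (simp add: bounded_partition_fps_0)
next
  case (Suc N)
  let ?a = "\<lambda>N n. norm (fps_nth (bounded_partition_fps c N) n) * r ^ n"
  have pos: "?a N n \<ge> 0" for N n using r by simp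
  have step: "?a (Suc N) n \<le> ?a N n + (if n < Suc N then 0 else r ^ Suc N * ?a (Suc N) (n - Suc N))" for n
  proof (cases "n < Suc N")
    case False
    then have e: "r ^ n = r ^ Suc N * r ^ (n - Suc N)" by (metis power_add le_add_diff_inverse not_less)
    have "norm (fps_nth (bounded_partition_fps c (Suc N)) n) \<le> norm (fps_nth (bounded_partition_fps c N) n)
        + norm (c (Suc N)) * norm (fps_nth (bounded_partition_fps c (Suc N)) (n - Suc N))"
      using norm_triangle_ineq[of "fps_nth (bounded_partition_fps c N) n" "c (Suc N) * fps_nth (bounded_partition_fps c (Suc N)) (n - Suc N)"] False
      by (simp add: bounded_partition_fps_nth_Suc[of c N n] norm_mult)
    also have "\<dots> \<le> norm (fps_nth (bounded_partition_fps c N) n)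
        + 1 * norm (fps_nth (bounded_partition_fps c (Suc N)) (n - Suc N))"
      by (intro add_left_mono mult_right_mono c) auto
    finally have "?a (Suc N) n \<le> (norm (fps_nth (bounded_partition_fps c N) n)
        + 1 * norm (fps_nth (bounded_partition_fps c (Suc N)) (n - Suc N))) * r ^ n"
      using r by (intro mult_right_mono) auto
    also have "\<dots> = ?a N n + r ^ Suc N * ?a (Suc N) (n - Suc N)"
      unfolding e by (simp only: distrib_left distrib_right mult_1 mult_ac)
    finally show ?thesis using False by simp
  qed (simp add: bounded_partition_fps_nth_Suc[of c N n])
  have "(\<Sum>n\<le>M. ?a (Suc N) n) \<le>
      (\<Sum>n\<le>M. ?a N n) + (\<Sum>n\<le>M. if n < Suc N then 0 else r ^ Suc N * ?a (Suc N) (n - Suc N))"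
    unfolding sum.distrib[symmetric] by (intro sum_mono step)
  also have "(\<Sum>n\<le>M. if n < Suc N then 0 else r ^ Suc N * ?a (Suc N) (n - Suc N)) =
      (\<Sum>n | n \<le> M \<and> \<not> n < Suc N. r ^ Suc N * ?a (Suc N) (n - Suc N))"
    by (rule sum.mono_neutral_cong_right) auto
  also have "\<dots> = (\<Sum>n\<in>(\<lambda>n. n - Suc N) ` {n. n \<le> M \<and> \<not> n < Suc N}. r ^ Suc N * ?a (Suc N) n)"
    by (subst sum.reindex) (auto simp: inj_on_def)
  also have "\<dots> \<le> (\<Sum>n\<le>M. r ^ Suc N * ?a (Suc N) n)"
    using r by (intro sum_mono2) auto
  also have "\<dots> = r ^ Suc N * (\<Sum>n\<le>M. ?a (Suc N) n)"
    by (rule sum_distrib_left[symmetric])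
  finally have "(\<Sum>n\<le>M. ?a (Suc N) n) \<le> (\<Sum>n\<le>M. ?a N n) + r ^ Suc N * (\<Sum>n\<le>M. ?a (Suc N) n)"
    by (simp only: add_left_mono)
  then have "(\<Sum>n\<le>M. ?a (Suc N) n) * (1 - r ^ Suc N) \<le> (\<Sum>n\<le>M. ?a N n)"
    by (simp only: right_diff_distrib mult_1_right mult.commute[of _ "r ^ Suc N"] diff_le_eq)
  moreover have "r ^ Suc k \<le> 1" for k using r by (intro power_le_one) auto
  then have "(\<Prod>k<N. 1 - r ^ Suc k) \<ge> 0"
    by (intro prod_nonneg) (simp del: power_Suc)
  ultimately have "(\<Sum>n\<le>M. ?a (Suc N) n) * (1 - r ^ Suc N) * (\<Prod>k<N. 1 - r ^ Suc k) \<le> (\<Sum>n\<le>M. ?a N n) * (\<Prod>k<N. 1 - r ^ Suc k)"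
    by (rule mult_right_mono)
  also have "\<dots> \<le> 1" by (rule Suc.IH)
  finally show ?case by (simp only: prod.lessThan_Suc mult_ac)
qed

text \<open>The product enters through its limit L, since the weights used for the crank change at a
  part size w and the product is then not a single (a;q).\<close>

lemma eval_partition_fps:
  assumes c: "\<And>k. norm (c k) \<le> 1"
  shows "fps_conv_radius (partition_fps c) \<ge> 1"
    and "norm q < 1 \<Longrightarrow> (\<lambda>N. \<Prod>k<N. 1 - c (Suc k) * q ^ Suc k) \<longlonglongrightarrow> L \<Longrightarrow> eval_fps (partition_fps c) q * L = 1"
proof -
  define F where "F = bounded_partition_fps c"
  have b: "\<exists>C. \<forall>N n. norm (fps_nth (F N) n) * r ^ n \<le> C" if r: "0 < r" "r < 1" for r
  proof -
    obtain C where C: "C > 0" "\<And>N. (\<Prod>k<N. 1 - r ^ Suc k) \<ge> C"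
      using prod_one_minus_power_ge[OF r] by blast
    have "norm (fps_nth (F N) n) * r ^ n \<le> 1 / C" for N n
    proof -
      have "norm (fps_nth (F N) n) * r ^ n \<le> (\<Sum>n\<le>n. norm (fps_nth (F N) n) * r ^ n)"
        using r by (intro member_le_sum) auto
      then have "norm (fps_nth (F N) n) * r ^ n * C \<le> (\<Sum>n\<le>n. norm (fps_nth (F N) n) * r ^ n) * (\<Prod>k<N. 1 - r ^ Suc k)"
        using r C by (intro mult_mono sum_nonneg) auto
      also have "\<dots> \<le> 1"
        unfolding F_def by (rule bounded_partition_fps_sum_le[OF c r])
      finally show ?thesis using C(1) by (simp add: field_simps)
    qed
    then show ?thesis by blast
  qed
  have stable: "fps_nth (F N) n = fps_nth (partition_fps c) n" if "n \<le> N" for N n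
    using that by (simp add: F_def partition_fps_def bounded_partition_fps_def bounded_partitions_eq)
  note lim = eval_fps_limit[of F "partition_fps c", OF b stable]
  show "fps_conv_radius (partition_fps c) \<ge> 1" by (rule lim(2))
  assume q: "norm q < 1" and L: "(\<lambda>N. \<Prod>k<N. 1 - c (Suc k) * q ^ Suc k) \<longlonglongrightarrow> L"
  have "eval_fps (F N) q * (\<Prod>k<N. 1 - c (Suc k) * q ^ Suc k) = 1" for N
  proof (induction N)
    case (Suc N)
    have R: "ereal (norm q) < fps_conv_radius (F (Suc N))"
      using q lim(1) less_le_trans[of "ereal (norm q)" 1] by simp
    define T :: "complex fps" where "T = fps_const (c (Suc N)) * fps_X ^ Suc N"
    have T: "fps_conv_radius T = \<infinity>" "fps_conv_radius (1 - T) = \<infinity>"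
    proof -
      show "fps_conv_radius T = \<infinity>"
        using fps_conv_radius_mult[of "fps_const (c (Suc N))" "fps_X ^ Suc N"] by (simp add: T_def del: power_Suc)
      then show "fps_conv_radius (1 - T) = \<infinity>"
        using fps_conv_radius_diff[of 1 T] by simp
    qed
    have "eval_fps T q = c (Suc N) * q ^ Suc N"
      unfolding T_def by (subst eval_fps_mult) (simp_all del: power_Suc)
    then have "eval_fps (1 - T) q = 1 - c (Suc N) * q ^ Suc N"
      by (subst eval_fps_diff) (simp_all add: T)
    then have "eval_fps (F (Suc N)) q * (1 - c (Suc N) * q ^ Suc N) = eval_fps (F N) q"
      unfolding F_def bounded_partition_fps_Suc[of c N, symmetric] T_def[symmetric]
      by (subst eval_fps_mult) (use R T in \<open>simp_all add: F_def del: power_Suc\<close>)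
    then show ?case using Suc by (metis (no_types, lifting) mult.assoc mult.commute prod.lessThan_Suc)
  qed (simp add: F_def bounded_partition_fps_0)
  moreover have "(\<lambda>N. eval_fps (F N) q * (\<Prod>k<N. 1 - c (Suc k) * q ^ Suc k)) \<longlonglongrightarrow> eval_fps (partition_fps c) q * L"
    by (intro tendsto_mult lim(3) q L)
  ultimately show "eval_fps (partition_fps c) q * L = 1"
    by (simp add: LIMSEQ_const_iff)
qed

section \<open>The crank series\<close>

text \<open>The coefficient recursion amounts to (1 - x) g(x) = (1 - a x) g(x q). Iteration moves
  the argument to 0, where g is continuous with g(0) = 1.\<close>

lemma suminf_q_binomial:
  fixes a q t :: complex
  assumes q: "norm q < 1" and t: "norm t < 1"
  defines "u \<equiv> \<lambda>w. (\<Prod>k<w. (1 - a * q ^ k) / (1 - q ^ Suc k))"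
  shows "summable (\<lambda>w. u w * t ^ w)" "(\<Sum>w. u w * t ^ w) = qp (a * t) q / qp t q"
proof -
  have ratio: "u (Suc w) * x ^ Suc w = (1 - a * q ^ w) / (1 - q * q ^ w) * x * (u w * x ^ w)" for w x
    by (simp add: u_def)
  have sm: "summable (\<lambda>w. u w * x ^ w)" if x: "norm x < 1" for x
  proof (rule summable_of_ratio_tendsto)
    show "u (Suc w) * x ^ Suc w = (1 - a * q ^ w) / (1 - q * q ^ w) * x * (u w * x ^ w)" for w
      by (rule ratio)
    have "(\<lambda>n. q ^ n) \<longlonglongrightarrow> 0"
      using q by (rule LIMSEQ_power_zero)
    then show "(\<lambda>w. (1 - a * q ^ w) / (1 - q * q ^ w) * x) \<longlonglongrightarrow> (1 - a * 0) / (1 - q * 0) * x"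
      by (intro tendsto_mult tendsto_divide tendsto_diff tendsto_const) auto
  qed (use x in simp)
  then show "summable (\<lambda>w. u w * t ^ w)" using t by blast
  define g where "g = (\<lambda>x. \<Sum>w. u w * x ^ w)"
  have fe: "(1 - x) * g x = (1 - a * x) * g (x * q)" if x: "norm x < 1" for x
  proof -
    have xq: "norm (x * q) < 1"
      using x q mult_strict_mono[of "norm x" 1 "norm q" 1] by (simp add: norm_mult)
    have "g x - g (x * q) = (\<Sum>w. u w * x ^ w - u w * (x * q) ^ w)"
      unfolding g_def by (intro suminf_diff sm x xq)
    also have "\<dots> = (\<Sum>w. u (Suc w) * x ^ Suc w - u (Suc w) * (x * q) ^ Suc w)"
      by (subst suminf_split_head) (auto intro!: summable_diff sm x xq)
    also have "(\<lambda>w. u (Suc w) * x ^ Suc w - u (Suc w) * (x * q) ^ Suc w) =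
               (\<lambda>w. x * (u w * x ^ w) - a * x * (u w * (x * q) ^ w))"
    proof
      fix w
      have "u (Suc w) * x ^ Suc w - u (Suc w) * (x * q) ^ Suc w = u (Suc w) * (1 - q ^ Suc w) * x ^ Suc w"
        unfolding power_mult_distrib by (simp add: algebra_simps)
      also have "u (Suc w) * (1 - q ^ Suc w) = u w * (1 - a * q ^ w)"
        using power_Suc_neq_1[OF q, of w] by (simp add: u_def)
      finally show "u (Suc w) * x ^ Suc w - u (Suc w) * (x * q) ^ Suc w = x * (u w * x ^ w) - a * x * (u w * (x * q) ^ w)"
        by (simp add: algebra_simps)
    qed
    also have "suminf \<dots> = x * g x - a * x * g (x * q)"
      unfolding g_def using sm[OF x] sm[OF xq]
      by (simp add: suminf_diff[symmetric] suminf_mult summable_mult)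
    finally show ?thesis by (simp add: algebra_simps)
  qed
  have iter: "(\<Prod>k<N. 1 - t * q ^ k) * g t = (\<Prod>k<N. 1 - a * t * q ^ k) * g (t * q ^ N)" for N
  proof (induction N)
    case (Suc N)
    have "norm t * norm q ^ N \<le> norm t * 1"
      using q by (intro mult_left_mono power_le_one) auto
    then have "norm (t * q ^ N) < 1"
      using t by (simp add: norm_mult norm_power)
    note f = fe[OF this]
    have "(\<Prod>k<Suc N. 1 - t * q ^ k) * g t = (1 - t * q ^ N) * ((\<Prod>k<N. 1 - t * q ^ k) * g t)"
      by (simp add: mult_ac)
    also have "\<dots> = (\<Prod>k<N. 1 - a * t * q ^ k) * ((1 - t * q ^ N) * g (t * q ^ N))"
      unfolding Suc by (rule mult.left_commute)
    also have "\<dots> = (\<Prod>k<Suc N. 1 - a * t * q ^ k) * g (t * q ^ Suc N)"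
      unfolding f by (simp add: mult_ac)
    finally show ?case .
  qed simp
  have "isCont g 0"
    unfolding g_def using sm[of "1/2"] by (intro isCont_powser[where K = "1/2"]) auto
  moreover have "(\<lambda>N. t * q ^ N) \<longlonglongrightarrow> 0"
    using tendsto_mult[OF tendsto_const LIMSEQ_power_zero[OF q], of t] by simp
  ultimately have "(\<lambda>N. g (t * q ^ N)) \<longlonglongrightarrow> g 0"
    by (rule isCont_tendsto_compose)
  moreover have "g 0 = 1"
    by (simp add: g_def u_def)
  ultimately have "(\<lambda>N. (\<Prod>k<N. 1 - a * t * q ^ k) * g (t * q ^ N)) \<longlonglongrightarrow> qp (a * t) q * 1"
    by (intro tendsto_mult qp_tendsto q) simp
  moreover have "(\<lambda>N. (\<Prod>k<N. 1 - t * q ^ k) * g t) \<longlonglongrightarrow> qp t q * g t"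
    by (intro tendsto_mult qp_tendsto q tendsto_const)
  ultimately have "qp t q * g t = qp (a * t) q"
    using LIMSEQ_unique unfolding iter by fastforce
  then show "(\<Sum>w. u w * t ^ w) = qp (a * t) q / qp t q"
    using qp_nonzero[OF q t] by (simp add: g_def field_simps)
qed

abbreviation qp_deriv :: "complex \<Rightarrow> complex \<Rightarrow> complex" where
  "qp_deriv x q \<equiv> deriv (\<lambda>x. qp x q) x"

text \<open>This is t d/dt of the q-binomial theorem; the factor w it produces will count the
  ones.\<close>

lemma sums_q_binomial_derivative:
  fixes a q t :: complex
  assumes q: "norm q < 1" and t: "norm t < 1"
  defines "u \<equiv> \<lambda>w. (\<Prod>k<w. (1 - a * q ^ k) / (1 - q ^ Suc k))"
  shows "(\<lambda>w. of_nat w * u w * t ^ w) sums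
    (t * (a * qp_deriv (a * t) q * qp t q - qp (a * t) q * qp_deriv t q) / (qp t q)\<^sup>2)"
proof -
  define K where "K = complex_of_real ((1 + norm t) / 2)"
  have nK: "norm K = (1 + norm t) / 2" unfolding K_def by (simp only: norm_of_real) simp
  have K: "norm t < norm K" "norm K < 1"
    using t by (simp_all add: nK)
  have sm: "summable (\<lambda>w. u w * x ^ w)" if "norm x < 1" for x
    unfolding u_def using suminf_q_binomial(1)[OF q that] .
  have D: "((\<lambda>x. \<Sum>w. u w * x ^ w) has_field_derivative (\<Sum>w. diffs u w * t ^ w)) (at t)"
    by (rule termdiffs_strong[OF sm[OF K(2)] K(1)])
  have D2: "((\<lambda>x. qp (a * x) q / qp x q) has_field_derivative
      (a * qp_deriv (a * t) q * qp t q - qp (a * t) q * qp_deriv t q) / (qp t q)\<^sup>2) (at t)"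
  proof -
    have 1: "((\<lambda>x. qp (a * x) q) has_field_derivative a * qp_deriv (a * t) q) (at t)"
      by (rule qp_DERIV_chain[OF q]) (auto intro!: derivative_eq_intros)
    show ?thesis
      by (rule DERIV_divide[THEN DERIV_cong, OF 1 qp_has_field_derivative[OF q] qp_nonzero[OF q t]])
        (simp add: power2_eq_square mult_ac)
  qed
  have "(\<Sum>w. diffs u w * t ^ w) = (a * qp_deriv (a * t) q * qp t q - qp (a * t) q * qp_deriv t q) / (qp t q)\<^sup>2"
  proof (rule has_field_derivative_cong_open[OF D D2])
    show "open (ball (0::complex) 1)" "t \<in> ball 0 1" using t by auto
    show "(\<Sum>w. u w * y ^ w) = qp (a * y) q / qp y q" if "y \<in> ball 0 1" for y
      unfolding u_def using that by (intro suminf_q_binomial(2)[OF q]) simp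
  qed
  moreover have "summable (\<lambda>w. diffs u w * t ^ w)"
  proof (rule termdiff_converges[where K = 1])
    show "summable (\<lambda>n. u n * x ^ n)" if "norm x < 1" for x using sm that .
  qed (use t in auto)
  then have "(\<lambda>w. of_nat w * u w * t ^ (w - Suc 0)) sums (\<Sum>w. diffs u w * t ^ w)"
    by (rule diffs_equiv)
  from sums_mult[OF this, of t] have "(\<lambda>w. t * (of_nat w * u w * t ^ (w - Suc 0))) sums (t * (\<Sum>w. diffs u w * t ^ w))" .
  moreover have "(\<lambda>w. t * (of_nat w * u w * t ^ (w - Suc 0))) = (\<lambda>w. of_nat w * u w * t ^ w)"
  proof
    show "t * (of_nat w * u w * t ^ (w - Suc 0)) = of_nat w * u w * t ^ w" for w
      by (cases w) auto
  qed
  ultimately show ?thesis by simp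
qed

text \<open>The generating function of \<open>\<omega>(\<pi>) z\<^bsup>crank \<pi>\<^esup>\<close>, by the \<open>q\<close>-binomial theorem at \<open>t = q / z\<close>.\<close>
definition crank_ones_series :: "complex \<Rightarrow> complex \<Rightarrow> complex" where
  "crank_ones_series z q = (1 - q) / qp (z * q) q *
     ((q\<^sup>2 * qp_deriv (q\<^sup>2) q * qp (q / z) q - q / z * qp (q\<^sup>2) q * qp_deriv (q / z) q) / (qp (q / z) q)\<^sup>2)"

text \<open>The terms with the derivative at q^2 are symmetric under z -> 1/z and cancel. What
  remains is the derivative of (z q;q)(q/z;q), that is, of theta with its factor 1 - z removed;
  restoring that factor produces the term z/theta(z).\<close>

lemma crank_ones_series_diff:
  assumes q: "0 < norm q" "norm q < 1" and z: "norm z = 1" "z \<noteq> 1"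
  shows "crank_ones_series z q - crank_ones_series (1 / z) q =
    (qp q q)\<^sup>2 * ((1 - z) * (z * deriv (\<lambda>x. theta x q) z) / (theta z q)\<^sup>2 + z / theta z q)"
proof -
  have z0: "z \<noteq> 0" using z by auto
  define P \<alpha> \<beta> d\<alpha> d\<beta> where defs: "P = qp q q" "\<alpha> = qp (z * q) q" "\<beta> = qp (q / z) q"
    "d\<alpha> = qp_deriv (z * q) q" "d\<beta> = qp_deriv (q / z) q"
  have nz: "P \<noteq> 0" "\<alpha> \<noteq> 0" "\<beta> \<noteq> 0"
    unfolding defs by (rule qp_nonzero; use q z in \<open>simp add: norm_mult norm_divide\<close>)+
  have P: "P = (1 - q) * qp (q\<^sup>2) q"
    unfolding defs using qp_rec[OF q(2), of q] by (simp add: power2_eq_square)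
  define g where "g = (\<lambda>x. qp q q * qp (x * q) q * qp (q / x) q)"
  have T: "theta x q = (1 - x) * g x" if "x \<noteq> 0" for x
    using that qp_rec[OF q(2), of x] by (simp add: g_def jacobi_triple_product[OF q])
  have Dg: "(g has_field_derivative (P * (q * d\<alpha> * \<beta> - q / z\<^sup>2 * \<alpha> * d\<beta>))) (at z)"
  proof -
    have 1: "((\<lambda>x. qp (x * q) q) has_field_derivative d\<alpha> * q) (at z)"
      by (rule qp_DERIV_chain[OF q(2)]) (auto intro!: derivative_eq_intros simp: defs)
    have 2: "((\<lambda>x. qp (q / x) q) has_field_derivative d\<beta> * (- q / z\<^sup>2)) (at z)"
      by (rule qp_DERIV_chain[OF q(2)]) (use z0 in \<open>auto intro!: derivative_eq_intros simp: defs power2_eq_square\<close>)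
    show ?thesis unfolding g_def
      by (rule derivative_eq_intros 1 2 refl)+ (simp add: defs algebra_simps)
  qed
  have "((\<lambda>x. (1 - x) * g x) has_field_derivative (- g z + (1 - z) * (P * (q * d\<alpha> * \<beta> - q / z\<^sup>2 * \<alpha> * d\<beta>)))) (at z)"
    by (rule derivative_eq_intros Dg refl)+ simp
  then have "((\<lambda>x. theta x q) has_field_derivative (- g z + (1 - z) * (P * (q * d\<alpha> * \<beta> - q / z\<^sup>2 * \<alpha> * d\<beta>)))) (at z)"
    by (rule has_field_derivative_transform_within_open[where S = "- {0}"]) (use z0 T in auto)
  then have dT: "deriv (\<lambda>x. theta x q) z = - (P * \<alpha> * \<beta>) + (1 - z) * (P * (q * d\<alpha> * \<beta> - q / z\<^sup>2 * \<alpha> * d\<beta>))"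
    by (simp add: DERIV_imp_deriv g_def defs)
  define A B where "A = q * z * d\<alpha>" and "B = q / z * d\<beta>"
  have zdT: "z * deriv (\<lambda>x. theta x q) z = - z * (P * \<alpha> * \<beta>) + (1 - z) * (P * (A * \<beta> - \<alpha> * B))"
    unfolding dT A_def B_def using z0 by (simp add: field_simps power2_eq_square)
  have Tz: "theta z q = (1 - z) * (P * \<alpha> * \<beta>)"
    using T[OF z0] by (simp add: g_def defs)
  define \<delta> p2 where "\<delta> = q\<^sup>2 * qp_deriv (q\<^sup>2) q" and "p2 = qp (q\<^sup>2) q"
  have E1: "crank_ones_series z q = (1 - q) / \<alpha> * ((\<delta> * \<beta> - p2 * B) / \<beta>\<^sup>2)"
    by (simp add: crank_ones_series_def defs B_def \<delta>_def p2_def mult_ac)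
  have E2: "crank_ones_series (1 / z) q = (1 - q) / \<beta> * ((\<delta> * \<alpha> - p2 * A) / \<alpha>\<^sup>2)"
    using z0 by (simp add: crank_ones_series_def defs A_def \<delta>_def p2_def mult_ac)
  have "crank_ones_series z q - crank_ones_series (1 / z) q = ((1 - q) * p2) * (A * \<beta> - \<alpha> * B) / (\<alpha>\<^sup>2 * \<beta>\<^sup>2)"
    unfolding E1 E2 using nz by (simp add: field_simps power2_eq_square)
  also have "\<dots> = P * (A * \<beta> - \<alpha> * B) / (\<alpha>\<^sup>2 * \<beta>\<^sup>2)"
    using P by (simp add: p2_def)
  also have "\<dots> = P\<^sup>2 * ((1 - z) * (- z * (P * \<alpha> * \<beta>) + (1 - z) * (P * (A * \<beta> - \<alpha> * B))) / ((1 - z) * (P * \<alpha> * \<beta>))\<^sup>2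
      + z / ((1 - z) * (P * \<alpha> * \<beta>)))"
  proof -
    define s U where "s = P * \<alpha> * \<beta>" and "U = A * \<beta> - \<alpha> * B"
    have s: "s \<noteq> 0" "1 - z \<noteq> 0" using nz z by (auto simp: s_def)
    have "(1 - z) * (- z * s + (1 - z) * (P * U)) / ((1 - z) * s)\<^sup>2 + z / ((1 - z) * s) = P * U / s\<^sup>2"
      using s by (simp add: power2_eq_square divide_simps)
    moreover have "P * U / (\<alpha>\<^sup>2 * \<beta>\<^sup>2) = P\<^sup>2 * (P * U / s\<^sup>2)"
      using nz by (simp add: s_def power2_eq_square field_simps)
    ultimately show ?thesis by (simp only: s_def U_def)
  qed
  finally show ?thesis unfolding zdT Tz defs(1) .
qed

lemma qp_fifth_roots:
  assumes \<omega>: "\<omega> ^ 5 = 1" "\<omega> \<noteq> 1" and q: "norm q < 1"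
  shows "(\<Prod>j<5. qp (\<omega> ^ j * s) q) = qp (s ^ 5) (q ^ 5)"
proof (rule LIMSEQ_unique)
  show "(\<lambda>N. \<Prod>j<5. \<Prod>k<N. 1 - \<omega> ^ j * s * q ^ k) \<longlonglongrightarrow> (\<Prod>j<5. qp (\<omega> ^ j * s) q)"
    by (intro tendsto_prod qp_tendsto q)
  have "(\<Prod>j<5. \<Prod>k<N. 1 - \<omega> ^ j * s * q ^ k) = (\<Prod>k<N. 1 - s ^ 5 * (q ^ 5) ^ k)" for N
  proof -
    have "(\<Prod>j<5. \<Prod>k<N. 1 - \<omega> ^ j * s * q ^ k) = (\<Prod>k<N. \<Prod>j<5. 1 - \<omega> ^ j * (s * q ^ k))"
      by (subst prod.swap) (simp add: mult.assoc)
    also have "\<dots> = (\<Prod>k<N. 1 - (s * q ^ k) ^ 5)"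
      by (simp only: prod_fifth_roots[OF \<omega>])
    finally show ?thesis
      by (simp add: power_mult_distrib mult.commute flip: power_mult)
  qed
  moreover have "norm (q ^ 5) < 1" using q by (simp add: norm_power power_less_one_iff)
  ultimately show "(\<lambda>N. \<Prod>j<5. \<Prod>k<N. 1 - \<omega> ^ j * s * q ^ k) \<longlonglongrightarrow> qp (s ^ 5) (q ^ 5)"
    using qp_tendsto[of "q ^ 5" "s ^ 5"] by simp
qed

text \<open>Together the two product forms contain (z^j q;q) for j = 1, ..., 4 and two factors
  (q;q); one of these completes the four to (q^5;q^5).\<close>

lemma theta_fifth_root_mult:
  assumes z: "z ^ 5 = 1" "z \<noteq> 1" and q: "0 < norm q" "norm q < 1"
  shows "theta z q * theta (z\<^sup>2) q = (1 - z) * (1 - z\<^sup>2) * qp q q * qp (q ^ 5) (q ^ 5)"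
proof -
  have z0: "z \<noteq> 0" using z by auto
  have inv: "q / z = z ^ 4 * q" "q / z\<^sup>2 = z ^ 3 * q"
  proof -
    have "z ^ 4 * z = 1" "z ^ 3 * z\<^sup>2 = 1" using z(1) by (simp_all flip: power_Suc2 power_add)
    then show "q / z = z ^ 4 * q" "q / z\<^sup>2 = z ^ 3 * q" using z0 by (simp_all add: field_simps)
  qed
  have "theta z q = qp q q * ((1 - z) * qp (z * q) q) * qp (z ^ 4 * q) q"
    using jacobi_triple_product[OF q z0] qp_rec[OF q(2), of z] by (simp add: inv)
  moreover have "theta (z\<^sup>2) q = qp q q * ((1 - z\<^sup>2) * qp (z\<^sup>2 * q) q) * qp (z ^ 3 * q) q"
    using jacobi_triple_product[OF q, of "z\<^sup>2"] qp_rec[OF q(2), of "z\<^sup>2"] z0 by (simp add: inv)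
  moreover have "qp q q * qp (z * q) q * qp (z\<^sup>2 * q) q * qp (z ^ 3 * q) q * qp (z ^ 4 * q) q = qp (q ^ 5) (q ^ 5)"
    using qp_fifth_roots[OF z q(2), of q] by (simp add: lessThan_Suc numeral_eq_Suc[of "Num.Bit1 (Num.Bit0 Num.One)"] mult_ac eval_nat_numeral)
  ultimately show ?thesis by (simp add: mult_ac)
qed

section \<open>The crank series at a fifth root of unity\<close>

context quintic_nome
begin

text \<open>The exponents tri(b) for b = -2, ..., 2 are 3, 1, 0, 0, 1, so the residues 2 and 4 do
  not occur.\<close>

lemma theta_root_split:
  assumes q: "q ^ 5 = Y" and z: "z \<noteq> 0"
  shows "theta z q = theta (z ^ 5 * Y\<^sup>2) Q - z * theta (z ^ 5 * Y ^ 3) Q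
    + q * (z\<^sup>2 * theta (z ^ 5 * Y ^ 4) Q - theta (z ^ 5 * Y) Q / z) + q ^ 3 * theta (z ^ 5) Q / z\<^sup>2"
proof -
  note q0 = nome_power_less_1(1)[OF q] and qn = nome_power_less_1(2)[OF q]
  have "q ^ 25 = (q ^ 5) ^ 5" by (simp flip: power_mult)
  then have Q25: "q ^ 25 = Q" by (simp only: q Q_def)
  have "q ^ 10 = (q ^ 5)\<^sup>2" "q ^ 15 = (q ^ 5) ^ 3" "q ^ 20 = (q ^ 5) ^ 4"
    by (simp_all flip: power_mult)
  then have Yp: "q ^ 5 = Y" "q ^ 10 = Y\<^sup>2" "q ^ 15 = Y ^ 3" "q ^ 20 = Y ^ 4"
    by (simp_all only: q)
  have t: "tri (-2) = 3" "tri (-1) = 1" "tri 2 = 1" by (simp_all add: tri_def)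
  have "theta z q = (\<Sum>b\<in>{-2..2}. (-z) powi b * q powi tri b * theta (z ^ 5 * q powi (10 + 5 * b)) (q ^ 25))"
    using q0 qn z by (intro theta_split_mod5) auto
  then show ?thesis
    unfolding sum_int_m2_2 using z
    by (simp add: t Yp Q25 power_int_minus field_simps power2_eq_square)
qed

text \<open>For z^5 = 1 the q^3 component of theta vanishes at z, being a multiple of theta(1), but
  its derivative is 5 theta'(1) = -5 (Q;Q)^3 up to a power of z. The other two coefficients stay
  existential.\<close>

lemma theta_root_deriv_split:
  assumes z: "z ^ 5 = 1"
  shows "\<exists>v0 v1. \<forall>q. q ^ 5 = Y \<longrightarrow> z * deriv (\<lambda>x. theta x q) z = v0 + v1 * q - 5 * PQ ^ 3 / z\<^sup>2 * q ^ 3"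
proof -
  have z0: "z \<noteq> 0" using z by auto
  define t where "t = (\<lambda>x. theta x Q)"
  define m where "m = (\<lambda>j. 5 * z ^ 4 * Y ^ j * deriv t (Y ^ j))"
  have D: "((\<lambda>x. t (x ^ 5 * Y ^ j)) has_field_derivative m j) (at z)" for j
    unfolding t_def by (rule theta_DERIV_chain[OF Q]) (auto intro!: derivative_eq_intros simp: z z0 m_def t_def)
  have tj: "t (Y\<^sup>2) = b" "t (Y ^ 3) = b" "t (Y ^ 4) = a" "t Y = a" "t 1 = 0"
    by (simp_all add: t_def a_def b_def theta_Y3[unfolded b_def] theta_Y4[unfolded a_def] theta_1[OF Q])
  have m0: "z * m 0 = - 5 * PQ ^ 3"
    using z deriv_theta_1[OF Q] by (simp add: m_def t_def PQ_def flip: power_Suc)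
  have "z * deriv (\<lambda>x. theta x q) z = z * (m 2 - b - z * m 3) + z * (2 * z * a + z\<^sup>2 * m 4 - (m 1 * z - a) / z\<^sup>2) * q
      - 5 * PQ ^ 3 / z\<^sup>2 * q ^ 3" if q: "q ^ 5 = Y" for q
  proof -
    note q0 = nome_power_less_1(1)[OF q] and qn = nome_power_less_1(2)[OF q]
    define f where "f = (\<lambda>z. t (z ^ 5 * Y ^ 2) - z * t (z ^ 5 * Y ^ 3)
      + q * (z\<^sup>2 * t (z ^ 5 * Y ^ 4) - t (z ^ 5 * Y ^ 1) / z) + q ^ 3 * t (z ^ 5 * Y ^ 0) / z\<^sup>2)"
    have "(f has_field_derivative (m 2 - (b + m 3 * z) + q * (2 * z * a + m 4 * z\<^sup>2 - (m 1 * z - a) / (z * z)) + q ^ 3 * m 0 / z\<^sup>2)) (at z)"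
      unfolding f_def
      by (rule derivative_eq_intros D refl z0)+ (use z0 in \<open>simp_all add: z tj power2_eq_square\<close>)
    then have "((\<lambda>x. theta x q) has_field_derivative (m 2 - (b + m 3 * z) + q * (2 * z * a + m 4 * z\<^sup>2 - (m 1 * z - a) / (z * z)) + q ^ 3 * m 0 / z\<^sup>2)) (at z)"
      by (rule has_field_derivative_transform_within_open[where S = "- {0}"])
        (use z0 theta_root_split[OF q] in \<open>auto simp: f_def t_def\<close>)
    then have dz: "deriv (\<lambda>x. theta x q) z = m 2 - (b + m 3 * z) + q * (2 * z * a + m 4 * z\<^sup>2 - (m 1 * z - a) / (z * z)) + q ^ 3 * m 0 / z\<^sup>2"
      by (rule DERIV_imp_deriv)
    have "z * deriv (\<lambda>x. theta x q) z = z * (m 2 - b - z * m 3) + z * (2 * z * a + z\<^sup>2 * m 4 - (m 1 * z - a) / z\<^sup>2) * q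
      + z * m 0 / z\<^sup>2 * q ^ 3"
      unfolding dz by (simp add: algebra_simps power2_eq_square)
    then show ?thesis unfolding m0 by simp
  qed
  then show ?thesis by blast
qed

text \<open>Replacing 1/theta(z) by a multiple of theta(z^2)/(q;q), with theta(z^2) = t0 + t1 q,
  makes everything polynomial in q. The term with the derivative contributes to residue 4 only v3
  q^3 times 2 t0 t1 q; the other term has degree at most 3.\<close>

lemma crank_dissection:
  assumes z: "z ^ 5 = 1" "z \<noteq> 1"
  shows "\<exists>e0 e1 e2 e3. \<forall>q. q ^ 5 = Y \<longrightarrow> crank_ones_series z q - crank_ones_series (1 / z) q =
    e0 + e1 * q + e2 * q\<^sup>2 + e3 * q ^ 3 + 10 * z / (1 - z\<^sup>2) * (PQ ^ 4 / PY) * q ^ 4"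
proof -
  have z0: "z \<noteq> 0" using z by auto
  have nz: "norm z = 1"
    using z(1) by (rule norm_fifth_root_of_unity)
  have zz: "1 - z \<noteq> 0" "1 - z\<^sup>2 \<noteq> 0"
    using z fifth_root_power_neq_1(1)[OF z] by auto
  obtain v0 v1 where v: "\<forall>q. q ^ 5 = Y \<longrightarrow> z * deriv (\<lambda>x. theta x q) z = v0 + v1 * q - 5 * PQ ^ 3 / z\<^sup>2 * q ^ 3"
    using theta_root_deriv_split[OF z(1)] by blast
  define v3 where "v3 = - 5 * PQ ^ 3 / z\<^sup>2"
  define t0 t1 where "t0 = (1 - z\<^sup>2) * b" and "t1 = - (z ^ 3) * (1 - z) * a"
  define c d where "c = (1 - z) / ((1 - z) * (1 - z\<^sup>2) * PY)\<^sup>2" and "d = z * PQ / ((1 - z) * (1 - z\<^sup>2) * PY)"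
  \<comment> \<open>t0 t1 contains a b = PQ PY, which removes the individual theta constants and
    leaves only the two eta-type products.\<close>
  have e4: "c * (2 * v3 * t0 * t1) = 10 * z / (1 - z\<^sup>2) * (PQ ^ 4 / PY)"
  proof -
    have "c * (2 * v3 * t0 * t1) = 10 * z * PQ ^ 3 * (a * b) / ((1 - z\<^sup>2) * PY\<^sup>2)"
    proof -
      have "U / (U * W * P)\<^sup>2 * (2 * (- 5 * R / z\<^sup>2) * (W * b) * (- (z ^ 3) * U * a)) = 10 * z * R * (a * b) / (W * P\<^sup>2)"
        if "U \<noteq> 0" "W \<noteq> 0" "P \<noteq> 0" for U W P R :: complex
        using that z0 by (simp add: field_simps eval_nat_numeral)
      then show ?thesis using zz by (simp only: c_def v3_def t0_def t1_def PY_nonzero not_False_eq_True simp_thms)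
    qed
    also have "\<dots> = 10 * z / (1 - z\<^sup>2) * (PQ ^ 4 / PY)"
      unfolding ab by (simp add: eval_nat_numeral)
    finally show ?thesis .
  qed
  have collect: "c * (A0 + A1 * q + A2 * q\<^sup>2 + A3 * q ^ 3 + A4 * q ^ 4) + d * (B0 + B1 * q + B2 * q\<^sup>2 + B3 * q ^ 3)
     = (c * A0 + d * B0) + (c * A1 + d * B1) * q + (c * A2 + d * B2) * q\<^sup>2 + (c * A3 + d * B3) * q ^ 3 + c * A4 * q ^ 4"
    for A0 A1 A2 A3 A4 B0 B1 B2 B3 q
    by (simp add: algebra_simps)
  have "crank_ones_series z q - crank_ones_series (1 / z) q =
      (c * (v0 * t0\<^sup>2 + v3 * t1\<^sup>2 * Y) + d * (x * t0)) + (c * (2 * v0 * t0 * t1 + v1 * t0\<^sup>2) + d * (x * t1 - t0)) * q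
      + (c * (v0 * t1\<^sup>2 + 2 * v1 * t0 * t1) + d * (- t1 - t0 / x)) * q\<^sup>2 + (c * (v1 * t1\<^sup>2 + v3 * t0\<^sup>2) + d * (- t1 / x)) * q ^ 3
      + 10 * z / (1 - z\<^sup>2) * (PQ ^ 4 / PY) * q ^ 4" if q: "q ^ 5 = Y" for q
  proof -
    note q0 = nome_power_less_1(1)[OF q] and qn = nome_power_less_1(2)[OF q]
    have q': "0 < norm q" using q0 by simp
    define P where "P = qp q q"
    define T where "T = theta z q"
    define T2 where "T2 = theta (z\<^sup>2) q"
    define N where "N = (1 - z) * (1 - z\<^sup>2) * PY"
    have P: "P = PQ * (x - q - q\<^sup>2 / x)" "P \<noteq> 0"
      unfolding P_def by (rule qp_dissection[OF q]) (rule qp_nonzero[OF qn qn])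
    have N: "N \<noteq> 0" using zz by (simp add: N_def)
    have TT: "T * T2 = P * N"
      using theta_fifth_root_mult[OF z q' qn] unfolding q by (simp add: T_def T2_def P_def N_def PY_def mult_ac)
    have Tnz: "T \<noteq> 0" using TT P N by auto
    have T2: "T2 = t0 + t1 * q"
    proof -
      have "z ^ 10 = (z ^ 5)\<^sup>2" by (simp flip: power_mult)
      then have e: "z ^ 10 = 1" using z(1) by simp
      have "T2 = b - z\<^sup>2 * b + q * ((z\<^sup>2)\<^sup>2 * a - a / z\<^sup>2)"
        using theta_root_split[OF q, of "z\<^sup>2"] z0
        by (simp add: T2_def e theta_Y3 theta_Y4 theta_1[OF Q] flip: a_def b_def)
      also have "a / z\<^sup>2 = z ^ 3 * a"
      proof -
        have "z ^ 3 * z\<^sup>2 = 1" using z(1) by (simp flip: power_add)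
        then show ?thesis using z0 by (simp add: field_simps)
      qed
      finally show ?thesis
        by (simp add: t0_def t1_def algebra_simps eval_nat_numeral)
    qed
    have "crank_ones_series z q - crank_ones_series (1 / z) q = P\<^sup>2 * ((1 - z) * (z * deriv (\<lambda>x. theta x q) z) / T\<^sup>2 + z / T)"
      unfolding P_def T_def by (rule crank_ones_series_diff[OF q' qn nz z(2)])
    also have "\<dots> = (1 - z) / N\<^sup>2 * (z * deriv (\<lambda>x. theta x q) z) * T2\<^sup>2 + z / N * P * T2"
    proof -
      have e: "T2 = P * N / T" using TT Tnz by (simp add: field_simps)
      show ?thesis unfolding e using N Tnz by (simp add: field_simps power2_eq_square)
    qed
    also have "\<dots> = c * ((v0 + v1 * q + v3 * q ^ 3) * (t0 + t1 * q)\<^sup>2) + d * ((x - q - q\<^sup>2 / x) * (t0 + t1 * q))"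
    proof -
      have "v0 + v1 * q - 5 * PQ ^ 3 / z\<^sup>2 * q ^ 3 = v0 + v1 * q + v3 * q ^ 3" by (simp add: v3_def)
      moreover have "(1 - z) / N\<^sup>2 = c" "z / N * (PQ * u) = d * u" for u by (simp_all add: c_def d_def N_def)
      ultimately show ?thesis unfolding v[rule_format, OF q] T2 P(1) by (simp only: mult.assoc)
    qed
    also have "(x - q - q\<^sup>2 / x) * (t0 + t1 * q) = x * t0 + (x * t1 - t0) * q + (- t1 - t0 / x) * q\<^sup>2 + (- t1 / x) * q ^ 3"
      by (simp add: algebra_simps eval_nat_numeral add_divide_distrib)
    also have "(v0 + v1 * q + v3 * q ^ 3) * (t0 + t1 * q)\<^sup>2 = (v0 * t0\<^sup>2 + v3 * t1\<^sup>2 * q ^ 5) + (2 * v0 * t0 * t1 + v1 * t0\<^sup>2) * q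
       + (v0 * t1\<^sup>2 + 2 * v1 * t0 * t1) * q\<^sup>2 + (v1 * t1\<^sup>2 + v3 * t0\<^sup>2) * q ^ 3 + 2 * v3 * t0 * t1 * q ^ 4"
      by (simp add: algebra_simps eval_nat_numeral)
    finally show ?thesis unfolding q e4[symmetric] by (simp only: collect)
  qed
  then show ?thesis by blast
qed

end

lemma crank_series_residue_4:
  assumes \<omega>: "\<omega> ^ 5 = 1" "\<omega> \<noteq> 1" and z: "z ^ 5 = 1" "z \<noteq> 1" and q: "0 < norm q" "norm q < 1"
  shows "(\<Sum>k<5. \<omega> ^ k * (crank_ones_series z (\<omega> ^ k * q) - crank_ones_series (1 / z) (\<omega> ^ k * q))) / 5
    = 10 * z / (1 - z\<^sup>2) * (qp (q ^ 25) (q ^ 25) ^ 4 / qp (q ^ 5) (q ^ 5)) * q ^ 4"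
proof -
  define Y where "Y = q ^ 5"
  have Y: "0 < norm Y" "norm Y < 1"
    using q by (auto simp: Y_def norm_power power_less_one_iff)
  interpret quintic_nome Y by unfold_locales (fact Y)+
  have "Y ^ 5 = q ^ 25" by (simp add: Y_def flip: power_mult)
  then have Q25: "Q = q ^ 25" by (simp only: Q_def)
  have "(\<omega> ^ k * q) ^ 5 = Y" for k
  proof -
    have "(\<omega> ^ k) ^ 5 = 1" using \<omega>(1) by (metis mult.commute power_mult power_one)
    then show ?thesis by (simp add: Y_def power_mult_distrib)
  qed
  moreover obtain e0 e1 e2 e3 where "\<forall>q. q ^ 5 = Y \<longrightarrow> crank_ones_series z q - crank_ones_series (1 / z) q =
    e0 + e1 * q + e2 * q\<^sup>2 + e3 * q ^ 3 + 10 * z / (1 - z\<^sup>2) * (PQ ^ 4 / PY) * q ^ 4"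
    using crank_dissection[OF z] by blast
  ultimately show ?thesis
    using fifth_root_filter[OF \<omega>, of "\<lambda>k. crank_ones_series z (\<omega> ^ k * q) - crank_ones_series (1 / z) (\<omega> ^ k * q)" e0 e1 q e2 e3
      "10 * z / (1 - z\<^sup>2) * (PQ ^ 4 / PY)"]
    by (simp only: PQ_def PY_def Q25) (simp only: Y_def)
qed

section \<open>The generating function of the ones weighted by the crank\<close>

definition crank_weight :: "complex \<Rightarrow> nat \<Rightarrow> nat \<Rightarrow> complex" where
  "crank_weight z w k = (if k \<le> 1 then 0 else if k \<le> w then 1 else z)"

lemma norm_crank_weight: "norm z = 1 \<Longrightarrow> norm (crank_weight z w k) \<le> 1"
  by (simp add: crank_weight_def)

text \<open>Describes what is left of a partition after its w ones are removed: the weight 0 forbids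
  ones, and each part above w contributes one z, so the exponent is \<mu>.\<close>

lemma part_weight_crank:
  assumes "0 \<notin># p" "w \<ge> 1"
  shows "part_weight (crank_weight z w) p = (if 1 \<in># p then 0 else z ^ size {#k \<in># p. k > w#})"
  using assms by (induction p) (auto simp: part_weight_def crank_weight_def)

text \<open>The product has factors 1 - q^k for 2 <= k <= w and 1 - z q^k for k > w. Completing the
  range of k in both leaves the w-th coefficient of the q-binomial series with a = z q.\<close>

lemma eval_crank_weight_fps:
  assumes q: "norm q < 1" and z: "norm z = 1" and w: "w \<ge> 1"
  shows "eval_fps (partition_fps (crank_weight z w)) q =
    (1 - q) / qp (z * q) q * (\<Prod>k<w. (1 - z * q * q ^ k) / (1 - q ^ Suc k))"
proof -
  define L where "L = (\<Prod>k\<in>{1..<w}. 1 - q ^ Suc k) * qp (z * q * q ^ w) q"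
  have "(\<lambda>N. \<Prod>k<N + w. 1 - crank_weight z w (Suc k) * q ^ Suc k) \<longlonglongrightarrow> L"
  proof -
    have "(\<Prod>k<N + w. 1 - crank_weight z w (Suc k) * q ^ Suc k) = (\<Prod>k\<in>{1..<w}. 1 - q ^ Suc k) * (\<Prod>k<N. 1 - (z * q * q ^ w) * q ^ k)" for N
    proof (induction N)
      case 0
      have "(\<Prod>k<w. 1 - crank_weight z w (Suc k) * q ^ Suc k) = (\<Prod>k\<in>{1..<w}. 1 - q ^ Suc k)"
        by (rule prod.mono_neutral_cong_right) (auto simp: crank_weight_def)
      then show ?case by simp
    next
      case (Suc N)
      have "crank_weight z w (Suc (N + w)) * q ^ Suc (N + w) = (z * q * q ^ w) * q ^ N"
        using w by (simp add: crank_weight_def power_add)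
      then show ?case using Suc by (simp only: add_Suc prod.lessThan_Suc mult.assoc)
    qed
    then show ?thesis
      unfolding L_def by (simp only:) (intro tendsto_mult tendsto_const qp_tendsto q)
  qed
  then have "(\<lambda>N. \<Prod>k<N. 1 - crank_weight z w (Suc k) * q ^ Suc k) \<longlonglongrightarrow> L"
    by (rule LIMSEQ_offset)
  then have e: "eval_fps (partition_fps (crank_weight z w)) q * L = 1"
    by (rule eval_partition_fps(2)[OF norm_crank_weight[OF z] q])
  have U: "(\<Prod>k<w. 1 - q ^ Suc k) \<noteq> 0"
    using power_Suc_neq_1[OF q] by (auto simp: prod_zero_iff simp del: power_Suc)
  have "norm (z * q) < 1" using q z by (simp add: norm_mult)
  then have nz: "qp (z * q) q \<noteq> 0" by (intro qp_nonzero q)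
  have "(\<Prod>k<w. 1 - q ^ Suc k) = (1 - q) * (\<Prod>k\<in>{1..<w}. 1 - q ^ Suc k)"
  proof -
    have "{..<w} = insert 0 {1..<w}" using w by auto
    then show ?thesis by simp
  qed
  then have "L * (1 - q) * (\<Prod>k<w. 1 - z * q * q ^ k) = (\<Prod>k<w. 1 - q ^ Suc k) * qp (z * q) q"
    unfolding L_def qp_split_head[OF q, of "z * q" w] by (simp add: mult_ac)
  then have "1 * ((1 - q) * (\<Prod>k<w. 1 - z * q * q ^ k)) = eval_fps (partition_fps (crank_weight z w)) q * ((\<Prod>k<w. 1 - q ^ Suc k) * qp (z * q) q)"
    unfolding e[symmetric] by (simp add: mult_ac)
  then show ?thesis
    using nz U by (simp add: prod_dividef field_simps)
qed

text \<open>Fubini for an absolutely summable double series in terms of \<open>sums\<close>, with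
  row and column sums supplied separately.\<close>

lemma sums_swap:
  fixes f :: "nat \<Rightarrow> nat \<Rightarrow> complex"
  assumes f: "\<And>w. summable (\<lambda>n. norm (f w n))" "summable (\<lambda>w. \<Sum>n. norm (f w n))"
    and r: "\<And>w. f w sums r w" "r sums s" and c: "\<And>n. (\<lambda>w. f w n) sums c n"
  shows "c sums s"
proof -
  have "(\<lambda>p. norm (case_prod f p)) summable_on UNIV \<times> UNIV"
  proof (subst Infinite_Sum.abs_summable_on_Sigma_iff, intro conjI ballI)
    show "(\<lambda>n. norm (case_prod f (w, n))) summable_on UNIV" for w
      using norm_summable_imp_summable_on[of "\<lambda>n. norm (f w n)"] f(1) by simp
    have "infsum (\<lambda>n. norm (f w n)) UNIV = (\<Sum>n. norm (f w n))" for w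
      using norm_summable_imp_has_sum[of "\<lambda>n. norm (f w n)"] f(1) by (auto intro!: infsumI)
    moreover have "(\<Sum>n. norm (f w n)) \<ge> 0" for w
      by (rule suminf_nonneg[OF f(1)]) simp
    ultimately show "(\<lambda>w. norm (infsum (\<lambda>n. norm (case_prod f (w, n))) UNIV)) summable_on UNIV"
      using norm_summable_imp_summable_on[of "\<lambda>w. \<Sum>n. norm (f w n)"] f(2) by simp
  qed
  then obtain S where S: "((\<lambda>(w, n). f w n) has_sum S) (UNIV \<times> UNIV)"
    using Infinite_Sum.abs_summable_summable summable_on_def by blast
  have "(r has_sum S) UNIV"
    by (rule has_sum_SigmaD[OF S]) (simp add: norm_summable_imp_has_sum f(1) r(1))
  then have "S = s"
    using has_sum_imp_sums r(2) sums_unique2 by blast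
  have S': "((\<lambda>(n, w). f w n) has_sum S) (UNIV \<times> UNIV)"
    using has_sum_swap[THEN iffD1, OF S] by (simp add: case_prod_unfold)
  have "((\<lambda>w. f w n) has_sum c n) UNIV" for n
  proof -
    have "(\<lambda>w. f w n) summable_on UNIV"
      using summable_on_SigmaD1[of "\<lambda>n w. f w n" UNIV "\<lambda>_. UNIV"] S' by (auto simp: summable_on_def)
    then obtain x where x: "((\<lambda>w. f w n) has_sum x) UNIV" by (auto simp: summable_on_def)
    then have "x = c n" using has_sum_imp_sums c sums_unique2 by blast
    with x show ?thesis by simp
  qed
  then have "(c has_sum S) UNIV"
    by (intro has_sum_SigmaD[OF S']) simp
  then show ?thesis
    using has_sum_imp_sums \<open>S = s\<close> by blast
qed

lemma summable_of_nat_power: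
  fixes x :: real
  assumes "0 \<le> x" "x < 1"
  shows "summable (\<lambda>m. of_nat m * x ^ m)"
proof -
  have "summable (\<lambda>w. of_nat (Suc w) * x ^ w)"
    using geometric_deriv_sums[of x] assms by (auto simp: sums_iff)
  then have "summable (\<lambda>w. x * (of_nat (Suc w) * x ^ w))"
    by (rule summable_mult)
  then have "summable (\<lambda>w. of_nat (Suc w) * x ^ Suc w)"
    by (simp only: power_Suc mult_ac)
  then show ?thesis by (rule summable_Suc_iff[THEN iffD1])
qed

definition num_partitions :: "nat \<Rightarrow> nat" where
  "num_partitions n = card (partitions n)"

lemma sums_num_partitions:
  assumes q: "norm q < 1"
  shows "(\<lambda>n. of_nat (num_partitions n) * q ^ n) sums (1 / qp q q)"
    and "summable (\<lambda>n. of_nat (num_partitions n) * norm q ^ n)"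
proof -
  have nth: "fps_nth (partition_fps (\<lambda>_. 1)) n = of_nat (num_partitions n)" for n
    by (simp add: partition_fps_def part_weight_def num_partitions_def)
  have R: "fps_conv_radius (partition_fps (\<lambda>_. 1)) \<ge> 1"
    by (rule eval_partition_fps) simp
  then have R': "ereal (norm q) < fps_conv_radius (partition_fps (\<lambda>_. 1))"
    using q less_le_trans[of "ereal (norm q)" 1] by simp
  have "(\<lambda>N. \<Prod>k<N. 1 - 1 * q ^ Suc k) \<longlonglongrightarrow> qp q q"
    using qp_tendsto[OF q, of q] by simp
  then have "eval_fps (partition_fps (\<lambda>_. 1)) q * qp q q = 1"
    by (intro eval_partition_fps(2) q) simp_all
  then have "eval_fps (partition_fps (\<lambda>_. 1)) q = 1 / qp q q"
    by (metis mult_zero_right nonzero_eq_divide_eq zero_neq_one)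
  then show "(\<lambda>n. of_nat (num_partitions n) * q ^ n) sums (1 / qp q q)"
    using sums_eval_fps[OF R'] by (simp add: nth)
  have "norm (of_nat (num_partitions n) * q ^ n) = of_nat (num_partitions n) * norm q ^ n" for n
    by (simp add: norm_mult norm_power)
  then show "summable (\<lambda>n. of_nat (num_partitions n) * norm q ^ n)"
    using norm_summable_fps[OF R'] by (simp only: nth)
qed

lemma norm_part_weight_le:
  assumes "\<And>k. norm (c k) \<le> 1"
  shows "norm (part_weight c p) \<le> 1"
proof (induction p)
  case (add k p)
  then show ?case
    using mult_mono[OF assms[of k] add.IH] by (simp add: part_weight_def norm_mult)
qed (simp add: part_weight_def)

lemma norm_partition_fps_nth_le:
  assumes "\<And>k. norm (c k) \<le> 1"
  shows "norm (fps_nth (partition_fps c) n) \<le> num_partitions n"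
  using sum_norm_le[of "partitions n" "part_weight c" "\<lambda>_. 1"] norm_part_weight_le[of c] assms
  by (simp add: partition_fps_def num_partitions_def)

text \<open>Partitions are grouped by their number w of ones. Removing these leaves a partition of n
  - w without ones that has \<mu> parts above w, so z^crank = z^(-w) z^\<mu> for w > 0. For w = 0
  the factor w makes both sides zero.\<close>

lemma sum_ones_power_crank:
  fixes z :: complex
  assumes z: "z \<noteq> 0"
  shows "(\<Sum>p\<in>partitions n. of_nat (num_ones p) * z powi partition_crank p) =
    (\<Sum>w\<le>n. of_nat w * (1 / z) ^ w * fps_nth (partition_fps (crank_weight z w)) (n - w))"
proof -
  have le: "num_ones p \<le> n" if "p \<in> partitions n" for p
  proof -
    have "num_ones p \<le> \<Sum>\<^sub># p"
      unfolding num_ones_def by (induction p) auto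
    then show ?thesis using that by (simp add: partitions_def)
  qed
  have "(\<Sum>p\<in>partitions n. of_nat (num_ones p) * z powi partition_crank p) =
    (\<Sum>w\<le>n. \<Sum>p\<in>{p\<in>partitions n. num_ones p = w}. of_nat (num_ones p) * z powi partition_crank p)"
    by (rule sum.group[symmetric]) (use le finite_partitions in auto)
  also have "\<dots> = (\<Sum>w\<le>n. of_nat w * (1 / z) ^ w * fps_nth (partition_fps (crank_weight z w)) (n - w))"
  proof (rule sum.cong[OF refl])
    fix w assume w: "w \<in> {..n}"
    show "(\<Sum>p\<in>{p\<in>partitions n. num_ones p = w}. of_nat (num_ones p) * z powi partition_crank p) =
        of_nat w * (1 / z) ^ w * fps_nth (partition_fps (crank_weight z w)) (n - w)"
    proof (cases "w = 0")
      case False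
      define R where "R = {r \<in> partitions (n - w). 1 \<notin># r}"
      have bij: "{p\<in>partitions n. num_ones p = w} = (\<lambda>r. r + replicate_mset w 1) ` R"
      proof (intro equalityI subsetI)
        fix p assume p: "p \<in> {p\<in>partitions n. num_ones p = w}"
        define r where "r = filter_mset (\<lambda>k. k \<noteq> 1) p"
        have "p = r + filter_mset (\<lambda>k. k = 1) p"
          unfolding r_def by (rule multiset_eqI) auto
        also have "filter_mset (\<lambda>k. k = 1) p = replicate_mset w 1"
          using p by (simp add: filter_eq_replicate_mset num_ones_def)
        finally have pr: "p = r + replicate_mset w 1" .
        have "\<Sum>\<^sub># p = \<Sum>\<^sub># r + w" by (subst pr) simp
        then have "r \<in> R"
          using p by (auto simp: R_def partitions_def r_def)
        with pr show "p \<in> (\<lambda>r. r + replicate_mset w 1) ` R" by blast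
      next
        fix p assume "p \<in> (\<lambda>r. r + replicate_mset w 1) ` R"
        then obtain r where r: "r \<in> R" "p = r + replicate_mset w 1" by blast
        then show "p \<in> {p\<in>partitions n. num_ones p = w}"
          using w by (auto simp: R_def partitions_def num_ones_def not_in_iff split: if_splits)
      qed
      have weight: "of_nat (num_ones (r + replicate_mset w 1)) * z powi partition_crank (r + replicate_mset w 1)
          = of_nat w * (1 / z) ^ w * part_weight (crank_weight z w) r" if r: "r \<in> R" for r
      proof -
        have o: "num_ones (r + replicate_mset w 1) = w"
          using r by (simp add: num_ones_def R_def not_in_iff)
        have f: "filter_mset (\<lambda>k. k > w) (replicate_mset w 1) = {#}"
          using False by (intro multiset_eqI) (simp add: not_less)
        have "z powi partition_crank (r + replicate_mset w 1) = z ^ size {#k \<in># r. k > w#} / z ^ w"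
          using False z by (simp add: partition_crank_def num_parts_gt_ones_def o[simplified] f[unfolded One_nat_def] power_int_diff)
        moreover have "part_weight (crank_weight z w) r = z ^ size {#k \<in># r. k > w#}"
          using r part_weight_crank[of r w z] False by (simp add: R_def partitions_def)
        ultimately show ?thesis by (simp add: o[simplified] power_divide)
      qed
      have zero: "part_weight (crank_weight z w) r = 0" if "r \<in> partitions (n - w) - R" for r
        using that part_weight_crank[of r w z] False by (auto simp: R_def partitions_def)
      have "(\<Sum>p\<in>{p\<in>partitions n. num_ones p = w}. of_nat (num_ones p) * z powi partition_crank p)
          = (\<Sum>r\<in>R. of_nat w * (1 / z) ^ w * part_weight (crank_weight z w) r)"
        unfolding bij by (subst sum.reindex) (auto simp: inj_on_def o_def simp del: One_nat_def intro!: sum.cong weight)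
      also have "\<dots> = of_nat w * (1 / z) ^ w * (\<Sum>r\<in>R. part_weight (crank_weight z w) r)"
        by (rule sum_distrib_left[symmetric])
      also have "(\<Sum>r\<in>R. part_weight (crank_weight z w) r) = (\<Sum>r\<in>partitions (n - w). part_weight (crank_weight z w) r)"
        by (rule sum.mono_neutral_left) (use zero finite_partitions in \<open>auto simp: R_def\<close>)
      finally show ?thesis by (simp add: partition_fps_def)
    qed simp
  qed
  finally show ?thesis .
qed

text \<open>Summing first over n for fixed w gives the q-binomial coefficients with a = z q and t =
  q/z, hence a t = q^2. The swap is justified by the bound w |q|^w times the generating function of
  all partitions at |q|.\<close>

theorem crank_ones_generating_function:
  assumes q: "norm q < 1" and z: "norm z = 1"
  shows "(\<lambda>n. (\<Sum>p\<in>partitions n. of_nat (num_ones p) * z powi partition_crank p) * q ^ n) sums crank_ones_series z q"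
proof -
  have z0: "z \<noteq> 0" using z by auto
  define P where "P = (\<lambda>w. partition_fps (crank_weight z w))"
  define f where "f = (\<lambda>w n. if w \<le> n then of_nat w * (1 / z) ^ w * fps_nth (P w) (n - w) * q ^ n else 0)"
  define r where "r = (\<lambda>w. of_nat w * (1 / z) ^ w * q ^ w * eval_fps (P w) q)"
  define K where "K = (\<Sum>n. of_nat (num_partitions n) * norm q ^ n)"
  have R: "ereal (norm q) < fps_conv_radius (P w)" for w
    unfolding P_def using q less_le_trans[of "ereal (norm q)" 1] eval_partition_fps(1)[OF norm_crank_weight[OF z]] by simp
  have fr: "f w sums r w" for w
  proof (subst sums_zero_iff_shift[of w, symmetric])
    have "(\<lambda>n. of_nat w * (1 / z) ^ w * q ^ w * (fps_nth (P w) n * q ^ n)) sums r w"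
      unfolding r_def by (intro sums_mult sums_eval_fps R)
    then show "(\<lambda>n. f w (n + w)) sums r w"
      by (simp add: f_def power_add mult_ac)
  qed (simp add: f_def)
  have le: "norm (f w (n + w)) \<le> of_nat w * norm q ^ w * (of_nat (num_partitions n) * norm q ^ n)" for w n
  proof -
    have "norm (f w (n + w)) = of_nat w * norm q ^ w * (norm (fps_nth (P w) n) * norm q ^ n)"
      using z by (simp add: f_def norm_mult norm_power norm_divide power_add)
    also have "\<dots> \<le> of_nat w * norm q ^ w * (of_nat (num_partitions n) * norm q ^ n)"
      unfolding P_def by (intro mult_left_mono mult_right_mono norm_partition_fps_nth_le norm_crank_weight z) auto
    finally show ?thesis .
  qed
  have sm: "summable (\<lambda>n. of_nat w * norm q ^ w * (of_nat (num_partitions n) * norm q ^ n))" for w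
    by (intro summable_mult sums_num_partitions q)
  have sf: "summable (\<lambda>n. norm (f w (n + w)))" for w
    using le by (intro summable_comparison_test'[OF sm[of w], of 0]) simp
  have sf': "summable (\<lambda>n. norm (f w n))" for w
    using sf[of w] by (simp add: summable_iff_shift[of "\<lambda>n. norm (f w n)" w])
  have total: "(\<Sum>n. norm (f w n)) \<le> of_nat w * norm q ^ w * K" for w
  proof -
    have "(\<lambda>n. norm (f w n)) sums (\<Sum>n. norm (f w (n + w)))"
      using sf[of w] by (subst sums_zero_iff_shift[of w, symmetric]) (auto simp: f_def summable_sums)
    then have "(\<Sum>n. norm (f w n)) = (\<Sum>n. norm (f w (n + w)))"
      by (rule sums_unique[symmetric])
    also have "\<dots> \<le> (\<Sum>n. of_nat w * norm q ^ w * (of_nat (num_partitions n) * norm q ^ n))"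
      by (intro suminf_le le sf sm)
    also have "\<dots> = of_nat w * norm q ^ w * K"
      unfolding K_def by (intro suminf_mult sums_num_partitions q)
    finally show ?thesis .
  qed
  have sm2: "summable (\<lambda>w. of_nat w * norm q ^ w * K)"
    using q by (intro summable_mult2 summable_of_nat_power) auto
  have f2: "summable (\<lambda>w. \<Sum>n. norm (f w n))"
  proof (rule summable_comparison_test'[OF sm2, of 0])
    have "(\<Sum>n. norm (f w n)) \<ge> 0" for w by (rule suminf_nonneg[OF sf']) simp
    then show "norm (\<Sum>n. norm (f w n)) \<le> of_nat w * norm q ^ w * K" for w
      using total[of w] by simp
  qed
  have rs: "r sums crank_ones_series z q"
  proof -
    have t: "norm (q / z) < 1" using q z by (simp add: norm_divide)
    have zq: "z * q * (q / z) = q\<^sup>2" using z0 by (simp add: power2_eq_square)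
    define u where "u = (\<lambda>w. (\<Prod>k<w. (1 - z * q * q ^ k) / (1 - q ^ Suc k)))"
    have "(\<lambda>w. of_nat w * u w * (q / z) ^ w) sums
      (q / z * (z * q * qp_deriv (q\<^sup>2) q * qp (q / z) q - qp (q\<^sup>2) q * qp_deriv (q / z) q) / (qp (q / z) q)\<^sup>2)"
      using sums_q_binomial_derivative[OF q t, of "z * q"] unfolding zq u_def .
    then have "(\<lambda>w. (1 - q) / qp (z * q) q * (of_nat w * u w * (q / z) ^ w)) sums
      ((1 - q) / qp (z * q) q * (q / z * (z * q * qp_deriv (q\<^sup>2) q * qp (q / z) q - qp (q\<^sup>2) q * qp_deriv (q / z) q) / (qp (q / z) q)\<^sup>2))"
      by (rule sums_mult)
    moreover have "(1 - q) / qp (z * q) q * (of_nat w * u w * (q / z) ^ w) = r w" for w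
    proof (cases "w = 0")
      case False
      then have "eval_fps (P w) q = (1 - q) / qp (z * q) q * u w"
        unfolding P_def u_def by (intro eval_crank_weight_fps q z) simp
      then show ?thesis by (simp add: r_def power_divide)
    qed (simp add: r_def)
    moreover have "q / z * (z * q * qp_deriv (q\<^sup>2) q * qp (q / z) q - qp (q\<^sup>2) q * qp_deriv (q / z) q)
        = q\<^sup>2 * qp_deriv (q\<^sup>2) q * qp (q / z) q - q / z * qp (q\<^sup>2) q * qp_deriv (q / z) q"
      using z0 by (simp add: right_diff_distrib power2_eq_square)
    ultimately show ?thesis
      by (simp only: crank_ones_series_def)
  qed
  have "(\<lambda>w. f w n) sums ((\<Sum>p\<in>partitions n. of_nat (num_ones p) * z powi partition_crank p) * q ^ n)" for n
  proof -
    have "(\<lambda>w. f w n) sums (\<Sum>w\<le>n. f w n)"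
      by (rule sums_finite) (auto simp: f_def)
    also have "(\<Sum>w\<le>n. f w n) = (\<Sum>p\<in>partitions n. of_nat (num_ones p) * z powi partition_crank p) * q ^ n"
      unfolding sum_ones_power_crank[OF z0] sum_distrib_right by (intro sum.cong) (auto simp: f_def P_def)
    finally show ?thesis .
  qed
  from sums_swap[OF sf' f2 fr rs this] show ?thesis .
qed

section \<open>Ranks of partitions\<close>

definition box_partitions :: "nat \<Rightarrow> nat \<Rightarrow> nat \<Rightarrow> nat multiset set" where
  "box_partitions l k n = {p \<in> partitions n. (\<forall>x\<in>#p. x \<le> l) \<and> size p \<le> k}"

lemma largest_part_le_iff: "largest_part p \<le> l \<longleftrightarrow> (\<forall>x\<in>#p. x \<le> l)"
  by (simp add: largest_part_def)

lemma largest_part_eq_Suc_iff: "largest_part p = Suc l \<longleftrightarrow> Suc l \<in># p \<and> (\<forall>x\<in>#p. x \<le> Suc l)"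
proof
  assume "largest_part p = Suc l"
  then have "Max (insert 0 (set_mset p)) = Suc l" by (simp add: largest_part_def)
  moreover have "Max (insert 0 (set_mset p)) \<in> insert 0 (set_mset p)" by (rule Max_in) auto
  moreover have "x \<le> Max (insert 0 (set_mset p))" if "x \<in># p" for x using that by (intro Max_ge) auto
  ultimately show "Suc l \<in># p \<and> (\<forall>x\<in>#p. x \<le> Suc l)" by auto
next
  assume "Suc l \<in># p \<and> (\<forall>x\<in>#p. x \<le> Suc l)"
  then show "largest_part p = Suc l"
    unfolding largest_part_def by (intro Max_eqI) auto
qed

lemma size_le_Sum_mset: "0 \<notin># p \<Longrightarrow> size p \<le> \<Sum>\<^sub># p"
  by (induction p) auto

lemma partition_size_le: "p \<in> partitions n \<Longrightarrow> size p \<le> n"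
  using size_le_Sum_mset by (auto simp: partitions_def)

lemma largest_part_le: "p \<in> partitions n \<Longrightarrow> largest_part p \<le> n"
  using partition_part_le by (auto simp: largest_part_le_iff)

text \<open>With parts as rows, a column of length k is put in front of the diagram; for size p <= k
  the result has exactly k parts.\<close>

definition add_column :: "nat \<Rightarrow> nat multiset \<Rightarrow> nat multiset" where
  "add_column k p = image_mset Suc p + replicate_mset (k - size p) 1"

definition remove_column :: "nat multiset \<Rightarrow> nat multiset" where
  "remove_column p = image_mset (\<lambda>x. x - 1) (filter_mset (\<lambda>x. x \<noteq> 1) p)"

lemma remove_add_column: "0 \<notin># p \<Longrightarrow> remove_column (add_column k p) = p"
proof -
  assume "0 \<notin># p"
  then have "filter_mset (\<lambda>x. x \<noteq> 1) (image_mset Suc p) = image_mset Suc p"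
    by (induction p) auto
  moreover have "filter_mset (\<lambda>x. x \<noteq> 1) (replicate_mset m (1::nat)) = {#}" for m
    by (induction m) auto
  ultimately show ?thesis
    by (simp add: remove_column_def add_column_def multiset.map_comp o_def)
qed

lemma add_remove_column:
  assumes "0 \<notin># p"
  shows "add_column (size p) (remove_column p) = p"
proof -
  have "image_mset Suc (remove_column p) = filter_mset (\<lambda>x. x \<noteq> 1) p"
    unfolding remove_column_def using assms by (induction p) auto
  moreover have s: "p = filter_mset (\<lambda>x. x \<noteq> 1) p + replicate_mset (count p 1) 1"
    by (rule multiset_eqI) auto
  moreover have "size p - size (remove_column p) = count p 1"
  proof -
    have "size p = size (filter_mset (\<lambda>x. x \<noteq> 1) p) + count p 1"
      by (subst s) simp
    then show ?thesis by (simp add: remove_column_def)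
  qed
  ultimately show ?thesis unfolding add_column_def by metis
qed

lemma sum_add_column: "size p \<le> k \<Longrightarrow> \<Sum>\<^sub># (add_column k p) = \<Sum>\<^sub># p + k"
proof -
  assume "size p \<le> k"
  moreover have "\<Sum>\<^sub># (image_mset Suc p) = \<Sum>\<^sub># p + size p" by (induction p) auto
  ultimately show ?thesis by (simp add: add_column_def)
qed

text \<open>Removing the first column, of length k, lowers every part by one and is inverted by
  \<open>add_column\<close>.\<close>

lemma card_partitions_size:
  "card {p \<in> partitions n. size p = k \<and> (\<forall>x\<in>#p. x \<le> Suc l)} = (if k \<le> n then card (box_partitions l k (n - k)) else 0)"
proof (cases "k \<le> n")
  case True
  have "{p \<in> partitions n. size p = k \<and> (\<forall>x\<in>#p. x \<le> Suc l)} = add_column k ` box_partitions l k (n - k)"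
  proof (intro equalityI subsetI)
    fix p assume "p \<in> {p \<in> partitions n. size p = k \<and> (\<forall>x\<in>#p. x \<le> Suc l)}"
    then have p: "0 \<notin># p" "\<Sum>\<^sub># p = n" "size p = k" "\<forall>x\<in>#p. x \<le> Suc l" by (auto simp: partitions_def)
    have e: "add_column k (remove_column p) = p" using add_remove_column[OF p(1)] p(3) by simp
    have sz: "size (remove_column p) \<le> k"
      using size_filter_mset_lesseq[of _ p] p(3) by (simp add: remove_column_def)
    have "\<Sum>\<^sub># (remove_column p) = n - k"
      using sum_add_column[OF sz] p(2) unfolding e by simp
    moreover have "0 \<notin># remove_column p" "\<forall>x\<in>#remove_column p. x \<le> l"
      using p(1,4) by (auto simp: remove_column_def)
        (metis One_nat_def Suc_pred' le_antisym less_one not_gr_zero not_less)+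
    ultimately have "remove_column p \<in> box_partitions l k (n - k)"
      using sz by (simp add: box_partitions_def partitions_def)
    with e show "p \<in> add_column k ` box_partitions l k (n - k)" by force
  next
    fix p assume "p \<in> add_column k ` box_partitions l k (n - k)"
    then obtain r where r: "r \<in> box_partitions l k (n - k)" "p = add_column k r" by blast
    then have "\<Sum>\<^sub># p = n" using True sum_add_column[of r k] by (simp add: box_partitions_def partitions_def)
    moreover have "size p = k" "0 \<notin># p" "\<forall>x\<in>#p. x \<le> Suc l"
      using r by (auto simp: box_partitions_def add_column_def)
    ultimately show "p \<in> {p \<in> partitions n. size p = k \<and> (\<forall>x\<in>#p. x \<le> Suc l)}" by (simp add: partitions_def)
  qed
  moreover have "inj_on (add_column k) (box_partitions l k (n - k))"
    by (rule inj_on_inverseI[of _ remove_column]) (simp add: remove_add_column box_partitions_def partitions_def)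
  ultimately show ?thesis using True by (simp add: card_image)
next
  case False
  then have "{p \<in> partitions n. size p = k \<and> (\<forall>x\<in>#p. x \<le> Suc l)} = {}"
    using partition_size_le by fastforce
  then show ?thesis using False by (simp only: if_False card.empty)
qed

text \<open>Removal of the largest part, the first row of the diagram. The condition on the number
  of parts is kept as a predicate, being used with an equality as well as with an
  inequality.\<close>

lemma partitions_largest_part:
  "{p \<in> partitions n. largest_part p = Suc l \<and> P (size p)} =
    (if Suc l \<le> n then add_mset (Suc l) ` {p \<in> partitions (n - Suc l). (\<forall>x\<in>#p. x \<le> Suc l) \<and> P (Suc (size p))} else {})"
proof (intro equalityI subsetI)
  fix p assume p: "p \<in> {p \<in> partitions n. largest_part p = Suc l \<and> P (size p)}"
  then have "Suc l \<in># p" by (simp add: largest_part_eq_Suc_iff)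
  then obtain r where r: "p = add_mset (Suc l) r"
    by (auto dest: multi_member_split)
  with p have "r \<in> {p \<in> partitions (n - Suc l). (\<forall>x\<in>#p. x \<le> Suc l) \<and> P (Suc (size p))}" "Suc l \<le> n"
    by (auto simp: partitions_def largest_part_eq_Suc_iff)
  with r show "p \<in> (if Suc l \<le> n then add_mset (Suc l) ` {p \<in> partitions (n - Suc l). (\<forall>x\<in>#p. x \<le> Suc l) \<and> P (Suc (size p))} else {})"
    by simp
qed (auto simp: partitions_def largest_part_eq_Suc_iff split: if_splits)

lemma card_partitions_largest_part:
  "card {p \<in> partitions n. largest_part p = Suc l \<and> P (size p)} =
    (if Suc l \<le> n then card {p \<in> partitions (n - Suc l). (\<forall>x\<in>#p. x \<le> Suc l) \<and> P (Suc (size p))} else 0)"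
  unfolding partitions_largest_part by (auto simp: card_image inj_on_def)

definition rank_pair_count :: "nat \<Rightarrow> nat \<Rightarrow> nat \<Rightarrow> nat" where
  "rank_pair_count l k n = card {p \<in> partitions n. largest_part p = l \<and> size p = k}"

text \<open>The first row and the first column together form a hook of l + k + 1 cells.\<close>

lemma rank_pair_count_Suc:
  "rank_pair_count (Suc l) (Suc k) n = (if Suc (l + k) \<le> n then card (box_partitions l k (n - Suc (l + k))) else 0)"
proof -
  have "rank_pair_count (Suc l) (Suc k) n =
      (if Suc l \<le> n then card {p \<in> partitions (n - Suc l). size p = k \<and> (\<forall>x\<in>#p. x \<le> Suc l)} else 0)"
    unfolding rank_pair_count_def using card_partitions_largest_part[of n l "\<lambda>s. s = Suc k"] by (simp add: conj_commute)
  then show ?thesis by (auto simp: card_partitions_size)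
qed

lemma rank_pair_count_0:
  "rank_pair_count 0 k n = (if k = 0 \<and> n = 0 then 1 else 0)" "rank_pair_count l 0 n = (if l = 0 \<and> n = 0 then 1 else 0)"
proof -
  have 1: "largest_part p = 0 \<longleftrightarrow> p = {#}" if "0 \<notin># p" for p
    using that largest_part_le_iff[of p 0] by (cases p) (auto simp: largest_part_def)
  have "{p \<in> partitions n. largest_part p = 0 \<and> size p = k} = (if k = 0 \<and> n = 0 then {{#}} else {})"
    using 1 by (auto simp: partitions_def)
  then show "rank_pair_count 0 k n = (if k = 0 \<and> n = 0 then 1 else 0)"
    by (simp add: rank_pair_count_def)
  have "{p \<in> partitions n. largest_part p = l \<and> size p = 0} = (if l = 0 \<and> n = 0 then {{#}} else {})"
    by (auto simp: partitions_def largest_part_def)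
  then show "rank_pair_count l 0 n = (if l = 0 \<and> n = 0 then 1 else 0)"
    by (simp add: rank_pair_count_def)
qed

lemma sum_partitions_rank_pair:
  fixes f :: "nat \<Rightarrow> nat \<Rightarrow> 'a :: comm_semiring_1"
  shows "(\<Sum>p\<in>partitions n. f (largest_part p) (size p)) =
    (\<Sum>l\<le>n. \<Sum>k\<le>n. of_nat (rank_pair_count l k n) * f l k)"
proof -
  have "(\<Sum>p\<in>partitions n. f (largest_part p) (size p)) =
      (\<Sum>x\<in>{..n} \<times> {..n}. \<Sum>p | p \<in> partitions n \<and> (largest_part p, size p) = x. f (largest_part p) (size p))"
    by (rule sum.group[symmetric]) (auto simp: finite_partitions largest_part_le partition_size_le)
  also have "\<dots> = (\<Sum>(l, k)\<in>{..n} \<times> {..n}. of_nat (rank_pair_count l k n) * f l k)"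
    by (intro sum.cong) (auto simp: rank_pair_count_def)
  also have "\<dots> = (\<Sum>l\<le>n. \<Sum>k\<le>n. of_nat (rank_pair_count l k n) * f l k)"
    by (rule sum.cartesian_product[symmetric])
  finally show ?thesis .
qed

text \<open>Removing the first row and column of the diagram leaves a partition in a smaller box,
  so the symmetry under conjugation follows by induction on \<open>n\<close>.\<close>
lemma rank_pair_count_commute: "rank_pair_count l k n = rank_pair_count k l n"
proof (induction n arbitrary: l k rule: less_induct)
  case (less n)
  have box: "card (box_partitions l k m) = (\<Sum>i\<le>m. \<Sum>j\<le>m. rank_pair_count i j m * (if i \<le> l \<and> j \<le> k then 1 else 0))" for l k m
  proof -
    have "card (box_partitions l k m) = (\<Sum>p\<in>partitions m. if largest_part p \<le> l \<and> size p \<le> k then 1 else 0)"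
      using finite_partitions by (simp add: box_partitions_def largest_part_le_iff sum.If_cases Int_def)
    also have "\<dots> = (\<Sum>i\<le>m. \<Sum>j\<le>m. rank_pair_count i j m * (if i \<le> l \<and> j \<le> k then 1 else 0))"
      using sum_partitions_rank_pair[of "\<lambda>i j. if i \<le> l \<and> j \<le> k then 1 else (0::nat)" m] by simp
    finally show ?thesis .
  qed
  have box_commute: "card (box_partitions l k m) = card (box_partitions k l m)" if "m < n" for l k m
    unfolding box[of l] box[of k] by (subst sum.swap) (intro sum.cong, auto simp: less[OF that])
  show ?case
  proof (cases "l = 0 \<or> k = 0")
    case False
    then obtain l' k' where "l = Suc l'" "k = Suc k'" by (meson not0_implies_Suc)
    then show ?thesis using box_commute[of "n - Suc (l' + k')" l' k'] by (simp add: rank_pair_count_Suc add.commute)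
  qed (auto simp: rank_pair_count_0)
qed

text \<open>Conjugation enters as a statement about counts: summands that depend only on the largest
  part and the number of parts see just the symmetric numbers
  \<open>rank_pair_count\<close>.\<close>

lemma sum_partitions_conjugate:
  fixes f :: "nat \<Rightarrow> nat \<Rightarrow> 'a :: comm_semiring_1"
  shows "(\<Sum>p\<in>partitions n. f (largest_part p) (size p)) = (\<Sum>p\<in>partitions n. f (size p) (largest_part p))"
proof -
  have "(\<Sum>p\<in>partitions n. f (size p) (largest_part p)) = (\<Sum>l\<le>n. \<Sum>k\<le>n. of_nat (rank_pair_count l k n) * f k l)"
    by (rule sum_partitions_rank_pair)
  also have "\<dots> = (\<Sum>k\<le>n. \<Sum>l\<le>n. of_nat (rank_pair_count k l n) * f k l)"
    by (subst sum.swap) (simp add: rank_pair_count_commute)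
  finally show ?thesis by (simp add: sum_partitions_rank_pair)
qed

text \<open>Ranks congruent to 1 modulo 5, weighted by themselves, with r and -r folded together:
  for positive m the value m comes from the rank m, the value -m from the rank -m.\<close>

definition rank_weight :: "nat \<Rightarrow> int" where
  "rank_weight m = (if m mod 5 = 1 then int m else if m mod 5 = 4 then - int m else 0)"

text \<open>Conjugation is used twice: besides exchanging the residues 1 and 4 it folds the negative
  ranks onto the positive ones, for which Dyson's recursion supplies generating functions.\<close>

lemma NT_difference:
  "NT 1 5 n - NT 4 5 n = - (\<Sum>p | p \<in> partitions n \<and> partition_rank p > 0. rank_weight (nat (partition_rank p)))"
proof -
  have "NT m 5 n = (\<Sum>p\<in>partitions n. if [int (largest_part p) - int (size p) = m] (mod 5) then int (size p) else 0)" for m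
    unfolding NT_def partition_rank_def using finite_partitions
    by (intro sum.mono_neutral_cong_left) auto
  note NT = this
  define g :: "int \<Rightarrow> int" where "g = (\<lambda>r. if [r = 1] (mod 5) then r else 0)"
  have "NT 4 5 n = (\<Sum>p\<in>partitions n. if [int (size p) - int (largest_part p) = 4] (mod 5) then int (largest_part p) else 0)"
    unfolding NT using sum_partitions_conjugate[of "\<lambda>l k. if [int l - int k = 4] (mod 5) then int k else 0"] by simp
  also have "\<dots> = (\<Sum>p\<in>partitions n. if [int (largest_part p) - int (size p) = 1] (mod 5) then int (largest_part p) else 0)"
    by (intro sum.cong refl if_cong) (auto simp: cong_def, presburger+)
  finally have NT4: "NT 4 5 n = (\<Sum>p\<in>partitions n. if [int (largest_part p) - int (size p) = 1] (mod 5) then int (largest_part p) else 0)" .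
  have "NT 1 5 n - NT 4 5 n = - (\<Sum>p\<in>partitions n. g (partition_rank p))"
    unfolding NT[of 1] NT4 sum_subtractf[symmetric] sum_negf[symmetric]
    by (rule sum.cong) (auto simp: g_def partition_rank_def)
  also have "(\<Sum>p\<in>partitions n. g (partition_rank p)) =
      (\<Sum>p\<in>partitions n. if partition_rank p > 0 then g (partition_rank p) else 0)
      + (\<Sum>p\<in>partitions n. if partition_rank p < 0 then g (partition_rank p) else 0)"
    unfolding sum.distrib[symmetric] by (intro sum.cong) (auto simp: g_def)
  also have "(\<Sum>p\<in>partitions n. if partition_rank p < 0 then g (partition_rank p) else 0) =
      (\<Sum>p\<in>partitions n. if partition_rank p > 0 then g (- partition_rank p) else 0)"
    using sum_partitions_conjugate[of "\<lambda>l k. if int l - int k < 0 then g (int l - int k) else 0" n]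
    unfolding partition_rank_def by (simp cong: if_cong)
  also have "(\<Sum>p\<in>partitions n. if partition_rank p > 0 then g (partition_rank p) else 0) + \<dots> =
      (\<Sum>p\<in>partitions n. if partition_rank p > 0 then rank_weight (nat (partition_rank p)) else 0)"
  proof -
    have "g r + g (- r) = rank_weight (nat r)" if r: "r > 0" for r
    proof -
      obtain m where "r = int m" using zero_le_imp_eq_int[of r] r by auto
      moreover have "int m mod 5 = 1 \<longleftrightarrow> m mod 5 = 1" "(- int m) mod 5 = 1 \<longleftrightarrow> m mod 5 = 4"
        by presburger+
      ultimately show ?thesis by (simp add: g_def rank_weight_def cong_def)
    qed
    then show ?thesis unfolding sum.distrib[symmetric] by (intro sum.cong) auto
  qed
  also have "\<dots> = (\<Sum>p | p \<in> partitions n \<and> partition_rank p > 0. rank_weight (nat (partition_rank p)))"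
    using finite_partitions by (intro sum.mono_neutral_cong_right) auto
  finally show ?thesis .
qed

section \<open>Dyson's recursion for the number of partitions of rank at least m\<close>

definition rank_ge_count :: "nat \<Rightarrow> nat \<Rightarrow> nat" where
  "rank_ge_count m n = card {p \<in> partitions n. partition_rank p \<ge> int m}"

text \<open>Dyson's adjoint: remove the first column, of length \<open>k\<close>, and add a new largest part
  \<open>k + m + 1\<close>.\<close>
lemma card_rank_le:
  "card {p \<in> partitions n. partition_rank p \<le> int m + 2} = rank_ge_count m (n + Suc m)"
proof -
  \<comment> \<open>With k parts, rank at most m + 2 means that every part is at most k + m + 2;
    after the column is removed the bound is k + m + 1, the size of the new largest part.\<close>
  have "card {p \<in> partitions n. partition_rank p \<le> int m + 2} =
      (\<Sum>k\<le>n. card {p \<in> partitions n. size p = k \<and> (\<forall>x\<in>#p. x \<le> Suc (k + Suc m))})"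
  proof -
    have "{p \<in> partitions n. partition_rank p \<le> int m + 2} =
        (\<Union>k\<in>{..n}. {p \<in> partitions n. size p = k \<and> (\<forall>x\<in>#p. x \<le> Suc (k + Suc m))})"
      using partition_size_le by (auto simp: partition_rank_def largest_part_le_iff[symmetric])
    then show ?thesis
      by (simp only:) (rule card_UN_disjoint, auto intro: finite_subset[OF _ finite_partitions])
  qed
  also have "\<dots> = (\<Sum>k\<le>n. card (box_partitions (k + Suc m) k (n - k)))"
    by (intro sum.cong) (simp_all add: card_partitions_size)
  also have "\<dots> = (\<Sum>k\<le>n. card {p \<in> partitions (n + Suc m). largest_part p = Suc (k + m) \<and> size p \<le> Suc k})"
    by (intro sum.cong) (simp_all add: card_partitions_largest_part[where P = "\<lambda>s. s \<le> Suc _"] box_partitions_def)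
  also have "\<dots> = card (\<Union>k\<in>{..n}. {p \<in> partitions (n + Suc m). largest_part p = Suc (k + m) \<and> size p \<le> Suc k})"
    by (rule card_UN_disjoint[symmetric]) (auto intro: finite_subset[OF _ finite_partitions])
  also have "(\<Union>k\<in>{..n}. {p \<in> partitions (n + Suc m). largest_part p = Suc (k + m) \<and> size p \<le> Suc k}) =
      {p \<in> partitions (n + Suc m). partition_rank p \<ge> int m}"
  proof (intro equalityI subsetI)
    fix p assume p: "p \<in> {p \<in> partitions (n + Suc m). partition_rank p \<ge> int m}"
    then have "p \<noteq> {#}" by (auto simp: partitions_def)
    then have "size p \<ge> 1" by (simp add: Suc_leI nonempty_has_size)
    moreover have "largest_part p \<le> n + Suc m" using p largest_part_le by blast
    moreover have "largest_part p \<ge> m + size p" using p by (simp add: partition_rank_def)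
    ultimately show "p \<in> (\<Union>k\<in>{..n}. {p \<in> partitions (n + Suc m). largest_part p = Suc (k + m) \<and> size p \<le> Suc k})"
      using p by (intro UN_I[of "largest_part p - Suc m"]) auto
  qed (auto simp: partition_rank_def)
  finally show ?thesis by (simp add: rank_ge_count_def)
qed

text \<open>The partitions of n of rank at most m + 2 are counted by the adjoint, and the remaining
  ones have rank at least m + 3.\<close>

lemma rank_ge_count_rec:
  "rank_ge_count m (n + Suc m) + rank_ge_count (m + 3) n = num_partitions n"
proof -
  have "card {p \<in> partitions n. partition_rank p \<le> int m + 2} + card {p \<in> partitions n. partition_rank p \<ge> int (m + 3)}
     = card ({p \<in> partitions n. partition_rank p \<le> int m + 2} \<union> {p \<in> partitions n. partition_rank p \<ge> int (m + 3)})"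
    by (rule card_Un_disjoint[symmetric]) (auto intro: finite_subset[OF _ finite_partitions])
  also have "{p \<in> partitions n. partition_rank p \<le> int m + 2} \<union> {p \<in> partitions n. partition_rank p \<ge> int (m + 3)} = partitions n"
    by auto
  finally show ?thesis
    unfolding card_rank_le by (simp add: rank_ge_count_def num_partitions_def)
qed

text \<open>The empty partition has rank 0, and any other has largest part at most n and at least
  one part, hence rank at most n - 1.\<close>

lemma rank_ge_count_eq_0:
  assumes "m \<ge> 1" "n < Suc m"
  shows "rank_ge_count m n = 0"
proof -
  have "\<not> partition_rank p \<ge> int m" if p: "p \<in> partitions n" for p
  proof (cases "p = {#}")
    case False
    then have "size p \<ge> 1" by (simp add: Suc_leI nonempty_has_size)
    then show ?thesis using largest_part_le[OF p] assms by (simp add: partition_rank_def)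
  qed (use assms in \<open>simp add: partition_rank_def largest_part_def\<close>)
  then have "{p \<in> partitions n. partition_rank p \<ge> int m} = {}" by auto
  then show ?thesis by (simp only: rank_ge_count_def card.empty)
qed

lemma sum_rank_weight:
  "(\<Sum>p | p \<in> partitions n \<and> partition_rank p > 0. rank_weight (nat (partition_rank p)))
    = (\<Sum>m\<le>n. rank_weight m * (int (rank_ge_count m n) - int (rank_ge_count (Suc m) n)))"
proof -
  define S where "S = {p. p \<in> partitions n \<and> partition_rank p > 0}"
  have "(\<Sum>p\<in>S. rank_weight (nat (partition_rank p)))
    = (\<Sum>m\<le>n. \<Sum>p\<in>{p \<in> S. nat (partition_rank p) = m}. rank_weight (nat (partition_rank p)))"
  proof (rule sum.group[symmetric])
    show "finite S" using finite_partitions by (rule finite_subset[rotated]) (auto simp: S_def)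
    show "(\<lambda>p. nat (partition_rank p)) ` S \<subseteq> {..n}"
      using largest_part_le by (force simp: partition_rank_def S_def)
  qed auto
  also have "\<dots> = (\<Sum>m\<le>n. rank_weight m * (int (rank_ge_count m n) - int (rank_ge_count (Suc m) n)))"
  proof (rule sum.cong[OF refl])
    fix m
    have fin: "finite {p \<in> partitions n. P p}" for P
      using finite_partitions by simp
    show "(\<Sum>p\<in>{p \<in> S. nat (partition_rank p) = m}. rank_weight (nat (partition_rank p)))
      = rank_weight m * (int (rank_ge_count m n) - int (rank_ge_count (Suc m) n))"
    proof (cases "m = 0")
      case False
      have "{p \<in> S. nat (partition_rank p) = m} =
         {p \<in> partitions n. partition_rank p \<ge> int m} - {p \<in> partitions n. partition_rank p \<ge> int (Suc m)}"
        using False by (auto simp: S_def)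
      moreover have "{p \<in> partitions n. partition_rank p \<ge> int (Suc m)} \<subseteq> {p \<in> partitions n. partition_rank p \<ge> int m}"
        by auto
      ultimately have "card {p \<in> S. nat (partition_rank p) = m}
          = rank_ge_count m n - rank_ge_count (Suc m) n" "rank_ge_count (Suc m) n \<le> rank_ge_count m n"
        unfolding rank_ge_count_def using fin by (simp_all add: card_Diff_subset card_mono)
      then show ?thesis by simp
    qed (simp add: rank_weight_def)
  qed
  finally show ?thesis by (simp only: S_def)
qed

section \<open>The generating function of the ranks\<close>

text \<open>For m >= 1 this is (q;q) times the generating function of the partitions of rank at
  least m: with N = k + 1, the alternating sum of q^(N(3N-1)/2 + m N).\<close>

definition dyson_sum :: "complex \<Rightarrow> nat \<Rightarrow> complex" where
  "dyson_sum q m = (\<Sum>k. (-1) ^ k * q powi (3 * tri (int (Suc k)) + int (Suc k)) * q ^ (m * Suc k))"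

lemma pentagonal_exponent: "\<exists>e. 3 * tri (int (Suc k)) + int (Suc k) = int e \<and> k \<le> e"
proof -
  have "int (Suc k) * (int (Suc k) - 1) \<ge> 0"
    by (intro mult_nonneg_nonneg) auto
  then have "3 * tri (int (Suc k)) + int (Suc k) \<ge> int (Suc k)"
    using two_tri[of "int (Suc k)"] by linarith
  then show ?thesis
    by (intro exI[of _ "nat (3 * tri (int (Suc k)) + int (Suc k))"]) linarith
qed

lemma norm_dyson_term_le:
  fixes q :: complex
  assumes q: "norm q < 1"
  shows "norm ((-1) ^ k * q powi (3 * tri (int (Suc k)) + int (Suc k)) * q ^ (m * Suc k)) \<le> norm q ^ k"
proof -
  obtain e where e: "3 * tri (int (Suc k)) + int (Suc k) = int e" "k \<le> e"
    using pentagonal_exponent by blast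
  have "norm ((-1) ^ k * q powi (3 * tri (int (Suc k)) + int (Suc k)) * q ^ (m * Suc k)) = norm q ^ (e + m * Suc k)"
    unfolding e(1) by (simp add: norm_mult norm_power power_add del: mult_Suc_right)
  also have "\<dots> \<le> norm q ^ k"
    using q e(2) by (intro power_decreasing) auto
  finally show ?thesis .
qed

lemma summable_dyson_sum:
  fixes q :: complex
  assumes q: "norm q < 1"
  shows "summable (\<lambda>k. (-1) ^ k * q powi (3 * tri (int (Suc k)) + int (Suc k)) * q ^ (m * Suc k))"
  using q by (intro summable_comparison_test'[OF summable_geometric[of "norm q"], of 0] norm_dyson_term_le) auto

lemma norm_dyson_sum_le:
  assumes q: "norm q < 1"
  shows "norm (dyson_sum q m) \<le> 1 / (1 - norm q)"
proof -
  have "norm (dyson_sum q m) \<le> (\<Sum>k. norm q ^ k)"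
    unfolding dyson_sum_def using q by (intro norm_suminf_le summable_geometric norm_dyson_term_le) auto
  also have "\<dots> = 1 / (1 - norm q)" using q by (intro suminf_geometric) simp
  finally show ?thesis .
qed

text \<open>The first term is q^(m+1); raising N to N + 1 adds 3N + 1 to the pentagonal exponent, so
  the rest is -q^(m+1) times the series at m + 3. This is the recursion that
  \<open>rank_ge_count_rec\<close> gives for generating functions.\<close>

lemma dyson_sum_rec:
  assumes q: "q \<noteq> 0" "norm q < 1"
  shows "dyson_sum q m = q ^ Suc m * (1 - dyson_sum q (m + 3))"
proof -
  define t where "t = (\<lambda>m k. (-1) ^ k * q powi (3 * tri (int (Suc k)) + int (Suc k)) * q ^ (m * Suc k))"
  have d: "dyson_sum q m = (\<Sum>k. t m k)" for m by (simp only: dyson_sum_def t_def)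
  have sm: "summable (t m)" for m unfolding t_def by (rule summable_dyson_sum[OF q(2)])
  have t0: "t m 0 = q ^ Suc m"
  proof -
    have "3 * tri (int (Suc 0)) + int (Suc 0) = 1" by simp
    then show ?thesis unfolding t_def by (simp only: power_int_1_right) simp
  qed
  have step: "t m (Suc k) = - (q ^ Suc m * t (m + 3) k)" for k
  proof -
    have "3 * tri (int (Suc (Suc k))) + int (Suc (Suc k)) = (3 * tri (int (Suc k)) + int (Suc k)) + int (3 * Suc k + 1)"
      using tri_plus_1[of "int (Suc k)"] by (simp add: algebra_simps)
    moreover have "q powi (E + int M) = q powi E * q ^ M" for E M
      using q(1) by (simp add: power_int_add)
    ultimately have "q powi (3 * tri (int (Suc (Suc k))) + int (Suc (Suc k)))
        = q powi (3 * tri (int (Suc k)) + int (Suc k)) * q ^ (3 * Suc k + 1)"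
      by (simp only:)
    moreover have "q ^ (3 * Suc k + 1) * q ^ (m * Suc (Suc k)) = q ^ Suc m * q ^ ((m + 3) * Suc k)"
      unfolding power_add[symmetric] by (rule arg_cong[where f = "power q"]) (simp add: algebra_simps)
    moreover have "(-1) ^ Suc k * (A * B) * C = - ((-1) ^ k * A * (B * C))" "- (D * ((-1) ^ k * A * E)) = - ((-1) ^ k * A * (D * E))"
      for A B C D E :: complex
      by (simp_all add: mult_ac)
    ultimately show ?thesis unfolding t_def by (simp only:)
  qed
  have "dyson_sum q m = t m 0 + (\<Sum>k. t m (Suc k))"
    unfolding d using suminf_split_head[OF sm[of m]] by simp
  also have "(\<Sum>k. t m (Suc k)) = - (q ^ Suc m * dyson_sum q (m + 3))"
    unfolding step d using sm by (simp add: suminf_minus suminf_mult summable_mult del: power_Suc)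
  finally show ?thesis unfolding t0 by (simp add: algebra_simps)
qed

text \<open>The difference D(m) of the two sides satisfies D(m) = -q^(m+1) D(m+3) and is bounded in
  m, so iterating forces it to be 0. The last claim gives geometric decay in m, for the interchange
  of sums over m and n.\<close>

lemma rank_ge_generating_function:
  assumes q: "0 < norm q" "norm q < 1" and m: "m \<ge> 1"
  shows "(\<lambda>n. of_nat (rank_ge_count m n) * q ^ n) sums (dyson_sum q m / qp q q)"
    and "summable (\<lambda>n. rank_ge_count m n * norm q ^ n)"
    and "(\<Sum>n. rank_ge_count m n * norm q ^ n) \<le> norm q ^ Suc m * (\<Sum>n. num_partitions n * norm q ^ n)"
proof -
  have q0: "q \<noteq> 0" using q by auto
  define K where "K = (\<Sum>n. num_partitions n * norm q ^ n)"
  have smP: "summable (\<lambda>n. num_partitions n * norm q ^ n)"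
    by (rule sums_num_partitions(2)[OF q(2)])
  have le: "rank_ge_count m n \<le> num_partitions n" for m n
    unfolding rank_ge_count_def num_partitions_def by (intro card_mono finite_partitions) auto
  have sm: "summable (\<lambda>n. rank_ge_count m n * norm q ^ n)" for m
    by (rule summable_comparison_test'[OF smP, of 0]) (use le in \<open>auto intro!: mult_right_mono\<close>)
  then show "summable (\<lambda>n. rank_ge_count m n * norm q ^ n)" .
  have smc: "summable (\<lambda>n. of_nat (rank_ge_count m n) * q ^ n :: complex)" for m
    by (rule summable_norm_cancel) (use sm[of m] in \<open>simp add: norm_mult norm_power\<close>)
  define h :: "nat \<Rightarrow> complex" where "h = (\<lambda>m. \<Sum>n. of_nat (rank_ge_count m n) * q ^ n)"
  have hK: "norm (h m) \<le> K" for m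
    unfolding h_def K_def using le by (intro norm_suminf_le smP) (auto simp: norm_mult norm_power intro!: mult_right_mono)
  have shift: "(\<lambda>n. of_nat (rank_ge_count m (n + Suc m)) * q ^ (n + Suc m)) sums h m" if "m \<ge> 1" for m
    unfolding h_def using smc[of m] rank_ge_count_eq_0[OF that] by (subst sums_zero_iff_shift) (auto simp: summable_sums)
  have rec: "h m = q ^ Suc m * (1 / qp q q - h (m + 3))" if m: "m \<ge> 1" for m
  proof -
    have "(\<lambda>n. q ^ Suc m * (of_nat (num_partitions n) * q ^ n - of_nat (rank_ge_count (m + 3) n) * q ^ n)) sums
       (q ^ Suc m * (1 / qp q q - h (m + 3)))"
      unfolding h_def by (intro sums_mult sums_diff sums_num_partitions(1) q summable_sums smc)
    moreover have "q ^ Suc m * (of_nat (num_partitions n) * q ^ n - of_nat (rank_ge_count (m + 3) n) * q ^ n) =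
       of_nat (rank_ge_count m (n + Suc m)) * q ^ (n + Suc m)" for n
    proof -
      have "of_nat (num_partitions n) - of_nat (rank_ge_count (m + 3) n) = (of_nat (rank_ge_count m (n + Suc m)) :: complex)"
        unfolding rank_ge_count_rec[of m n, symmetric] of_nat_add by simp
      moreover have "q ^ Suc m * (a * x - b * x) = (a - b) * (x * q ^ Suc m)" for a b x
        by (simp add: algebra_simps)
      ultimately show ?thesis by (simp only: power_add)
    qed
    ultimately have "(\<lambda>n. of_nat (rank_ge_count m (n + Suc m)) * q ^ (n + Suc m)) sums (q ^ Suc m * (1 / qp q q - h (m + 3)))"
      by (simp only:)
    with shift[OF m] show ?thesis by (rule sums_unique2)
  qed
  define D where "D = (\<lambda>m. h m - dyson_sum q m / qp q q)"
  define C where "C = K + 1 / (1 - norm q) / norm (qp q q)"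
  have Drec: "D m = - (q ^ Suc m * D (m + 3))" if "m \<ge> 1" for m
    unfolding D_def rec[OF that] dyson_sum_rec[OF q0 q(2), of m] by (simp add: diff_divide_distrib algebra_simps)
  have DC: "norm (D m) \<le> C" for m
  proof -
    have "norm (dyson_sum q m / qp q q) \<le> 1 / (1 - norm q) / norm (qp q q)"
      unfolding norm_divide by (intro divide_right_mono norm_dyson_sum_le q) auto
    then show ?thesis
      unfolding D_def C_def using norm_triangle_ineq4[of "h m" "dyson_sum q m / qp q q"] hK[of m] by linarith
  qed
  have "norm (D m) \<le> norm q ^ j * C" if "m \<ge> 1" for m j
    using that
  proof (induction j arbitrary: m)
    case 0
    then show ?case using DC by simp
  next
    case (Suc j)
    have "norm (D m) = norm q ^ Suc m * norm (D (m + 3))"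
      unfolding Drec[OF Suc.prems] by (simp add: norm_mult norm_power)
    also have "\<dots> \<le> norm q * (norm q ^ j * C)"
    proof (intro mult_mono Suc.IH)
      have "norm q ^ Suc m \<le> norm q ^ 1" using q by (intro power_decreasing) auto
      then show "norm q ^ Suc m \<le> norm q" by simp
    qed auto
    finally show ?case by (simp add: mult_ac)
  qed
  from this[OF m] have b: "norm (D m) \<le> norm q ^ j * C" for j .
  have "(\<lambda>j. norm q ^ j * C) \<longlonglongrightarrow> 0 * C"
    using q by (intro tendsto_mult tendsto_const LIMSEQ_power_zero) auto
  then have "norm (D m) \<le> 0 * C"
    by (rule LIMSEQ_le_const) (use b in auto)
  then have "h m = dyson_sum q m / qp q q" by (simp add: D_def)
  then show "(\<lambda>n. of_nat (rank_ge_count m n) * q ^ n) sums (dyson_sum q m / qp q q)"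
    using summable_sums[OF smc[of m]] by (simp add: h_def)
  have sh: "(\<lambda>n. rank_ge_count m (n + Suc m) * norm q ^ (n + Suc m)) sums (\<Sum>n. rank_ge_count m n * norm q ^ n)"
    using sm[of m] rank_ge_count_eq_0[OF m] by (subst sums_zero_iff_shift) (auto simp: summable_sums)
  have "(\<Sum>n. rank_ge_count m n * norm q ^ n) = (\<Sum>n. rank_ge_count m (n + Suc m) * norm q ^ (n + Suc m))"
    by (rule sums_unique[OF sh])
  also have "\<dots> \<le> (\<Sum>n. norm q ^ Suc m * (num_partitions n * norm q ^ n))"
  proof (rule suminf_le)
    show "summable (\<lambda>n. norm q ^ Suc m * (num_partitions n * norm q ^ n))"
      by (intro summable_mult smP)
    show "summable (\<lambda>n. rank_ge_count m (n + Suc m) * norm q ^ (n + Suc m))"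
      using sh by (rule sums_summable)
    fix n
    have "rank_ge_count m (n + Suc m) \<le> num_partitions n"
      using rank_ge_count_rec[of m n] by linarith
    then have "rank_ge_count m (n + Suc m) * norm q ^ (n + Suc m) \<le> num_partitions n * norm q ^ (n + Suc m)"
      by (intro mult_right_mono) auto
    then show "rank_ge_count m (n + Suc m) * norm q ^ (n + Suc m) \<le> norm q ^ Suc m * (num_partitions n * norm q ^ n)"
      by (simp only: power_add mult_ac)
  qed
  also have "\<dots> = norm q ^ Suc m * K"
    unfolding K_def by (intro suminf_mult smP)
  finally show "(\<Sum>n. rank_ge_count m n * norm q ^ n) \<le> norm q ^ Suc m * (\<Sum>n. num_partitions n * norm q ^ n)"
    by (simp only: K_def)
qed

lemma abs_rank_weight_le: "\<bar>rank_weight m\<bar> \<le> int m"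
  by (simp add: rank_weight_def)

text \<open>Blocks of five terms leave arithmetic-geometric series in x^5. The sum is arranged to
  match \<open>rank_term\<close> and \<open>rank_term'\<close> at w = 1, where x will be a power of
  q.\<close>

lemma sums_rank_weight:
  fixes x :: complex
  assumes x: "norm x < 1"
  shows "(\<lambda>m. of_int (rank_weight m) * x ^ m) sums
    ((x + x ^ 4) / (1 - x ^ 5) + 5 * (x ^ 6 - x ^ 4) / (1 - x ^ 5)\<^sup>2)"
proof -
  have sm: "summable (\<lambda>m. of_int (rank_weight m) * x ^ m)"
  proof (rule summable_comparison_test'[OF summable_of_nat_power[of "norm x"], of 0])
    fix m
    have "\<bar>real_of_int (rank_weight m)\<bar> \<le> real m"
      using abs_rank_weight_le[of m] by linarith
    then show "norm (of_int (rank_weight m) * x ^ m) \<le> real m * norm x ^ m"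
      by (auto simp: norm_mult norm_power intro!: mult_right_mono)
  qed (use x in auto)
  define y where "y = x ^ 5"
  have y: "norm y < 1" using x by (simp add: y_def norm_power power_less_one_iff)
  then have y1: "1 - y \<noteq> 0" by auto
  have "(\<lambda>j. (\<Sum>m\<in>{j * 5..<j * 5 + 5}. of_int (rank_weight m) * x ^ m)) sums (\<Sum>m. of_int (rank_weight m) * x ^ m)"
    by (rule sums_group) (use sm in \<open>auto simp: summable_sums\<close>)
  moreover have "(\<Sum>m\<in>{j * 5..<j * 5 + 5}. of_int (rank_weight m) * x ^ m) =
     (x - 4 * x ^ 4) * y ^ j + (5 * (x - x ^ 4)) * (of_nat j * y ^ j)" for j
  proof -
    have "{j * 5..<j * 5 + 5} = {j * 5, j * 5 + 1, j * 5 + 2, j * 5 + 3, j * 5 + 4}" by auto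
    moreover have "rank_weight (j * 5) = 0" "rank_weight (j * 5 + 1) = int (j * 5 + 1)" "rank_weight (j * 5 + 2) = 0"
      "rank_weight (j * 5 + 3) = 0" "rank_weight (j * 5 + 4) = - int (j * 5 + 4)"
      by (simp_all add: rank_weight_def mod_Suc)
    ultimately have "(\<Sum>m\<in>{j * 5..<j * 5 + 5}. of_int (rank_weight m) * x ^ m) =
       of_int (int (j * 5 + 1)) * x ^ (j * 5 + 1) + of_int (- int (j * 5 + 4)) * x ^ (j * 5 + 4)"
      by simp
    then have "(\<Sum>m\<in>{j * 5..<j * 5 + 5}. of_int (rank_weight m) * x ^ m) =
       of_nat (j * 5 + 1) * x ^ (j * 5 + 1) - of_nat (j * 5 + 4) * x ^ (j * 5 + 4)"
      by (simp only: of_int_minus of_int_of_nat_eq mult_minus_left diff_conv_add_uminus)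
    moreover have "x ^ (j * 5 + i) = y ^ j * x ^ i" for i
      by (simp add: y_def power_add mult.commute flip: power_mult)
    ultimately have "(\<Sum>m\<in>{j * 5..<j * 5 + 5}. of_int (rank_weight m) * x ^ m) =
       of_nat (j * 5 + 1) * (y ^ j * x ^ 1) - of_nat (j * 5 + 4) * (y ^ j * x ^ 4)"
      by (simp only:)
    then show ?thesis by (simp add: algebra_simps)
  qed
  moreover have "(\<lambda>j. (x - 4 * x ^ 4) * y ^ j + (5 * (x - x ^ 4)) * (of_nat j * y ^ j)) sums
     ((x - 4 * x ^ 4) * (1 / (1 - y)) + (5 * (x - x ^ 4)) * (y / (1 - y)\<^sup>2))"
  proof (intro sums_add sums_mult geometric_sums y)
    have "(\<lambda>j. y * (of_nat (Suc j) * y ^ j)) sums (y * (1 / (1 - y)\<^sup>2))"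
      by (intro sums_mult geometric_deriv_sums y)
    then have "(\<lambda>j. of_nat (Suc j) * y ^ Suc j) sums (y / (1 - y)\<^sup>2)"
      by (simp add: mult_ac)
    then show "(\<lambda>j. of_nat j * y ^ j) sums (y / (1 - y)\<^sup>2)"
      by (subst (asm) sums_Suc_iff) simp
  qed
  ultimately have "(\<Sum>m. of_int (rank_weight m) * x ^ m) = (x - 4 * x ^ 4) * (1 / (1 - y)) + (5 * (x - x ^ 4)) * (y / (1 - y)\<^sup>2)"
    using sums_unique2 by (simp only:) blast
  also have "\<dots> = ((x - 4 * x ^ 4) * (1 - y) + 5 * (x - x ^ 4) * y) / (1 - y)\<^sup>2"
    using y1 by (simp add: divide_simps power2_eq_square)
  also have "(x - 4 * x ^ 4) * (1 - y) + 5 * (x - x ^ 4) * y = (x + x ^ 4) * (1 - y) + 5 * (x ^ 6 - x ^ 4)"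
    by (simp add: y_def algebra_simps eval_nat_numeral)
  also have "\<dots> / (1 - y)\<^sup>2 = (x + x ^ 4) / (1 - y) + 5 * (x ^ 6 - x ^ 4) / (1 - y)\<^sup>2"
    using y1 by (simp add: add_divide_distrib power2_eq_square)
  finally show ?thesis using summable_sums[OF sm] by (simp add: y_def)
qed

text \<open>Partitions of rank m are counted by a difference of consecutive
  \<open>rank_ge_count\<close>, which is the origin of the factor 1 - q^N in
  \<open>rank_coeff\<close>. Two interchanges occur: of m with the index of Dyson's series, and of m
  with n.\<close>

theorem rank_weight_generating_function:
  assumes q: "0 < norm q" "norm q < 1"
  shows "(\<lambda>n. of_int (\<Sum>p | p \<in> partitions n \<and> partition_rank p > 0. rank_weight (nat (partition_rank p))) * q ^ n)
    sums rank_series q"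
proof -
  define P where "P = qp q q"
  have P: "P \<noteq> 0" unfolding P_def using q by (intro qp_nonzero)
  define S where "S = (\<Sum>n. rank_term q n 1) + 5 * (\<Sum>n. rank_term' q n 1)"
  define c where "c = (\<lambda>m. of_int (rank_weight m) * (dyson_sum q m - dyson_sum q (Suc m)))"
  have cS: "c sums S"
  proof (rule sums_swap)
    define f where "f = (\<lambda>k m. rank_coeff q k * (of_int (rank_weight m) * (q ^ Suc k) ^ m))"
    define K where "K = (\<Sum>m. of_nat m * norm q ^ m)"
    have smK: "summable (\<lambda>m. of_nat m * norm q ^ m)" using q by (intro summable_of_nat_power) auto
    have w: "\<bar>real_of_int (rank_weight m)\<bar> \<le> real m" for m
      using abs_rank_weight_le[of m] by linarith
    have b: "norm (f k m) \<le> 2 * norm q ^ k * (of_nat m * norm q ^ m)" for k m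
    proof -
      have "norm q ^ (Suc k * m) \<le> norm q ^ m" using q by (intro power_decreasing) auto
      then have "norm (of_int (rank_weight m) * (q ^ Suc k) ^ m) \<le> of_nat m * norm q ^ m"
        unfolding norm_mult norm_power power_mult[symmetric] using w by (intro mult_mono) auto
      then show ?thesis unfolding f_def norm_mult[of "rank_coeff q k"]
        by (intro mult_mono norm_rank_coeff_le q) auto
    qed
    have sm: "summable (\<lambda>m. 2 * norm q ^ k * (of_nat m * norm q ^ m))" for k
      by (intro summable_mult smK)
    show f1: "summable (\<lambda>m. norm (f k m))" for k
      by (rule summable_comparison_test'[OF sm[of k], of 0]) (use b in auto)
    show "summable (\<lambda>k. \<Sum>m. norm (f k m))"
    proof (rule summable_comparison_test'[where N = 0])
      show "summable (\<lambda>k. 2 * norm q ^ k * K)"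
        using q by (intro summable_mult2 summable_mult summable_geometric) auto
      fix k
      have "(\<Sum>m. norm (f k m)) \<le> (\<Sum>m. 2 * norm q ^ k * (of_nat m * norm q ^ m))"
        by (intro suminf_le b f1 sm)
      also have "\<dots> = 2 * norm q ^ k * K" unfolding K_def by (intro suminf_mult smK)
      finally show "norm (\<Sum>m. norm (f k m)) \<le> 2 * norm q ^ k * K"
        using suminf_nonneg[OF f1[of k]] by simp
    qed
    show "f k sums (rank_term q k 1 + 5 * rank_term' q k 1)" for k
    proof -
      define x where "x = q ^ Suc k"
      have x: "norm x < 1" unfolding x_def norm_power using q power_less_one_iff[of "norm q" "Suc k"] by (simp del: power_Suc)
      have px: "q ^ Suc k = x" "q ^ (i * Suc k) = x ^ i" for i
        by (simp_all only: x_def power_mult[symmetric] mult.commute)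
      have "f k sums (rank_coeff q k * ((x + x ^ 4) / (1 - x ^ 5) + 5 * (x ^ 6 - x ^ 4) / (1 - x ^ 5)\<^sup>2))"
        unfolding f_def x_def[symmetric] by (intro sums_mult sums_rank_weight x)
      also have "rank_coeff q k * ((x + x ^ 4) / (1 - x ^ 5) + 5 * (x ^ 6 - x ^ 4) / (1 - x ^ 5)\<^sup>2) = rank_term q k 1 + 5 * rank_term' q k 1"
        unfolding rank_term_def rank_term'_def px mult_1
        by (simp add: add_divide_distrib diff_divide_distrib algebra_simps)
      finally show ?thesis .
    qed
    show "(\<lambda>k. rank_term q k 1 + 5 * rank_term' q k 1) sums S"
      unfolding S_def by (intro sums_add sums_mult summable_sums rank_term_series_derivative(1,2) q)
    show "(\<lambda>k. f k m) sums c m" for m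
    proof -
      have "(\<lambda>k. of_int (rank_weight m) * ((-1) ^ k * q powi (3 * tri (int (Suc k)) + int (Suc k)) * q ^ (m * Suc k)
          - (-1) ^ k * q powi (3 * tri (int (Suc k)) + int (Suc k)) * q ^ (Suc m * Suc k))) sums c m"
        unfolding c_def dyson_sum_def by (intro sums_mult sums_diff summable_sums summable_dyson_sum q)
      moreover have "of_int (rank_weight m) * ((-1) ^ k * q powi (3 * tri (int (Suc k)) + int (Suc k)) * q ^ (m * Suc k)
          - (-1) ^ k * q powi (3 * tri (int (Suc k)) + int (Suc k)) * q ^ (Suc m * Suc k)) = f k m" for k
      proof -
        have "q ^ (Suc m * Suc k) = q ^ (m * Suc k) * q ^ Suc k"
          by (metis mult_Suc power_add mult.commute)
        moreover have "(q ^ Suc k) ^ m = q ^ (m * Suc k)"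
          by (metis power_mult mult.commute)
        moreover have "r * (s * e * X - s * e * (X * y)) = s * e * (1 - y) * (r * X)" for r s e X y :: complex
          by (simp add: algebra_simps)
        ultimately show ?thesis
          unfolding f_def rank_coeff_def by (simp only:)
      qed
      ultimately show ?thesis by simp
    qed
  qed
  have "(\<lambda>n. (\<Sum>m\<le>n. of_int (rank_weight m) * (of_nat (rank_ge_count m n) - of_nat (rank_ge_count (Suc m) n))) * q ^ n) sums (S / P)"
  proof (rule sums_swap)
    define f where "f = (\<lambda>m n. of_int (rank_weight m) * ((of_nat (rank_ge_count m n) - of_nat (rank_ge_count (Suc m) n)) * q ^ n))"
    define K where "K = (\<Sum>n. num_partitions n * norm q ^ n)"
    have K: "K \<ge> 0" unfolding K_def by (rule suminf_nonneg[OF sums_num_partitions(2)[OF q(2)]]) simp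
    have w: "\<bar>real_of_int (rank_weight m)\<bar> \<le> real m" for m
      using abs_rank_weight_le[of m] by linarith
    have mono: "rank_ge_count (Suc m) n \<le> rank_ge_count m n" for m n
      unfolding rank_ge_count_def by (intro card_mono finite_subset[OF _ finite_partitions]) auto
    have b: "norm (f m n) \<le> of_nat m * (rank_ge_count m n * norm q ^ n)" for m n
    proof -
      have "norm (of_nat (rank_ge_count m n) - of_nat (rank_ge_count (Suc m) n) :: complex) = rank_ge_count m n - rank_ge_count (Suc m) n"
        using mono[of m n] by (metis norm_of_nat of_nat_diff)
      also have "\<dots> \<le> rank_ge_count m n" by simp
      finally show ?thesis
        unfolding f_def norm_mult norm_power using w[of m] by (intro mult_mono) auto
    qed
    have sm: "summable (\<lambda>n. of_nat m * (rank_ge_count m n * norm q ^ n))" for m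
    proof (cases "m = 0")
      case False
      then show ?thesis using q by (intro summable_mult rank_ge_generating_function) auto
    qed simp
    show f1: "summable (\<lambda>n. norm (f m n))" for m
      by (rule summable_comparison_test'[OF sm[of m], of 0]) (use b in auto)
    show "summable (\<lambda>m. \<Sum>n. norm (f m n))"
    proof (rule summable_comparison_test'[where N = 0])
      show "summable (\<lambda>m. of_nat m * norm q ^ m * K)"
        using q by (intro summable_mult2 summable_of_nat_power) auto
      fix m
      have "(\<Sum>n. norm (f m n)) \<le> of_nat m * norm q ^ m * K"
      proof (cases "m = 0")
        case False
        have "(\<Sum>n. norm (f m n)) \<le> (\<Sum>n. of_nat m * (rank_ge_count m n * norm q ^ n))"
          by (intro suminf_le b f1 sm)
        also have "\<dots> = of_nat m * (\<Sum>n. rank_ge_count m n * norm q ^ n)"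
          using False q by (intro suminf_mult rank_ge_generating_function) auto
        also have "\<dots> \<le> of_nat m * (norm q ^ Suc m * K)"
          unfolding K_def using False q by (intro mult_left_mono rank_ge_generating_function) auto
        also have "\<dots> \<le> of_nat m * (norm q ^ m * K)"
          using q K by (intro mult_left_mono mult_right_mono power_decreasing) auto
        finally show ?thesis by simp
      qed (simp add: f_def rank_weight_def)
      then show "norm (\<Sum>n. norm (f m n)) \<le> of_nat m * norm q ^ m * K"
        using suminf_nonneg[OF f1[of m]] by simp
    qed
    show "f m sums (c m / P)" for m
    proof (cases "m = 0")
      case False
      have "(\<lambda>n. of_int (rank_weight m) * (of_nat (rank_ge_count m n) * q ^ n - of_nat (rank_ge_count (Suc m) n) * q ^ n)) sums
         (of_int (rank_weight m) * (dyson_sum q m / qp q q - dyson_sum q (Suc m) / qp q q))"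
        using False q by (intro sums_mult sums_diff rank_ge_generating_function(1)) auto
      then show ?thesis
        by (simp add: f_def c_def P_def left_diff_distrib diff_divide_distrib right_diff_distrib)
    qed (simp add: f_def c_def rank_weight_def)
    show "(\<lambda>m. c m / P) sums (S / P)" by (intro sums_divide cS)
    show "(\<lambda>m. f m n) sums ((\<Sum>m\<le>n. of_int (rank_weight m) * (of_nat (rank_ge_count m n) - of_nat (rank_ge_count (Suc m) n))) * q ^ n)" for n
    proof -
      have "(\<lambda>m. f m n) sums (\<Sum>m\<le>n. f m n)"
      proof (rule sums_finite)
        fix m assume "m \<notin> {..n}"
        then have "rank_ge_count m n = 0" "rank_ge_count (Suc m) n = 0"
          by (auto intro!: rank_ge_count_eq_0)
        then show "f m n = 0" by (simp add: f_def)
      qed simp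
      then show ?thesis by (simp add: f_def sum_distrib_right mult.assoc)
    qed
  qed
  then show ?thesis
    unfolding sum_rank_weight rank_series_def by (simp add: S_def P_def)
qed

section \<open>Extracting coefficients\<close>

text \<open>The sum over k of \<omega>^(k(n+1)) is 5 if n is 4 modulo 5 and 0 otherwise; the terms
  are compared in blocks of five consecutive n.\<close>

lemma sums_fifth_root_filter:
  fixes c :: "nat \<Rightarrow> complex"
  assumes \<omega>: "\<omega> ^ 5 = 1" "\<omega> \<noteq> 1"
    and C: "\<And>k. (\<lambda>n. c n * (\<omega> ^ k * q) ^ n) sums C k"
  shows "(\<lambda>n. c (5 * n + 4) * q ^ (5 * n + 4)) sums ((\<Sum>k<5. \<omega> ^ k * C k) / 5)"
proof -
  define S where "S = (\<lambda>n. (\<Sum>k<5. \<omega> ^ k * (\<omega> ^ k) ^ n) / 5)"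
  have "(\<lambda>n. (\<Sum>k<5. \<omega> ^ k * (c n * (\<omega> ^ k * q) ^ n)) / 5) sums ((\<Sum>k<5. \<omega> ^ k * C k) / 5)"
    by (intro sums_divide sums_sum sums_mult C)
  moreover have "(\<Sum>k<5. \<omega> ^ k * (c n * (\<omega> ^ k * q) ^ n)) / 5 = c n * q ^ n * S n" for n
    by (simp add: S_def power_mult_distrib sum_distrib_left mult_ac)
  ultimately have "(\<lambda>n. c n * q ^ n * S n) sums ((\<Sum>k<5. \<omega> ^ k * C k) / 5)"
    by (simp only:)
  then have "(\<lambda>j. \<Sum>n\<in>{j * 5..<j * 5 + 5}. c n * q ^ n * S n) sums ((\<Sum>k<5. \<omega> ^ k * C k) / 5)"
    by (rule sums_group) simp
  moreover have "(\<Sum>n\<in>{j * 5..<j * 5 + 5}. c n * q ^ n * S n) = c (5 * j + 4) * q ^ (5 * j + 4)" for j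
  proof -
    have "{..<5::nat} = {0, 1, 2, 3, 4}" by auto
    then have S: "S n = (1 + \<omega> ^ (n + 1) + (\<omega> ^ (n + 1))\<^sup>2 + (\<omega> ^ (n + 1)) ^ 3 + (\<omega> ^ (n + 1)) ^ 4) / 5" for n
      by (simp add: S_def power_mult_distrib add.assoc flip: power_mult) (simp add: power_mult_distrib mult.commute flip: power_mult power_add power_Suc)
    have m: "\<omega> ^ (j * 5 + i) = \<omega> ^ i" for i
      using \<omega>(1) by (simp add: power_add mult.commute[of j] power_mult)
    have r: "S (j * 5 + i) = 0" if "\<omega> ^ (i + 1) \<noteq> 1" for i
    proof -
      have "(\<omega> ^ (i + 1)) ^ 5 = 1" using \<omega>(1) by (metis mult.commute power_mult power_one)
      from sum_fifth_root[OF this that] show ?thesis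
        unfolding S add.assoc m by simp
    qed
    have "S (j * 5) = 0" "S (j * 5 + 1) = 0" "S (j * 5 + 2) = 0" "S (j * 5 + 3) = 0"
      using r[of 0] r[of 1] r[of 2] r[of 3] \<omega>(2) fifth_root_power_neq_1[OF \<omega>] by (simp_all add: eval_nat_numeral)
    moreover have "S (j * 5 + 4) = 1"
      unfolding S add.assoc m using \<omega>(1) by simp
    moreover have "{j * 5..<j * 5 + 5} = {j * 5, j * 5 + 1, j * 5 + 2, j * 5 + 3, j * 5 + 4}" by auto
    ultimately show ?thesis by (simp add: mult.commute[of j])
  qed
  ultimately show ?thesis by simp
qed

text \<open>The hypotheses say nothing at \<open>q = 0\<close>; a factor \<open>X\<close> makes the comparison valid there as well.\<close>
lemma coeff_residue_4:
  fixes c :: "nat \<Rightarrow> complex" and \<kappa> :: complex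
  assumes \<omega>: "\<omega> ^ 5 = 1" "\<omega> \<noteq> 1"
    and C: "\<And>q. 0 < norm q \<Longrightarrow> norm q < 1 \<Longrightarrow> (\<lambda>n. c n * q ^ n) sums C q"
    and res: "\<And>q. 0 < norm q \<Longrightarrow> norm q < 1 \<Longrightarrow>
      (\<Sum>k<5. \<omega> ^ k * C (\<omega> ^ k * q)) / 5 = \<kappa> * (qp (q ^ 25) (q ^ 25) ^ 4 / qp (q ^ 5) (q ^ 5)) * q ^ 4"
  shows "c (5 * n + 4) = \<kappa> * fps_nth (qpoch_inf (fps_X ^ 5) (fps_X ^ 5) ^ 4 / qpoch_inf fps_X fps_X) n"
proof -
  define F where "F = Abs_fps (\<lambda>n. c (5 * n + 4))"
  have norm_\<omega>: "norm \<omega> = 1"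
    using \<omega>(1) by (rule norm_fifth_root_of_unity)
  have F: "(\<lambda>n. fps_nth F n * y ^ n) sums (\<kappa> * (qp (y ^ 5) (y ^ 5) ^ 4 / qp y y))" if y: "0 < norm y" "norm y < 1" for y
  proof -
    \<comment> \<open>A fifth root of y: the hypotheses are in terms of q, the wanted power series
      in terms of y = q^5.\<close>
    define q where "q = exp (Ln y / 5)"
    have "q ^ 5 = exp (of_nat 5 * (Ln y / 5))" unfolding q_def by (rule exp_of_nat_mult[symmetric])
    also have "\<dots> = y" using y by simp
    finally have q5: "q ^ 5 = y" .
    have q0: "q \<noteq> 0" by (simp add: q_def)
    have "norm q ^ 5 < 1" using q5 y by (metis norm_power)
    then have qn: "0 < norm q" "norm q < 1" using q0 by (auto simp: power_less_one_iff)
    have "(\<lambda>n. c n * (\<omega> ^ k * q) ^ n) sums C (\<omega> ^ k * q)" for k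
      using qn norm_\<omega> by (intro C) (simp_all add: norm_mult norm_power)
    from sums_fifth_root_filter[OF \<omega> this]
    have "(\<lambda>n. c (5 * n + 4) * q ^ (5 * n + 4)) sums (\<kappa> * (qp (q ^ 25) (q ^ 25) ^ 4 / qp (q ^ 5) (q ^ 5)) * q ^ 4)"
      unfolding res[OF qn] .
    then have "(\<lambda>n. c (5 * n + 4) * q ^ (5 * n + 4) / q ^ 4) sums (\<kappa> * (qp (q ^ 25) (q ^ 25) ^ 4 / qp (q ^ 5) (q ^ 5)) * q ^ 4 / q ^ 4)"
      by (rule sums_divide)
    moreover have "c (5 * n + 4) * q ^ (5 * n + 4) / q ^ 4 = fps_nth F n * y ^ n" for n
      using q0 by (simp add: F_def power_add power_mult q5)
    moreover have "q ^ 25 = y ^ 5" unfolding q5[symmetric] by (simp flip: power_mult)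
    ultimately show ?thesis using q0 by (simp add: q5)
  qed
  define A1 A5 :: "complex fps" where "A1 = qpoch_inf fps_X fps_X" and "A5 = qpoch_inf (fps_X ^ 5) (fps_X ^ 5)"
  have R1: "fps_conv_radius A1 \<ge> 1" "\<And>y. norm y < 1 \<Longrightarrow> eval_fps A1 y = qp y y"
    using eval_qpoch_inf[of 1] by (simp_all add: A1_def)
  have R5: "fps_conv_radius A5 \<ge> 1" "\<And>y. norm y < 1 \<Longrightarrow> eval_fps A5 y = qp (y ^ 5) (y ^ 5)"
    using eval_qpoch_inf[of 5] by (simp_all add: A5_def)
  have RF: "fps_conv_radius F \<ge> 1"
    unfolding fps_conv_radius_def
  proof (rule conv_radius_geI_ex)
    fix r :: real assume r: "0 < r" "ereal r < 1"
    then have "summable (\<lambda>n. fps_nth F n * of_real r ^ n)"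
      using F[of "of_real r"] by (auto simp: sums_iff)
    then show "\<exists>z. norm z = r \<and> summable (\<lambda>n. fps_nth F n * z ^ n)"
      using r by (intro exI[of _ "of_real r"]) auto
  qed
  have lt: "ereal (norm y) < R" if "norm y < 1" "R \<ge> 1" for y :: complex and R
    using that less_le_trans[of "ereal (norm y)" 1 R] by simp
  define L R where "L = fps_X * (F * A1)" and "R = fps_X * (fps_const \<kappa> * A5 ^ 4)"
  have RFA: "fps_conv_radius (F * A1) \<ge> 1"
    using fps_conv_radius_mult[of F A1] RF R1(1) by (meson min.boundedI order_trans)
  have RA4: "fps_conv_radius (A5 ^ 4) \<ge> 1"
    using fps_conv_radius_power[of A5 4] R5(1) by (meson order_trans)
  have RkA: "fps_conv_radius (fps_const \<kappa> * A5 ^ 4) \<ge> 1"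
    using fps_conv_radius_mult[of "fps_const \<kappa>" "A5 ^ 4"] RA4 by simp
  have RL: "fps_conv_radius L \<ge> 1"
    unfolding L_def using fps_conv_radius_mult[of fps_X "F * A1"] RFA by simp
  have RR: "fps_conv_radius R \<ge> 1"
    unfolding R_def using fps_conv_radius_mult[of fps_X "fps_const \<kappa> * A5 ^ 4"] RkA by simp
  have "L = R"
  proof (rule eval_fps_eqD)
    show "fps_conv_radius L > 0" "fps_conv_radius R > 0"
      using RL RR by (auto intro: less_le_trans[of 0 1])
    have "eval_fps L y = eval_fps R y" if y: "norm y < 1" for y
    proof -
      have "eval_fps L y = y * (eval_fps F y * qp y y)"
        unfolding L_def using y by (simp add: eval_fps_mult lt RFA RF R1)
      moreover have "eval_fps R y = y * (\<kappa> * qp (y ^ 5) (y ^ 5) ^ 4)"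
        unfolding R_def using y by (simp add: eval_fps_mult eval_fps_power lt RkA RA4 R5)
      moreover have "eval_fps F y * qp y y = \<kappa> * qp (y ^ 5) (y ^ 5) ^ 4" if "y \<noteq> 0"
      proof -
        have "eval_fps F y = \<kappa> * (qp (y ^ 5) (y ^ 5) ^ 4 / qp y y)"
          unfolding eval_fps_def using F[of y] y that by (simp add: sums_iff)
        then show ?thesis using qp_nonzero[OF y y] by simp
      qed
      ultimately show ?thesis by (cases "y = 0") auto
    qed
    then show "\<forall>\<^sub>F y in nhds 0. eval_fps L y = eval_fps R y"
      by (intro eventually_nhds_in_open[of "ball 0 1", THEN eventually_mono]) auto
  qed
  then have FA: "F * A1 = fps_const \<kappa> * A5 ^ 4"
    by (simp add: L_def R_def)
  have A1: "fps_nth A1 0 \<noteq> 0"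
    unfolding A1_def using qpoch_inf_has_prod(2)[of "fps_X :: complex fps" fps_X] by simp
  have "F = fps_const \<kappa> * (A5 ^ 4 / A1)"
  proof -
    have "A1 * inverse A1 = 1" using A1 by (rule inverse_mult_eq_1')
    then have "F = fps_const \<kappa> * A5 ^ 4 * inverse A1"
      unfolding FA[symmetric] by (simp add: mult.assoc)
    then show ?thesis using A1 by (simp add: fps_divide_unit mult.assoc)
  qed
  then have "fps_nth F n = \<kappa> * fps_nth (A5 ^ 4 / A1) n" by simp
  then show ?thesis by (simp add: F_def A1_def A5_def)
qed

text \<open>z^c depends only on c modulo 5, so the partitions can be grouped by the residue of the
  crank.\<close>

lemma sum_crank_fifth_root:
  fixes z :: complex
  assumes z: "z ^ 5 = 1"
  shows "(\<Sum>p\<in>partitions n. of_nat (num_ones p) * z powi partition_crank p) =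
    (\<Sum>j<5. z ^ j * of_int (M_omega (int j) 5 n))"
proof -
  have z0: "z \<noteq> 0" using z by auto
  have per: "z powi c = z ^ nat (c mod 5)" for c :: int
  proof -
    have "z powi c = z powi (5 * (c div 5) + c mod 5)" by simp
    also have "\<dots> = (z powi 5) powi (c div 5) * z powi (c mod 5)"
      using z0 by (subst power_int_add) (auto simp: power_int_mult)
    also have "z powi 5 = 1" using z by simp
    also have "z powi (c mod 5) = z ^ nat (c mod 5)" by (simp add: power_int_def)
    finally show ?thesis by simp
  qed
  have "(\<Sum>p\<in>partitions n. of_nat (num_ones p) * z powi partition_crank p) =
    (\<Sum>j<5. \<Sum>p | p \<in> partitions n \<and> nat (partition_crank p mod 5) = j. of_nat (num_ones p) * z powi partition_crank p)"
    by (rule sum.group[symmetric]) (use finite_partitions in auto)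
  also have "\<dots> = (\<Sum>j<5. z ^ j * of_int (M_omega (int j) 5 n))"
  proof (rule sum.cong[OF refl])
    fix j :: nat assume j: "j \<in> {..<5}"
    have "{p. p \<in> partitions n \<and> nat (partition_crank p mod 5) = j} = {p. p \<in> partitions n \<and> [partition_crank p = int j] (mod 5)}"
      using j by (auto simp: cong_def)
    then show "(\<Sum>p | p \<in> partitions n \<and> nat (partition_crank p mod 5) = j. of_nat (num_ones p) * z powi partition_crank p)
        = z ^ j * of_int (M_omega (int j) 5 n)"
      unfolding M_omega_def of_int_sum sum_distrib_left per
      by (intro sum.cong) (use j in \<open>auto simp: cong_def\<close>)
  qed
  finally show ?thesis .
qed

theorem theorem1p1:
  shows "Abs_fps (\<lambda>n. complex_of_int
            (NT 1 5 (5 * n + 4) - NT 4 5 (5 * n + 4)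
             + 2 * M_omega 2 5 (5 * n + 4) - 2 * M_omega 3 5 (5 * n + 4)))
         = - 5 * (qpoch_inf (fps_X ^ 5) (fps_X ^ 5) ^ 4 / qpoch_inf fps_X fps_X)
    \<and> (\<forall>n::nat. M_omega 2 5 (5 * n + 4) - M_omega 3 5 (5 * n + 4)
                 = 2 * NT 1 5 (5 * n + 4) - 2 * NT 4 5 (5 * n + 4))"
proof -
  define g where "g = fps_nth (qpoch_inf (fps_X ^ 5) (fps_X ^ 5) ^ 4 / qpoch_inf fps_X fps_X :: complex fps)"
  obtain \<omega> :: complex where \<omega>: "\<omega> ^ 5 = 1" "\<omega> \<noteq> 1"
    using ex_fifth_root_of_unity by blast
  have rank: "of_int (NT 1 5 (5 * n + 4) - NT 4 5 (5 * n + 4)) = - g n" for n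
  proof -
    have "of_int (NT 1 5 (5 * n + 4) - NT 4 5 (5 * n + 4)) = - 1 * g n"
      unfolding g_def
    proof (rule coeff_residue_4[OF \<omega>, where c = "\<lambda>n. of_int (NT 1 5 n - NT 4 5 n)"])
      fix q :: complex assume q: "0 < norm q" "norm q < 1"
      show "(\<lambda>n. of_int (NT 1 5 n - NT 4 5 n) * q ^ n) sums (- rank_series q)"
        using sums_minus[OF rank_weight_generating_function[OF q]] unfolding NT_difference by simp
      show "(\<Sum>k<5. \<omega> ^ k * - rank_series (\<omega> ^ k * q)) / 5 = - 1 * (qp (q ^ 25) (q ^ 25) ^ 4 / qp (q ^ 5) (q ^ 5)) * q ^ 4"
        using rank_series_residue_4[OF \<omega> q] by (simp add: sum_negf mult.commute)
    qed
    then show ?thesis by simp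
  qed
  \<comment> \<open>Since 1/z = z^4, the difference of the sums at z and 1/z pairs the residues 1
    with 4 and 2 with 3, and residue 0 cancels.\<close>
  have crank: "(z - z ^ 4) * of_int (M_omega 1 5 (5 * n + 4) - M_omega 4 5 (5 * n + 4))
      + (z\<^sup>2 - z ^ 3) * of_int (M_omega 2 5 (5 * n + 4) - M_omega 3 5 (5 * n + 4)) = 10 * z / (1 - z\<^sup>2) * g n"
    if z: "z ^ 5 = 1" "z \<noteq> 1" for z n
  proof -
    have z0: "z \<noteq> 0" using z by auto
    have nz: "norm z = 1" using z(1) by (rule norm_fifth_root_of_unity)
    have inv: "1 / z = z ^ 4" using z(1) z0 by (simp add: field_simps flip: power_Suc)
    define c where "c = (\<lambda>n. (\<Sum>p\<in>partitions n. of_nat (num_ones p) * z powi partition_crank p)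
      - (\<Sum>p\<in>partitions n. of_nat (num_ones p) * (1 / z) powi partition_crank p))"
    have "c (5 * n + 4) = 10 * z / (1 - z\<^sup>2) * g n"
      unfolding g_def
    proof (rule coeff_residue_4[OF \<omega>])
      fix q :: complex assume q: "0 < norm q" "norm q < 1"
      show "(\<lambda>n. c n * q ^ n) sums (crank_ones_series z q - crank_ones_series (1 / z) q)"
        unfolding c_def left_diff_distrib
        by (intro sums_diff crank_ones_generating_function q) (simp_all add: nz norm_divide)
      show "(\<Sum>k<5. \<omega> ^ k * (crank_ones_series z (\<omega> ^ k * q) - crank_ones_series (1 / z) (\<omega> ^ k * q))) / 5
          = 10 * z / (1 - z\<^sup>2) * (qp (q ^ 25) (q ^ 25) ^ 4 / qp (q ^ 5) (q ^ 5)) * q ^ 4"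
        by (rule crank_series_residue_4[OF \<omega> z q])
    qed
    moreover have "c m = (z - z ^ 4) * of_int (M_omega 1 5 m - M_omega 4 5 m) + (z\<^sup>2 - z ^ 3) * of_int (M_omega 2 5 m - M_omega 3 5 m)" for m
    proof -
      have "(1 / z) ^ 5 = 1" using z(1) by (simp add: power_divide)
      then have "c m = (\<Sum>j<5. z ^ j * of_int (M_omega (int j) 5 m)) - (\<Sum>j<5. (1 / z) ^ j * of_int (M_omega (int j) 5 m))"
        unfolding c_def using z(1) by (simp add: sum_crank_fifth_root)
      also have "\<dots> = (\<Sum>j<5. (z ^ j - (z ^ 4) ^ j) * of_int (M_omega (int j) 5 m))"
        unfolding inv by (simp add: sum_subtractf left_diff_distrib)
      also have "\<dots> = (z - z ^ 4) * of_int (M_omega 1 5 m) + (z\<^sup>2 - (z ^ 4)\<^sup>2) * of_int (M_omega 2 5 m)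
         + (z ^ 3 - (z ^ 4) ^ 3) * of_int (M_omega 3 5 m) + (z ^ 4 - (z ^ 4) ^ 4) * of_int (M_omega 4 5 m)"
      proof -
        have "{..<5::nat} = {0, 1, 2, 3, 4}" by auto
        then show ?thesis by simp
      qed
      finally have cm: "c m = (z - z ^ 4) * of_int (M_omega 1 5 m) + (z\<^sup>2 - (z ^ 4)\<^sup>2) * of_int (M_omega 2 5 m)
         + (z ^ 3 - (z ^ 4) ^ 3) * of_int (M_omega 3 5 m) + (z ^ 4 - (z ^ 4) ^ 4) * of_int (M_omega 4 5 m)" .
      have e: "(z ^ 4)\<^sup>2 = z ^ 3" "(z ^ 4) ^ 3 = z\<^sup>2" "(z ^ 4) ^ 4 = z"
        using z(1) by algebra+
      show ?thesis unfolding cm e by (simp add: algebra_simps)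
    qed
    ultimately show ?thesis by simp
  qed
  have B: "of_int (M_omega 2 5 (5 * n + 4) - M_omega 3 5 (5 * n + 4)) = - 2 * g n" for n
  proof -
    define A B :: complex where "A = of_int (M_omega 1 5 (5 * n + 4) - M_omega 4 5 (5 * n + 4))"
      and "B = of_int (M_omega 2 5 (5 * n + 4) - M_omega 3 5 (5 * n + 4))"
    \<comment> \<open>The equation at z = \<omega> has the two unknowns A and B; z = \<omega>^2
      gives a second equation.\<close>
    have z: "(\<omega>\<^sup>2) ^ 5 = 1" "\<omega>\<^sup>2 \<noteq> 1"
      using \<omega>(1) fifth_root_power_neq_1(1)[OF \<omega>] by (metis mult.commute power_mult power_one)+
    have w4: "\<omega> ^ 4 \<noteq> 1" using fifth_root_power_neq_1[OF \<omega>] by simp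
    have e1: "((\<omega> - \<omega> ^ 4) * A + (\<omega>\<^sup>2 - \<omega> ^ 3) * B) * (1 - \<omega>\<^sup>2) = 10 * \<omega> * g n"
      using crank[OF \<omega>, of n] z(2) unfolding A_def[symmetric] B_def[symmetric] by simp
    have e2: "((\<omega>\<^sup>2 - (\<omega>\<^sup>2) ^ 4) * A + ((\<omega>\<^sup>2)\<^sup>2 - (\<omega>\<^sup>2) ^ 3) * B) * (1 - (\<omega>\<^sup>2)\<^sup>2) = 10 * \<omega>\<^sup>2 * g n"
      using crank[OF z, of n] w4 unfolding A_def[symmetric] B_def[symmetric] by (simp flip: power_mult)
    have s: "1 + \<omega> + \<omega>\<^sup>2 + \<omega> ^ 3 + \<omega> ^ 4 = 0" by (rule sum_fifth_root[OF \<omega>])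
    \<comment> \<open>Eliminating A leaves a quadratic Gauss sum times B + 2 g(n); the square of
      that sum is 5, so it can be cancelled.\<close>
    have "(\<omega>\<^sup>2 + \<omega> ^ 3 - \<omega> - \<omega> ^ 4) * (B + 2 * g n) = 0"
      using e1 e2 s \<omega>(1) by algebra
    moreover have "(\<omega>\<^sup>2 + \<omega> ^ 3 - \<omega> - \<omega> ^ 4)\<^sup>2 = 5"
      using s \<omega>(1) by algebra
    then have "\<omega>\<^sup>2 + \<omega> ^ 3 - \<omega> - \<omega> ^ 4 \<noteq> 0" by auto
    ultimately show ?thesis by (simp add: B_def add_eq_0_iff)
  qed
  \<comment> \<open>With the rank difference -g and the crank difference -2 g, the series has
    coefficients -g - 4 g = -5 g, and -2 g = 2 (-g) is the second claim.\<close>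
  show ?thesis
  proof (intro conjI allI)
    have m5: "(- 5 :: complex fps) = fps_const (- 5)"
      by (metis fps_const_neg numeral_fps_const)
    show "Abs_fps (\<lambda>n. complex_of_int
            (NT 1 5 (5 * n + 4) - NT 4 5 (5 * n + 4)
             + 2 * M_omega 2 5 (5 * n + 4) - 2 * M_omega 3 5 (5 * n + 4)))
         = - 5 * (qpoch_inf (fps_X ^ 5) (fps_X ^ 5) ^ 4 / qpoch_inf fps_X fps_X)"
    proof (rule fps_ext)
      fix n
      have "complex_of_int (NT 1 5 (5 * n + 4) - NT 4 5 (5 * n + 4) + 2 * M_omega 2 5 (5 * n + 4) - 2 * M_omega 3 5 (5 * n + 4))
        = of_int (NT 1 5 (5 * n + 4) - NT 4 5 (5 * n + 4)) + 2 * of_int (M_omega 2 5 (5 * n + 4) - M_omega 3 5 (5 * n + 4))"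
        by simp
      also have "\<dots> = - 5 * g n" unfolding rank B by simp
      finally show "fps_nth (Abs_fps (\<lambda>n. complex_of_int
            (NT 1 5 (5 * n + 4) - NT 4 5 (5 * n + 4)
             + 2 * M_omega 2 5 (5 * n + 4) - 2 * M_omega 3 5 (5 * n + 4)))) n
         = fps_nth (- 5 * (qpoch_inf (fps_X ^ 5) (fps_X ^ 5) ^ 4 / qpoch_inf fps_X fps_X)) n"
        unfolding m5 fps_mult_left_const_nth by (simp only: g_def fps_nth_Abs_fps)
    qed
  next
    fix n
    have "complex_of_int (M_omega 2 5 (5 * n + 4) - M_omega 3 5 (5 * n + 4)) = of_int (2 * (NT 1 5 (5 * n + 4) - NT 4 5 (5 * n + 4)))"
      unfolding B of_int_mult rank by simp
    then have "M_omega 2 5 (5 * n + 4) - M_omega 3 5 (5 * n + 4) = 2 * (NT 1 5 (5 * n + 4) - NT 4 5 (5 * n + 4))"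
      by (simp only: of_int_eq_iff)
    then show "M_omega 2 5 (5 * n + 4) - M_omega 3 5 (5 * n + 4) = 2 * NT 1 5 (5 * n + 4) - 2 * NT 4 5 (5 * n + 4)"
      by simp
  qed
qed

end
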